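(* Let $n\ge 2$, $T>0$, and let $b,\sigma:\mathbb{R}_+\times(\mathbb{R}^n\otimes\mathbb{R}^n)\to\mathbb{R}^n\otimes\mathbb{R}^n$ be jointly measurable. Assume that there exist integrable functions $\kappa_1,\kappa_2:[0,T]\to\mathbb{R}_+$ such that for all $t\in[0,T]$ and all $x,y\in\mathbb{R}^n\otimes\mathbb{R}^n$, $$\|b(t,x)-b(t,y)\|_{HS}^2+\|\sigma(t,x)-\sigma(t,y)\|_{HS}^2\le\kappa_1(t)\|x-y\|_{HS}^2,$$ $$\|b(t,0)\|_{HS}^2+\|\sigma(t,0)\|_{HS}^2\le\kappa_2(t).$$ Set $\kappa(t):=\kappa_1(t)+\kappa_2(t)$. Then for every $x\in\mathbb{R}^n\otimes\mathbb{R}^n$ the matrix-valued SDE $$dX(t)=b(t,X(t))\,dt+\sigma(t,X(t))\,dB_t,\qquad X(0)=x,$$ has a unique strong solution $(X(t))$ on the whole of $[0,T]$, and this solution satisfies $$\mathbb{E}\Big(\sup_{0\le t\le T}\|X(t)\|_{HS}^2\Big)\le(1+3\|x\|_{HS}^2)\,e^{6(T+4n)\int_0^T\kappa(s)\,ds}.$$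
   Context: $\mathbb{R}^n\otimes\mathbb{R}^n$ denotes the space of real $n\times n$ matrices with inner product $\langle A,B\rangle_{HS}=\mathrm{trace}(A^TB)$ and induced norm $\|\cdot\|_{HS}$. $e_{ij}$ is the $n\times n$ matrix with entry $1$ in position $(i,j)$ and $0$ elsewhere. On a filtered probability space $(\Omega,\mathcal{F},(\mathcal{F}_t)_{t\ge0},\mathbb{P})$ (with the usual convention that the filtration contains all $\mathbb{P}$-null sets) let $B^{(ij)}$, $1\le i,j\le n$, be independent real-valued standard $(\mathcal{F}_t)$-Brownian motions, and let $B_t=B(t)=\sum_{i,j=1}^nB^{(ij)}_te_{ij}$ be the matrix-valued Brownian motion. The Itô integral $\int V\,dB$ of an adapted $\mathbb{R}^n\otimes\mathbb{R}^n$-valued process is the usual one with integrand multiplying from the left by matrix product, i.e. $\big(\int_0^tV(s)\,dB(s)\big)_{ij}=\sum_{m=1}^n\int_0^tV_{im}(s)\,dB^{(mj)}_s$. A strong solution is a continuous adapted $\mathbb{R}^n\otimes\mathbb{R}^n$-valued process $X$, on the given probability space with the given $B$, for which the integrals below are well defined and, almost surely, $X(t)=x+\int_0^tb(s,X(s))\,ds+\int_0^t\sigma(s,X(s))\,dB(s)$ for all $t$; uniqueness means that any two strong solutions are indistinguishable. *)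

theory Defs
  imports "HOL-Probability.Probability"
begin

definition hs_inner :: "real^'n^'n \<Rightarrow> real^'n^'n \<Rightarrow> real" where
  "hs_inner A B = trace (transpose A ** B)"

definition hs_norm :: "real^'n^'n \<Rightarrow> real" where
  "hs_norm A = sqrt (hs_inner A A)"

text \<open>The library inner product and norm on \<^typ>\<open>real^'n^'n\<close> are the Hilbert-Schmidt ones, so that
  continuity, measurability and integrability of matrix-valued maps may use the library structure.\<close>

lemma hs_inner_eq_inner: "hs_inner A B = A \<bullet> B"
proof -
  have "hs_inner A B = (\<Sum>i\<in>UNIV. \<Sum>k\<in>UNIV. A $ k $ i * B $ k $ i)"
    by (simp add: hs_inner_def trace_def transpose_def matrix_matrix_mult_def)
  also have "\<dots> = (\<Sum>k\<in>UNIV. \<Sum>i\<in>UNIV. A $ k $ i * B $ k $ i)"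
    by (rule sum.swap)
  finally show ?thesis
    by (simp add: inner_vec_def)
qed

lemma hs_norm_eq_norm: "hs_norm A = norm A"
  by (simp add: hs_norm_def hs_inner_eq_inner norm_eq_sqrt_inner)


text \<open>The library locale \<^locale>\<open>filtration\<close> is used with the whole of \<^typ>\<open>real\<close> as index set, but
  only the \<sigma>-algebras with index \<open>t \<ge> 0\<close> matter: a filtration indexed by \<open>t \<ge> 0\<close> extends by
  \<open>F t = F 0\<close> for \<open>t < 0\<close>. Right-continuity of the filtration is not required.\<close>

locale filtered_prob_space = prob_space M + filtration "space M" F
  for M :: "'a measure" and F :: "real \<Rightarrow> 'a measure" +
  assumes subalgebra_F: "\<And>t. t \<ge> 0 \<Longrightarrow> subalgebra M (F t)"
    and null_sets_F: "\<And>t. t \<ge> 0 \<Longrightarrow> null_sets M \<subseteq> sets (F t)"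

definition adapted_on :: "(real \<Rightarrow> 'a measure) \<Rightarrow> real set \<Rightarrow> (real \<Rightarrow> 'a \<Rightarrow> 'b::topological_space) \<Rightarrow> bool"
  where "adapted_on F I X \<longleftrightarrow> (\<forall>t\<in>I. X t \<in> borel_measurable (F t))"

definition std_brownian_motion ::
    "'a measure \<Rightarrow> (real \<Rightarrow> 'a measure) \<Rightarrow> (real \<Rightarrow> 'a \<Rightarrow> real) \<Rightarrow> bool" where
  "std_brownian_motion M F W \<longleftrightarrow>
     adapted_on F {0..} W \<and>
     (AE \<omega> in M. W 0 \<omega> = 0) \<and>
     (AE \<omega> in M. continuous_on {0..} (\<lambda>t. W t \<omega>)) \<and>
     (\<forall>s t. 0 \<le> s \<and> s < t \<longrightarrow>
        distributed M lborel (\<lambda>\<omega>. W t \<omega> - W s \<omega>) (normal_density 0 (sqrt (t - s))) \<and>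
        prob_space.indep_set M (sets (F s))
          {(\<lambda>\<omega>. W t \<omega> - W s \<omega>) -` A \<inter> space M | A. A \<in> sets borel})"

text \<open>Independence of the entries is independence of whole processes, i.e. of the random elements
  \<open>\<omega> \<mapsto> (t \<mapsto> B t \<omega> $ i $ j)\<close> of the product space over all times \<open>t \<ge> 0\<close>.\<close>

definition matrix_brownian_motion ::
    "'a measure \<Rightarrow> (real \<Rightarrow> 'a measure) \<Rightarrow> (real \<Rightarrow> 'a \<Rightarrow> real^'n^'n) \<Rightarrow> bool" where
  "matrix_brownian_motion M F B \<longleftrightarrow>
     (\<forall>i j. std_brownian_motion M F (\<lambda>t \<omega>. B t \<omega> $ i $ j)) \<and>
     prob_space.indep_vars M (\<lambda>_. \<Pi>\<^sub>M t\<in>{0..}. borel)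
       (\<lambda>(i, j) \<omega>. \<lambda>t\<in>{0..}. B t \<omega> $ i $ j) (UNIV :: ('n \<times> 'n) set)"


definition prog_measurable ::
    "(real \<Rightarrow> 'a measure) \<Rightarrow> real \<Rightarrow> (real \<Rightarrow> 'a \<Rightarrow> real) \<Rightarrow> bool" where
  "prog_measurable F T H \<longleftrightarrow>
     (\<forall>t\<in>{0..T}. (\<lambda>(s, \<omega>). H s \<omega>) \<in> borel_measurable (restrict_space borel {0..t} \<Otimes>\<^sub>M F t))"

definition tendsto_in_prob :: "'a measure \<Rightarrow> (nat \<Rightarrow> 'a \<Rightarrow> real) \<Rightarrow> ('a \<Rightarrow> real) \<Rightarrow> bool" where
  "tendsto_in_prob M X Y \<longleftrightarrow>
     (\<forall>N. X N \<in> borel_measurable M) \<and> Y \<in> borel_measurable M \<and>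
     (\<forall>\<epsilon>>0. (\<lambda>N. measure M {\<omega>\<in>space M. \<bar>X N \<omega> - Y \<omega>\<bar> > \<epsilon>}) \<longlonglongrightarrow> 0)"

text \<open>A simple integrand is given by a number \<open>m\<close> of steps, deterministic partition points
  \<open>0 \<le> \<tau> 0 < \<dots> < \<tau> m\<close> and bounded \<open>F (\<tau> k)\<close>-measurable heights \<open>\<xi> k\<close> on \<open>(\<tau> k, \<tau> (k + 1)]\<close>.\<close>

definition simple_integrand ::
    "'a measure \<Rightarrow> (real \<Rightarrow> 'a measure) \<Rightarrow> nat \<Rightarrow> (nat \<Rightarrow> real) \<Rightarrow> (nat \<Rightarrow> 'a \<Rightarrow> real) \<Rightarrow> bool" where
  "simple_integrand M F m \<tau> \<xi> \<longleftrightarrow>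
     0 \<le> \<tau> 0 \<and> (\<forall>k<m. \<tau> k < \<tau> (Suc k)) \<and>
     (\<forall>k<m. \<xi> k \<in> borel_measurable (F (\<tau> k)) \<and> (\<exists>C. \<forall>\<omega>\<in>space M. \<bar>\<xi> k \<omega>\<bar> \<le> C))"

definition simple_process ::
    "nat \<Rightarrow> (nat \<Rightarrow> real) \<Rightarrow> (nat \<Rightarrow> 'a \<Rightarrow> real) \<Rightarrow> real \<Rightarrow> 'a \<Rightarrow> real" where
  "simple_process m \<tau> \<xi> s \<omega> = (\<Sum>k<m. \<xi> k \<omega> * indicator {\<tau> k<..\<tau> (Suc k)} s)"

definition simple_ito_integral ::
    "(real \<Rightarrow> 'a \<Rightarrow> real) \<Rightarrow> nat \<Rightarrow> (nat \<Rightarrow> real) \<Rightarrow> (nat \<Rightarrow> 'a \<Rightarrow> real) \<Rightarrow> real \<Rightarrow> 'a \<Rightarrow> real" where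
  "simple_ito_integral W m \<tau> \<xi> t \<omega> =
     (\<Sum>k<m. \<xi> k \<omega> * (W (min t (\<tau> (Suc k))) \<omega> - W (min t (\<tau> k)) \<omega>))"

text \<open>\<open>I\<close> is the It\^o integral process of \<open>H\<close> on \<open>[0, T]\<close>: \<open>H\<close> is progressively measurable with
  almost surely square integrable paths, and \<open>I\<close> is a continuous adapted process such that each
  \<open>I t\<close> is the limit in probability of the elementary integrals of simple integrands approximating
  \<open>H\<close> (in probability, in \<open>L\<^sup>2\<close> of the time interval). This determines \<open>I\<close> up to
  indistinguishability, which is why the integral is a relation and not a function.\<close>

definition has_ito_integral ::
    "'a measure \<Rightarrow> (real \<Rightarrow> 'a measure) \<Rightarrow> (real \<Rightarrow> 'a \<Rightarrow> real) \<Rightarrow> real \<Rightarrow>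
     (real \<Rightarrow> 'a \<Rightarrow> real) \<Rightarrow> (real \<Rightarrow> 'a \<Rightarrow> real) \<Rightarrow> bool" where
  "has_ito_integral M F W T H I \<longleftrightarrow>
     prog_measurable F T H \<and>
     (AE \<omega> in M. set_integrable lborel {0..T} (\<lambda>s. (H s \<omega>)\<^sup>2)) \<and>
     adapted_on F {0..T} I \<and>
     (\<forall>\<omega>\<in>space M. continuous_on {0..T} (\<lambda>t. I t \<omega>)) \<and>
     (\<exists>m \<tau> \<xi>.
        (\<forall>N. simple_integrand M F (m N) (\<tau> N) (\<xi> N)) \<and>
        tendsto_in_prob M
          (\<lambda>N \<omega>. LINT s:{0..T}|lborel. (simple_process (m N) (\<tau> N) (\<xi> N) s \<omega> - H s \<omega>)\<^sup>2)
          (\<lambda>\<omega>. 0) \<and>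
        (\<forall>t\<in>{0..T}. tendsto_in_prob M
          (\<lambda>N. simple_ito_integral W (m N) (\<tau> N) (\<xi> N) t) (I t)))"

definition has_matrix_ito_integral ::
    "'a measure \<Rightarrow> (real \<Rightarrow> 'a measure) \<Rightarrow> (real \<Rightarrow> 'a \<Rightarrow> real^'n^'n) \<Rightarrow> real \<Rightarrow>
     (real \<Rightarrow> 'a \<Rightarrow> real^'n^'n) \<Rightarrow> (real \<Rightarrow> 'a \<Rightarrow> real^'n^'n) \<Rightarrow> bool" where
  "has_matrix_ito_integral M F B T V I \<longleftrightarrow>
     (\<exists>J. (\<forall>i m j. has_ito_integral M F (\<lambda>t \<omega>. B t \<omega> $ m $ j) T (\<lambda>t \<omega>. V t \<omega> $ i $ m) (J i m j)) \<and>
          (\<forall>t\<in>{0..T}. \<forall>\<omega>\<in>space M. I t \<omega> = (\<chi> i j. \<Sum>m\<in>UNIV. J i m j t \<omega>)))"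


definition strong_solution ::
    "'a measure \<Rightarrow> (real \<Rightarrow> 'a measure) \<Rightarrow> (real \<Rightarrow> 'a \<Rightarrow> real^'n^'n) \<Rightarrow> real \<Rightarrow>
     (real \<Rightarrow> real^'n^'n \<Rightarrow> real^'n^'n) \<Rightarrow> (real \<Rightarrow> real^'n^'n \<Rightarrow> real^'n^'n) \<Rightarrow> real^'n^'n \<Rightarrow>
     (real \<Rightarrow> 'a \<Rightarrow> real^'n^'n) \<Rightarrow> bool" where
  "strong_solution M F B T b \<sigma> x X \<longleftrightarrow>
     adapted_on F {0..T} X \<and>
     (\<forall>\<omega>\<in>space M. continuous_on {0..T} (\<lambda>t. X t \<omega>)) \<and>
     (AE \<omega> in M. set_integrable lborel {0..T} (\<lambda>s. b s (X s \<omega>))) \<and>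
     (\<exists>I. has_matrix_ito_integral M F B T (\<lambda>s \<omega>. \<sigma> s (X s \<omega>)) I \<and>
        (AE \<omega> in M. \<forall>t\<in>{0..T}. X t \<omega> = x + (LINT s:{0..t}|lborel. b s (X s \<omega>)) + I t \<omega>))"

definition indistinguishable_on ::
    "'a measure \<Rightarrow> real set \<Rightarrow> (real \<Rightarrow> 'a \<Rightarrow> 'b) \<Rightarrow> (real \<Rightarrow> 'a \<Rightarrow> 'b) \<Rightarrow> bool" where
  "indistinguishable_on M I X Y \<longleftrightarrow> (AE \<omega> in M. \<forall>t\<in>I. X t \<omega> = Y t \<omega>)"

end

theory Submission
  imports Defs
begin

text \<open>
  The moment bound rests on an \<open>L\<^sup>2\<close> maximal inequality for It\^o integrals up to a stopping time:
  for simple integrands it is Doob's inequality together with the It\^o isometry, and it passes to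
  limits by Fatou's lemma. The constant 4 of Doob's inequality, the isometry
  \<open>E \<parallel>\<integral>\<^sub>0\<^sup>t \<sigma> dB\<parallel>\<^sup>2 = n * E (\<integral>\<^sub>0\<^sup>t \<parallel>\<sigma>\<parallel>\<^sup>2)\<close> (each entry of \<open>\<sigma>\<close> enters \<open>n\<close> entries of the integral), the drift estimate
  \<open>\<parallel>\<integral>\<^sub>0\<^sup>t b\<parallel>\<^sup>2 \<le> T * \<integral>\<^sub>0\<^sup>t \<parallel>b\<parallel>\<^sup>2\<close> and the inequality \<open>\<parallel>p + q + r\<parallel>\<^sup>2 \<le> 3 * (\<parallel>p\<parallel>\<^sup>2 + \<parallel>q\<parallel>\<^sup>2 + \<parallel>r\<parallel>\<^sup>2)\<close>
  give \<open>3 * (T + 4 * n)\<close>. The growth bound \<open>\<parallel>b\<parallel>\<^sup>2 + \<parallel>\<sigma>\<parallel>\<^sup>2 \<le> 2 * \<kappa> * (1 + \<parallel>X\<parallel>\<^sup>2)\<close> contributes the factor 2, and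
  Gronwall's inequality for \<open>1 + E (sup \<parallel>X\<parallel>\<^sup>2)\<close>, localized by exit times of balls, yields the
  estimate. The same argument for the difference of two solutions, where the growth bound becomes
  the Lipschitz bound, shows uniqueness. For existence, the successive differences of the Picard
  iterates decay geometrically in \<open>E (sup \<parallel>X\<parallel>\<^sup>2)\<close>: weighting the \<open>k\<close>-th one by \<open>8\<^sup>k\<close>, the partial sums
  satisfy a Gronwall inequality with a constant that does not depend on their length.
\<close>

section \<open>Square integrable variables and Brownian increments\<close>

text \<open>The estimates for integrals and solutions are inequalities in \<open>ennreal\<close>, so
  they can be stated before anything is known to be finite. Finiteness is a hypothesis of Gronwall's
  inequality, and since a solution has no known moments, it has to be localized. Stopping times
  \<theta> appear as predicates standing for s \<le> \<theta>. It suffices that this event lies in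
  \<open>F s\<close>, which holds for exit times from closed balls without right-continuity of the
  filtration; on a grid the predicate is a 0-1 factor in front of each increment, so that optional
  stopping reduces to orthogonality of increments. Suprema run over dyadic times, a countable dense
  set, and are the full suprema when paths are continuous. Each entry of a matrix integral involves
  one column of Brownian motions, and the isometry rests on the fact that simultaneous increments in
  a column are orthogonal given the past. The rate 1/8 recurs because squared distances are chained
  by (a + b)^2 \<le> 2 a^2 + 2 b^2, which doubles the weight at every link and asks for a rate below
  1/2.\<close>

definition sq_integrable :: "'a measure \<Rightarrow> ('a \<Rightarrow> real) \<Rightarrow> bool" where
  "sq_integrable M X \<longleftrightarrow> X \<in> borel_measurable M \<and> integrable M (\<lambda>\<omega>. (X \<omega>)\<^sup>2)"

lemma sq_integrable_measurable[measurable_dest]: "sq_integrable M X \<Longrightarrow> X \<in> borel_measurable M"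
  by (simp add: sq_integrable_def)

lemma sq_integrable_square: "sq_integrable M X \<Longrightarrow> integrable M (\<lambda>\<omega>. (X \<omega>)\<^sup>2)"
  by (simp add: sq_integrable_def)

lemma integrable_mult_sq_integrable:
  assumes "sq_integrable M X" "sq_integrable M Y"
  shows "integrable M (\<lambda>\<omega>. X \<omega> * Y \<omega>)"
proof (rule Bochner_Integration.integrable_bound)
  show "integrable M (\<lambda>\<omega>. (X \<omega>)\<^sup>2 + (Y \<omega>)\<^sup>2)" using assms by (simp add: sq_integrable_def)
  show "(\<lambda>\<omega>. X \<omega> * Y \<omega>) \<in> borel_measurable M" using assms by measurable
  have "\<bar>x * y\<bar> \<le> x\<^sup>2 + y\<^sup>2" for x y :: real
    using sum_squares_bound[of x y] sum_squares_bound[of x "-y"] by (simp add: abs_le_iff)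
  then show "AE \<omega> in M. norm (X \<omega> * Y \<omega>) \<le> norm ((X \<omega>)\<^sup>2 + (Y \<omega>)\<^sup>2)" by simp
qed

lemma sq_integrable_add[intro]:
  assumes "sq_integrable M X" "sq_integrable M Y"
  shows "sq_integrable M (\<lambda>\<omega>. X \<omega> + Y \<omega>)"
proof -
  have "integrable M (\<lambda>\<omega>. (X \<omega>)\<^sup>2 + (Y \<omega>)\<^sup>2 + 2 * (X \<omega> * Y \<omega>))"
    using assms integrable_mult_sq_integrable[OF assms] by (simp add: sq_integrable_def)
  also have "(\<lambda>\<omega>. (X \<omega>)\<^sup>2 + (Y \<omega>)\<^sup>2 + 2 * (X \<omega> * Y \<omega>)) = (\<lambda>\<omega>. (X \<omega> + Y \<omega>)\<^sup>2)"
    by (simp add: power2_sum mult.assoc)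
  finally show ?thesis using assms by (auto simp: sq_integrable_def)
qed

lemma sq_integrable_bounded_mult:
  assumes "Z \<in> borel_measurable M" "\<And>\<omega>. \<omega> \<in> space M \<Longrightarrow> \<bar>Z \<omega>\<bar> \<le> C" "sq_integrable M X"
  shows "sq_integrable M (\<lambda>\<omega>. Z \<omega> * X \<omega>)"
proof -
  have "integrable M (\<lambda>\<omega>. (Z \<omega> * X \<omega>)\<^sup>2)"
  proof (rule Bochner_Integration.integrable_bound)
    show "integrable M (\<lambda>\<omega>. C\<^sup>2 * (X \<omega>)\<^sup>2)" using assms by (simp add: sq_integrable_def)
    show "(\<lambda>\<omega>. (Z \<omega> * X \<omega>)\<^sup>2) \<in> borel_measurable M" using assms by measurable
    have "(Z \<omega>)\<^sup>2 \<le> C\<^sup>2" if "\<omega> \<in> space M" for \<omega>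
      using assms(2)[OF that] by (simp add: abs_le_square_iff[symmetric])
    then show "AE \<omega> in M. norm ((Z \<omega> * X \<omega>)\<^sup>2) \<le> norm (C\<^sup>2 * (X \<omega>)\<^sup>2)"
      by (auto simp: power_mult_distrib intro!: mult_right_mono)
  qed
  then show ?thesis using assms by (auto simp: sq_integrable_def)
qed

lemma sq_integrable_uminus[intro]: "sq_integrable M X \<Longrightarrow> sq_integrable M (\<lambda>\<omega>. - X \<omega>)"
  by (auto simp: sq_integrable_def)

lemma sq_integrable_diff[intro]:
  "sq_integrable M X \<Longrightarrow> sq_integrable M Y \<Longrightarrow> sq_integrable M (\<lambda>\<omega>. X \<omega> - Y \<omega>)"
  using sq_integrable_add[of M X "\<lambda>\<omega>. - Y \<omega>"] by auto

lemma sq_integrable_zero[simp, intro]: "sq_integrable M (\<lambda>\<omega>. 0)"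
  by (auto simp: sq_integrable_def)

lemma sq_integrable_abs[intro]: "sq_integrable M X \<Longrightarrow> sq_integrable M (\<lambda>\<omega>. \<bar>X \<omega>\<bar>)"
  by (auto simp: sq_integrable_def)

lemma sq_integrable_max[intro]:
  assumes X: "sq_integrable M X" and Y: "sq_integrable M Y"
  shows "sq_integrable M (\<lambda>\<omega>. max (X \<omega>) (Y \<omega>))"
proof -
  have "integrable M (\<lambda>\<omega>. (max (X \<omega>) (Y \<omega>))\<^sup>2)"
  proof (rule Bochner_Integration.integrable_bound)
    show "integrable M (\<lambda>\<omega>. (X \<omega>)\<^sup>2 + (Y \<omega>)\<^sup>2)" using assms by (simp add: sq_integrable_def)
    show "(\<lambda>\<omega>. (max (X \<omega>) (Y \<omega>))\<^sup>2) \<in> borel_measurable M" using assms by measurable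
  qed (auto simp: max_def)
  then show ?thesis using assms by (auto simp: sq_integrable_def)
qed

lemma sq_integrable_sum[intro]:
  "(\<And>k. k \<in> A \<Longrightarrow> sq_integrable M (X k)) \<Longrightarrow> sq_integrable M (\<lambda>\<omega>. \<Sum>k\<in>A. X k \<omega>)"
  by (induction A rule: infinite_finite_induct) auto

lemma (in finite_measure) sq_integrable_const_bound:
  assumes "Z \<in> borel_measurable M" "\<And>\<omega>. \<omega> \<in> space M \<Longrightarrow> \<bar>Z \<omega>\<bar> \<le> C"
  shows "sq_integrable M Z"
  using sq_integrable_bounded_mult[OF assms, of "\<lambda>_. 1"]
  by (simp add: sq_integrable_def)

lemma (in finite_measure) sq_integrable_integrable:
  "sq_integrable M X \<Longrightarrow> integrable M X"
  using integrable_mult_sq_integrable[of M X "\<lambda>_. 1"] by (simp add: sq_integrable_def)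

lemma (in prob_space) square_expectation_le:
  assumes "sq_integrable M X"
  shows "(expectation X)\<^sup>2 \<le> expectation (\<lambda>\<omega>. (X \<omega>)\<^sup>2)"
  using variance_eq[OF sq_integrable_integrable[OF assms] sq_integrable_square[OF assms]]
    variance_positive[of X] by simp


text \<open>Pairs of indices are sorted into the diagonal and the two triangles. In a triangle the
  factor with the later index stands apart, so for increments it is orthogonal to everything that
  precedes it.\<close>

lemma sum_product_triangular:
  fixes a b :: "nat \<Rightarrow> 'b::comm_ring"
  shows "(\<Sum>k<N. a k) * (\<Sum>k<N. b k) =
    (\<Sum>k<N. a k * b k) + (\<Sum>k<N. (\<Sum>l<k. a l) * b k) + (\<Sum>k<N. (\<Sum>l<k. b l) * a k)"
  by (induction N) (auto simp: algebra_simps)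

section \<open>Increments of Brownian motions given the past\<close>

context filtered_prob_space begin

lemma measurable_F_mono: "s \<le> t \<Longrightarrow> X \<in> measurable (F s) N \<Longrightarrow> X \<in> measurable (F t) N"
  using sets_F_mono[of s t] by (auto simp: measurable_def space_F)

lemma measurable_F_M: "0 \<le> t \<Longrightarrow> X \<in> measurable (F t) N \<Longrightarrow> X \<in> measurable M N"
  using subalgebra_F[of t] by (auto simp: measurable_def space_F subalgebra_def)

text \<open>Null sets of \<open>M\<close> belong to \<open>F t\<close> for t \<ge> 0, so a variable
  may be reset to a constant on a null set without losing adaptedness. This is how limits obtain
  paths that are continuous for every \<omega> and not merely for almost every one.\<close>

lemma AE_cong_measurable_F:
  fixes f g :: "'a \<Rightarrow> 'b::topological_space"
  assumes "0 \<le> t" "f \<in> borel_measurable (F t)" "N \<in> null_sets M"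
    "\<And>\<omega>. \<omega> \<in> space M \<Longrightarrow> \<omega> \<notin> N \<Longrightarrow> g \<omega> = f \<omega>" "\<And>\<omega>. \<omega> \<in> N \<Longrightarrow> g \<omega> = c"
  shows "g \<in> borel_measurable (F t)"
proof -
  have N: "N \<in> sets (F t)" using null_sets_F[OF assms(1)] assms(3) by auto
  have "(\<lambda>\<omega>. if \<omega> \<in> N then c else f \<omega>) \<in> borel_measurable (F t)"
    using N assms(2) by measurable
  then show ?thesis
    by (rule measurable_cong[THEN iffD1, rotated]) (use assms(4,5) in \<open>auto simp: space_F\<close>)
qed

lemma bm_measurable: "std_brownian_motion M F W \<Longrightarrow> 0 \<le> t \<Longrightarrow> W t \<in> borel_measurable (F t)"
  by (auto simp: std_brownian_motion_def adapted_on_def)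

lemma bm_indep_var:
  assumes W: "std_brownian_motion M F W" and st: "0 \<le> s" "s < t" and Z: "Z \<in> borel_measurable (F s)"
  shows "indep_var borel Z borel (\<lambda>\<omega>. W t \<omega> - W s \<omega>)"
proof -
  have m: "(\<lambda>\<omega>. W t \<omega> - W s \<omega>) \<in> borel_measurable M"
    using measurable_F_M[OF _ bm_measurable[OF W, of t]] measurable_F_M[OF _ bm_measurable[OF W, of s]] st
    by auto
  have i: "indep_set (sets (F s)) {(\<lambda>\<omega>. W t \<omega> - W s \<omega>) -` A \<inter> space M | A. A \<in> sets borel}"
    using W st by (auto simp: std_brownian_motion_def)
  \<comment> \<open>Independence of random variables is independence of the generated
    \<sigma>-algebras, which follows from independence of generators only if these are stable under
    intersection.\<close>
  have stable: "Int_stable {X -` A \<inter> space M | A. A \<in> sets borel}" for X :: "'a \<Rightarrow> real"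
  proof (rule Int_stableI, safe)
    fix A A' :: "real set" assume "A \<in> sets borel" "A' \<in> sets borel"
    then show "\<exists>B. X -` A \<inter> space M \<inter> (X -` A' \<inter> space M) = X -` B \<inter> space M \<and> B \<in> sets borel"
      by (intro exI[of _ "A \<inter> A'"]) auto
  qed
  have "indep_set {Z -` A \<inter> space M | A. A \<in> sets borel} {(\<lambda>\<omega>. W t \<omega> - W s \<omega>) -` A \<inter> space M | A. A \<in> sets borel}"
    unfolding indep_set_def
    by (rule indep_sets_mono_sets[OF i[unfolded indep_set_def]])
      (use Z in \<open>auto simp: measurable_def space_F split: bool.splits\<close>)
  then have "indep_set (sigma_sets (space M) {Z -` A \<inter> space M | A. A \<in> sets borel})
      (sigma_sets (space M) {(\<lambda>\<omega>. W t \<omega> - W s \<omega>) -` A \<inter> space M | A. A \<in> sets borel})"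
    by (rule indep_set_sigma_sets[OF _ stable stable])
  then show ?thesis
    unfolding indep_var_eq using m measurable_F_M[OF st(1) Z] by auto
qed

lemma bm_normal:
  assumes W: "std_brownian_motion M F W" and st: "0 \<le> s" "s < t"
  shows "distributed M lborel (\<lambda>\<omega>. W t \<omega> - W s \<omega>) (normal_density 0 (sqrt (t - s)))"
  using W st by (auto simp: std_brownian_motion_def)

lemma bm_increment:
  assumes W: "std_brownian_motion M F W" and st: "0 \<le> s" "s \<le> t"
  shows "sq_integrable M (\<lambda>\<omega>. W t \<omega> - W s \<omega>)"
    "expectation (\<lambda>\<omega>. W t \<omega> - W s \<omega>) = 0"
    "expectation (\<lambda>\<omega>. (W t \<omega> - W s \<omega>)\<^sup>2) = t - s"
proof -
  have *: "sq_integrable M (\<lambda>\<omega>. W t \<omega> - W s \<omega>) \<and> expectation (\<lambda>\<omega>. W t \<omega> - W s \<omega>) = 0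
    \<and> expectation (\<lambda>\<omega>. (W t \<omega> - W s \<omega>)\<^sup>2) = t - s"
  \<comment> \<open>A zero increment has no density, and the definition of Brownian motion speaks of
    s < t only.\<close>
  proof (cases "s = t")
    case True then show ?thesis by simp
  next
    case False
    then have l: "s < t" using st by simp
    note d = bm_normal[OF W st(1) l]
    have m: "(\<lambda>\<omega>. W t \<omega> - W s \<omega>) \<in> borel_measurable M"
      using distributed_measurable[OF d] by simp
    have "integrable lborel (\<lambda>x. normal_density 0 (sqrt (t - s)) x * (x - 0)^2)"
      by (rule integrable_normal_moment) (use l in auto)
    then have "integrable M (\<lambda>\<omega>. (W t \<omega> - W s \<omega>)\<^sup>2)"
      using distributed_integrable[OF d, of "\<lambda>x. x\<^sup>2"] by (auto)
    moreover have "expectation (\<lambda>\<omega>. W t \<omega> - W s \<omega>) = 0"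
      using normal_distributed_expectation[OF _ d] l by auto
    moreover have "variance (\<lambda>\<omega>. W t \<omega> - W s \<omega>) = (sqrt (t - s))\<^sup>2"
      using normal_distributed_variance[OF _ d] l by auto
    ultimately show ?thesis using l m by (auto simp: sq_integrable_def)
  qed
  show "sq_integrable M (\<lambda>\<omega>. W t \<omega> - W s \<omega>)"
    "expectation (\<lambda>\<omega>. W t \<omega> - W s \<omega>) = 0"
    "expectation (\<lambda>\<omega>. (W t \<omega> - W s \<omega>)\<^sup>2) = t - s" using * by auto
qed

lemma bm_mean:
  assumes W: "std_brownian_motion M F W" and st: "0 \<le> s" "s \<le> t"
    and Z: "Z \<in> borel_measurable (F s)" "integrable M Z"
  shows "expectation (\<lambda>\<omega>. Z \<omega> * (W t \<omega> - W s \<omega>)) = 0"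
proof (cases "s = t")
  case False
  then have l: "s < t" using st by simp
  have "expectation (\<lambda>\<omega>. Z \<omega> * (W t \<omega> - W s \<omega>)) = expectation Z * expectation (\<lambda>\<omega>. W t \<omega> - W s \<omega>)"
    by (rule indep_var_lebesgue_integral[OF bm_indep_var[OF W st(1) l Z(1)] Z(2)
       sq_integrable_integrable[OF bm_increment(1)[OF W st]]])
  then show ?thesis using bm_increment(2)[OF W st] by simp
qed simp

lemma bm_square:
  assumes W: "std_brownian_motion M F W" and st: "0 \<le> s" "s \<le> t"
    and Z: "Z \<in> borel_measurable (F s)" "integrable M Z"
  shows "expectation (\<lambda>\<omega>. Z \<omega> * (W t \<omega> - W s \<omega>)\<^sup>2) = (t - s) * expectation Z"
proof (cases "s = t")
  case False
  then have l: "s < t" using st by simp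
  have "indep_var borel (id \<circ> Z) borel ((\<lambda>x. x\<^sup>2) \<circ> (\<lambda>\<omega>. W t \<omega> - W s \<omega>))"
    by (rule indep_var_compose[OF bm_indep_var[OF W st(1) l Z(1)]]) auto
  then have i: "indep_var borel Z borel (\<lambda>\<omega>. (W t \<omega> - W s \<omega>)\<^sup>2)" by (simp add: o_def)
  have "expectation (\<lambda>\<omega>. Z \<omega> * (W t \<omega> - W s \<omega>)\<^sup>2) = expectation Z * expectation (\<lambda>\<omega>. (W t \<omega> - W s \<omega>)\<^sup>2)"
    by (rule indep_var_lebesgue_integral[OF i Z(2)]) (use bm_increment(1)[OF W st] in \<open>simp add: sq_integrable_def\<close>)
  then show ?thesis using bm_increment(3)[OF W st] by simp
qed simp

text \<open>The increments of two \<open>F\<close>-Brownian motions that are independent of each other as processes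
  are orthogonal conditionally on \<open>F s\<close>, although joint independence of the pair from \<open>F s\<close> is not
  assumed: on a partition of \<open>[s, t]\<close> the off-diagonal products of increments vanish by
  adaptedness, and the diagonal ones are small in \<open>L\<^sup>2\<close>.\<close>

lemma bm_orthogonal:
  assumes W: "std_brownian_motion M F W" and V: "std_brownian_motion M F V"
    and ind: "indep_var (\<Pi>\<^sub>M t\<in>{0..}. borel) (\<lambda>\<omega>. \<lambda>t\<in>{0::real..}. W t \<omega>)
       (\<Pi>\<^sub>M t\<in>{0..}. borel) (\<lambda>\<omega>. \<lambda>t\<in>{0::real..}. V t \<omega>)"
    and st: "0 \<le> s" "s \<le> t"
    and Z: "Z \<in> borel_measurable (F s)" and ZC: "\<And>\<omega>. \<omega> \<in> space M \<Longrightarrow> \<bar>Z \<omega>\<bar> \<le> C"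
  shows "expectation (\<lambda>\<omega>. Z \<omega> * ((W t \<omega> - W s \<omega>) * (V t \<omega> - V s \<omega>))) = 0" (is "?E = 0")
proof -
  \<comment> \<open>Of the triangular decomposition only the diagonal sum survives. Its second
    moment is N ((t - s) / N)^2, which vanishes with the mesh, and the square of an expectation is
    at most the expectation of the square.\<close>
  have bound: "?E\<^sup>2 \<le> C\<^sup>2 * (t - s)\<^sup>2 * inverse (real (Suc n))" for n
  proof -
    define N where "N = Suc n"
    define u where "u k = s + real k * (t - s) / N" for k
    have N0: "N > 0" by (simp add: N_def)
    have u0: "u 0 = s" and uN: "u N = t" using N0 by (auto simp: u_def field_simps)
    have us: "s \<le> u k" for k using st by (auto simp: u_def)
    then have upos: "0 \<le> u k" for k using st order_trans by blast
    have umono: "k \<le> l \<Longrightarrow> u k \<le> u l" for k l using st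
      by (auto simp: u_def intro!: divide_right_mono mult_right_mono)
    have ud: "u (Suc k) - u k = (t - s) / N" for k by (simp add: u_def diff_divide_distrib[symmetric] algebra_simps)
    define a where "a k \<omega> = W (u (Suc k)) \<omega> - W (u k) \<omega>" for k \<omega>
    define b where "b k \<omega> = V (u (Suc k)) \<omega> - V (u k) \<omega>" for k \<omega>
    have asum: "(\<Sum>l<k. a l \<omega>) = W (u k) \<omega> - W s \<omega>" for k \<omega>
      unfolding a_def using sum_lessThan_telescope[of "\<lambda>k. W (u k) \<omega>" k] by (simp add: u0)
    have bsum: "(\<Sum>l<k. b l \<omega>) = V (u k) \<omega> - V s \<omega>" for k \<omega>
      unfolding b_def using sum_lessThan_telescope[of "\<lambda>k. V (u k) \<omega>" k] by (simp add: u0)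
    have sa: "sq_integrable M (a k)" for k unfolding a_def using umono upos by (intro bm_increment(1)[OF W]) auto
    have sb: "sq_integrable M (b k)" for k unfolding b_def using umono upos by (intro bm_increment(1)[OF V]) auto
    have ma: "a k \<in> borel_measurable (F (u (Suc k)))" for k unfolding a_def
      by (intro borel_measurable_diff measurable_F_mono[OF umono bm_measurable[OF W]] upos) auto
    have mb: "b k \<in> borel_measurable (F (u (Suc k)))" for k unfolding b_def
      by (intro borel_measurable_diff measurable_F_mono[OF umono bm_measurable[OF V]] upos) auto
    have mZ: "Z \<in> borel_measurable (F (u k))" for k by (rule measurable_F_mono[OF us Z])
    have mZM: "Z \<in> borel_measurable M" by (rule measurable_F_M[OF st(1) Z])
    have ab0: "expectation (\<lambda>\<omega>. Z \<omega> * ((\<Sum>l<k. a l \<omega>) * b k \<omega>)) = 0" for k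
    proof -
      have "expectation (\<lambda>\<omega>. (Z \<omega> * (\<Sum>l<k. a l \<omega>)) * (V (u (Suc k)) \<omega> - V (u k) \<omega>)) = 0"
      proof (rule bm_mean[OF V upos umono])
        show "(\<lambda>\<omega>. Z \<omega> * (\<Sum>l<k. a l \<omega>)) \<in> borel_measurable (F (u k))"
          by (intro borel_measurable_times borel_measurable_sum mZ measurable_F_mono[OF umono ma]) auto
        show "integrable M (\<lambda>\<omega>. Z \<omega> * (\<Sum>l<k. a l \<omega>))"
          by (intro sq_integrable_integrable sq_integrable_bounded_mult[OF mZM ZC] sq_integrable_sum sa)
      qed simp
      then show ?thesis by (simp add: b_def mult.assoc)
    qed
    have ba0: "expectation (\<lambda>\<omega>. Z \<omega> * ((\<Sum>l<k. b l \<omega>) * a k \<omega>)) = 0" for k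
    proof -
      have "expectation (\<lambda>\<omega>. (Z \<omega> * (\<Sum>l<k. b l \<omega>)) * (W (u (Suc k)) \<omega> - W (u k) \<omega>)) = 0"
      proof (rule bm_mean[OF W upos umono])
        show "(\<lambda>\<omega>. Z \<omega> * (\<Sum>l<k. b l \<omega>)) \<in> borel_measurable (F (u k))"
          by (intro borel_measurable_times borel_measurable_sum mZ measurable_F_mono[OF umono mb]) auto
        show "integrable M (\<lambda>\<omega>. Z \<omega> * (\<Sum>l<k. b l \<omega>))"
          by (intro sq_integrable_integrable sq_integrable_bounded_mult[OF mZM ZC] sq_integrable_sum sb)
      qed simp
      then show ?thesis by (simp add: a_def mult.assoc)
    qed
    define Q where "Q \<omega> = (\<Sum>k<N. a k \<omega> * b k \<omega>)" for \<omega>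
    \<comment> \<open>Independence of the whole processes enters here: the two products are
      functions of the two paths, each evaluated at several times.\<close>
    have indab: "indep_var borel (\<lambda>\<omega>. a k \<omega> * a l \<omega>) borel (\<lambda>\<omega>. b k \<omega> * b l \<omega>)" for k l
    proof -
      define f where "f x = (x (u (Suc k)) - x (u k)) * (x (u (Suc l)) - x (u l))" for x :: "real \<Rightarrow> real"
      have "f \<in> borel_measurable (\<Pi>\<^sub>M t\<in>{0..}. borel)" unfolding f_def
        by (intro borel_measurable_times borel_measurable_diff measurable_component_singleton) (auto simp: upos)
      from indep_var_compose[OF ind this this]
      show ?thesis by (simp add: o_def f_def a_def b_def upos)
    qed
    have iaa: "integrable M (\<lambda>\<omega>. a k \<omega> * a l \<omega>)" for k l by (rule integrable_mult_sq_integrable[OF sa sa])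
    have ibb: "integrable M (\<lambda>\<omega>. b k \<omega> * b l \<omega>)" for k l by (rule integrable_mult_sq_integrable[OF sb sb])
    have iQ: "integrable M (\<lambda>\<omega>. (a k \<omega> * a l \<omega>) * (b k \<omega> * b l \<omega>))" for k l
      by (rule indep_var_integrable[OF indab iaa ibb])
    have aa0: "expectation (\<lambda>\<omega>. a k \<omega> * a l \<omega>) = 0" if "k < l" for k l
    proof -
      have "u (Suc k) \<le> u l" using that by (intro umono) simp
      then show ?thesis unfolding a_def[of l]
        by (intro bm_mean[OF W upos umono] measurable_F_mono[OF _ ma] sq_integrable_integrable[OF sa]) auto
    qed
    have aaeq: "expectation (\<lambda>\<omega>. a k \<omega> * a l \<omega>) = (if k = l then (t - s) / N else 0)" for k l
    proof (cases k l rule: linorder_cases)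
      case equal
      then show ?thesis using bm_increment(3)[OF W upos umono, of k "Suc k"] ud
        by (simp add: a_def power2_eq_square)
    qed (use aa0[of k l] aa0[of l k] in \<open>auto simp: mult.commute\<close>)
    \<comment> \<open>Off the diagonal the product of expectations already vanishes through its
      \<open>a\<close> factor, so only the diagonal moments of \<open>b\<close> are
      evaluated.\<close>
    have bb: "expectation (\<lambda>\<omega>. b k \<omega> * b k \<omega>) = (t - s) / N" for k
      using bm_increment(3)[OF V upos umono, of k "Suc k"] ud by (simp add: b_def power2_eq_square)
    have Q2: "(Q \<omega>)\<^sup>2 = (\<Sum>k<N. \<Sum>l<N. (a k \<omega> * a l \<omega>) * (b k \<omega> * b l \<omega>))" for \<omega>
      unfolding Q_def power2_eq_square sum_product by (simp add: mult_ac)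
    have sQ: "sq_integrable M Q"
      unfolding sq_integrable_def Q2 using iQ sq_integrable_measurable[OF sa] sq_integrable_measurable[OF sb]
      by (auto simp: Q_def[abs_def])
    have "expectation (\<lambda>\<omega>. (Q \<omega>)\<^sup>2) = (\<Sum>k<N. \<Sum>l<N. expectation (\<lambda>\<omega>. (a k \<omega> * a l \<omega>) * (b k \<omega> * b l \<omega>)))"
      unfolding Q2 by (simp add: iQ)
    also have "\<dots> = (\<Sum>k<N. \<Sum>l<N. expectation (\<lambda>\<omega>. a k \<omega> * a l \<omega>) * expectation (\<lambda>\<omega>. b k \<omega> * b l \<omega>))"
      using indep_var_lebesgue_integral[OF indab iaa ibb] by simp
    also have "\<dots> = (\<Sum>k<N. \<Sum>l<N. if k = l then ((t - s) / N)\<^sup>2 else 0)"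
      by (intro sum.cong refl) (auto simp: aaeq bb power2_eq_square)
    also have "\<dots> = N * ((t - s) / N)\<^sup>2" by simp
    also have "\<dots> = (t - s)\<^sup>2 * inverse N" using N0 by (simp add: power2_eq_square field_simps)
    finally have EQ: "expectation (\<lambda>\<omega>. (Q \<omega>)\<^sup>2) = (t - s)\<^sup>2 * inverse N" .
    have iZ: "integrable M (\<lambda>\<omega>. Z \<omega> * (X \<omega> * Y \<omega>))" if "sq_integrable M X" "sq_integrable M Y" for X Y
      using integrable_mult_sq_integrable[OF sq_integrable_bounded_mult[OF mZM ZC that(1)] that(2)]
      by (simp add: mult.assoc)
    have asumN: "(\<Sum>l<N. a l \<omega>) = W t \<omega> - W s \<omega>" for \<omega> by (simp add: asum uN)
    have bsumN: "(\<Sum>l<N. b l \<omega>) = V t \<omega> - V s \<omega>" for \<omega> by (simp add: bsum uN)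
    have "(W t \<omega> - W s \<omega>) * (V t \<omega> - V s \<omega>) = Q \<omega> + (\<Sum>k<N. (\<Sum>l<k. a l \<omega>) * b k \<omega>)
         + (\<Sum>k<N. (\<Sum>l<k. b l \<omega>) * a k \<omega>)" for \<omega>
      using sum_product_triangular[where a = "\<lambda>k. a k \<omega>" and b = "\<lambda>k. b k \<omega>" and N = N] asumN[of \<omega>] bsumN[of \<omega>]
      unfolding Q_def by simp
    then have eq: "Z \<omega> * ((W t \<omega> - W s \<omega>) * (V t \<omega> - V s \<omega>)) = Z \<omega> * Q \<omega> +
         (\<Sum>k<N. Z \<omega> * ((\<Sum>l<k. a l \<omega>) * b k \<omega>)) + (\<Sum>k<N. Z \<omega> * ((\<Sum>l<k. b l \<omega>) * a k \<omega>))" for \<omega>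
      by (simp add: ring_distribs sum_distrib_left)
    have sZQ: "sq_integrable M (\<lambda>\<omega>. Z \<omega> * Q \<omega>)" by (rule sq_integrable_bounded_mult[OF mZM ZC sQ])
    have isab: "integrable M (\<lambda>\<omega>. Z \<omega> * ((\<Sum>l<k. a l \<omega>) * b k \<omega>))" for k
      by (intro iZ sq_integrable_sum sa sb)
    have isba: "integrable M (\<lambda>\<omega>. Z \<omega> * ((\<Sum>l<k. b l \<omega>) * a k \<omega>))" for k
      by (intro iZ sq_integrable_sum sa sb)
    have "?E = expectation (\<lambda>\<omega>. Z \<omega> * Q \<omega>)"
      unfolding eq using sq_integrable_integrable[OF sZQ] isab isba by (simp add: ab0 ba0)
    then have "?E\<^sup>2 \<le> expectation (\<lambda>\<omega>. (Z \<omega> * Q \<omega>)\<^sup>2)"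
      using square_expectation_le[OF sZQ] by simp
    also have "\<dots> \<le> expectation (\<lambda>\<omega>. C\<^sup>2 * (Q \<omega>)\<^sup>2)"
    proof (rule integral_mono)
      show "integrable M (\<lambda>\<omega>. (Z \<omega> * Q \<omega>)\<^sup>2)" using sZQ by (simp add: sq_integrable_def)
      show "integrable M (\<lambda>\<omega>. C\<^sup>2 * (Q \<omega>)\<^sup>2)" using sQ by (simp add: sq_integrable_def)
      fix \<omega> assume "\<omega> \<in> space M"
      then have "(Z \<omega>)\<^sup>2 \<le> C\<^sup>2" using ZC[of \<omega>] by (simp add: abs_le_square_iff[symmetric])
      then show "(Z \<omega> * Q \<omega>)\<^sup>2 \<le> C\<^sup>2 * (Q \<omega>)\<^sup>2"
        by (auto simp: power_mult_distrib intro!: mult_right_mono)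
    qed
    also have "\<dots> = C\<^sup>2 * (t - s)\<^sup>2 * inverse (real (Suc n))" using EQ by (simp add: N_def)
    finally show ?thesis .
  qed
  have "(\<lambda>n. C\<^sup>2 * (t - s)\<^sup>2 * inverse (real (Suc n))) \<longlonglongrightarrow> C\<^sup>2 * (t - s)\<^sup>2 * 0"
    by (intro tendsto_intros LIMSEQ_inverse_real_of_nat)
  then have "?E\<^sup>2 \<le> 0"
    using LIMSEQ_le_const[of "\<lambda>n. C\<^sup>2 * (t - s)\<^sup>2 * inverse (real (Suc n))" "C\<^sup>2 * (t - s)\<^sup>2 * 0" "?E\<^sup>2"] bound
    by auto
  then show ?thesis by simp
qed

end

section \<open>Simple integrals and the It\^o isometry\<close>

text \<open>Progressive measurability and measurability of the coefficients are stated on restricted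
  time sets. Extension by zero moves both to the whole line, where products and integrals over
  \<open>lborel\<close> need no care with the domain.\<close>

lemma borel_measurable_restrict_pair_iff:
  fixes f :: "'b \<Rightarrow> 'c \<Rightarrow> 'd::real_normed_vector"
  assumes "A \<inter> space M \<in> sets M"
  shows "(\<lambda>(r, \<omega>). f r \<omega>) \<in> borel_measurable (restrict_space M A \<Otimes>\<^sub>M N) \<longleftrightarrow>
    (\<lambda>(r, \<omega>). indicator A r *\<^sub>R f r \<omega>) \<in> borel_measurable (M \<Otimes>\<^sub>M N)"
proof -
  let ?R = "restrict_space (M \<Otimes>\<^sub>M N) (A \<times> space N)"
  have "A \<times> space N \<inter> space (M \<Otimes>\<^sub>M N) = (A \<inter> space M) \<times> space N"
    by (auto simp: space_pair_measure)
  then have sets: "A \<times> space N \<inter> space (M \<Otimes>\<^sub>M N) \<in> sets (M \<Otimes>\<^sub>M N)" using assms by simp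
  have "(\<lambda>(r, \<omega>). f r \<omega>) \<in> borel_measurable (restrict_space M A \<Otimes>\<^sub>M N) \<longleftrightarrow>
    (\<lambda>(r, \<omega>). f r \<omega>) \<in> borel_measurable ?R"
  proof
    have 1: "(\<lambda>x. (fst x, snd x)) \<in> ?R \<rightarrow>\<^sub>M restrict_space M A \<Otimes>\<^sub>M N"
      by (intro measurable_Pair measurable_restrict_space1 measurable_restrict_space2)
        (auto simp: space_restrict_space space_pair_measure)
    show "(\<lambda>(r, \<omega>). f r \<omega>) \<in> borel_measurable ?R"
      if "(\<lambda>(r, \<omega>). f r \<omega>) \<in> borel_measurable (restrict_space M A \<Otimes>\<^sub>M N)"
      by (rule measurable_compose[OF 1[unfolded prod.collapse] that])
    have "(\<lambda>x. (fst x, snd x)) \<in> restrict_space M A \<Otimes>\<^sub>M N \<rightarrow>\<^sub>M M \<Otimes>\<^sub>M N"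
      by (intro measurable_Pair measurable_compose[OF measurable_fst] measurable_snd measurable_restrict_space1 measurable_ident[unfolded id_def])
    then have 2: "(\<lambda>x. x) \<in> restrict_space M A \<Otimes>\<^sub>M N \<rightarrow>\<^sub>M ?R"
      by (intro measurable_restrict_space2) (auto simp: space_restrict_space space_pair_measure)
    show "(\<lambda>(r, \<omega>). f r \<omega>) \<in> borel_measurable (restrict_space M A \<Otimes>\<^sub>M N)"
      if "(\<lambda>(r, \<omega>). f r \<omega>) \<in> borel_measurable ?R"
      by (rule measurable_compose[OF 2 that])
  qed
  also have "\<dots> \<longleftrightarrow>
    (\<lambda>x. indicator (A \<times> space N) x *\<^sub>R (case x of (r, \<omega>) \<Rightarrow> f r \<omega>)) \<in> borel_measurable (M \<Otimes>\<^sub>M N)"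
    using sets by (subst borel_measurable_restrict_space_iff) auto
  also have "\<dots> \<longleftrightarrow> (\<lambda>(r, \<omega>). indicator A r *\<^sub>R f r \<omega>) \<in> borel_measurable (M \<Otimes>\<^sub>M N)"
    by (intro measurable_cong) (auto simp: space_pair_measure indicator_def)
  finally show ?thesis .
qed

text \<open>One column of the matrix Brownian motion. In place of independence it records
  orthogonality of simultaneous increments, weighted by bounded variables from the past; nothing
  more about the joint law enters the isometry.\<close>

locale orthogonal_bm = filtered_prob_space M F
  for M :: "'a measure" and F :: "real \<Rightarrow> 'a measure" +
  fixes W :: "'i::finite \<Rightarrow> real \<Rightarrow> 'a \<Rightarrow> real"
  assumes W_bm: "\<And>m. std_brownian_motion M F (W m)"
    and W_orth: "\<And>m m' s t Z C. m \<noteq> m' \<Longrightarrow> 0 \<le> s \<Longrightarrow> s \<le> t \<Longrightarrow> Z \<in> borel_measurable (F s) \<Longrightarrow>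
      (\<And>\<omega>. \<omega> \<in> space M \<Longrightarrow> \<bar>Z \<omega>\<bar> \<le> C) \<Longrightarrow>
      expectation (\<lambda>\<omega>. Z \<omega> * ((W m t \<omega> - W m s \<omega>) * (W m' t \<omega> - W m' s \<omega>))) = 0"
begin

lemma W_measurable: "0 \<le> s \<Longrightarrow> s \<le> t \<Longrightarrow> W m s \<in> borel_measurable (F t)"
  using measurable_F_mono[OF _ bm_measurable[OF W_bm]] by auto

lemma W_continuous: "AE \<omega> in M. continuous_on {0..} (\<lambda>t. W m t \<omega>)"
  using W_bm[of m] by (auto simp: std_brownian_motion_def)

lemma increment_sq: "0 \<le> s \<Longrightarrow> s \<le> t \<Longrightarrow> sq_integrable M (\<lambda>\<omega>. W m t \<omega> - W m s \<omega>)"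
  using bm_increment(1)[OF W_bm] .

lemma increment_mean:
  assumes "0 \<le> s" "s \<le> t" "X \<in> borel_measurable (F s)" "sq_integrable M X"
  shows "expectation (\<lambda>\<omega>. X \<omega> * (W m t \<omega> - W m s \<omega>)) = 0"
  using assms by (intro bm_mean[OF W_bm] sq_integrable_integrable)

lemma increment_cov_same:
  assumes st: "0 \<le> s" "s \<le> t" and Z: "Z \<in> borel_measurable (F s)" "\<And>\<omega>. \<omega> \<in> space M \<Longrightarrow> \<bar>Z \<omega>\<bar> \<le> C"
  shows "expectation (\<lambda>\<omega>. Z \<omega> * ((W m t \<omega> - W m s \<omega>) * (W m' t \<omega> - W m' s \<omega>))) =
    (if m = m' then (t - s) * expectation Z else 0)"
proof (cases "m = m'")
  case True
  have "integrable M Z"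
    by (intro sq_integrable_integrable sq_integrable_const_bound[OF measurable_F_M[OF st(1) Z(1)] Z(2)])
  then show ?thesis using bm_square[OF W_bm st Z(1)] True by (simp add: power2_eq_square)
qed (use W_orth[OF _ st Z] in auto)

text \<open>Cutting both intervals at c and at \<open>min b d\<close> leaves a common part, where
  the covariance is computed directly, and products in which one increment starts after everything
  else is known. The latter vanish by the mean-zero property. The weight is known only at the later
  left end c, which suffices because the first increment up to c is known there too.\<close>

lemma increment_cov_le:
  assumes ab: "0 \<le> a" "a \<le> b" "a \<le> c" "c \<le> d"
    and Y: "Y \<in> borel_measurable (F c)" "\<And>\<omega>. \<omega> \<in> space M \<Longrightarrow> \<bar>Y \<omega>\<bar> \<le> C"
  shows "expectation (\<lambda>\<omega>. Y \<omega> * ((W m b \<omega> - W m a \<omega>) * (W m' d \<omega> - W m' c \<omega>))) =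
    (if m = m' then max 0 (min b d - c) * expectation Y else 0)"
proof -
  have c0: "0 \<le> c" using ab by simp
  have YM: "Y \<in> borel_measurable M" by (rule measurable_F_M[OF c0 Y(1)])
  have sqY: "sq_integrable M (\<lambda>\<omega>. Y \<omega> * X \<omega>)" if "sq_integrable M X" for X
    by (rule sq_integrable_bounded_mult[OF YM Y(2) that])
  have ii: "integrable M (\<lambda>\<omega>. Y \<omega> * (X \<omega> * X' \<omega>))" if "sq_integrable M X" "sq_integrable M X'" for X X'
    using integrable_mult_sq_integrable[OF sqY[OF that(1)] that(2)] by (simp add: mult.assoc)
  have zero: "expectation (\<lambda>\<omega>. Y \<omega> * ((W k q \<omega> - W k p \<omega>) * (W k' q' \<omega> - W k' p' \<omega>))) = 0"
    if "0 \<le> p" "p \<le> q" "q \<le> p'" "p' \<le> q'" "c \<le> p'" for k k' p q p' q'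
  proof -
    have "expectation (\<lambda>\<omega>. (Y \<omega> * (W k q \<omega> - W k p \<omega>)) * (W k' q' \<omega> - W k' p' \<omega>)) = 0"
      by (intro increment_mean sqY increment_sq borel_measurable_times borel_measurable_diff W_measurable
          measurable_F_mono[OF _ Y(1)]) (use that in auto)
    then show ?thesis by (simp add: mult.assoc)
  qed
  show ?thesis
  proof (cases "b \<le> c")
    case True
    then show ?thesis using zero[of a b c d m m'] ab by (auto simp: max_def)
  next
    case False
    then have cb: "c \<le> b" by simp
    define e where "e = min b d"
    have e: "c \<le> e" "e \<le> b" "e \<le> d" using cb ab by (auto simp: e_def)
    have s: "sq_integrable M (\<lambda>\<omega>. W k q \<omega> - W k p \<omega>)" if "c \<le> p" "p \<le> q" for k p q
      using increment_sq that c0 by auto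
    have s': "sq_integrable M (\<lambda>\<omega>. W m c \<omega> - W m a \<omega>)" using increment_sq ab by auto
    have "(W m b \<omega> - W m a \<omega>) * (W m' d \<omega> - W m' c \<omega>) =
        (W m c \<omega> - W m a \<omega>) * (W m' d \<omega> - W m' c \<omega>)
      + (W m e \<omega> - W m c \<omega>) * (W m' e \<omega> - W m' c \<omega>)
      + (W m e \<omega> - W m c \<omega>) * (W m' d \<omega> - W m' e \<omega>)
      + (W m' e \<omega> - W m' c \<omega>) * (W m b \<omega> - W m e \<omega>)" for \<omega>
      by (cases "b \<le> d") (simp_all add: e_def algebra_simps)
    note eq = this
    have "expectation (\<lambda>\<omega>. Y \<omega> * ((W m b \<omega> - W m a \<omega>) * (W m' d \<omega> - W m' c \<omega>))) =
      expectation (\<lambda>\<omega>. Y \<omega> * ((W m c \<omega> - W m a \<omega>) * (W m' d \<omega> - W m' c \<omega>)))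
    + expectation (\<lambda>\<omega>. Y \<omega> * ((W m e \<omega> - W m c \<omega>) * (W m' e \<omega> - W m' c \<omega>)))
    + expectation (\<lambda>\<omega>. Y \<omega> * ((W m e \<omega> - W m c \<omega>) * (W m' d \<omega> - W m' e \<omega>)))
    + expectation (\<lambda>\<omega>. Y \<omega> * ((W m' e \<omega> - W m' c \<omega>) * (W m b \<omega> - W m e \<omega>)))"
      unfolding eq distrib_left
      using ii[OF s' s[of c d m']] ii[OF s[of c e m] s[of c e m']]
        ii[OF s[of c e m] s[of e d m']]
        ii[OF s[of c e m'] s[of e b m]] ab e
      by simp
    also have "\<dots> = (if m = m' then (e - c) * expectation Y else 0)"
      using increment_cov_same[OF c0 e(1) Y, where m=m and m'=m']
        zero[of a c c d m m'] zero[of c e e d m m']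
        zero[of c e e b m' m] ab c0 e by simp
    finally show ?thesis using e by (simp add: e_def[symmetric])
  qed
qed

lemma increment_cov:
  assumes ab: "0 \<le> a" "a \<le> b" "0 \<le> c" "c \<le> d"
    and Y: "Y \<in> borel_measurable (F (max a c))" "\<And>\<omega>. \<omega> \<in> space M \<Longrightarrow> \<bar>Y \<omega>\<bar> \<le> C"
  shows "expectation (\<lambda>\<omega>. Y \<omega> * ((W m b \<omega> - W m a \<omega>) * (W m' d \<omega> - W m' c \<omega>))) =
    (if m = m' then max 0 (min b d - max a c) * expectation Y else 0)"
proof (cases "a \<le> c")
  case True
  then show ?thesis using increment_cov_le[OF ab(1,2) True ab(4) _ Y(2), where m=m and m'=m'] Y(1)
    by (simp add: max_def)
next
  case False
  then show ?thesis using increment_cov_le[OF ab(3,4) _ ab(2) _ Y(2), where m=m' and m'=m] Y(1)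
    by (simp add: max_def mult.commute min.commute split: if_splits)
qed

inductive simple_integral :: "('i \<Rightarrow> real \<Rightarrow> 'a \<Rightarrow> real) \<Rightarrow> (real \<Rightarrow> 'a \<Rightarrow> real) \<Rightarrow> bool" where
  zero: "simple_integral (\<lambda>i s \<omega>. 0) (\<lambda>t \<omega>. 0)"
| block: "0 \<le> u \<Longrightarrow> u \<le> v \<Longrightarrow> \<xi> \<in> borel_measurable (F u) \<Longrightarrow> (\<And>\<omega>. \<omega> \<in> space M \<Longrightarrow> \<bar>\<xi> \<omega>\<bar> \<le> C) \<Longrightarrow>
    simple_integral (\<lambda>i s \<omega>. if i = m then \<xi> \<omega> * indicator {u<..v} s else 0)
      (\<lambda>t \<omega>. \<xi> \<omega> * (W m (min t v) \<omega> - W m (min t u) \<omega>))"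
| add: "simple_integral D S \<Longrightarrow> simple_integral D' S' \<Longrightarrow>
    simple_integral (\<lambda>i s \<omega>. D i s \<omega> + D' i s \<omega>) (\<lambda>t \<omega>. S t \<omega> + S' t \<omega>)"

lemma simple_integral_uminus:
  "simple_integral D S \<Longrightarrow> simple_integral (\<lambda>i s \<omega>. - D i s \<omega>) (\<lambda>t \<omega>. - S t \<omega>)"
proof (induction rule: simple_integral.induct)
  case zero then show ?case using simple_integral.zero by simp
next
  case (block u v \<xi> C m)
  then have "simple_integral (\<lambda>i s \<omega>. if i = m then (- \<xi> \<omega>) * indicator {u<..v} s else 0)
      (\<lambda>t \<omega>. (- \<xi> \<omega>) * (W m (min t v) \<omega> - W m (min t u) \<omega>))"
    by (intro simple_integral.block[where C = C]) auto
  moreover have "(\<lambda>i s \<omega>. if i = m then (- \<xi> \<omega>) * indicator {u<..v} s else 0) =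
     (\<lambda>i s \<omega>. - (if i = m then \<xi> \<omega> * indicator {u<..v} s else 0))" by (auto simp: fun_eq_iff)
  ultimately show ?case by simp
next
  case (add D S D' S')
  from simple_integral.add[OF add.IH] show ?case by (simp add: add.commute)
qed

lemma simple_integral_diff:
  "simple_integral D S \<Longrightarrow> simple_integral D' S' \<Longrightarrow>
    simple_integral (\<lambda>i s \<omega>. D i s \<omega> - D' i s \<omega>) (\<lambda>t \<omega>. S t \<omega> - S' t \<omega>)"
  using simple_integral.add[OF _ simple_integral_uminus] by fastforce

lemma simple_integral_sum:
  "finite A \<Longrightarrow> (\<And>k. k \<in> A \<Longrightarrow> simple_integral (D k) (S k)) \<Longrightarrow>
    simple_integral (\<lambda>i s \<omega>. \<Sum>k\<in>A. D k i s \<omega>) (\<lambda>t \<omega>. \<Sum>k\<in>A. S k t \<omega>)"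
proof (induction A rule: finite_induct)
  case (insert x A)
  then have "simple_integral (\<lambda>i s \<omega>. D x i s \<omega> + (\<Sum>k\<in>A. D k i s \<omega>)) (\<lambda>t \<omega>. S x t \<omega> + (\<Sum>k\<in>A. S k t \<omega>))"
    by (intro simple_integral.add) auto
  then show ?case using insert by simp
qed (use simple_integral.zero in simp)

lemma simple_integrand_measurable:
  "simple_integral D S \<Longrightarrow> 0 \<le> t \<Longrightarrow>
    (\<lambda>(r, \<omega>). indicator {0..t} r *\<^sub>R D i r \<omega>) \<in> borel_measurable (borel \<Otimes>\<^sub>M F t)"
proof (induction rule: simple_integral.induct)
  case (block u v \<xi> C m)
  show ?case
  proof (cases "u \<le> t \<and> i = m")
    case True
    have [measurable]: "\<xi> \<in> borel_measurable (F t)" using measurable_F_mono[OF _ block(3)] True by auto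
    have "(\<lambda>(r, \<omega>). indicator {0..t} r *\<^sub>R (\<xi> \<omega> * indicator {u<..v} r)) \<in> borel_measurable (borel \<Otimes>\<^sub>M F t)"
      by measurable
    then show ?thesis using True by simp
  next
    case False
    then have "(\<lambda>(r, \<omega>). indicator {0..t} r *\<^sub>R (if i = m then \<xi> \<omega> * indicator {u<..v} r else 0)) = (\<lambda>_. 0)"
      by (auto simp: fun_eq_iff indicator_def)
    then show ?thesis by simp
  qed
next
  case (add D S D' S')
  then have "(\<lambda>x. (case x of (r, \<omega>) \<Rightarrow> indicator {0..t} r *\<^sub>R D i r \<omega>) + (case x of (r, \<omega>) \<Rightarrow> indicator {0..t} r *\<^sub>R D' i r \<omega>))
    \<in> borel_measurable (borel \<Otimes>\<^sub>M F t)" by (intro borel_measurable_add) auto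
  then show ?case by (simp add: case_prod_unfold ring_distribs)
qed simp

lemma simple_integrand_measurable_M:
  "simple_integral D S \<Longrightarrow> (\<lambda>(r, \<omega>). D i r \<omega>) \<in> borel_measurable (borel \<Otimes>\<^sub>M M)"
proof (induction rule: simple_integral.induct)
  case (block u v \<xi> C m)
  have [measurable]: "\<xi> \<in> borel_measurable M" using measurable_F_M block by auto
  show ?case by (cases "i = m") simp_all
qed (simp_all add: case_prod_unfold)

lemma simple_integrand_bounded:
  "simple_integral D S \<Longrightarrow> \<exists>C\<ge>0. \<forall>i s. \<forall>\<omega>\<in>space M. \<bar>D i s \<omega>\<bar> \<le> C"
proof (induction rule: simple_integral.induct)
  case (block u v \<xi> C m)
  then have "\<bar>if i = m then \<xi> \<omega> * indicator {u<..v} s else 0\<bar> \<le> \<bar>C\<bar>" if "\<omega> \<in> space M" for i s \<omega>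
    using block(4)[OF that] by (auto simp: indicator_def abs_mult)
  then show ?case by (intro exI[of _ "\<bar>C\<bar>"]) auto
next
  case (add D S D' S')
  then obtain C C' where "C \<ge> 0" "C' \<ge> 0" "\<forall>i s. \<forall>\<omega>\<in>space M. \<bar>D i s \<omega>\<bar> \<le> C" "\<forall>i s. \<forall>\<omega>\<in>space M. \<bar>D' i s \<omega>\<bar> \<le> C'"
    by blast
  then show ?case by (intro exI[of _ "C + C'"]) (auto intro!: order_trans[OF abs_triangle_ineq] add_mono)
qed auto

lemma simple_integral_sq: "simple_integral D S \<Longrightarrow> 0 \<le> t \<Longrightarrow> sq_integrable M (S t)"
proof (induction rule: simple_integral.induct)
  case (block u v \<xi> C m)
  show ?case
    by (rule sq_integrable_bounded_mult[OF measurable_F_M[OF block(1,3)] block(4)])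
      (use increment_sq[of "min t u" "min t v"] block in auto)
qed auto

lemma simple_integral_measurable: "simple_integral D S \<Longrightarrow> 0 \<le> t \<Longrightarrow> S t \<in> borel_measurable (F t)"
proof (induction rule: simple_integral.induct)
  case (block u v \<xi> C m)
  show ?case
  proof (cases "u \<le> t")
    case True
    show ?thesis
      by (intro borel_measurable_times borel_measurable_diff W_measurable measurable_F_mono[OF True block(3)])
        (use block True in auto)
  next
    case False then show ?thesis using block by (simp add: min_def)
  qed
qed auto

lemma simple_integral_continuous: "simple_integral D S \<Longrightarrow> AE \<omega> in M. continuous_on {0..} (\<lambda>t. S t \<omega>)"
proof (induction rule: simple_integral.induct)
  case (block u v \<xi> C m)
  show ?case using W_continuous[of m]
  proof eventually_elim
    case (elim \<omega>)
    show ?case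
      by (intro continuous_intros continuous_on_compose2[OF elim]) (use block in auto)
  qed
next
  case (add D S D' S')
  from add.IH show ?case by eventually_elim (intro continuous_intros)
qed auto

lemma simple_integral_0: "simple_integral D S \<Longrightarrow> S 0 \<omega> = 0"
  by (induction rule: simple_integral.induct) auto

text \<open>The map \<open>max s (min t x)\<close> projects x onto [s, t]. What a block integral
  gains between s and t is therefore a single increment over the projected block, which starts no
  earlier than s.\<close>

lemma block_increment:
  fixes w :: "real \<Rightarrow> real"
  assumes "s \<le> t" "u \<le> v"
  shows "(w (min t v) - w (min t u)) - (w (min s v) - w (min s u)) = w (max s (min t v)) - w (max s (min t u))"
  using assms by (auto simp: min_def max_def)

text \<open>The martingale property without conditional expectations: testing against square
  integrable variables known at time s is all that Doob's inequality and the orthogonality of grid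
  increments ask for.\<close>

lemma simple_integral_mart:
  "simple_integral D S \<Longrightarrow> 0 \<le> s \<Longrightarrow> s \<le> t \<Longrightarrow> Z \<in> borel_measurable (F s) \<Longrightarrow> sq_integrable M Z \<Longrightarrow>
    expectation (\<lambda>\<omega>. Z \<omega> * (S t \<omega> - S s \<omega>)) = 0"
proof (induction rule: simple_integral.induct)
  case (block u v \<xi> C m)
  let ?f = "\<lambda>x. max s (min t x)"
  have eq: "Z \<omega> * (\<xi> \<omega> * (W m (min t v) \<omega> - W m (min t u) \<omega>) - \<xi> \<omega> * (W m (min s v) \<omega> - W m (min s u) \<omega>))
     = (\<xi> \<omega> * Z \<omega>) * (W m (?f v) \<omega> - W m (?f u) \<omega>)" for \<omega>
    using block_increment[OF block(6,2), of "\<lambda>t. W m t \<omega>"] by (simp add: right_diff_distrib[symmetric])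
  show ?case
  proof (cases "u \<le> t")
    case True
    show ?thesis unfolding eq
      by (intro increment_mean borel_measurable_times measurable_F_mono[OF _ block(3)] measurable_F_mono[OF _ block(7)]
          sq_integrable_bounded_mult[OF measurable_F_M[OF block(1,3)] block(4)] block(8)) (use block True in auto)
  next
    case False
    then show ?thesis unfolding eq using block by (simp add: min_def)
  qed
next
  case (add D S D' S')
  have eq: "Z \<omega> * (S t \<omega> + S' t \<omega> - (S s \<omega> + S' s \<omega>)) = Z \<omega> * (S t \<omega> - S s \<omega>) + Z \<omega> * (S' t \<omega> - S' s \<omega>)" for \<omega>
    by (simp add: algebra_simps)
  have "integrable M (\<lambda>\<omega>. Z \<omega> * (S t \<omega> - S s \<omega>))" "integrable M (\<lambda>\<omega>. Z \<omega> * (S' t \<omega> - S' s \<omega>))"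
    using simple_integral_sq[OF add(1)] simple_integral_sq[OF add(2)] add.prems
    by (auto intro!: integrable_mult_sq_integrable)
  then show ?case unfolding eq using add by simp
qed auto

text \<open>The covariation over [s, t] of the integrals of \<open>D\<close> and \<open>D'\<close>
  against independent Brownian motions. It is kept bilinear, with the second integrand free, for the
  induction in the isometry.\<close>

definition energy :: "('i \<Rightarrow> real \<Rightarrow> 'a \<Rightarrow> real) \<Rightarrow> ('i \<Rightarrow> real \<Rightarrow> 'a \<Rightarrow> real) \<Rightarrow> real \<Rightarrow> real \<Rightarrow> 'a \<Rightarrow> real" where
  "energy D D' s t \<omega> = (LINT r:{s..t}|lborel. \<Sum>i\<in>UNIV. D i r \<omega> * D' i r \<omega>)"

lemma energy_integrable:
  assumes "simple_integral D S" "simple_integral D' S'" "\<omega> \<in> space M"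
  shows "set_integrable lborel {s..t} (\<lambda>r. \<Sum>i\<in>UNIV. D i r \<omega> * D' i r \<omega>)"
proof -
  obtain C C' where C: "C \<ge> 0" "C' \<ge> 0" "\<And>i s. \<bar>D i s \<omega>\<bar> \<le> C" "\<And>i s. \<bar>D' i s \<omega>\<bar> \<le> C'"
    using simple_integrand_bounded[OF assms(1)] simple_integrand_bounded[OF assms(2)] assms(3) by blast
  have [measurable]: "(\<lambda>r. D i r \<omega>) \<in> borel_measurable borel" "(\<lambda>r. D' i r \<omega>) \<in> borel_measurable borel" for i
    using measurable_compose[OF measurable_Pair2'[OF assms(3)] simple_integrand_measurable_M[OF assms(1)], of i]
     measurable_compose[OF measurable_Pair2'[OF assms(3)] simple_integrand_measurable_M[OF assms(2)], of i]
    by simp_all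
  have b: "\<bar>D i r \<omega> * D' i r \<omega>\<bar> \<le> C * C'" for i r using C by (auto simp: abs_mult intro!: mult_mono)
  have bs: "\<bar>\<Sum>i\<in>UNIV. D i r \<omega> * D' i r \<omega>\<bar> \<le> (\<Sum>i\<in>(UNIV :: 'i set). C * C')" for r
    by (rule order_trans[OF sum_abs sum_mono[OF b]])
  show ?thesis unfolding set_integrable_def
  proof (rule integrableI_bounded_set[where A = "{s..t}" and B = "\<Sum>i\<in>(UNIV :: 'i set). C * C'"])
    show "AE r in lborel. r \<in> {s..t} \<longrightarrow> norm (indicat_real {s..t} r *\<^sub>R (\<Sum>i\<in>UNIV. D i r \<omega> * D' i r \<omega>)) \<le> (\<Sum>i\<in>(UNIV :: 'i set). C * C')"
      using bs by (auto simp: indicator_def)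
  qed (auto simp: emeasure_lborel_Icc_eq)
qed

lemma energy_measurable:
  assumes "simple_integral D S" "simple_integral D' S'" "0 \<le> s" "0 \<le> t"
  shows "energy D D' s t \<in> borel_measurable (F t)"
proof -
  note [measurable] = simple_integrand_measurable[OF assms(1,4)] simple_integrand_measurable[OF assms(2,4)]
  \<comment> \<open>Inserting the indicator of {0..t} changes nothing for s \<ge> 0, but it ties the
    integrands to their joint measurability with respect to \<open>F t\<close>.\<close>
  have "(\<lambda>\<omega>. LINT r|lborel. indicator {s..t} r *\<^sub>R (\<Sum>i\<in>UNIV. (indicator {0..t} r *\<^sub>R D i r \<omega>) * (indicator {0..t} r *\<^sub>R D' i r \<omega>)))
     \<in> borel_measurable (F t)" by measurable
  also have "(\<lambda>\<omega>. LINT r|lborel. indicator {s..t} r *\<^sub>R (\<Sum>i\<in>UNIV. (indicator {0..t} r *\<^sub>R D i r \<omega>) * (indicator {0..t} r *\<^sub>R D' i r \<omega>)))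
    = energy D D' s t" unfolding energy_def set_lebesgue_integral_def
    by (intro ext Bochner_Integration.integral_cong refl) (use assms(3) in \<open>auto simp: indicator_def\<close>)
  finally show ?thesis .
qed

lemma energy_bounded:
  assumes "simple_integral D S" "simple_integral D' S'" "s \<le> t"
  shows "\<exists>C. \<forall>\<omega>\<in>space M. \<bar>energy D D' s t \<omega>\<bar> \<le> C"
proof -
  obtain C C' where C: "C \<ge> 0" "C' \<ge> 0" "\<And>i s \<omega>. \<omega> \<in> space M \<Longrightarrow> \<bar>D i s \<omega>\<bar> \<le> C" "\<And>i s \<omega>. \<omega> \<in> space M \<Longrightarrow> \<bar>D' i s \<omega>\<bar> \<le> C'"
    using simple_integrand_bounded[OF assms(1)] simple_integrand_bounded[OF assms(2)] by blast
  have "\<bar>energy D D' s t \<omega>\<bar> \<le> (\<Sum>i\<in>(UNIV :: 'i set). C * C') * (t - s)" if o: "\<omega> \<in> space M" for \<omega>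
  proof -
    have "\<bar>D i r \<omega> * D' i r \<omega>\<bar> \<le> C * C'" for i r using C o by (auto simp: abs_mult intro!: mult_mono)
    then have b: "\<bar>\<Sum>i\<in>UNIV. D i r \<omega> * D' i r \<omega>\<bar> \<le> (\<Sum>i\<in>(UNIV :: 'i set). C * C')" for r
      by (intro order_trans[OF sum_abs] sum_mono)
    have i: "set_integrable lborel {s..t} (\<lambda>r. \<Sum>i\<in>(UNIV :: 'i set). C * C')"
      unfolding set_integrable_def by (simp add: emeasure_lborel_Icc_eq)
    have "\<bar>energy D D' s t \<omega>\<bar> \<le> (LINT r:{s..t}|lborel. \<bar>\<Sum>i\<in>UNIV. D i r \<omega> * D' i r \<omega>\<bar>)"
      unfolding energy_def using set_integral_norm_bound[OF energy_integrable[OF assms(1,2) o]] by simp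
    also have "\<dots> \<le> (LINT r:{s..t}|lborel. (\<Sum>i\<in>(UNIV :: 'i set). C * C'))"
      by (rule set_integral_mono[OF set_integrable_abs[OF energy_integrable[OF assms(1,2) o]] i b])
    also have "\<dots> = (\<Sum>i\<in>(UNIV :: 'i set). C * C') * (t - s)" using assms(3)
      by (simp add: set_lebesgue_integral_def)
    finally show ?thesis .
  qed
  then show ?thesis by blast
qed

lemma energy_add_left:
  assumes "simple_integral D S" "simple_integral D' S'" "simple_integral E R" "\<omega> \<in> space M"
  shows "energy (\<lambda>i s \<omega>. D i s \<omega> + D' i s \<omega>) E s t \<omega> = energy D E s t \<omega> + energy D' E s t \<omega>"
  unfolding energy_def
  using set_integral_add(2)[OF energy_integrable[OF assms(1,3,4)] energy_integrable[OF assms(2,3,4)]]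
  by (simp add: ring_distribs sum.distrib)

lemma energy_commute: "energy D E = energy E D"
  by (simp add: energy_def fun_eq_iff mult.commute)

lemma isometry_block_block:
  fixes m m' :: 'i
  assumes 1: "0 \<le> u" "u \<le> v" "\<xi> \<in> borel_measurable (F u)" "\<And>\<omega>. \<omega> \<in> space M \<Longrightarrow> \<bar>\<xi> \<omega>\<bar> \<le> C"
    and 2: "0 \<le> u'" "u' \<le> v'" "\<xi>' \<in> borel_measurable (F u')" "\<And>\<omega>. \<omega> \<in> space M \<Longrightarrow> \<bar>\<xi>' \<omega>\<bar> \<le> C'"
    and st: "0 \<le> s" "s \<le> t" and Z: "Z \<in> borel_measurable (F s)" "\<And>\<omega>. \<omega> \<in> space M \<Longrightarrow> \<bar>Z \<omega>\<bar> \<le> K"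
  defines "S \<equiv> \<lambda>t \<omega>. \<xi> \<omega> * (W m (min t v) \<omega> - W m (min t u) \<omega>)"
    and "S' \<equiv> \<lambda>t \<omega>. \<xi>' \<omega> * (W m' (min t v') \<omega> - W m' (min t u') \<omega>)"
  shows "expectation (\<lambda>\<omega>. Z \<omega> * ((S t \<omega> - S s \<omega>) * (S' t \<omega> - S' s \<omega>))) =
    expectation (\<lambda>\<omega>. Z \<omega> * energy (\<lambda>i s \<omega>. if i = m then \<xi> \<omega> * indicator {u<..v} s else 0)
      (\<lambda>i s \<omega>. if i = m' then \<xi>' \<omega> * indicator {u'<..v'} s else 0) s t \<omega>)"
proof -
  let ?f = "\<lambda>x. max s (min t x)"
  define Y where "Y \<omega> = Z \<omega> * \<xi> \<omega> * \<xi>' \<omega>" for \<omega>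
  have eq: "Z \<omega> * ((S t \<omega> - S s \<omega>) * (S' t \<omega> - S' s \<omega>)) =
     Y \<omega> * ((W m (?f v) \<omega> - W m (?f u) \<omega>) * (W m' (?f v') \<omega> - W m' (?f u') \<omega>))" for \<omega>
    using block_increment[OF st(2) 1(2), of "\<lambda>t. W m t \<omega>"] block_increment[OF st(2) 2(2), of "\<lambda>t. W m' t \<omega>"]
    by (simp add: S_def S'_def Y_def right_diff_distrib[symmetric] mult_ac)
  \<comment> \<open>The length of the overlap of the two projected blocks, 0 if they are
    disjoint.\<close>
  define L where "L = max 0 (min (?f v) (?f v') - max (?f u) (?f u'))"
  have en: "energy (\<lambda>i s \<omega>. if i = m then \<xi> \<omega> * indicator {u<..v} s else 0)
      (\<lambda>i s \<omega>. if i = m' then \<xi>' \<omega> * indicator {u'<..v'} s else 0) s t \<omega> = (if m = m' then \<xi> \<omega> * \<xi>' \<omega> * L else 0)" for \<omega>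
  proof -
    have e: "energy (\<lambda>i s \<omega>. if i = m then \<xi> \<omega> * indicator {u<..v} s else 0)
      (\<lambda>i s \<omega>. if i = m' then \<xi>' \<omega> * indicator {u'<..v'} s else 0) s t \<omega> =
      (LINT r|lborel. (if m = m' then \<xi> \<omega> * \<xi>' \<omega> else 0) * indicator {max (?f u) (?f u')<..min (?f v) (?f v')} r)"
      (is "?e = ?l") unfolding energy_def set_lebesgue_integral_def
    proof (rule integral_cong_AE)
      let ?K = "if m = m' then \<xi> \<omega> * \<xi>' \<omega> else 0"
      have sumeq: "(\<Sum>i\<in>UNIV. (if i = m then \<xi> \<omega> * indicator {u<..v} r else 0) * (if i = m' then \<xi>' \<omega> * indicator {u'<..v'} r else 0))
         = ?K * (indicator {u<..v} r * indicator {u'<..v'} r)" for r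
        by (cases "m = m'") (auto simp: if_distrib if_distribR sum.delta cong: if_cong)
      \<comment> \<open>A closed interval meets half-open blocks: the indicators can differ at the
        endpoints s and t, which form a null set.\<close>
      have ne: "AE r in lborel. r \<noteq> s \<and> r \<noteq> t" using AE_lborel_singleton[of s] AE_lborel_singleton[of t] by eventually_elim auto
      have ind: "indicator {s..t} r * (indicator {u<..v} r * indicator {u'<..v'} r) =
          (indicator {max (?f u) (?f u')<..min (?f v) (?f v')} r :: real)" if "r \<noteq> s" "r \<noteq> t" for r
        using that by (auto simp: indicator_def)
      show "AE r in lborel. indicator {s..t} r *\<^sub>R (\<Sum>i\<in>UNIV. (if i = m then \<xi> \<omega> * indicator {u<..v} r else 0) * (if i = m' then \<xi>' \<omega> * indicator {u'<..v'} r else 0))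
          = ?K * indicator {max (?f u) (?f u')<..min (?f v) (?f v')} r"
      proof (rule eventually_mono[OF ne])
        fix r assume "r \<noteq> s \<and> r \<noteq> t"
        then have r: "r \<noteq> s" "r \<noteq> t" by auto
        show "indicator {s..t} r *\<^sub>R (\<Sum>i\<in>UNIV. (if i = m then \<xi> \<omega> * indicator {u<..v} r else 0) * (if i = m' then \<xi>' \<omega> * indicator {u'<..v'} r else 0))
          = ?K * indicator {max (?f u) (?f u')<..min (?f v) (?f v')} r"
          unfolding sumeq real_scaleR_def mult.left_commute[of "indicat_real {s..t} r" ?K] ind[OF r] by (rule refl)
      qed
    qed auto
    have measure_Ioc: "measure lborel {p<..q} = max 0 (q - p)" for p q :: real
      by (cases "p \<le> q") auto
    have l: "?l = (if m = m' then \<xi> \<omega> * \<xi>' \<omega> else 0) * L"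
      unfolding L_def measure_Ioc[symmetric] by simp
    show ?thesis unfolding e l by (cases "m = m'") simp_all
  qed
  show ?thesis
  \<comment> \<open>A block that begins after t is projected to the point t. Its height need not be
    known there, but its increment vanishes; hence the separate case.\<close>
  proof (cases "u \<le> t \<and> u' \<le> t")
    case True
    have 0: "0 \<le> ?f u" "0 \<le> ?f u'" "?f u \<le> ?f v" "?f u' \<le> ?f v'" using 1 2 st by auto
    have mY: "Y \<in> borel_measurable (F (max (?f u) (?f u')))" unfolding Y_def
      by (intro borel_measurable_times measurable_F_mono[OF _ Z(1)] measurable_F_mono[OF _ 1(3)] measurable_F_mono[OF _ 2(3)])
        (use True in auto)
    have bY: "\<bar>Y \<omega>\<bar> \<le> K * C * C'" if "\<omega> \<in> space M" for \<omega>
      using Z(2)[OF that] 1(4)[OF that] 2(4)[OF that] unfolding Y_def abs_mult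
      by (intro mult_mono) (auto intro: order_trans[OF abs_ge_zero])
    have "expectation (\<lambda>\<omega>. Y \<omega> * ((W m (?f v) \<omega> - W m (?f u) \<omega>) * (W m' (?f v') \<omega> - W m' (?f u') \<omega>))) =
      (if m = m' then L * expectation Y else 0)"
      unfolding L_def by (rule increment_cov[OF 0(1,3,2,4) mY bY])
    moreover have "expectation (\<lambda>\<omega>. Z \<omega> * (if m = m' then \<xi> \<omega> * \<xi>' \<omega> * L else 0)) =
      (if m = m' then L * expectation Y else 0)"
      unfolding Y_def[abs_def] by (simp add: mult.assoc[symmetric])
    ultimately show ?thesis unfolding eq en by simp
  next
    case False
    then have "L = 0" using st 1 2 by (auto simp: L_def)
    moreover have "(W m (?f v) \<omega> - W m (?f u) \<omega>) * (W m' (?f v') \<omega> - W m' (?f u') \<omega>) = 0" for \<omega>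
      using False st 1 2 by (auto simp: min_def)
    ultimately show ?thesis unfolding eq en by (simp only: mult_zero_right if_cancel)
  qed
qed

lemma isometry_add:
  assumes D: "simple_integral D S" "simple_integral D' S'" "simple_integral E R"
    and st: "0 \<le> s" "s \<le> t" and Z: "Z \<in> borel_measurable (F s)" "\<And>\<omega>. \<omega> \<in> space M \<Longrightarrow> \<bar>Z \<omega>\<bar> \<le> K"
    and 1: "expectation (\<lambda>\<omega>. Z \<omega> * ((S t \<omega> - S s \<omega>) * (R t \<omega> - R s \<omega>))) = expectation (\<lambda>\<omega>. Z \<omega> * energy D E s t \<omega>)"
    and 2: "expectation (\<lambda>\<omega>. Z \<omega> * ((S' t \<omega> - S' s \<omega>) * (R t \<omega> - R s \<omega>))) = expectation (\<lambda>\<omega>. Z \<omega> * energy D' E s t \<omega>)"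
  shows "expectation (\<lambda>\<omega>. Z \<omega> * (((S t \<omega> + S' t \<omega>) - (S s \<omega> + S' s \<omega>)) * (R t \<omega> - R s \<omega>))) =
    expectation (\<lambda>\<omega>. Z \<omega> * energy (\<lambda>i s \<omega>. D i s \<omega> + D' i s \<omega>) E s t \<omega>)"
proof -
  have t0: "0 \<le> t" using st by simp
  have ZM: "Z \<in> borel_measurable M" by (rule measurable_F_M[OF st(1) Z(1)])
  have sq: "sq_integrable M (\<lambda>\<omega>. Z \<omega> * (U t \<omega> - U s \<omega>))" if "simple_integral A U" for A U
    by (intro sq_integrable_bounded_mult[OF ZM Z(2)] sq_integrable_diff simple_integral_sq[OF that] st t0)
  have i: "integrable M (\<lambda>\<omega>. Z \<omega> * ((U t \<omega> - U s \<omega>) * (R t \<omega> - R s \<omega>)))" if "simple_integral A U" for A U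
    using integrable_mult_sq_integrable[OF sq[OF that] sq_integrable_diff[OF simple_integral_sq[OF D(3) t0] simple_integral_sq[OF D(3) st(1)]]]
    by (simp add: mult.assoc)
  have ie: "integrable M (\<lambda>\<omega>. Z \<omega> * energy A E s t \<omega>)" if A: "simple_integral A U" for A U
  proof -
    obtain C where C: "\<And>\<omega>. \<omega>\<in>space M \<Longrightarrow> \<bar>energy A E s t \<omega>\<bar> \<le> C" using energy_bounded[OF A D(3) st(2)] by blast
    show ?thesis
      by (intro integrable_mult_sq_integrable sq_integrable_const_bound[OF ZM Z(2)]
          sq_integrable_const_bound[OF measurable_F_M[OF t0 energy_measurable[OF A D(3) st(1) t0]] C])
  qed
  have "expectation (\<lambda>\<omega>. Z \<omega> * (((S t \<omega> + S' t \<omega>) - (S s \<omega> + S' s \<omega>)) * (R t \<omega> - R s \<omega>))) =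
    expectation (\<lambda>\<omega>. Z \<omega> * ((S t \<omega> - S s \<omega>) * (R t \<omega> - R s \<omega>)) + Z \<omega> * ((S' t \<omega> - S' s \<omega>) * (R t \<omega> - R s \<omega>)))"
    by (simp add: algebra_simps)
  also have "\<dots> = expectation (\<lambda>\<omega>. Z \<omega> * energy D E s t \<omega>) + expectation (\<lambda>\<omega>. Z \<omega> * energy D' E s t \<omega>)"
    using i[OF D(1)] i[OF D(2)] 1 2 by simp
  also have "\<dots> = expectation (\<lambda>\<omega>. Z \<omega> * energy D E s t \<omega> + Z \<omega> * energy D' E s t \<omega>)"
    using ie[OF D(1)] ie[OF D(2)] by simp
  also have "\<dots> = expectation (\<lambda>\<omega>. Z \<omega> * energy (\<lambda>i s \<omega>. D i s \<omega> + D' i s \<omega>) E s t \<omega>)"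
    by (intro Bochner_Integration.integral_cong refl) (simp add: energy_add_left[OF D] ring_distribs)
  finally show ?thesis .
qed

text \<open>Induction on the first integrand and, once it is a block, on the second. The bounded
  weight known at time s makes this a conditional isometry, which allows the 0-1 factor of a cutoff
  to be placed in front of each increment.\<close>

lemma isometry:
  assumes D: "simple_integral D S" and D': "simple_integral D' S'"
    and st: "0 \<le> s" "s \<le> t" and Z: "Z \<in> borel_measurable (F s)" "\<And>\<omega>. \<omega> \<in> space M \<Longrightarrow> \<bar>Z \<omega>\<bar> \<le> K"
  shows "expectation (\<lambda>\<omega>. Z \<omega> * ((S t \<omega> - S s \<omega>) * (S' t \<omega> - S' s \<omega>))) = expectation (\<lambda>\<omega>. Z \<omega> * energy D D' s t \<omega>)"
  using D
proof (induction rule: simple_integral.induct)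
  case zero show ?case by (simp add: energy_def)
next
  case (add D S E R)
  show ?case by (rule isometry_add[OF add(1,2) D' st Z add(3,4)])
next
  case (block u v \<xi> C m)
  note b = simple_integral.block[OF block, where m = m]
  from D' show ?case
  proof (induction rule: simple_integral.induct)
    case zero show ?case by (simp add: energy_def)
  next
    case (add D S E R)
    show ?case
      using isometry_add[OF add(1,2) b st Z] add(3,4) by (simp add: mult.commute energy_commute)
  next
    case 2: (block u' v' \<xi>' C' m')
    show ?case by (rule isometry_block_block[OF block 2 st Z])
  qed
qed

end

section \<open>Doob's inequality, dyadic times and cutoffs\<close>

fun running_max :: "(nat \<Rightarrow> real) \<Rightarrow> nat \<Rightarrow> real" where
  "running_max y 0 = \<bar>y 0\<bar>"
| "running_max y (Suc n) = max (running_max y n) \<bar>y (Suc n)\<bar>"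

lemma running_max_ge: "k \<le> n \<Longrightarrow> \<bar>y k\<bar> \<le> running_max y n"
  by (induction n) (auto simp: le_Suc_eq)

text \<open>Doob's inequality path by path. The sum is a discrete integral of the running maximum
  against \<bar>y\<bar>, and for a martingale its mean is nonnegative. The induction uses that the
  running maximum changes only by jumping to the current value of \<bar>y\<bar>.\<close>

lemma doob_pathwise:
  "(running_max y n)\<^sup>2 \<le> 4 * (y n)\<^sup>2 - 4 * (\<Sum>k<n. running_max y k * (\<bar>y (Suc k)\<bar> - \<bar>y k\<bar>))"
proof -
  have "(running_max y n)\<^sup>2 / 2 \<le> running_max y n * \<bar>y n\<bar> - (\<Sum>k<n. running_max y k * (\<bar>y (Suc k)\<bar> - \<bar>y k\<bar>))"
  proof (induction n)
    case (Suc n)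
    let ?m = "running_max y n" and ?s = "\<bar>y n\<bar>" and ?s' = "\<bar>y (Suc n)\<bar>"
    have "(max ?m ?s')\<^sup>2 / 2 \<le> max ?m ?s' * ?s' + ?m\<^sup>2 / 2 - ?m * ?s'"
    proof (cases "?s' \<le> ?m")
      case False
      have "0 \<le> (?s' - ?m)\<^sup>2" by simp
      then have "2 * ?m * ?s' \<le> ?s'\<^sup>2 + ?m\<^sup>2" by (simp only: power2_diff) (simp add: mult_ac)
      moreover have "max ?m ?s' = ?s'" using False by simp
      ultimately show ?thesis by (simp only: power2_eq_square)
    qed (simp add: max_absorb1)
    then show ?case using Suc.IH by (simp add: algebra_simps)
  qed (simp add: power2_eq_square)
  \<comment> \<open>This square gives m \<bar>y\<bar> \<le> m^2 / 4 + y^2 for the running maximum m.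
    It leaves m^2 / 4 on the left and is the origin of the constant 4.\<close>
  moreover have "0 \<le> (running_max y n - 2 * \<bar>y n\<bar>)\<^sup>2" by simp
  ultimately show ?thesis
    by (simp only: power2_diff) (simp add: power2_eq_square abs_mult[symmetric])
qed

lemma (in filtered_prob_space) doob_L2:
  fixes Y :: "nat \<Rightarrow> 'a \<Rightarrow> real" and t :: "nat \<Rightarrow> real"
  assumes t: "mono t" "0 \<le> t 0"
    and sq: "\<And>k. k \<le> n \<Longrightarrow> sq_integrable M (Y k)"
    and ad: "\<And>k. k \<le> n \<Longrightarrow> Y k \<in> borel_measurable (F (t k))"
    and mart: "\<And>k Z. k < n \<Longrightarrow> Z \<in> borel_measurable (F (t k)) \<Longrightarrow> sq_integrable M Z \<Longrightarrow>
      expectation (\<lambda>\<omega>. Z \<omega> * (Y (Suc k) \<omega> - Y k \<omega>)) = 0"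
  shows "(\<integral>\<^sup>+\<omega>. ennreal ((running_max (\<lambda>k. Y k \<omega>) n)\<^sup>2) \<partial>M) \<le> 4 * ennreal (expectation (\<lambda>\<omega>. (Y n \<omega>)\<^sup>2))"
proof -
  let ?m = "\<lambda>k \<omega>. running_max (\<lambda>k. Y k \<omega>) k"
  have msq: "sq_integrable M (?m k)" if "k \<le> n" for k
    using that
  proof (induction k)
    case (Suc k)
    then show ?case using sq_integrable_max[OF Suc.IH sq_integrable_abs[OF sq[OF Suc.prems]]] by simp
  qed (use sq[of 0] sq_integrable_abs in auto)
  have mad: "?m k \<in> borel_measurable (F (t k))" if "k \<le> n" for k
    using that
  proof (induction k)
    case (Suc k)
    have "?m k \<in> borel_measurable (F (t (Suc k)))"
      by (rule measurable_F_mono[OF _ Suc.IH]) (use Suc.prems t in \<open>auto simp: mono_def\<close>)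
    then show ?case using ad[OF Suc.prems] by auto
  qed (use ad[of 0] in auto)
  have inc: "0 \<le> expectation (\<lambda>\<omega>. ?m k \<omega> * (\<bar>Y (Suc k) \<omega>\<bar> - \<bar>Y k \<omega>\<bar>))" if k: "k < n" for k
  proof -
    \<comment> \<open>The submartingale property of \<bar>Y\<bar> in testable form: multiplied by
      sgn (Y k), the increment of Y lies below that of \<bar>Y\<bar>, and the running maximum is a
      nonnegative weight.\<close>
    define Z where "Z \<omega> = sgn (Y k \<omega>) * ?m k \<omega>" for \<omega>
    have sg: "(\<lambda>\<omega>. sgn (Y k \<omega>)) \<in> borel_measurable (F (t k))"
      using ad[of k] k by (auto intro!: borel_measurable_sgn)
    have t0: "0 \<le> t k" using t by (meson le0 monoD order_trans)
    have "sq_integrable M Z" unfolding Z_def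
      by (rule sq_integrable_bounded_mult[OF measurable_F_M[OF t0 sg], of 1]) (use msq[of k] k in \<open>auto simp: sgn_real_def\<close>)
    moreover have "Z \<in> borel_measurable (F (t k))" unfolding Z_def using sg mad[of k] k by auto
    ultimately have z: "0 = expectation (\<lambda>\<omega>. Z \<omega> * (Y (Suc k) \<omega> - Y k \<omega>))"
      and i: "integrable M (\<lambda>\<omega>. Z \<omega> * (Y (Suc k) \<omega> - Y k \<omega>))"
      using mart[OF k] integrable_mult_sq_integrable[of M Z "\<lambda>\<omega>. Y (Suc k) \<omega> - Y k \<omega>"] sq[of k] sq[of "Suc k"] k by auto
    have "0 = expectation (\<lambda>\<omega>. Z \<omega> * (Y (Suc k) \<omega> - Y k \<omega>))" by (rule z)
    also have "\<dots> \<le> expectation (\<lambda>\<omega>. ?m k \<omega> * (\<bar>Y (Suc k) \<omega>\<bar> - \<bar>Y k \<omega>\<bar>))"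
    proof (rule integral_mono[OF i])
      show "integrable M (\<lambda>\<omega>. ?m k \<omega> * (\<bar>Y (Suc k) \<omega>\<bar> - \<bar>Y k \<omega>\<bar>))"
        using k sq by (intro integrable_mult_sq_integrable msq sq_integrable_diff sq_integrable_abs) auto
      fix \<omega>
      have "0 \<le> ?m k \<omega>" using running_max_ge[of 0 k "\<lambda>k. Y k \<omega>"] by auto
      moreover have "sgn (Y k \<omega>) * (Y (Suc k) \<omega> - Y k \<omega>) \<le> \<bar>Y (Suc k) \<omega>\<bar> - \<bar>Y k \<omega>\<bar>"
        by (auto simp: sgn_real_def)
      ultimately show "Z \<omega> * (Y (Suc k) \<omega> - Y k \<omega>) \<le> ?m k \<omega> * (\<bar>Y (Suc k) \<omega>\<bar> - \<bar>Y k \<omega>\<bar>)"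
        unfolding Z_def using mult_left_mono by (metis mult.assoc mult.left_commute)
    qed
    finally show ?thesis .
  qed
  have ii: "integrable M (\<lambda>\<omega>. ?m k \<omega> * (\<bar>Y (Suc k) \<omega>\<bar> - \<bar>Y k \<omega>\<bar>))" if "k < n" for k
    using that sq by (intro integrable_mult_sq_integrable msq sq_integrable_diff sq_integrable_abs) auto
  have iY: "integrable M (\<lambda>\<omega>. (Y n \<omega>)\<^sup>2)" and im: "integrable M (\<lambda>\<omega>. (?m n \<omega>)\<^sup>2)"
    using sq[of n] msq[of n] by (auto simp: sq_integrable_def)
  have "expectation (\<lambda>\<omega>. (?m n \<omega>)\<^sup>2) \<le>
    expectation (\<lambda>\<omega>. 4 * (Y n \<omega>)\<^sup>2 - 4 * (\<Sum>k<n. ?m k \<omega> * (\<bar>Y (Suc k) \<omega>\<bar> - \<bar>Y k \<omega>\<bar>)))"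
  proof (rule integral_mono[OF im _ doob_pathwise])
    show "integrable M (\<lambda>\<omega>. 4 * (Y n \<omega>)\<^sup>2 - 4 * (\<Sum>k<n. ?m k \<omega> * (\<bar>Y (Suc k) \<omega>\<bar> - \<bar>Y k \<omega>\<bar>)))"
      by (intro Bochner_Integration.integrable_diff integrable_mult_right Bochner_Integration.integrable_sum ii iY) auto
  qed
  also have "\<dots> = 4 * expectation (\<lambda>\<omega>. (Y n \<omega>)\<^sup>2) - 4 * (\<Sum>k<n. expectation (\<lambda>\<omega>. ?m k \<omega> * (\<bar>Y (Suc k) \<omega>\<bar> - \<bar>Y k \<omega>\<bar>)))"
    using iY ii by (subst Bochner_Integration.integral_diff) (auto simp del: right_diff_distrib)
  also have "\<dots> \<le> 4 * expectation (\<lambda>\<omega>. (Y n \<omega>)\<^sup>2)" using inc by (auto intro!: sum_nonneg)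
  finally have "ennreal (expectation (\<lambda>\<omega>. (?m n \<omega>)\<^sup>2)) \<le> ennreal (4 * expectation (\<lambda>\<omega>. (Y n \<omega>)\<^sup>2))"
    by (rule ennreal_leI)
  then show ?thesis using nn_integral_eq_integral[OF im] by (simp add: ennreal_mult)
qed

section \<open>Dyadic grids in [0, T]\<close>

definition grid :: "real \<Rightarrow> nat \<Rightarrow> nat \<Rightarrow> real" where
  "grid T n k = real k * T / 2 ^ n"

definition grid_index :: "real \<Rightarrow> nat \<Rightarrow> real \<Rightarrow> nat" where
  "grid_index T n s = nat \<lfloor>s * 2 ^ n / T\<rfloor>"

text \<open>The times over which suprema are taken: countable, so that the suprema are measurable,
  and dense, so that continuous paths lose nothing.\<close>

definition dyadic :: "real \<Rightarrow> real set" where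
  "dyadic T = (\<Union>n. grid T n ` {..2 ^ n})"

lemma grid_0[simp]: "grid T n 0 = 0" by (simp add: grid_def)
lemma grid_last[simp]: "grid T n (2 ^ n) = T" by (simp add: grid_def)
lemma grid_double: "grid T (Suc n) (2 * k) = grid T n k" by (simp add: grid_def)

lemma grid_mono: "0 < T \<Longrightarrow> k \<le> l \<Longrightarrow> grid T n k \<le> grid T n l"
  by (auto simp: grid_def intro!: divide_right_mono mult_right_mono)

lemma grid_nonneg: "0 < T \<Longrightarrow> 0 \<le> grid T n k" by (simp add: grid_def)
lemma grid_le: "0 < T \<Longrightarrow> k \<le> 2 ^ n \<Longrightarrow> grid T n k \<le> T" using grid_mono[of T k "2 ^ n" n] by simp

lemma grid_refine: "grid T n ` {..2 ^ n} \<subseteq> grid T (Suc n) ` {..2 ^ Suc n}"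
proof
  fix x assume "x \<in> grid T n ` {..2 ^ n}"
  then obtain k where "k \<le> 2 ^ n" "x = grid T (Suc n) (2 * k)" by (auto simp: grid_double)
  then show "x \<in> grid T (Suc n) ` {..2 ^ Suc n}" by auto
qed

lemma dyadic_subset: "0 < T \<Longrightarrow> dyadic T \<subseteq> {0..T}"
  by (auto simp: dyadic_def grid_nonneg grid_le)

lemma countable_dyadic[simp]: "countable (dyadic T)" by (auto simp: dyadic_def)
lemma zero_in_dyadic[simp]: "0 \<in> dyadic T" unfolding dyadic_def by (auto intro!: image_eqI[of _ _ 0])
lemma grid_index_eq_iff:
  assumes "0 < T" "0 \<le> s"
  shows "grid_index T n s = k \<longleftrightarrow> grid T n k \<le> s \<and> s < grid T n (Suc k)"
proof -
  have "0 \<le> s * 2 ^ n / T" using assms by simp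
  then have "grid_index T n s = k \<longleftrightarrow> \<lfloor>s * 2 ^ n / T\<rfloor> = int k" unfolding grid_index_def by linarith
  also have "\<dots> \<longleftrightarrow> real k \<le> s * 2 ^ n / T \<and> s * 2 ^ n / T < real k + 1" by (simp add: floor_eq_iff)
  also have "\<dots> \<longleftrightarrow> grid T n k \<le> s \<and> s < grid T n (Suc k)" using assms
    by (simp add: grid_def field_simps)
  finally show ?thesis .
qed

lemma grid_index_grid:
  assumes "0 < T" "0 \<le> s"
  shows "grid T n (grid_index T n s) \<le> s" "s < grid T n (grid_index T n s) + T / 2 ^ n"
  using grid_index_eq_iff[OF assms, of n "grid_index T n s"] by (auto simp: grid_def field_simps)

lemma grid_index_le:
  assumes "0 < T" "0 \<le> s" "s \<le> T"
  shows "grid_index T n s \<le> 2 ^ n"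
proof -
  have "grid T n (grid_index T n s) \<le> T" using grid_index_grid(1)[OF assms(1,2), of n] assms by simp
  then have "real (grid_index T n s) \<le> 2 ^ n" using assms by (simp add: grid_def field_simps)
  then show ?thesis by (metis of_nat_le_iff of_nat_numeral of_nat_power)
qed

lemma grid_index_in_dyadic: "0 < T \<Longrightarrow> 0 \<le> s \<Longrightarrow> s \<le> T \<Longrightarrow> grid T n (grid_index T n s) \<in> dyadic T"
  unfolding dyadic_def using grid_index_le by blast

text \<open>Point k of one level is point 2 k of the next, so the grid points to the left of s
  increase with the level. Cutoffs evaluated at these points therefore decrease.\<close>

lemma grid_index_refine:
  assumes "0 < T" "0 \<le> s"
  shows "grid T n (grid_index T n s) \<le> grid T (Suc n) (grid_index T (Suc n) s)"
proof -
  define k where "k = grid_index T n s"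
  define l where "l = grid_index T (Suc n) s"
  have "grid T n k \<le> s" using grid_index_grid(1)[OF assms] by (simp add: k_def)
  then have "grid T (Suc n) (2 * k) \<le> s" by (simp add: grid_double)
  moreover have "s < grid T (Suc n) (Suc l)" using grid_index_eq_iff[OF assms, of "Suc n" l] by (simp add: l_def)
  ultimately have "grid T (Suc n) (2 * k) < grid T (Suc n) (Suc l)" by simp
  then have "2 * k < Suc l" using grid_mono[OF assms(1), of "Suc l" "2 * k" "Suc n"] by linarith
  then have "2 * k \<le> l" by simp
  from grid_mono[OF assms(1) this, of "Suc n"] show ?thesis by (simp add: grid_double k_def l_def)
qed

lemma grid_index_tendsto:
  assumes "0 < T" "0 \<le> s"
  shows "(\<lambda>n. grid T n (grid_index T n s)) \<longlonglongrightarrow> s"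
proof (rule tendsto_sandwich[of "\<lambda>n. s - T * (1/2) ^ n" _ _ "\<lambda>_. s"])
  have "(\<lambda>n. s - T * (1/2) ^ n) \<longlonglongrightarrow> s - T * 0" by (intro tendsto_intros LIMSEQ_realpow_zero) auto
  then show "(\<lambda>n. s - T * (1/2) ^ n) \<longlonglongrightarrow> s" by simp
  have "s - T * (1/2) ^ n \<le> grid T n (grid_index T n s)" for n
    using grid_index_grid(2)[OF assms, of n] by (simp add: power_one_over)
  then show "\<forall>\<^sub>F n in sequentially. s - T * (1/2) ^ n \<le> grid T n (grid_index T n s)" by simp
qed (use grid_index_grid(1)[OF assms] in auto)

lemma grid_index_measurable[measurable]: "grid_index T n \<in> measurable borel (count_space UNIV)"
  unfolding grid_index_def[abs_def] by measurable

text \<open>A cutoff \<open>c\<close> plays the role of a stopping time \<open>\<theta>\<close>: \<open>c s \<omega>\<close> stands for \<open>s \<le> \<theta> \<omega>\<close>.\<close>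

definition (in filtered_prob_space) cutoff :: "real \<Rightarrow> (real \<Rightarrow> 'a \<Rightarrow> bool) \<Rightarrow> bool" where
  "cutoff T c \<longleftrightarrow>
    (\<forall>s\<in>{0..T}. {\<omega>\<in>space M. c s \<omega>} \<in> sets (F s)) \<and>
    (\<forall>\<omega>\<in>space M. \<forall>s t. 0 \<le> s \<longrightarrow> s \<le> t \<longrightarrow> t \<le> T \<longrightarrow> c t \<omega> \<longrightarrow> c s \<omega>) \<and>
    (\<forall>\<omega>\<in>space M. \<forall>t\<in>{0<..T}. (\<forall>s\<in>{0..<t}. c s \<omega>) \<longrightarrow> c t \<omega>)"

text \<open>The maximum and, in \<open>int_cut\<close>, the time integral up to the stopping time.
  The default 0 is neutral for both, since all values are nonnegative.\<close>

definition sup_cut :: "real \<Rightarrow> (real \<Rightarrow> 'a \<Rightarrow> bool) \<Rightarrow> (real \<Rightarrow> 'a \<Rightarrow> ennreal) \<Rightarrow> 'a \<Rightarrow> ennreal" where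
  "sup_cut T c f \<omega> = (SUP t\<in>dyadic T. if c t \<omega> then f t \<omega> else 0)"

definition int_cut :: "real \<Rightarrow> (real \<Rightarrow> 'a \<Rightarrow> bool) \<Rightarrow> (real \<Rightarrow> 'a \<Rightarrow> ennreal) \<Rightarrow> 'a \<Rightarrow> ennreal" where
  "int_cut T c f \<omega> = (\<integral>\<^sup>+s. (if s \<in> {0..T} \<and> c s \<omega> then f s \<omega> else 0) \<partial>lborel)"

section \<open>Measurability of cutoffs and of stopped suprema and integrals\<close>

context filtered_prob_space begin

lemma cutoff_measurable: "cutoff T c \<Longrightarrow> 0 \<le> s \<Longrightarrow> s \<le> T \<Longrightarrow> {\<omega>\<in>space M. c s \<omega>} \<in> sets (F s)"
  by (auto simp: cutoff_def)

lemma cutoff_antimono: "cutoff T c \<Longrightarrow> \<omega> \<in> space M \<Longrightarrow> 0 \<le> s \<Longrightarrow> s \<le> t \<Longrightarrow> t \<le> T \<Longrightarrow> c t \<omega> \<Longrightarrow> c s \<omega>"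
  unfolding cutoff_def by blast

lemma cutoff_left: "cutoff T c \<Longrightarrow> \<omega> \<in> space M \<Longrightarrow> 0 < t \<Longrightarrow> t \<le> T \<Longrightarrow> (\<And>s. 0 \<le> s \<Longrightarrow> s < t \<Longrightarrow> c s \<omega>) \<Longrightarrow> c t \<omega>"
  unfolding cutoff_def by (metis atLeastLessThan_iff greaterThanAtMost_iff)

lemma cutoff_True: "cutoff T (\<lambda>_ _. True)"
proof -
  have "space M \<in> sets (F s)" for s using sets.top[of "F s"] by (simp add: space_F)
  then show ?thesis by (simp add: cutoff_def)
qed

lemma cutoff_conj: "cutoff T c \<Longrightarrow> cutoff T d \<Longrightarrow> cutoff T (\<lambda>s \<omega>. c s \<omega> \<and> d s \<omega>)"
  unfolding cutoff_def
proof (intro conjI ballI allI impI; (elim conjE)?)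
  fix s assume "s \<in> {0..T}" "\<forall>s\<in>{0..T}. {\<omega> \<in> space M. c s \<omega>} \<in> sets (F s)" "\<forall>s\<in>{0..T}. {\<omega> \<in> space M. d s \<omega>} \<in> sets (F s)"
  then have "{\<omega> \<in> space M. c s \<omega>} \<inter> {\<omega> \<in> space M. d s \<omega>} \<in> sets (F s)" by auto
  also have "{\<omega> \<in> space M. c s \<omega>} \<inter> {\<omega> \<in> space M. d s \<omega>} = {\<omega> \<in> space M. c s \<omega> \<and> d s \<omega>}" by auto
  finally show "{\<omega> \<in> space M. c s \<omega> \<and> d s \<omega>} \<in> sets (F s)" .
qed (meson atLeastLessThan_iff)+

text \<open>Grid points approach s from below, and a cutoff that holds at all earlier times holds at
  s. A cutoff is thus the decreasing limit of its discretizations, which makes it jointly measurable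
  and lets maximal inequalities on grids pass to the limit.\<close>

lemma cutoff_grid_iff:
  assumes c: "cutoff T c" and T: "0 < T" and s: "0 \<le> s" "s \<le> T" and o: "\<omega> \<in> space M"
  shows "c s \<omega> \<longleftrightarrow> (\<forall>n. c (grid T n (grid_index T n s)) \<omega>)"
proof
  assume "c s \<omega>"
  then show "\<forall>n. c (grid T n (grid_index T n s)) \<omega>"
    using cutoff_antimono[OF c o grid_nonneg[OF T] grid_index_grid(1)[OF T s(1)] s(2)] by blast
next
  assume *: "\<forall>n. c (grid T n (grid_index T n s)) \<omega>"
  show "c s \<omega>"
  proof (cases "s = 0")
    case True then show ?thesis using *[rule_format, of 0] by (simp add: grid_index_def)
  next
    case False
    show ?thesis
    proof (rule cutoff_left[OF c o _ s(2)])
      fix r assume r: "0 \<le> r" "r < s"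
      obtain n where "r < grid T n (grid_index T n s)"
        using order_tendstoD(1)[OF grid_index_tendsto[OF T s(1)] r(2)] by (auto simp: eventually_sequentially)
      then show "c r \<omega>"
        using cutoff_antimono[OF c o r(1) _ _ *[rule_format, of n]] grid_index_grid(1)[OF T s(1), of n] s by auto
    qed (use False s in auto)
  qed
qed

lemma cutoff_grid_joint:
  assumes c: "cutoff T c" and T: "0 < T" and t: "0 \<le> t" "t \<le> T"
  shows "{(s, \<omega>) \<in> UNIV \<times> space M. s \<in> {0..t} \<and> c (grid T n (grid_index T n s)) \<omega>} \<in> sets (borel \<Otimes>\<^sub>M F t)"
proof -
  have "{s. s \<in> {0..t} \<and> grid_index T n s = k} \<times> {\<omega>\<in>space M. c (grid T n k) \<omega>} \<in> sets (borel \<Otimes>\<^sub>M F t)" for k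
  \<comment> \<open>The cutoff at a grid point beyond t need not be known at time t, but the time
    slice of such a point in {0..t} is empty.\<close>
  proof (cases "{s. s \<in> {0..t} \<and> grid_index T n s = k} = {}")
    case True then show ?thesis unfolding True by simp
  next
    case False
    then obtain s where s: "0 \<le> s" "s \<le> t" "grid_index T n s = k" by auto
    then have k: "grid T n k \<le> t" using grid_index_grid(1)[OF T s(1), of n] by simp
    have "{\<omega>\<in>space M. c (grid T n k) \<omega>} \<in> sets (F (grid T n k))"
      using cutoff_measurable[OF c grid_nonneg[OF T]] k t by auto
    then have "{\<omega>\<in>space M. c (grid T n k) \<omega>} \<in> sets (F t)" using sets_F_mono[OF k] by auto
    moreover have "{s. s \<in> {0..t} \<and> grid_index T n s = k} \<in> sets borel" by measurable
    ultimately show ?thesis by auto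
  qed
  then have "(\<Union>k. {s. s \<in> {0..t} \<and> grid_index T n s = k} \<times> {\<omega>\<in>space M. c (grid T n k) \<omega>}) \<in> sets (borel \<Otimes>\<^sub>M F t)"
    by auto
  also have "(\<Union>k. {s. s \<in> {0..t} \<and> grid_index T n s = k} \<times> {\<omega>\<in>space M. c (grid T n k) \<omega>}) =
    {(s, \<omega>) \<in> UNIV \<times> space M. s \<in> {0..t} \<and> c (grid T n (grid_index T n s)) \<omega>}" by auto
  finally show ?thesis .
qed

lemma cutoff_joint:
  assumes c: "cutoff T c" and T: "0 < T" and t: "0 \<le> t" "t \<le> T"
  shows "{(s, \<omega>) \<in> UNIV \<times> space M. s \<in> {0..t} \<and> c s \<omega>} \<in> sets (borel \<Otimes>\<^sub>M F t)"
proof -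
  have "(\<Inter>n. {(s, \<omega>) \<in> UNIV \<times> space M. s \<in> {0..t} \<and> c (grid T n (grid_index T n s)) \<omega>}) \<in> sets (borel \<Otimes>\<^sub>M F t)"
    using cutoff_grid_joint[OF assms] by auto
  also have "(\<Inter>n. {(s, \<omega>) \<in> UNIV \<times> space M. s \<in> {0..t} \<and> c (grid T n (grid_index T n s)) \<omega>}) =
    {(s, \<omega>) \<in> UNIV \<times> space M. s \<in> {0..t} \<and> c s \<omega>}"
    using cutoff_grid_iff[OF c T] t by fastforce
  finally show ?thesis .
qed

lemma sets_pair_F_M: "0 \<le> t \<Longrightarrow> sets (borel \<Otimes>\<^sub>M F t) \<subseteq> sets (borel \<Otimes>\<^sub>M M)"
  using measurable_F_M[of t "\<lambda>\<omega>. \<omega>" "F t"]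
proof -
  assume t: "0 \<le> t"
  have "(\<lambda>\<omega>. \<omega>) \<in> measurable M (F t)" using measurable_F_M[OF t measurable_ident[of "F t", unfolded id_def]] .
  then have *: "(\<lambda>x. (fst x, snd x)) \<in> measurable (borel \<Otimes>\<^sub>M M) (borel \<Otimes>\<^sub>M F t)"
    by (intro measurable_Pair measurable_fst measurable_compose[OF measurable_snd])
  show ?thesis
  proof
    fix A assume A: "A \<in> sets (borel \<Otimes>\<^sub>M F t)"
    have "A \<subseteq> UNIV \<times> space M" using sets.sets_into_space[OF A] by (auto simp: space_pair_measure space_F)
    then have "A = (\<lambda>x. (fst x, snd x)) -` A \<inter> space (borel \<Otimes>\<^sub>M M)"
      by (auto simp: space_pair_measure)
    then show "A \<in> sets (borel \<Otimes>\<^sub>M M)" using measurable_sets[OF * A] by simp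
  qed
qed

lemma cut_measurable:
  fixes f :: "real \<Rightarrow> 'a \<Rightarrow> ennreal"
  assumes A: "{(s, \<omega>) \<in> UNIV \<times> space M. s \<in> {0..t} \<and> c s \<omega>} \<in> sets (borel \<Otimes>\<^sub>M N)" and N: "space N = space M"
    and f: "(\<lambda>(s, \<omega>). indicator {0..t} s * f s \<omega>) \<in> borel_measurable (borel \<Otimes>\<^sub>M N)"
  shows "(\<lambda>(s, \<omega>). if s \<in> {0..t} \<and> c s \<omega> then f s \<omega> else 0) \<in> borel_measurable (borel \<Otimes>\<^sub>M N)"
proof -
  have "(\<lambda>x. indicator {(s, \<omega>) \<in> UNIV \<times> space M. s \<in> {0..t} \<and> c s \<omega>} x * (case x of (s, \<omega>) \<Rightarrow> indicator {0..t} s * f s \<omega>))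
     \<in> borel_measurable (borel \<Otimes>\<^sub>M N)"
    by (intro borel_measurable_times_ennreal borel_measurable_indicator A f)
  then show ?thesis
    by (rule measurable_cong[THEN iffD1, rotated]) (auto simp: space_pair_measure N indicator_def split: if_splits)
qed

lemma int_cut_measurable_F:
  assumes "cutoff T c" "0 < T" "0 \<le> t" "t \<le> T"
    and f: "(\<lambda>(s, \<omega>). indicator {0..t} s * f s \<omega>) \<in> borel_measurable (borel \<Otimes>\<^sub>M F t)"
  shows "int_cut t c f \<in> borel_measurable (F t)"
proof -
  note [measurable] = cut_measurable[OF cutoff_joint[OF assms(1-4)] space_F f]
  show ?thesis unfolding int_cut_def[abs_def] by measurable
qed

lemma int_cut_measurable:
  assumes "cutoff T c" "0 < T"
    and f: "(\<lambda>(s, \<omega>). indicator {0..T} s * f s \<omega>) \<in> borel_measurable (borel \<Otimes>\<^sub>M M)"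
  shows "int_cut T c f \<in> borel_measurable M"
proof -
  have T: "0 \<le> T" "T \<le> T" using assms by auto
  note * = cutoff_joint[OF assms(1,2) T]
  note [measurable] = cut_measurable[OF subsetD[OF sets_pair_F_M[OF T(1)] *] refl f]
  show ?thesis unfolding int_cut_def[abs_def] using assms by measurable
qed

lemma sup_cut_measurable:
  assumes c: "cutoff T c" and T: "0 < T" and f: "\<And>t. t \<in> dyadic T \<Longrightarrow> f t \<in> borel_measurable M"
  shows "sup_cut T c f \<in> borel_measurable M"
proof -
  have "(\<lambda>\<omega>. if c t \<omega> then f t \<omega> else 0) \<in> borel_measurable M" if t: "t \<in> dyadic T" for t
  proof -
    have t': "0 \<le> t" "t \<le> T" using t dyadic_subset[OF T] by auto
    have "{\<omega>\<in>space M. c t \<omega>} \<in> sets M" using cutoff_measurable[OF c t'] subalgebra_F[OF t'(1)] by (auto simp: subalgebra_def)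
    then show ?thesis using f[OF t] by (intro measurable_If) auto
  qed
  then show ?thesis unfolding sup_cut_def[abs_def] by (intro borel_measurable_SUP) auto
qed

end

lemma ennreal_le_mult_INF:
  fixes y :: "nat \<Rightarrow> ennreal"
  assumes "\<And>n. x \<le> 4 * y n"
  shows "x \<le> 4 * (INF n. y n)"
proof -
  have "x / 4 \<le> (INF n. y n)" using assms by (intro INF_greatest divide_le_posI_ennreal) auto
  then have "4 * (x / 4) \<le> 4 * (INF n. y n)" by (rule mult_left_mono) simp
  moreover have "4 * (x / 4) = x"
    by (simp add: ennreal_times_divide mult.commute[of 4] mult_divide_eq_ennreal)
  ultimately show ?thesis by simp
qed

section \<open>The maximal inequality for simple integrals up to a cutoff\<close>

context orthogonal_bm begin

text \<open>Dropping the right endpoint makes the grid cells disjoint, in agreement with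
  \<open>grid_index_eq_iff\<close>, so that the energies of cells add up to one integral.\<close>

lemma energy_ennreal:
  assumes "simple_integral D S" "\<omega> \<in> space M"
  shows "ennreal (energy D D s t \<omega>) = (\<integral>\<^sup>+r. ennreal (indicator {s..<t} r * (\<Sum>i\<in>UNIV. (D i r \<omega>)\<^sup>2)) \<partial>lborel)"
proof -
  have "(\<integral>\<^sup>+r. ennreal (indicator {s..t} r *\<^sub>R (\<Sum>i\<in>UNIV. D i r \<omega> * D i r \<omega>)) \<partial>lborel) = ennreal (energy D D s t \<omega>)"
    unfolding energy_def set_lebesgue_integral_def
    using energy_integrable[OF assms(1,1,2), of s t] unfolding set_integrable_def
    by (intro nn_integral_eq_integral AE_I2 scaleR_nonneg_nonneg sum_nonneg) auto
  moreover have "(\<integral>\<^sup>+r. ennreal (indicator {s..t} r *\<^sub>R (\<Sum>i\<in>UNIV. D i r \<omega> * D i r \<omega>)) \<partial>lborel) =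
     (\<integral>\<^sup>+r. ennreal (indicator {s..<t} r * (\<Sum>i\<in>UNIV. (D i r \<omega>)\<^sup>2)) \<partial>lborel)"
  proof (rule nn_integral_cong_AE)
    show "AE r in lborel. ennreal (indicator {s..t} r *\<^sub>R (\<Sum>i\<in>UNIV. D i r \<omega> * D i r \<omega>)) =
        ennreal (indicator {s..<t} r * (\<Sum>i\<in>UNIV. (D i r \<omega>)\<^sup>2))"
      using AE_lborel_singleton[of t] by eventually_elim (auto simp: indicator_def power2_eq_square)
  qed
  ultimately show ?thesis by simp
qed

text \<open>Doob's inequality is applied to the martingale \<open>Y\<close> that keeps an increment
  only if the cutoff holds at the left end of its cell. At every grid point where the cutoff holds,
  all earlier factors are 1 and \<open>Y\<close> coincides with \<open>S\<close>. The conditional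
  isometry then produces the energy of the cells that are kept, so on the right the cutoff is
  evaluated at the grid point to the left of s.\<close>

lemma simple_grid_bound:
  assumes T: "0 < T" and D: "simple_integral D S" and c: "cutoff T c"
  shows "(\<integral>\<^sup>+\<omega>. (SUP t\<in>grid T n ` {..2 ^ n}. if c t \<omega> then ennreal ((S t \<omega>)\<^sup>2) else 0) \<partial>M) \<le>
    4 * (\<integral>\<^sup>+\<omega>. int_cut T (\<lambda>s \<omega>. c (grid T n (grid_index T n s)) \<omega>) (\<lambda>s \<omega>. ennreal (\<Sum>i\<in>UNIV. (D i s \<omega>)\<^sup>2)) \<omega> \<partial>M)"
    (is "(\<integral>\<^sup>+\<omega>. ?L \<omega> \<partial>M) \<le> 4 * (\<integral>\<^sup>+\<omega>. ?R \<omega> \<partial>M)")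
proof -
  define N :: nat where "N = 2 ^ n"
  define t where "t = grid T n"
  have t: "mono t" "t 0 = 0" "\<And>k. 0 \<le> t k" "\<And>k. k \<le> N \<Longrightarrow> t k \<le> T" "\<And>k. t k \<le> t (Suc k)"
    unfolding t_def N_def using T by (auto intro: monoI grid_mono grid_nonneg grid_le)
  define c0 where "c0 l \<omega> = (of_bool (c (t l) \<omega>) :: real)" for l \<omega>
  have c01: "\<bar>c0 l \<omega>\<bar> \<le> 1" and c0sq: "c0 l \<omega> * c0 l \<omega> = c0 l \<omega>" and c0nn: "0 \<le> c0 l \<omega>" for l \<omega> by (auto simp: c0_def)
  have c0F: "c0 l \<in> borel_measurable (F (t l))" if "l \<le> N" for l
  proof -
    have "{\<omega>\<in>space (F (t l)). c (t l) \<omega>} \<in> sets (F (t l))"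
      using cutoff_measurable[OF c t(3) t(4)[OF that]] by (simp add: space_F)
    then have "(\<lambda>\<omega>. if c (t l) \<omega> then 1 else 0 :: real) \<in> borel_measurable (F (t l))"
      by (intro measurable_If) auto
    also have "(\<lambda>\<omega>. if c (t l) \<omega> then 1 else 0 :: real) = c0 l" by (auto simp: c0_def)
    finally show ?thesis .
  qed
  have c0M: "c0 l \<in> borel_measurable M" if "l \<le> N" for l by (rule measurable_F_M[OF t(3) c0F[OF that]])
  define dS where "dS l \<omega> = S (t (Suc l)) \<omega> - S (t l) \<omega>" for l \<omega>
  have dSsq: "sq_integrable M (dS l)" for l unfolding dS_def by (intro sq_integrable_diff simple_integral_sq[OF D] t)
  have dSF: "dS l \<in> borel_measurable (F (t (Suc l)))" for l
    unfolding dS_def by (intro borel_measurable_diff simple_integral_measurable[OF D] t measurable_F_mono[OF t(5) simple_integral_measurable[OF D]])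
  define Y where "Y k \<omega> = (\<Sum>l<k. c0 l \<omega> * dS l \<omega>)" for k \<omega>
  have Ysq: "sq_integrable M (Y k)" if "k \<le> N" for k unfolding Y_def
    by (intro sq_integrable_sum sq_integrable_bounded_mult[OF c0M c01 dSsq]) (use that in auto)
  have YF: "Y k \<in> borel_measurable (F (t k))" if "k \<le> N" for k unfolding Y_def
  proof (intro borel_measurable_sum borel_measurable_times)
    fix l assume l: "l \<in> {..<k}"
    show "c0 l \<in> borel_measurable (F (t k))"
      by (rule measurable_F_mono[OF monoD[OF t(1)] c0F]) (use l that in auto)
    show "dS l \<in> borel_measurable (F (t k))"
      by (rule measurable_F_mono[OF monoD[OF t(1)] dSF]) (use l that in auto)
  qed
  have mart: "expectation (\<lambda>\<omega>. Z \<omega> * (c0 k \<omega> * dS k \<omega>)) = 0"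
    if "k < N" "Z \<in> borel_measurable (F (t k))" "sq_integrable M Z" for k Z
  proof -
    have "expectation (\<lambda>\<omega>. (c0 k \<omega> * Z \<omega>) * (S (t (Suc k)) \<omega> - S (t k) \<omega>)) = 0"
      by (rule simple_integral_mart[OF D t(3,5) borel_measurable_times[OF c0F that(2)]
          sq_integrable_bounded_mult[OF c0M c01 that(3)]]) (use that in auto)
    then show ?thesis by (simp add: dS_def mult_ac)
  qed
  let ?en = "\<lambda>l. energy D D (t l) (t (Suc l))"
  have cen: "integrable M (\<lambda>\<omega>. c0 l \<omega> * ?en l \<omega>)" if "l < N" for l
  proof -
    obtain C where C: "\<And>\<omega>. \<omega>\<in>space M \<Longrightarrow> \<bar>?en l \<omega>\<bar> \<le> C" using energy_bounded[OF D D t(5)] by blast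
    show ?thesis
      by (intro integrable_mult_sq_integrable sq_integrable_const_bound[OF c0M c01]
          sq_integrable_const_bound[OF measurable_F_M[OF t(3) energy_measurable[OF D D t(3) t(3)]] C]) (use that in auto)
  qed
  have EY: "expectation (\<lambda>\<omega>. (Y k \<omega>)\<^sup>2) = (\<Sum>l<k. expectation (\<lambda>\<omega>. c0 l \<omega> * ?en l \<omega>))" if "k \<le> N" for k
    using that
  proof (induction k)
    case (Suc k)
    then have k: "k < N" "k \<le> N" by auto
    have cd: "sq_integrable M (\<lambda>\<omega>. c0 k \<omega> * dS k \<omega>)" by (rule sq_integrable_bounded_mult[OF c0M[OF k(2)] c01 dSsq])
    have i2: "integrable M (\<lambda>\<omega>. c0 k \<omega> * (dS k \<omega> * dS k \<omega>))"
      using integrable_mult_sq_integrable[OF cd dSsq[of k]] by (simp add: mult.assoc)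
    have i1: "integrable M (\<lambda>\<omega>. Y k \<omega> * (c0 k \<omega> * dS k \<omega>))"
      by (rule integrable_mult_sq_integrable[OF Ysq[OF k(2)] cd])
    \<comment> \<open>The 0-1 factor is its own square, so it occurs only once in front of the
      squared increment.\<close>
    have "(Y (Suc k) \<omega>)\<^sup>2 = (Y k \<omega>)\<^sup>2 + 2 * (Y k \<omega> * (c0 k \<omega> * dS k \<omega>)) + c0 k \<omega> * (dS k \<omega> * dS k \<omega>)" for \<omega>
      unfolding Y_def by (auto simp: power2_sum c0_def power2_eq_square algebra_simps)
    then have "expectation (\<lambda>\<omega>. (Y (Suc k) \<omega>)\<^sup>2) = expectation (\<lambda>\<omega>. (Y k \<omega>)\<^sup>2) +
        2 * expectation (\<lambda>\<omega>. Y k \<omega> * (c0 k \<omega> * dS k \<omega>)) + expectation (\<lambda>\<omega>. c0 k \<omega> * (dS k \<omega> * dS k \<omega>))"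
      using i1 i2 sq_integrable_square[OF Ysq[OF k(2)]] by simp
    also have "expectation (\<lambda>\<omega>. Y k \<omega> * (c0 k \<omega> * dS k \<omega>)) = 0" by (rule mart[OF k(1) YF[OF k(2)] Ysq[OF k(2)]])
    also have "expectation (\<lambda>\<omega>. c0 k \<omega> * (dS k \<omega> * dS k \<omega>)) = expectation (\<lambda>\<omega>. c0 k \<omega> * ?en k \<omega>)"
      unfolding dS_def by (rule isometry[OF D D t(3,5) c0F[OF k(2)] c01])
    finally show ?case using Suc.IH k by simp
  qed (simp add: Y_def)
  have ennn: "0 \<le> ?en l \<omega>" for l \<omega> unfolding energy_def set_lebesgue_integral_def
    by (intro Bochner_Integration.integral_nonneg scaleR_nonneg_nonneg sum_nonneg) auto
  have pw: "(\<Sum>l<N. ennreal (c0 l \<omega> * ?en l \<omega>)) \<le> ?R \<omega>" if o: "\<omega> \<in> space M" for \<omega>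
  proof -
    let ?e = "\<lambda>r. \<Sum>i\<in>UNIV. (D i r \<omega>)\<^sup>2"
    have [measurable]: "(\<lambda>r. D i r \<omega>) \<in> borel_measurable borel" for i
      using measurable_compose[OF measurable_Pair2'[OF o] simple_integrand_measurable_M[OF D], of i] by simp
    have "ennreal (c0 l \<omega> * ?en l \<omega>) = (\<integral>\<^sup>+r. (if c (t l) \<omega> then ennreal (indicator {t l..<t (Suc l)} r * ?e r) else 0) \<partial>lborel)" for l
      using energy_ennreal[OF D o, of "t l" "t (Suc l)"] by (simp add: c0_def)
    then have "(\<Sum>l<N. ennreal (c0 l \<omega> * ?en l \<omega>)) =
      (\<integral>\<^sup>+r. (\<Sum>l<N. if c (t l) \<omega> then ennreal (indicator {t l..<t (Suc l)} r * ?e r) else 0) \<partial>lborel)"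
      by (subst nn_integral_sum) auto
    also have "\<dots> \<le> ?R \<omega>" unfolding int_cut_def
    proof (rule nn_integral_mono)
      fix r
      show "(\<Sum>l<N. if c (t l) \<omega> then ennreal (indicator {t l..<t (Suc l)} r * ?e r) else 0)
        \<le> (if r \<in> {0..T} \<and> c (grid T n (grid_index T n r)) \<omega> then ennreal (?e r) else 0)"
      proof (cases "0 \<le> r")
        case False
        then have "indicator {t l..<t (Suc l)} r = (0 :: real)" for l using t(3)[of l] by (auto simp: indicator_def)
        then show ?thesis by (simp cong: if_cong)
      next
        case True
        let ?l = "grid_index T n r"
        have "(if c (t l) \<omega> then ennreal (indicator {t l..<t (Suc l)} r * ?e r) else 0) =
           (if l = ?l then (if c (t ?l) \<omega> then ennreal (?e r) else 0) else 0)" for l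
          using grid_index_eq_iff[OF T True, of n l] by (auto simp: indicator_def t_def)
        then have "(\<Sum>l<N. if c (t l) \<omega> then ennreal (indicator {t l..<t (Suc l)} r * ?e r) else 0)
          = (if ?l < N then (if c (t ?l) \<omega> then ennreal (?e r) else 0) else 0)" by simp
        moreover have "r \<le> T" if "?l < N"
        proof -
          have "r < t (Suc ?l)" using grid_index_eq_iff[OF T True, of n ?l] by (simp add: t_def)
          also have "\<dots> \<le> T" using that by (intro t(4)) auto
          finally show ?thesis by simp
        qed
        ultimately show ?thesis using True by (auto simp: t_def)
      qed
    qed
    finally show ?thesis .
  qed
  have "(\<integral>\<^sup>+\<omega>. ?L \<omega> \<partial>M) \<le> (\<integral>\<^sup>+\<omega>. ennreal ((running_max (\<lambda>k. Y k \<omega>) N)\<^sup>2) \<partial>M)"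
  proof (intro nn_integral_mono SUP_least)
    fix \<omega> s assume o: "\<omega> \<in> space M" and "s \<in> grid T n ` {..2 ^ n}"
    then obtain k where k: "k \<le> N" "s = t k" by (auto simp: N_def t_def)
    show "(if c s \<omega> then ennreal ((S s \<omega>)\<^sup>2) else 0) \<le> ennreal ((running_max (\<lambda>k. Y k \<omega>) N)\<^sup>2)"
    proof (cases "c s \<omega>")
      case True
      have "c0 l \<omega> = 1" if "l < k" for l
        using cutoff_antimono[OF c o t(3) monoD[OF t(1)] t(4)[OF k(1)]] True k that by (auto simp: c0_def)
      then have "Y k \<omega> = (\<Sum>l<k. S (t (Suc l)) \<omega> - S (t l) \<omega>)" by (simp add: Y_def dS_def)
      also have "\<dots> = S (t k) \<omega>"
        using sum_lessThan_telescope[of "\<lambda>l. S (t l) \<omega>" k] t(2) simple_integral_0[OF D] by simp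
      finally have "\<bar>S s \<omega>\<bar> \<le> running_max (\<lambda>k. Y k \<omega>) N"
        using running_max_ge[OF k(1), of "\<lambda>k. Y k \<omega>"] k by simp
      from power_mono[OF this, of 2]
      have "(S s \<omega>)\<^sup>2 \<le> (running_max (\<lambda>k. Y k \<omega>) N)\<^sup>2" by simp
      then show ?thesis using True by (simp add: ennreal_leI)
    qed simp
  qed
  also have "\<dots> \<le> 4 * ennreal (expectation (\<lambda>\<omega>. (Y N \<omega>)\<^sup>2))"
  proof (rule doob_L2[OF t(1)])
    fix k Z assume k: "k < N" "Z \<in> borel_measurable (F (t k))" "sq_integrable M Z"
    show "expectation (\<lambda>\<omega>. Z \<omega> * (Y (Suc k) \<omega> - Y k \<omega>)) = 0"
      using mart[OF k] by (simp add: Y_def)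
  qed (use t Ysq YF in auto)
  also have "ennreal (expectation (\<lambda>\<omega>. (Y N \<omega>)\<^sup>2)) = (\<Sum>l<N. ennreal (expectation (\<lambda>\<omega>. c0 l \<omega> * ?en l \<omega>)))"
    unfolding EY[OF order_refl] using ennn c0nn by (intro sum_ennreal[symmetric] Bochner_Integration.integral_nonneg mult_nonneg_nonneg)
  also have "\<dots> = (\<Sum>l<N. \<integral>\<^sup>+\<omega>. ennreal (c0 l \<omega> * ?en l \<omega>) \<partial>M)"
    using cen ennn c0nn by (intro sum.cong refl nn_integral_eq_integral[symmetric]) auto
  also have "\<dots> = (\<integral>\<^sup>+\<omega>. (\<Sum>l<N. ennreal (c0 l \<omega> * ?en l \<omega>)) \<partial>M)"
    using cen by (intro nn_integral_sum[symmetric]) auto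
  also have "\<dots> \<le> (\<integral>\<^sup>+\<omega>. ?R \<omega> \<partial>M)" by (intro nn_integral_mono pw)
  finally show ?thesis by (simp add: mult_left_mono)
qed

text \<open>Refining the grid moves both sides monotonically: the maxima over grid points increase
  to the supremum over dyadic times, and the rounded cutoffs decrease to the cutoff. Boundedness of
  simple integrands provides the finite integral that downward monotone convergence needs.\<close>

lemma simple_cutoff_bound:
  assumes T: "0 < T" and D: "simple_integral D S" and c: "cutoff T c"
  shows "(\<integral>\<^sup>+\<omega>. sup_cut T c (\<lambda>t \<omega>. ennreal ((S t \<omega>)\<^sup>2)) \<omega> \<partial>M) \<le>
    4 * (\<integral>\<^sup>+\<omega>. int_cut T c (\<lambda>s \<omega>. ennreal (\<Sum>i\<in>UNIV. (D i s \<omega>)\<^sup>2)) \<omega> \<partial>M)"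
proof -
  let ?e = "\<lambda>s \<omega>. ennreal (\<Sum>i\<in>UNIV. (D i s \<omega>)\<^sup>2)"
  define g where "g n s = grid T n (grid_index T n s)" for n s
  define L where "L n \<omega> = (SUP t\<in>grid T n ` {..2 ^ n}. if c t \<omega> then ennreal ((S t \<omega>)\<^sup>2) else 0)" for n \<omega>
  define cn where "cn n s \<omega> = c (g n s) \<omega>" for n s \<omega>
  define R where "R n = int_cut T (cn n) ?e" for n
  have T0: "0 \<le> T" "T \<le> T" using T by auto
  have LR: "(\<integral>\<^sup>+\<omega>. L n \<omega> \<partial>M) \<le> 4 * (\<integral>\<^sup>+\<omega>. R n \<omega> \<partial>M)" for n
    using simple_grid_bound[OF T D c, of n] unfolding L_def R_def cn_def g_def .
  have incL: "incseq (\<lambda>n \<omega>. L n \<omega>)"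
    unfolding L_def by (intro incseq_SucI le_funI SUP_subset_mono grid_refine) auto
  have cM: "{\<omega>\<in>space M. c t \<omega>} \<in> sets M" if "0 \<le> t" "t \<le> T" for t
    using cutoff_measurable[OF c that] subalgebra_F[OF that(1)] by (auto simp: subalgebra_def)
  have LM: "L n \<in> borel_measurable M" for n
    unfolding L_def
  proof (intro borel_measurable_SUP countable_finite)
    fix t assume "t \<in> grid T n ` {..2 ^ n}"
    then have t: "0 \<le> t" "t \<le> T" using T by (auto simp: grid_nonneg grid_le)
    show "(\<lambda>\<omega>. if c t \<omega> then ennreal ((S t \<omega>)\<^sup>2) else 0) \<in> borel_measurable M"
      using cM[OF t] sq_integrable_measurable[OF simple_integral_sq[OF D t(1)]] by (intro measurable_If) auto
  qed auto
  have "sup_cut T c (\<lambda>t \<omega>. ennreal ((S t \<omega>)\<^sup>2)) \<omega> = (SUP n. L n \<omega>)" for \<omega>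
    unfolding sup_cut_def L_def dyadic_def by (rule SUP_UNION)
  then have "(\<integral>\<^sup>+\<omega>. sup_cut T c (\<lambda>t \<omega>. ennreal ((S t \<omega>)\<^sup>2)) \<omega> \<partial>M) = (SUP n. \<integral>\<^sup>+\<omega>. L n \<omega> \<partial>M)"
    using nn_integral_monotone_convergence_SUP[OF incL LM] by simp
  also have "\<dots> \<le> 4 * (\<integral>\<^sup>+\<omega>. int_cut T c ?e \<omega> \<partial>M)"
  proof (rule SUP_least)
    fix m
    have eM: "(\<lambda>(s, \<omega>). indicator {0..T} s * ?e s \<omega>) \<in> borel_measurable (borel \<Otimes>\<^sub>M M)"
    proof -
      note [measurable] = simple_integrand_measurable_M[OF D]
      show ?thesis by measurable
    qed
    have cutM: "(\<lambda>(s, \<omega>). if s \<in> {0..T} \<and> cn n s \<omega> then ?e s \<omega> else 0) \<in> borel_measurable (borel \<Otimes>\<^sub>M M)" for n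
      using cut_measurable[OF subsetD[OF sets_pair_F_M[OF T0(1)] cutoff_grid_joint[OF c T T0]] refl eM, of n]
      by (simp add: cn_def g_def)
    have RM: "R n \<in> borel_measurable M" for n
    proof -
      note [measurable] = cutM[of n]
      show ?thesis unfolding R_def int_cut_def[abs_def] by measurable
    qed
    obtain C where C: "C \<ge> 0" "\<And>i s \<omega>. \<omega>\<in>space M \<Longrightarrow> \<bar>D i s \<omega>\<bar> \<le> C" using simple_integrand_bounded[OF D] by blast
    define K where "K = (\<Sum>i\<in>(UNIV :: 'i set). C\<^sup>2)"
    have eK: "?e s \<omega> \<le> ennreal K" if "\<omega> \<in> space M" for s \<omega>
      unfolding K_def using C(2)[OF that] C(1) by (intro ennreal_leI sum_mono) (simp add: abs_le_square_iff[symmetric])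
    have finR: "R n \<omega> \<le> ennreal (K * T)" if o: "\<omega> \<in> space M" for n \<omega>
    proof -
      have "R n \<omega> \<le> (\<integral>\<^sup>+s. ennreal K * indicator {0..T} s \<partial>lborel)"
        unfolding R_def int_cut_def using eK[OF o] by (intro nn_integral_mono) (auto simp: indicator_def)
      also have "\<dots> = ennreal (K * T)" using T by (simp add: nn_integral_cmult ennreal_mult K_def)
      finally show ?thesis .
    qed
    have dec: "cn (Suc n) s \<omega> \<Longrightarrow> cn n s \<omega>" if "\<omega> \<in> space M" "0 \<le> s" "s \<le> T" for n s \<omega>
      unfolding cn_def g_def
      by (rule cutoff_antimono[OF c that(1) grid_nonneg[OF T] grid_index_refine[OF T that(2)]])
        (use grid_index_grid(1)[OF T that(2), of "Suc n"] that in auto)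
    have inner: "(INF n. R n \<omega>) = int_cut T c ?e \<omega>" and decR: "R (Suc n) \<omega> \<le> R n \<omega>" if o: "\<omega> \<in> space M" for \<omega> n
    proof -
      let ?f = "\<lambda>n s. if s \<in> {0..T} \<and> cn n s \<omega> then ?e s \<omega> else 0"
      have fm: "?f n \<in> borel_measurable lborel" for n
        using measurable_compose[OF measurable_Pair2'[OF o] cutM[of n]] by simp
      have fd: "?f (Suc n) s \<le> ?f n s" for n s using dec[OF o, of s n] by auto
      show "R (Suc n) \<omega> \<le> R n \<omega>" unfolding R_def int_cut_def by (intro nn_integral_mono fd)
      have "(INF n. R n \<omega>) = (\<integral>\<^sup>+s. (INF n. ?f n s) \<partial>lborel)"
        unfolding R_def int_cut_def
      proof (rule nn_integral_monotone_convergence_INF_decseq[symmetric])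
        show "decseq ?f" by (intro decseq_SucI le_funI fd)
        show "integral\<^sup>N lborel (?f 0) < \<infinity>"
          using finR[OF o, of 0] unfolding R_def int_cut_def by (auto intro: le_less_trans)
      qed (rule fm)
      also have "\<dots> = int_cut T c ?e \<omega>"
        unfolding int_cut_def
      proof (rule nn_integral_cong)
        fix s
        show "(INF n. ?f n s) = (if s \<in> {0..T} \<and> c s \<omega> then ?e s \<omega> else 0)"
        proof (cases "s \<in> {0..T}")
          case True
          then have iff: "c s \<omega> \<longleftrightarrow> (\<forall>n. cn n s \<omega>)"
            unfolding cn_def g_def by (intro cutoff_grid_iff[OF c T _ _ o]) auto
          show ?thesis
          proof (cases "c s \<omega>")
            case False
            then obtain n where "\<not> cn n s \<omega>" using iff by auto
            then have "(INF n. ?f n s) \<le> 0" by (intro INF_lower2[of n]) auto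
            then show ?thesis using False by simp
          qed (use iff True in simp)
        next
          case False
          then have eq: "(\<lambda>n. ?f n s) = (\<lambda>_. 0)" by auto
          show ?thesis unfolding eq using False by auto
        qed
      qed
      finally show "(INF n. R n \<omega>) = int_cut T c ?e \<omega>" .
    qed
    have "(\<integral>\<^sup>+\<omega>. L m \<omega> \<partial>M) \<le> 4 * (INF n. \<integral>\<^sup>+\<omega>. R n \<omega> \<partial>M)"
    proof -
      \<comment> \<open>Passing through level \<open>max m n\<close> decouples the level on the left
        from the one on the right.\<close>
      have "(\<integral>\<^sup>+\<omega>. L m \<omega> \<partial>M) \<le> 4 * (\<integral>\<^sup>+\<omega>. R n \<omega> \<partial>M)" for n
      proof -
        have "(\<integral>\<^sup>+\<omega>. L m \<omega> \<partial>M) \<le> (\<integral>\<^sup>+\<omega>. L (max m n) \<omega> \<partial>M)"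
          using incL by (intro nn_integral_mono) (auto simp: incseq_def le_fun_def)
        also have "\<dots> \<le> 4 * (\<integral>\<^sup>+\<omega>. R (max m n) \<omega> \<partial>M)" by (rule LR)
        also have "\<dots> \<le> 4 * (\<integral>\<^sup>+\<omega>. R n \<omega> \<partial>M)"
        proof (intro mult_left_mono nn_integral_mono)
          fix \<omega> assume o: "\<omega> \<in> space M"
          show "R (max m n) \<omega> \<le> R n \<omega>"
            using lift_Suc_antimono_le[of "\<lambda>n. R n \<omega>", OF decR[OF o], of n "max m n"] by simp
        qed simp
        finally show ?thesis .
      qed
      then show ?thesis by (rule ennreal_le_mult_INF)
    qed
    also have "(INF n. \<integral>\<^sup>+\<omega>. R n \<omega> \<partial>M) = (\<integral>\<^sup>+\<omega>. (INF n. R n \<omega>) \<partial>M)"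
    proof (rule nn_integral_monotone_convergence_INF_AE[symmetric])
      show "AE \<omega> in M. R (Suc i) \<omega> \<le> R i \<omega>" for i using decR by (intro AE_I2) auto
      have "(\<integral>\<^sup>+\<omega>. R 0 \<omega> \<partial>M) \<le> (\<integral>\<^sup>+\<omega>. ennreal (K * T) \<partial>M)" by (intro nn_integral_mono finR)
      also have "\<dots> < \<infinity>" by (simp add: emeasure_space_1)
      finally show "(\<integral>\<^sup>+\<omega>. R 0 \<omega> \<partial>M) < \<infinity>" .
    qed (rule RM)
    also have "\<dots> = (\<integral>\<^sup>+\<omega>. int_cut T c ?e \<omega> \<partial>M)" by (intro nn_integral_cong inner)
    finally show "(\<integral>\<^sup>+\<omega>. L m \<omega> \<partial>M) \<le> 4 * (\<integral>\<^sup>+\<omega>. int_cut T c ?e \<omega> \<partial>M)" .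
  qed
  finally show ?thesis .
qed

end

section \<open>Progressive processes\<close>

definition sq_norm :: "('i::finite \<Rightarrow> real \<Rightarrow> 'a \<Rightarrow> real) \<Rightarrow> real \<Rightarrow> 'a \<Rightarrow> ennreal" where
  "sq_norm H s \<omega> = ennreal (\<Sum>i\<in>UNIV. (H i s \<omega>)\<^sup>2)"

abbreviation always :: "real \<Rightarrow> 'a \<Rightarrow> bool" where
  "always \<equiv> \<lambda>_ _. True"

text \<open>The weights 1 + \<epsilon> and 1 + 1 / \<epsilon> replace 2 and 2: an approximation
  error tends to 0 for fixed \<epsilon>, and \<epsilon> is sent to 0 afterwards, so the maximal
  inequality keeps its constant in the limit.\<close>

lemma square_sum_weighted:
  fixes h d :: real
  assumes "0 < \<epsilon>"
  shows "h\<^sup>2 \<le> (1 + \<epsilon>) * k\<^sup>2 + (1 + 1 / \<epsilon>) * (h - k)\<^sup>2"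
proof -
  have "0 \<le> (\<epsilon> * k - (h - k))\<^sup>2 / \<epsilon>" using assms by simp
  also have "\<dots> = (1 + \<epsilon>) * k\<^sup>2 + (1 + 1 / \<epsilon>) * (h - k)\<^sup>2 - h\<^sup>2"
    using assms by (simp add: power2_eq_square field_simps)
  finally show ?thesis by simp
qed

lemma sq_norm_weighted:
  assumes "0 < \<epsilon>"
  shows "sq_norm D s \<omega> \<le> ennreal (1 + \<epsilon>) * sq_norm H s \<omega> + ennreal (1 + 1 / \<epsilon>) * sq_norm (\<lambda>i s \<omega>. D i s \<omega> - H i s \<omega>) s \<omega>"
proof -
  have "(\<Sum>i\<in>UNIV. (D i s \<omega>)\<^sup>2) \<le> (\<Sum>i\<in>UNIV. (1 + \<epsilon>) * (H i s \<omega>)\<^sup>2 + (1 + 1 / \<epsilon>) * (D i s \<omega> - H i s \<omega>)\<^sup>2)"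
    by (intro sum_mono square_sum_weighted assms)
  also have "\<dots> = (1 + \<epsilon>) * (\<Sum>i\<in>UNIV. (H i s \<omega>)\<^sup>2) + (1 + 1 / \<epsilon>) * (\<Sum>i\<in>UNIV. (D i s \<omega> - H i s \<omega>)\<^sup>2)"
    by (simp add: sum.distrib sum_distrib_left)
  finally have "sq_norm D s \<omega> \<le> ennreal ((1 + \<epsilon>) * (\<Sum>i\<in>UNIV. (H i s \<omega>)\<^sup>2) + (1 + 1 / \<epsilon>) * (\<Sum>i\<in>UNIV. (D i s \<omega> - H i s \<omega>)\<^sup>2))"
    unfolding sq_norm_def by (rule ennreal_leI)
  also have "\<dots> = ennreal (1 + \<epsilon>) * sq_norm H s \<omega> + ennreal (1 + 1 / \<epsilon>) * sq_norm (\<lambda>i s \<omega>. D i s \<omega> - H i s \<omega>) s \<omega>"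
    unfolding sq_norm_def using assms
    by (subst ennreal_plus) (auto intro!: sum_nonneg mult_nonneg_nonneg simp: ennreal_mult' sum_nonneg)
  finally show ?thesis .
qed

lemma int_cut_mono: "s \<le> t \<Longrightarrow> int_cut s always f \<omega> \<le> int_cut t always f \<omega>"
  unfolding int_cut_def by (intro nn_integral_mono) auto

context filtered_prob_space begin

text \<open>Extension by zero takes the place of restriction to [0, t]. For real processes this is
  equivalent to \<open>prog_measurable\<close>, by \<open>prog_measurable_iff\<close>, and it covers
  vector and \<open>ennreal\<close> values in one form. In return, the composition lemmas ask for
  maps that send 0 to 0.\<close>

definition progressive :: "real \<Rightarrow> (real \<Rightarrow> 'a \<Rightarrow> 'b::{zero, topological_space}) \<Rightarrow> bool" where
  "progressive T f \<longleftrightarrow> (\<forall>t\<in>{0..T}. (\<lambda>(s, \<omega>). if s \<in> {0..t} then f s \<omega> else 0) \<in> borel_measurable (borel \<Otimes>\<^sub>M F t))"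

lemma progressiveD:
  "progressive T f \<Longrightarrow> 0 \<le> t \<Longrightarrow> t \<le> T \<Longrightarrow> (\<lambda>(s, \<omega>). if s \<in> {0..t} then f s \<omega> else 0) \<in> borel_measurable (borel \<Otimes>\<^sub>M F t)"
  by (auto simp: progressive_def)

lemma progressive_M:
  assumes "progressive T f" "0 \<le> T"
  shows "(\<lambda>(s, \<omega>). if s \<in> {0..T} then f s \<omega> else 0) \<in> borel_measurable (borel \<Otimes>\<^sub>M M)"
proof -
  have "(\<lambda>\<omega>. \<omega>) \<in> measurable M (F T)" using measurable_F_M[OF assms(2) measurable_ident[of "F T", unfolded id_def]] .
  then have *: "(\<lambda>x. (fst x, snd x)) \<in> measurable (borel \<Otimes>\<^sub>M M) (borel \<Otimes>\<^sub>M F T)"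
    by (intro measurable_Pair measurable_fst measurable_compose[OF measurable_snd])
  show ?thesis using measurable_compose[OF *[unfolded prod.collapse] progressiveD[OF assms(1)]] assms(2) by simp
qed

lemma progressive_section:
  assumes "progressive T f" "0 \<le> T" "\<omega> \<in> space M"
  shows "(\<lambda>s. if s \<in> {0..T} then f s \<omega> else 0) \<in> borel_measurable borel"
  using measurable_compose[OF measurable_Pair2'[OF assms(3)] progressive_M[OF assms(1,2)]] by simp

lemma progressive_compose:
  assumes "progressive T f" "g \<in> borel_measurable borel" "g 0 = 0"
  shows "progressive T (\<lambda>s \<omega>. g (f s \<omega>))"
  unfolding progressive_def
proof
  fix t assume t: "t \<in> {0..T}"
  have "(\<lambda>x. g (case x of (s, \<omega>) \<Rightarrow> if s \<in> {0..t} then f s \<omega> else 0)) \<in> borel_measurable (borel \<Otimes>\<^sub>M F t)"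
    using measurable_compose[OF progressiveD[OF assms(1)] assms(2)] t by auto
  also have "(\<lambda>x. g (case x of (s, \<omega>) \<Rightarrow> if s \<in> {0..t} then f s \<omega> else 0)) = (\<lambda>(s, \<omega>). if s \<in> {0..t} then g (f s \<omega>) else 0)"
    using assms(3) by (auto simp: fun_eq_iff)
  finally show "(\<lambda>(s, \<omega>). if s \<in> {0..t} then g (f s \<omega>) else 0) \<in> borel_measurable (borel \<Otimes>\<^sub>M F t)" .
qed

lemma progressive_compose2:
  assumes "progressive T f" "progressive T f'" "(\<lambda>(x, y). g x y) \<in> borel_measurable (borel \<Otimes>\<^sub>M borel)" "g 0 0 = 0"
  shows "progressive T (\<lambda>s \<omega>. g (f s \<omega>) (f' s \<omega>))"
  unfolding progressive_def
proof
  fix t assume t: "t \<in> {0..T}"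
  have "(\<lambda>x. (case x of (s, \<omega>) \<Rightarrow> if s \<in> {0..t} then f s \<omega> else 0, case x of (s, \<omega>) \<Rightarrow> if s \<in> {0..t} then f' s \<omega> else 0))
    \<in> measurable (borel \<Otimes>\<^sub>M F t) (borel \<Otimes>\<^sub>M borel)"
    using progressiveD[OF assms(1)] progressiveD[OF assms(2)] t by (intro measurable_Pair) auto
  from measurable_compose[OF this assms(3)]
  show "(\<lambda>(s, \<omega>). if s \<in> {0..t} then g (f s \<omega>) (f' s \<omega>) else 0) \<in> borel_measurable (borel \<Otimes>\<^sub>M F t)"
    by (rule measurable_cong[THEN iffD1, rotated]) (auto simp: assms(4))
qed

lemma progressive_add:
  fixes f g :: "real \<Rightarrow> 'a \<Rightarrow> 'b::{second_countable_topology, topological_monoid_add}"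
  shows "progressive T f \<Longrightarrow> progressive T g \<Longrightarrow> progressive T (\<lambda>s \<omega>. f s \<omega> + g s \<omega>)"
proof -
  have "(\<lambda>(x :: 'b, y). x + y) \<in> borel_measurable (borel \<Otimes>\<^sub>M borel)"
    unfolding case_prod_unfold by measurable
  then show "progressive T f \<Longrightarrow> progressive T g \<Longrightarrow> progressive T (\<lambda>s \<omega>. f s \<omega> + g s \<omega>)"
    by (intro progressive_compose2[where g = "(+)"]) auto
qed

lemma progressive_diff:
  fixes f g :: "real \<Rightarrow> 'a \<Rightarrow> 'b::{second_countable_topology, real_normed_vector}"
  shows "progressive T f \<Longrightarrow> progressive T g \<Longrightarrow> progressive T (\<lambda>s \<omega>. f s \<omega> - g s \<omega>)"
proof -
  have "(\<lambda>(x :: 'b, y). x - y) \<in> borel_measurable (borel \<Otimes>\<^sub>M borel)"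
    unfolding case_prod_unfold by measurable
  then show "progressive T f \<Longrightarrow> progressive T g \<Longrightarrow> progressive T (\<lambda>s \<omega>. f s \<omega> - g s \<omega>)"
    by (intro progressive_compose2[where g = "(-)"]) auto
qed

lemma progressive_zero: "progressive T (\<lambda>_ _. 0)"
  unfolding progressive_def by simp

lemma progressive_sum:
  fixes f :: "'j \<Rightarrow> real \<Rightarrow> 'a \<Rightarrow> 'b::{second_countable_topology, topological_comm_monoid_add}"
  shows "(\<And>i. i \<in> A \<Longrightarrow> progressive T (f i)) \<Longrightarrow> progressive T (\<lambda>s \<omega>. \<Sum>i\<in>A. f i s \<omega>)"
  by (induction A rule: infinite_finite_induct) (auto intro: progressive_zero progressive_add)

lemma progressive_sq_norm:
  "(\<And>i. progressive T (H i)) \<Longrightarrow> progressive T (sq_norm H)"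
  unfolding sq_norm_def[abs_def]
  by (rule progressive_compose[where g = ennreal], rule progressive_sum, rule progressive_compose[where g = "\<lambda>x. x\<^sup>2"]) auto

lemma prog_measurable_iff: "prog_measurable F T H \<longleftrightarrow> progressive T H"
  unfolding prog_measurable_def progressive_def
proof (intro ball_cong refl)
  fix t assume "t \<in> {0..T}"
  have "(\<lambda>(r, \<omega>). indicat_real {0..t} r *\<^sub>R H r \<omega>) = (\<lambda>(s, \<omega>). if s \<in> {0..t} then H s \<omega> else 0)"
    by (auto simp: fun_eq_iff indicator_def)
  then show "(\<lambda>(s, \<omega>). H s \<omega>) \<in> borel_measurable (restrict_space borel {0..t} \<Otimes>\<^sub>M F t) \<longleftrightarrow>
     (\<lambda>(s, \<omega>). if s \<in> {0..t} then H s \<omega> else 0) \<in> borel_measurable (borel \<Otimes>\<^sub>M F t)"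
    using borel_measurable_restrict_pair_iff[of "{0..t}" borel H "F t"] by simp
qed

lemma indicator_ennreal_eq:
  "(\<lambda>(s, \<omega>). indicator {0..t} s * f s \<omega>) = (\<lambda>(s, \<omega>). if s \<in> {0..t} then f s \<omega> else (0::ennreal))"
  by (auto simp: fun_eq_iff indicator_def)

lemma int_cut_adapted:
  assumes "cutoff T c" "0 < T" "progressive T f" "0 \<le> t" "t \<le> T"
  shows "int_cut t c f \<in> borel_measurable (F t)"
  using int_cut_measurable_F[OF assms(1,2,4,5)] progressiveD[OF assms(3-5)] by (simp add: indicator_ennreal_eq)

lemma int_cut_measurable_M:
  assumes "cutoff T c" "0 < T" "progressive T f"
  shows "int_cut T c f \<in> borel_measurable M"
  using int_cut_measurable[OF assms(1,2)] progressive_M[OF assms(3)] assms(2) by (simp add: indicator_ennreal_eq)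

lemma cut_section:
  assumes c: "cutoff T c" "0 < T" and f: "progressive T f" and o: "\<omega> \<in> space M"
  shows "(\<lambda>s. if s \<in> {0..T} \<and> c s \<omega> then f s \<omega> else (0::ennreal)) \<in> borel_measurable borel"
proof -
  have T: "0 \<le> T" "T \<le> T" using c by auto
  have "(\<lambda>(s, \<omega>). indicator {0..T} s * f s \<omega>) \<in> borel_measurable (borel \<Otimes>\<^sub>M M)"
    unfolding indicator_ennreal_eq by (rule progressive_M[OF f T(1)])
  from measurable_compose[OF measurable_Pair2'[OF o] cut_measurable[OF subsetD[OF sets_pair_F_M[OF T(1)] cutoff_joint[OF c T]] refl this]]
  show ?thesis by simp
qed

text \<open>The integral of f up to s serves as a clock that is stopped at level K. Left-closedness
  is Fatou's lemma along times that increase strictly below t; the clock may be infinite at other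
  times.\<close>

lemma cutoff_int:
  assumes f: "progressive T f" and T: "0 < T"
  shows "cutoff T (\<lambda>s \<omega>. int_cut s always f \<omega> \<le> K)"
  unfolding cutoff_def
proof (intro conjI ballI allI impI)
  fix s assume s: "s \<in> {0..T}"
  have "int_cut s always f \<in> borel_measurable (F s)"
    by (rule int_cut_adapted[OF cutoff_True T f]) (use s in auto)
  then have "{\<omega>\<in>space (F s). int_cut s always f \<omega> \<le> K} \<in> sets (F s)" by measurable
  then show "{\<omega>\<in>space M. int_cut s always f \<omega> \<le> K} \<in> sets (F s)" by (simp add: space_F)
next
  fix \<omega> t assume o: "\<omega> \<in> space M" and t: "t \<in> {0<..T}" and le: "\<forall>s\<in>{0..<t}. int_cut s always f \<omega> \<le> K"
  define r where "r n = t * (real n / real (Suc n))" for n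
  have r: "0 \<le> r n" "r n < t" for n using t by (auto simp: r_def field_simps)
  have rlim: "r \<longlonglongrightarrow> t * 1" unfolding r_def by (intro tendsto_intros LIMSEQ_n_over_Suc_n)
  have m: "(\<lambda>s. if s \<in> {0..T} then f s \<omega> else 0) \<in> borel_measurable borel"
    using progressive_section[OF f _ o] T by simp
  have fm: "(\<lambda>s. if s \<in> {0..r n} then f s \<omega> else 0) \<in> borel_measurable lborel" for n
  proof -
    have "(\<lambda>s. indicator {0..r n} s * (if s \<in> {0..T} then f s \<omega> else 0)) \<in> borel_measurable lborel" using m by simp
    also have "(\<lambda>s. indicator {0..r n} s * (if s \<in> {0..T} then f s \<omega> else 0)) = (\<lambda>s. if s \<in> {0..r n} then f s \<omega> else 0)"
      using r[of n] t by (auto simp: fun_eq_iff indicator_def)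
    finally show ?thesis .
  qed
  have "int_cut t always f \<omega> \<le> (\<integral>\<^sup>+s. liminf (\<lambda>n. if s \<in> {0..r n} then f s \<omega> else 0) \<partial>lborel)"
    unfolding int_cut_def
  proof (rule nn_integral_mono_AE)
    show "AE s in lborel. (if s \<in> {0..t} \<and> True then f s \<omega> else 0) \<le> liminf (\<lambda>n. if s \<in> {0..r n} then f s \<omega> else 0)"
      using AE_lborel_singleton[of t]
    proof eventually_elim
      case (elim s)
      show ?case
      proof (cases "s \<in> {0..<t}")
        case True
        have "\<forall>\<^sub>F n in sequentially. s < r n" using order_tendstoD(1)[OF rlim, of s] True by simp
        then have "\<forall>\<^sub>F n in sequentially. f s \<omega> \<le> (if s \<in> {0..r n} then f s \<omega> else 0)"
          by eventually_elim (use True in auto)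
        then show ?thesis using True by (simp add: Liminf_bounded)
      qed (use elim in auto)
    qed
  qed
  also have "\<dots> \<le> liminf (\<lambda>n. \<integral>\<^sup>+s. (if s \<in> {0..r n} then f s \<omega> else 0) \<partial>lborel)"
    by (rule nn_integral_liminf[OF fm])
  also have "\<dots> \<le> K"
    using le r unfolding int_cut_def by (intro Liminf_le) auto
  finally show "int_cut t always f \<omega> \<le> K" .
next
  fix \<omega> s t assume st: "s \<le> t" and K: "int_cut t always f \<omega> \<le> K"
  show "int_cut s always f \<omega> \<le> K" by (rule order_trans[OF int_cut_mono[OF st] K])
qed

lemma int_cut_bounded:
  assumes c: "cutoff T c" and f: "progressive T f" and T: "0 < T" and o: "\<omega> \<in> space M"
  shows "int_cut T (\<lambda>s \<omega>. c s \<omega> \<and> int_cut s always f \<omega> \<le> K) f \<omega> \<le> K"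
proof -
  let ?d = "\<lambda>s \<omega>. c s \<omega> \<and> int_cut s always f \<omega> \<le> K"
  have d: "cutoff T ?d" by (intro cutoff_conj c cutoff_int f T)
  define A where "A = {s\<in>{0..T}. ?d s \<omega>}"
  show ?thesis
  proof (cases "A = {}")
    case True
    have "int_cut T ?d f \<omega> = (\<integral>\<^sup>+(s::real). 0 \<partial>lborel)"
      unfolding int_cut_def[of T ?d] by (rule nn_integral_cong) (use True in \<open>auto simp: A_def\<close>)
    then show ?thesis by simp
  next
    case False
    have bdd: "bdd_above A" unfolding A_def by (intro bdd_aboveI[of _ T]) auto
    define \<theta> where "\<theta> = Sup A"
    have \<theta>: "0 \<le> \<theta>" "\<theta> \<le> T"
      using False bdd unfolding \<theta>_def by (auto simp: A_def intro!: cSup_upper2 cSup_least)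
    have "?d \<theta> \<omega>"
    proof (cases "\<theta> = 0")
      case True
      obtain a where a: "a \<in> A" using False by auto
      then have "a \<le> 0" using cSup_upper[OF a bdd] True by (simp add: \<theta>_def)
      then have "a = 0" using a by (simp add: A_def)
      then show ?thesis using a True by (simp add: A_def)
    next
      case nz: False
      show ?thesis
      proof (rule cutoff_left[OF d o])
        fix s assume s: "0 \<le> s" "s < \<theta>"
        then obtain a where "a \<in> A" "s < a" using less_cSup_iff[OF False bdd] by (auto simp: \<theta>_def)
        then show "?d s \<omega>" using cutoff_antimono[OF d o s(1), of a] by (auto simp: A_def)
      qed (use nz \<theta> in auto)
    qed
    then have "int_cut \<theta> always f \<omega> \<le> K" by simp
    moreover have "int_cut T ?d f \<omega> \<le> int_cut \<theta> always f \<omega>"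
      unfolding int_cut_def[of T ?d] int_cut_def[of \<theta>]
    proof (rule nn_integral_mono)
      fix s
      show "(if s \<in> {0..T} \<and> ?d s \<omega> then f s \<omega> else 0) \<le> (if s \<in> {0..\<theta>} \<and> True then f s \<omega> else 0)"
        using cSup_upper[of s A] bdd by (auto simp: \<theta>_def A_def)
    qed
    ultimately show ?thesis by simp
  qed
qed

end

section \<open>Limits of simple integrals\<close>

context orthogonal_bm begin

lemma simple_integrand_progressive: "simple_integral D S \<Longrightarrow> progressive T (D i)"
  unfolding progressive_def
proof
  fix t assume "simple_integral D S" "t \<in> {0..T}"
  then have "(\<lambda>(r, \<omega>). indicator {0..t} r *\<^sub>R D i r \<omega>) \<in> borel_measurable (borel \<Otimes>\<^sub>M F t)"
    by (intro simple_integrand_measurable) auto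
  also have "(\<lambda>(r, \<omega>). indicator {0..t} r *\<^sub>R D i r \<omega>) = (\<lambda>(s, \<omega>). if s \<in> {0..t} then D i s \<omega> else 0)"
    by (auto simp: fun_eq_iff indicator_def)
  finally show "(\<lambda>(s, \<omega>). if s \<in> {0..t} then D i s \<omega> else 0) \<in> borel_measurable (borel \<Otimes>\<^sub>M F t)" .
qed

text \<open>\<open>approx_integral T H I\<close> says that \<open>I\<close> is the sum over \<open>i\<close> of the It\^o integrals of \<open>H i\<close> with
  respect to \<open>W i\<close>. Convergence in probability is replaced by almost sure convergence (along a
  subsequence), and \<open>I\<close> is only evaluated at the dyadic points of \<open>[0, T]\<close>.\<close>

definition approx_integral :: "real \<Rightarrow> ('i \<Rightarrow> real \<Rightarrow> 'a \<Rightarrow> real) \<Rightarrow> (real \<Rightarrow> 'a \<Rightarrow> real) \<Rightarrow> bool" where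
  "approx_integral T H I \<longleftrightarrow>
    (\<forall>i. progressive T (H i)) \<and> (AE \<omega> in M. int_cut T always (sq_norm H) \<omega> < \<infinity>) \<and>
    (\<forall>t\<in>dyadic T. I t \<in> borel_measurable M) \<and>
    (\<exists>D S. (\<forall>N. simple_integral (D N) (S N)) \<and>
      (AE \<omega> in M. (\<lambda>N. int_cut T always (sq_norm (\<lambda>i s \<omega>. D N i s \<omega> - H i s \<omega>)) \<omega>) \<longlonglongrightarrow> 0) \<and>
      (AE \<omega> in M. \<forall>t\<in>dyadic T. (\<lambda>N. S N t \<omega>) \<longlonglongrightarrow> I t \<omega>))"

lemma approx_integral_bound_bounded:
  assumes T: "0 < T" and HI: "approx_integral T H I" and c: "cutoff T c"
    and K: "0 \<le> K" "AE \<omega> in M. int_cut T c (sq_norm H) \<omega> \<le> ennreal K"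
  shows "(\<integral>\<^sup>+\<omega>. sup_cut T c (\<lambda>t \<omega>. ennreal ((I t \<omega>)\<^sup>2)) \<omega> \<partial>M) \<le> 4 * (\<integral>\<^sup>+\<omega>. int_cut T c (sq_norm H) \<omega> \<partial>M)"
proof -
  have T0: "0 \<le> T" "T \<le> T" using T by auto
  obtain D S where DS: "\<And>N. simple_integral (D N) (S N)"
    and conv: "AE \<omega> in M. (\<lambda>N. int_cut T always (sq_norm (\<lambda>i s \<omega>. D N i s \<omega> - H i s \<omega>)) \<omega>) \<longlonglongrightarrow> 0"
    and convS: "AE \<omega> in M. \<forall>t\<in>dyadic T. (\<lambda>N. S N t \<omega>) \<longlonglongrightarrow> I t \<omega>"
    using HI unfolding approx_integral_def by blast
  have Hp: "progressive T (H i)" and IM: "t \<in> dyadic T \<Longrightarrow> I t \<in> borel_measurable M" for i t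
    using HI unfolding approx_integral_def by auto
  have Dp: "progressive T (D N i)" for N i by (rule simple_integrand_progressive[OF DS])
  have pH: "progressive T (sq_norm H)" and pD: "progressive T (sq_norm (D N))"
    and pd: "progressive T (sq_norm (\<lambda>i s \<omega>. D N i s \<omega> - H i s \<omega>))" for N
    by (intro progressive_sq_norm progressive_diff Hp Dp)+
  define a where "a N \<omega> = int_cut T c (sq_norm (D N)) \<omega>" for N \<omega>
  define d where "d N \<omega> = int_cut T always (sq_norm (\<lambda>i s \<omega>. D N i s \<omega> - H i s \<omega>)) \<omega>" for N \<omega>
  define x where "x \<omega> = int_cut T c (sq_norm H) \<omega>" for \<omega>
  define cN where "cN N s \<omega> \<longleftrightarrow> c s \<omega> \<and> int_cut s always (sq_norm (D N)) \<omega> \<le> ennreal (K + 1)" for N s \<omega>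
  define b where "b N \<omega> = int_cut T (cN N) (sq_norm (D N)) \<omega>" for N \<omega>
  have cNc: "cutoff T (cN N)" for N unfolding cN_def[abs_def] by (intro cutoff_conj c cutoff_int pD T)
  have bK: "b N \<omega> \<le> ennreal (K + 1)" if "\<omega> \<in> space M" for N \<omega>
    unfolding b_def cN_def[abs_def] by (rule int_cut_bounded[OF c pD T that])
  have ba: "b N \<omega> \<le> a N \<omega>" for N \<omega>
    unfolding a_def b_def int_cut_def[of T] cN_def by (intro nn_integral_mono) auto
  have ax: "a N \<omega> \<le> ennreal (1 + \<epsilon>) * x \<omega> + ennreal (1 + 1 / \<epsilon>) * d N \<omega>" if e: "0 < \<epsilon>" and o: "\<omega> \<in> space M" for N \<omega> \<epsilon>
  proof -
    let ?h = "\<lambda>s. if s \<in> {0..T} \<and> c s \<omega> then sq_norm H s \<omega> else 0"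
    let ?d = "\<lambda>s. if s \<in> {0..T} \<and> True then sq_norm (\<lambda>i s \<omega>. D N i s \<omega> - H i s \<omega>) s \<omega> else 0"
    have m: "?h \<in> borel_measurable lborel" "?d \<in> borel_measurable lborel"
      using cut_section[OF c T pH o] cut_section[OF cutoff_True T pd o, of N] by auto
    have "a N \<omega> \<le> (\<integral>\<^sup>+s. ennreal (1 + \<epsilon>) * ?h s + ennreal (1 + 1 / \<epsilon>) * ?d s \<partial>lborel)"
      unfolding a_def int_cut_def using sq_norm_weighted[OF e] by (intro nn_integral_mono) auto
    also have "\<dots> = ennreal (1 + \<epsilon>) * x \<omega> + ennreal (1 + 1 / \<epsilon>) * d N \<omega>"
      unfolding x_def d_def int_cut_def using m by (subst nn_integral_add) (auto simp: nn_integral_cmult)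
    finally show ?thesis .
  qed
  have lim: "(\<lambda>N. ennreal (1 + \<epsilon>) * x \<omega> + ennreal (1 + 1 / \<epsilon>) * d N \<omega>) \<longlonglongrightarrow> ennreal (1 + \<epsilon>) * x \<omega>"
    if "(\<lambda>N. d N \<omega>) \<longlonglongrightarrow> 0" for \<epsilon> \<omega>
  proof -
    have "(\<lambda>N. ennreal (1 + \<epsilon>) * x \<omega> + ennreal (1 + 1 / \<epsilon>) * d N \<omega>) \<longlonglongrightarrow> ennreal (1 + \<epsilon>) * x \<omega> + ennreal (1 + 1 / \<epsilon>) * 0"
      by (intro tendsto_add tendsto_const ennreal_tendsto_cmult that) auto
    then show ?thesis by simp
  qed
  let ?LS = "\<lambda>N \<omega>. sup_cut T (cN N) (\<lambda>t \<omega>. ennreal ((S N t \<omega>)\<^sup>2)) \<omega>"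
  have LSM: "?LS N \<in> borel_measurable M" for N
    by (rule sup_cut_measurable[OF cNc T]) (use dyadic_subset[OF T] simple_integral_sq[OF DS] in \<open>force simp: sq_integrable_def\<close>)
  have L: "AE \<omega> in M. sup_cut T c (\<lambda>t \<omega>. ennreal ((I t \<omega>)\<^sup>2)) \<omega> \<le> liminf (\<lambda>N. ?LS N \<omega>)"
    using conv convS K(2) AE_space
  proof eventually_elim
    case (elim \<omega>)
    have dl: "(\<lambda>N. d N \<omega>) \<longlonglongrightarrow> 0" using elim by (simp add: d_def)
    \<comment> \<open>Any \<epsilon> with (1 + \<epsilon>) K < K + 1 would do.\<close>
    define \<epsilon> where "\<epsilon> = 1 / (2 * (K + 1))"
    have e: "0 < \<epsilon>" using K by (simp add: \<epsilon>_def)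
    have "ennreal (1 + \<epsilon>) * x \<omega> \<le> ennreal (1 + \<epsilon>) * ennreal K"
      using elim(3) by (intro mult_left_mono) (auto simp: x_def)
    also have "\<dots> = ennreal ((1 + \<epsilon>) * K)" using e K by (simp add: ennreal_mult)
    also have "\<dots> < ennreal (K + 1)" using K by (intro ennreal_lessI) (auto simp: \<epsilon>_def field_simps)
    finally have "\<forall>\<^sub>F N in sequentially. ennreal (1 + \<epsilon>) * x \<omega> + ennreal (1 + 1 / \<epsilon>) * d N \<omega> < ennreal (K + 1)"
      by (rule order_tendstoD(2)[OF lim[OF dl]])
    then have aK: "\<forall>\<^sub>F N in sequentially. a N \<omega> \<le> ennreal (K + 1)"
      by eventually_elim (use ax[OF e elim(4)] in \<open>meson le_less_trans less_imp_le\<close>)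
    show ?case unfolding sup_cut_def[of T c]
    proof (rule SUP_least)
      fix t assume t: "t \<in> dyadic T"
      then have t0: "0 \<le> t" "t \<le> T" using dyadic_subset[OF T] by auto
      show "(if c t \<omega> then ennreal ((I t \<omega>)\<^sup>2) else 0) \<le> liminf (\<lambda>N. ?LS N \<omega>)"
      proof (cases "c t \<omega>")
        case True
        have ev: "\<forall>\<^sub>F N in sequentially. ennreal ((S N t \<omega>)\<^sup>2) \<le> ?LS N \<omega>"
          using aK
        proof eventually_elim
          case e: (elim N)
          have "int_cut t always (sq_norm (D N)) \<omega> \<le> a N \<omega>"
            unfolding a_def int_cut_def
            using cutoff_antimono[OF c elim(4) _ _ t0(2) True] t0 by (intro nn_integral_mono) auto
          then have "cN N t \<omega>" using True e by (auto simp: cN_def)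
          then have "ennreal ((S N t \<omega>)\<^sup>2) = (if cN N t \<omega> then ennreal ((S N t \<omega>)\<^sup>2) else 0)" by simp
          also have "\<dots> \<le> ?LS N \<omega>" unfolding sup_cut_def by (rule SUP_upper[OF t])
          finally show ?case .
        qed
        have "(\<lambda>N. ennreal ((S N t \<omega>)\<^sup>2)) \<longlonglongrightarrow> ennreal ((I t \<omega>)\<^sup>2)"
          using elim(2) t by (intro tendsto_ennrealI tendsto_power) auto
        then have "ennreal ((I t \<omega>)\<^sup>2) = liminf (\<lambda>N. ennreal ((S N t \<omega>)\<^sup>2))"
          by (intro lim_imp_Liminf[symmetric]) auto
        also have "\<dots> \<le> liminf (\<lambda>N. ?LS N \<omega>)" by (rule Liminf_mono[OF ev])
        finally show ?thesis using True by simp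
      qed simp
    qed
  qed
  have bM: "b N \<in> borel_measurable M" for N
    unfolding b_def[abs_def] by (rule int_cut_measurable_M[OF cNc T pD])
  have xM: "x \<in> borel_measurable M" unfolding x_def[abs_def] by (rule int_cut_measurable_M[OF c T pH])
  \<comment> \<open>For fixed \<epsilon> the approximation error disappears in the limit of the
    approximants; afterwards \<epsilon> tends to 0 along 1 / (n + 1).\<close>
  have main: "(\<integral>\<^sup>+\<omega>. sup_cut T c (\<lambda>t \<omega>. ennreal ((I t \<omega>)\<^sup>2)) \<omega> \<partial>M) \<le> 4 * (ennreal (1 + \<epsilon>) * (\<integral>\<^sup>+\<omega>. x \<omega> \<partial>M))"
    if e: "0 < \<epsilon>" for \<epsilon>
  proof -
    have "(\<integral>\<^sup>+\<omega>. sup_cut T c (\<lambda>t \<omega>. ennreal ((I t \<omega>)\<^sup>2)) \<omega> \<partial>M) \<le> (\<integral>\<^sup>+\<omega>. liminf (\<lambda>N. ?LS N \<omega>) \<partial>M)"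
      by (rule nn_integral_mono_AE[OF L])
    also have "\<dots> \<le> liminf (\<lambda>N. \<integral>\<^sup>+\<omega>. ?LS N \<omega> \<partial>M)" by (rule nn_integral_liminf[OF LSM])
    also have "\<dots> \<le> liminf (\<lambda>N. \<integral>\<^sup>+\<omega>. 4 * b N \<omega> \<partial>M)"
    proof (intro Liminf_mono always_eventually allI)
      fix N
      have "(\<integral>\<^sup>+\<omega>. ?LS N \<omega> \<partial>M) \<le> 4 * (\<integral>\<^sup>+\<omega>. b N \<omega> \<partial>M)"
        using simple_cutoff_bound[OF T DS cNc, of N] unfolding b_def sq_norm_def[abs_def] .
      also have "\<dots> = (\<integral>\<^sup>+\<omega>. 4 * b N \<omega> \<partial>M)" by (rule nn_integral_cmult[symmetric, OF bM])
      finally show "(\<integral>\<^sup>+\<omega>. ?LS N \<omega> \<partial>M) \<le> (\<integral>\<^sup>+\<omega>. 4 * b N \<omega> \<partial>M)" .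
    qed
    also have "\<dots> \<le> limsup (\<lambda>N. \<integral>\<^sup>+\<omega>. 4 * b N \<omega> \<partial>M)" by (rule Liminf_le_Limsup) simp
    also have "\<dots> \<le> (\<integral>\<^sup>+\<omega>. limsup (\<lambda>N. 4 * b N \<omega>) \<partial>M)"
    proof (rule nn_integral_limsup[where w = "\<lambda>_. 4 * ennreal (K + 1)"])
      show "AE \<omega> in M. 4 * b N \<omega> \<le> 4 * ennreal (K + 1)" for N
        using bK by (intro AE_I2 mult_left_mono) auto
      show "(\<integral>\<^sup>+\<omega>. 4 * ennreal (K + 1) \<partial>M) < \<infinity>"
        by (simp add: emeasure_space_1 ennreal_mult_less_top)
    qed (use bM in auto)
    also have "\<dots> \<le> (\<integral>\<^sup>+\<omega>. 4 * (ennreal (1 + \<epsilon>) * x \<omega>) \<partial>M)"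
    proof (rule nn_integral_mono_AE)
      show "AE \<omega> in M. limsup (\<lambda>N. 4 * b N \<omega>) \<le> 4 * (ennreal (1 + \<epsilon>) * x \<omega>)"
        using conv AE_space
      proof eventually_elim
        case (elim \<omega>)
        have dl: "(\<lambda>N. d N \<omega>) \<longlonglongrightarrow> 0" using elim by (simp add: d_def)
        have "limsup (\<lambda>N. 4 * b N \<omega>) \<le> limsup (\<lambda>N. 4 * (ennreal (1 + \<epsilon>) * x \<omega> + ennreal (1 + 1 / \<epsilon>) * d N \<omega>))"
          using ba ax[OF e elim(2)] by (intro Limsup_mono always_eventually allI mult_left_mono) (auto intro: order_trans)
        also have "\<dots> = 4 * (ennreal (1 + \<epsilon>) * x \<omega>)"
          by (intro lim_imp_Limsup ennreal_tendsto_cmult lim dl) auto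
        finally show ?case .
      qed
    qed
    also have "\<dots> = 4 * (ennreal (1 + \<epsilon>) * (\<integral>\<^sup>+\<omega>. x \<omega> \<partial>M))" using xM by (simp add: nn_integral_cmult)
    finally show ?thesis .
  qed
  have "(\<lambda>n. 4 * (ennreal (1 + inverse (real (Suc n))) * (\<integral>\<^sup>+\<omega>. x \<omega> \<partial>M))) \<longlonglongrightarrow> 4 * ((\<integral>\<^sup>+\<omega>. x \<omega> \<partial>M) * ennreal (1 + 0))"
  proof -
    have "(\<integral>\<^sup>+\<omega>. x \<omega> \<partial>M) \<le> (\<integral>\<^sup>+\<omega>. ennreal K \<partial>M)" using K(2) unfolding x_def by (rule nn_integral_mono_AE)
    also have "\<dots> < top" by (simp add: emeasure_space_1)
    finally show ?thesis unfolding mult.commute[of "ennreal (1 + _)"]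
      by (intro ennreal_tendsto_cmult tendsto_ennrealI tendsto_add tendsto_const LIMSEQ_inverse_real_of_nat) auto
  qed
  then have "(\<integral>\<^sup>+\<omega>. sup_cut T c (\<lambda>t \<omega>. ennreal ((I t \<omega>)\<^sup>2)) \<omega> \<partial>M) \<le> 4 * ((\<integral>\<^sup>+\<omega>. x \<omega> \<partial>M) * ennreal (1 + 0))"
    by (rule LIMSEQ_le_const) (use main in auto)
  then show ?thesis by (simp add: x_def)
qed

text \<open>Stopping at the clock of H at level K leads back to the bounded case. The total energy
  is almost surely finite, so for almost every path some integer level is never exceeded, and
  monotone convergence in K removes the additional cutoff.\<close>

theorem approx_integral_bound:
  assumes T: "0 < T" and HI: "approx_integral T H I" and c: "cutoff T c"
  shows "(\<integral>\<^sup>+\<omega>. sup_cut T c (\<lambda>t \<omega>. ennreal ((I t \<omega>)\<^sup>2)) \<omega> \<partial>M) \<le> 4 * (\<integral>\<^sup>+\<omega>. int_cut T c (sq_norm H) \<omega> \<partial>M)"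
proof -
  define cK where "cK K s \<omega> \<longleftrightarrow> c s \<omega> \<and> int_cut s always (sq_norm H) \<omega> \<le> ennreal (real K)" for K :: nat and s \<omega>
  have pH: "progressive T (sq_norm H)" and IM: "\<And>t. t \<in> dyadic T \<Longrightarrow> I t \<in> borel_measurable M"
    and fin: "AE \<omega> in M. int_cut T always (sq_norm H) \<omega> < \<infinity>"
    using HI unfolding approx_integral_def by (auto intro: progressive_sq_norm)
  have cKc: "cutoff T (cK K)" for K unfolding cK_def[abs_def] by (intro cutoff_conj c cutoff_int pH T)
  let ?f = "\<lambda>t \<omega>. ennreal ((I t \<omega>)\<^sup>2)"
  have bnd: "(\<integral>\<^sup>+\<omega>. sup_cut T (cK K) ?f \<omega> \<partial>M) \<le> 4 * (\<integral>\<^sup>+\<omega>. int_cut T c (sq_norm H) \<omega> \<partial>M)" for K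
  proof -
    have "AE \<omega> in M. int_cut T (cK K) (sq_norm H) \<omega> \<le> ennreal (real K)"
      unfolding cK_def[abs_def] using int_cut_bounded[OF c pH T] by (intro AE_I2)
    then have "(\<integral>\<^sup>+\<omega>. sup_cut T (cK K) ?f \<omega> \<partial>M) \<le> 4 * (\<integral>\<^sup>+\<omega>. int_cut T (cK K) (sq_norm H) \<omega> \<partial>M)"
      by (intro approx_integral_bound_bounded[OF T HI cKc]) auto
    also have "\<dots> \<le> 4 * (\<integral>\<^sup>+\<omega>. int_cut T c (sq_norm H) \<omega> \<partial>M)"
      unfolding int_cut_def[of T] cK_def by (intro mult_left_mono nn_integral_mono) auto
    finally show ?thesis .
  qed
  have M: "sup_cut T (cK K) ?f \<in> borel_measurable M" for K
    by (rule sup_cut_measurable[OF cKc T]) (use IM in auto)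
  have inc: "incseq (\<lambda>K \<omega>. sup_cut T (cK K) ?f \<omega>)"
  proof (intro incseq_SucI le_funI)
    fix K \<omega>
    show "sup_cut T (cK K) ?f \<omega> \<le> sup_cut T (cK (Suc K)) ?f \<omega>"
      unfolding sup_cut_def
    proof (rule SUP_mono)
      fix t assume t: "t \<in> dyadic T"
      have "cK (Suc K) t \<omega>" if "cK K t \<omega>"
        using that order_trans[of _ "ennreal (real K)" "ennreal (real (Suc K))"] by (auto simp: cK_def ennreal_leI)
      then show "\<exists>m\<in>dyadic T. (if cK K t \<omega> then ?f t \<omega> else 0) \<le> (if cK (Suc K) m \<omega> then ?f m \<omega> else 0)"
        using t by (intro bexI[of _ t]) auto
    qed
  qed
  have "AE \<omega> in M. sup_cut T c ?f \<omega> \<le> (SUP K. sup_cut T (cK K) ?f \<omega>)"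
    using fin
  proof eventually_elim
    case (elim \<omega>)
    then obtain r where r: "int_cut T always (sq_norm H) \<omega> = ennreal r" "0 \<le> r" by (cases "int_cut T always (sq_norm H) \<omega>" rule: ennreal_cases) auto
    obtain K :: nat where K: "r \<le> real K" using real_arch_simple by blast
    have "sup_cut T c ?f \<omega> \<le> sup_cut T (cK K) ?f \<omega>"
      unfolding sup_cut_def[of T c]
    proof (rule SUP_least)
      fix t assume t: "t \<in> dyadic T"
      then have "t \<le> T" using dyadic_subset[OF T] by auto
      then have "int_cut t always (sq_norm H) \<omega> \<le> ennreal (real K)"
        using int_cut_mono[of t T "sq_norm H" \<omega>] r K by (metis ennreal_leI order_trans)
      then have "(if c t \<omega> then ?f t \<omega> else 0) \<le> (if cK K t \<omega> then ?f t \<omega> else 0)" by (auto simp: cK_def)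
      also have "\<dots> \<le> sup_cut T (cK K) ?f \<omega>" unfolding sup_cut_def by (rule SUP_upper[OF t])
      finally show "(if c t \<omega> then ?f t \<omega> else 0) \<le> sup_cut T (cK K) ?f \<omega>" .
    qed
    then show ?case by (rule SUP_upper2[OF UNIV_I])
  qed
  then have "(\<integral>\<^sup>+\<omega>. sup_cut T c ?f \<omega> \<partial>M) \<le> (\<integral>\<^sup>+\<omega>. (SUP K. sup_cut T (cK K) ?f \<omega>) \<partial>M)" by (rule nn_integral_mono_AE)
  also have "\<dots> = (SUP K. \<integral>\<^sup>+\<omega>. sup_cut T (cK K) ?f \<omega> \<partial>M)" by (rule nn_integral_monotone_convergence_SUP[OF inc M])
  also have "\<dots> \<le> 4 * (\<integral>\<^sup>+\<omega>. int_cut T c (sq_norm H) \<omega> \<partial>M)" by (intro SUP_least bnd)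
  finally show ?thesis .
qed

end

text \<open>One choice of indices serves countably many sequences: \<open>r N\<close> is such that
  each of the first N + 1 of them deviates by more than 2^-N with probability below 2^-N, and the
  Borel-Cantelli lemma is applied to each sequence.\<close>

lemma (in prob_space) tendsto_in_prob_AE_subseq:
  fixes X :: "nat \<Rightarrow> nat \<Rightarrow> 'a \<Rightarrow> real"
  assumes "\<And>j. tendsto_in_prob M (X j) (Y j)"
  obtains r where "AE \<omega> in M. \<forall>j. (\<lambda>N. X j (r N) \<omega>) \<longlonglongrightarrow> Y j \<omega>"
proof -
  let ?A = "\<lambda>j n N. {\<omega>\<in>space M. \<bar>X j n \<omega> - Y j \<omega>\<bar> > (1/2)^N}"
  have m: "X j n \<in> borel_measurable M" "Y j \<in> borel_measurable M" for j n
    using assms[of j] by (auto simp: tendsto_in_prob_def)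
  have lim: "(\<lambda>n. measure M (?A j n N)) \<longlonglongrightarrow> 0" for j N
  proof -
    have "\<forall>\<epsilon>>0. (\<lambda>n. measure M {\<omega>\<in>space M. \<bar>X j n \<omega> - Y j \<omega>\<bar> > \<epsilon>}) \<longlonglongrightarrow> 0"
      using assms[of j] unfolding tendsto_in_prob_def by blast
    then show ?thesis by simp
  qed
  have "\<exists>n. \<forall>j\<in>{..N}. measure M (?A j n N) < (1/2)^N" for N :: nat
  proof -
    have "\<forall>\<^sub>F n in sequentially. measure M (?A j n N) < (1/2)^N" for j
      by (rule order_tendstoD(2)[OF lim[of N j]]) simp
    then have "\<forall>\<^sub>F n in sequentially. \<forall>j\<in>{..N}. measure M (?A j n N) < (1/2)^N"
      by (simp add: eventually_ball_finite_distrib)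
    then show ?thesis by (auto simp: eventually_sequentially)
  qed
  then obtain r where r: "\<And>N j. j \<le> N \<Longrightarrow> measure M (?A j (r N) N) < (1/2)^N" by (metis atMost_iff)
  have "AE \<omega> in M. (\<lambda>N. X j (r N) \<omega>) \<longlonglongrightarrow> Y j \<omega>" for j
  proof -
    define A where "A N = (if j \<le> N then ?A j (r N) N else {})" for N
    have A: "A N \<in> sets M" for N using m unfolding A_def by (cases "j \<le> N") auto
    have "summable (\<lambda>N. measure M (A N))"
      by (rule summable_comparison_test'[of "\<lambda>N. (1/2)^N" 0])
        (use r[THEN less_imp_le] in \<open>auto simp: A_def intro: summable_geometric\<close>)
    then have "AE \<omega> in M. \<forall>\<^sub>F N in sequentially. \<omega> \<in> space M - A N"
      by (intro borel_cantelli_AE1 A) (auto simp: less_top[symmetric] emeasure_finite)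
    then show ?thesis
    proof eventually_elim
      case (elim \<omega>)
      have "\<forall>\<^sub>F N in sequentially. norm (X j (r N) \<omega> - Y j \<omega>) \<le> (1/2)^N"
        using elim eventually_ge_at_top[of j]
        by eventually_elim (auto simp: A_def not_less split: if_splits)
      moreover have "(\<lambda>N. (1/2 :: real)^N) \<longlonglongrightarrow> 0" by (intro LIMSEQ_realpow_zero) auto
      ultimately have "(\<lambda>N. X j (r N) \<omega> - Y j \<omega>) \<longlonglongrightarrow> 0" by (rule Lim_null_comparison)
      then show ?case by (simp add: LIM_zero_iff)
    qed
  qed
  then have "AE \<omega> in M. \<forall>j. (\<lambda>N. X j (r N) \<omega>) \<longlonglongrightarrow> Y j \<omega>" by (simp add: AE_all_countable)
  then show ?thesis by (rule that)
qed

lemma (in prob_space) tendsto_in_prob_AE: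
  assumes X: "\<And>N. X N \<in> borel_measurable M" and Y: "Y \<in> borel_measurable M"
    and lim: "AE \<omega> in M. (\<lambda>N. X N \<omega>) \<longlonglongrightarrow> Y \<omega>"
  shows "tendsto_in_prob M X Y"
  unfolding tendsto_in_prob_def
proof (intro conjI allI impI X Y)
  fix \<epsilon> :: real assume e: "\<epsilon> > 0"
  let ?A = "\<lambda>N. {\<omega>\<in>space M. \<bar>X N \<omega> - Y \<omega>\<bar> > \<epsilon>}"
  have A: "?A N \<in> sets M" for N using X Y by measurable
  have "(\<lambda>N. \<integral>\<omega>. indicat_real (?A N) \<omega> \<partial>M) \<longlonglongrightarrow> (\<integral>\<omega>. 0 \<partial>M)"
  proof (rule integral_dominated_convergence[where w = "\<lambda>_. 1"])
    show "AE \<omega> in M. (\<lambda>N. indicat_real (?A N) \<omega>) \<longlonglongrightarrow> 0"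
      using lim
    proof eventually_elim
      case (elim \<omega>)
      have "\<forall>\<^sub>F N in sequentially. dist (X N \<omega>) (Y \<omega>) < \<epsilon>" by (rule tendstoD[OF elim e])
      then have "\<forall>\<^sub>F N in sequentially. indicat_real (?A N) \<omega> = 0"
        by eventually_elim (auto simp: dist_real_def)
      then show ?case by (rule tendsto_eventually)
    qed
  qed (use A in auto)
  then show "(\<lambda>N. measure M (?A N)) \<longlonglongrightarrow> 0" using A by simp
qed

lemma ennreal_tendsto_0_le:
  fixes f g :: "nat \<Rightarrow> ennreal"
  assumes "\<And>N. f N \<le> g N" "g \<longlonglongrightarrow> 0"
  shows "f \<longlonglongrightarrow> 0"
  by (rule tendsto_sandwich[OF _ _ tendsto_const assms(2)]) (use assms(1) in auto)

lemma sq_norm_add_le: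
  "sq_norm (\<lambda>i s \<omega>. A i s \<omega> + B i s \<omega>) s \<omega> \<le> 2 * sq_norm A s \<omega> + 2 * sq_norm B s \<omega>"
proof -
  have *: "(a + b)\<^sup>2 \<le> 2 * a\<^sup>2 + 2 * b\<^sup>2" for a b :: real
    using zero_le_power2[of "a - b"] by (simp add: power2_eq_square algebra_simps)
  have "(\<Sum>i\<in>UNIV. (A i s \<omega> + B i s \<omega>)\<^sup>2) \<le> 2 * (\<Sum>i\<in>UNIV. (A i s \<omega>)\<^sup>2) + 2 * (\<Sum>i\<in>UNIV. (B i s \<omega>)\<^sup>2)"
    unfolding sum_distrib_left sum.distrib[symmetric] by (intro sum_mono *)
  then have "sq_norm (\<lambda>i s \<omega>. A i s \<omega> + B i s \<omega>) s \<omega> \<le> ennreal (2 * (\<Sum>i\<in>UNIV. (A i s \<omega>)\<^sup>2) + 2 * (\<Sum>i\<in>UNIV. (B i s \<omega>)\<^sup>2))"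
    unfolding sq_norm_def by (rule ennreal_leI)
  also have "\<dots> = 2 * sq_norm A s \<omega> + 2 * sq_norm B s \<omega>"
    unfolding sq_norm_def by (subst ennreal_plus) (auto intro!: sum_nonneg mult_nonneg_nonneg simp: ennreal_mult' sum_nonneg)
  finally show ?thesis .
qed

lemma (in filtered_prob_space) int_cut_add_le:
  assumes c: "cutoff T c" "0 < T" and f: "progressive T f" "progressive T g" and o: "\<omega> \<in> space M"
    and h: "\<And>s. s \<in> {0..T} \<Longrightarrow> h s \<omega> \<le> a * f s \<omega> + b * g s \<omega>"
  shows "int_cut T c h \<omega> \<le> a * int_cut T c f \<omega> + b * int_cut T c g \<omega>"
proof -
  let ?f = "\<lambda>f s. if s \<in> {0..T} \<and> c s \<omega> then f s \<omega> else 0"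
  have m: "?f f \<in> borel_measurable lborel" "?f g \<in> borel_measurable lborel"
    using cut_section[OF c f(1) o] cut_section[OF c f(2) o] by auto
  have "int_cut T c h \<omega> \<le> (\<integral>\<^sup>+s. a * ?f f s + b * ?f g s \<partial>lborel)"
    unfolding int_cut_def using h by (intro nn_integral_mono) auto
  also have "\<dots> = a * int_cut T c f \<omega> + b * int_cut T c g \<omega>"
    unfolding int_cut_def using m by (subst nn_integral_add) (auto simp: nn_integral_cmult)
  finally show ?thesis .
qed

section \<open>Linearity of limit integrals, and the passage from convergence in probability\<close>

context orthogonal_bm begin

lemma approx_integral_add:
  assumes T: "0 < T" and 1: "approx_integral T H I" and 2: "approx_integral T H' I'"
  shows "approx_integral T (\<lambda>i s \<omega>. H i s \<omega> + H' i s \<omega>) (\<lambda>t \<omega>. I t \<omega> + I' t \<omega>)"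
proof -
  obtain D S where DS: "\<And>N. simple_integral (D N) (S N)"
    and c: "AE \<omega> in M. (\<lambda>N. int_cut T always (sq_norm (\<lambda>i s \<omega>. D N i s \<omega> - H i s \<omega>)) \<omega>) \<longlonglongrightarrow> 0"
    and cS: "AE \<omega> in M. \<forall>t\<in>dyadic T. (\<lambda>N. S N t \<omega>) \<longlonglongrightarrow> I t \<omega>"
    using 1 unfolding approx_integral_def by blast
  obtain D' S' where DS': "\<And>N. simple_integral (D' N) (S' N)"
    and c': "AE \<omega> in M. (\<lambda>N. int_cut T always (sq_norm (\<lambda>i s \<omega>. D' N i s \<omega> - H' i s \<omega>)) \<omega>) \<longlonglongrightarrow> 0"
    and cS': "AE \<omega> in M. \<forall>t\<in>dyadic T. (\<lambda>N. S' N t \<omega>) \<longlonglongrightarrow> I' t \<omega>"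
    using 2 unfolding approx_integral_def by blast
  have p: "progressive T (H i)" "progressive T (H' i)" for i using 1 2 unfolding approx_integral_def by auto
  have f: "AE \<omega> in M. int_cut T always (sq_norm H) \<omega> < \<infinity>" "AE \<omega> in M. int_cut T always (sq_norm H') \<omega> < \<infinity>"
    using 1 2 unfolding approx_integral_def by auto
  have m: "t \<in> dyadic T \<Longrightarrow> I t \<in> borel_measurable M" "t \<in> dyadic T \<Longrightarrow> I' t \<in> borel_measurable M" for t
    using 1 2 unfolding approx_integral_def by auto
  note le = int_cut_add_le[OF cutoff_True T _ _ _ sq_norm_add_le]
  have pD: "progressive T (D N i)" "progressive T (D' N i)" for N i
    by (rule simple_integrand_progressive[OF DS] simple_integrand_progressive[OF DS'])+
  have "AE \<omega> in M. int_cut T always (sq_norm (\<lambda>i s \<omega>. H i s \<omega> + H' i s \<omega>)) \<omega> < \<infinity>"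
    using f AE_space
  proof eventually_elim
    case (elim \<omega>)
    have "int_cut T always (sq_norm (\<lambda>i s \<omega>. H i s \<omega> + H' i s \<omega>)) \<omega> \<le>
      2 * int_cut T always (sq_norm H) \<omega> + 2 * int_cut T always (sq_norm H') \<omega>"
      by (intro le progressive_sq_norm p elim)
    also have "\<dots> < \<infinity>" using elim by (simp add: ennreal_mult_less_top)
    finally show ?case .
  qed
  moreover have "AE \<omega> in M. (\<lambda>N. int_cut T always (sq_norm (\<lambda>i s \<omega>. (D N i s \<omega> + D' N i s \<omega>) - (H i s \<omega> + H' i s \<omega>))) \<omega>) \<longlonglongrightarrow> 0"
    using c c' AE_space
  proof eventually_elim
    case (elim \<omega>)
    let ?d = "\<lambda>N. int_cut T always (sq_norm (\<lambda>i s \<omega>. D N i s \<omega> - H i s \<omega>)) \<omega>"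
    let ?d' = "\<lambda>N. int_cut T always (sq_norm (\<lambda>i s \<omega>. D' N i s \<omega> - H' i s \<omega>)) \<omega>"
    have "int_cut T always (sq_norm (\<lambda>i s \<omega>. (D N i s \<omega> + D' N i s \<omega>) - (H i s \<omega> + H' i s \<omega>))) \<omega> \<le> 2 * ?d N + 2 * ?d' N" for N
      unfolding add_diff_add by (intro le progressive_sq_norm progressive_diff p pD elim)
    moreover have "(\<lambda>N. 2 * ?d N + 2 * ?d' N) \<longlonglongrightarrow> 2 * 0 + 2 * 0"
      by (intro tendsto_add ennreal_tendsto_cmult elim) auto
    then have "(\<lambda>N. 2 * ?d N + 2 * ?d' N) \<longlonglongrightarrow> 0" by simp
    ultimately show ?case by (rule ennreal_tendsto_0_le)
  qed
  moreover have "AE \<omega> in M. \<forall>t\<in>dyadic T. (\<lambda>N. S N t \<omega> + S' N t \<omega>) \<longlonglongrightarrow> I t \<omega> + I' t \<omega>"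
    using cS cS' by eventually_elim (auto intro: tendsto_add)
  ultimately show ?thesis
    unfolding approx_integral_def
    by (intro conjI allI ballI progressive_add borel_measurable_add p m
        exI[of _ "\<lambda>N i s \<omega>. D N i s \<omega> + D' N i s \<omega>"] exI[of _ "\<lambda>N t \<omega>. S N t \<omega> + S' N t \<omega>"] simple_integral.add DS DS')
qed

lemma approx_integral_uminus:
  assumes 1: "approx_integral T H I"
  shows "approx_integral T (\<lambda>i s \<omega>. - H i s \<omega>) (\<lambda>t \<omega>. - I t \<omega>)"
proof -
  obtain D S where DS: "\<And>N. simple_integral (D N) (S N)"
    and c: "AE \<omega> in M. (\<lambda>N. int_cut T always (sq_norm (\<lambda>i s \<omega>. D N i s \<omega> - H i s \<omega>)) \<omega>) \<longlonglongrightarrow> 0"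
    and cS: "AE \<omega> in M. \<forall>t\<in>dyadic T. (\<lambda>N. S N t \<omega>) \<longlonglongrightarrow> I t \<omega>"
    using 1 unfolding approx_integral_def by blast
  have eq: "sq_norm (\<lambda>i s \<omega>. - H i s \<omega>) = sq_norm H" by (simp add: sq_norm_def fun_eq_iff)
  have eq': "sq_norm (\<lambda>i s \<omega>. - D N i s \<omega> - - H i s \<omega>) = sq_norm (\<lambda>i s \<omega>. D N i s \<omega> - H i s \<omega>)" for N
    by (simp add: sq_norm_def fun_eq_iff power2_commute)
  have p: "progressive T (\<lambda>s \<omega>. - H i s \<omega>)" for i
    by (rule progressive_compose[where g = uminus]) (use 1 in \<open>auto simp: approx_integral_def\<close>)
  have cS': "AE \<omega> in M. \<forall>t\<in>dyadic T. (\<lambda>N. - S N t \<omega>) \<longlonglongrightarrow> - I t \<omega>"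
    using cS by eventually_elim (auto intro: tendsto_minus)
  show ?thesis
    unfolding approx_integral_def eq
    by (intro conjI allI ballI exI[of _ "\<lambda>N i s \<omega>. - D N i s \<omega>"] exI[of _ "\<lambda>N t \<omega>. - S N t \<omega>"] p
        simple_integral_uminus DS cS')
      (use 1 c eq' in \<open>auto simp: approx_integral_def\<close>)
qed

lemma approx_integral_diff:
  assumes "0 < T" "approx_integral T H I" "approx_integral T H' I'"
  shows "approx_integral T (\<lambda>i s \<omega>. H i s \<omega> - H' i s \<omega>) (\<lambda>t \<omega>. I t \<omega> - I' t \<omega>)"
  using approx_integral_add[OF assms(1,2) approx_integral_uminus[OF assms(3)]] by simp

lemma approx_integral_zero: "approx_integral T (\<lambda>_ _ _. 0) (\<lambda>_ _. 0)"
proof -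
  have eq: "sq_norm (\<lambda>(_ :: 'i) _ _. 0) = (\<lambda>_ (_ :: 'a). 0)" by (simp add: sq_norm_def fun_eq_iff)
  have z: "int_cut T always (sq_norm (\<lambda>(_ :: 'i) _ _. 0)) \<omega> = 0" for \<omega> :: 'a
    unfolding int_cut_def eq by simp
  show ?thesis unfolding approx_integral_def
    by (intro conjI allI ballI exI[of _ "\<lambda>N i s \<omega>. 0"] exI[of _ "\<lambda>N t \<omega>. 0"] simple_integral.zero progressive_zero)
      (simp_all add: z)
qed

lemma approx_integral_sum:
  assumes T: "0 < T"
  shows "finite A \<Longrightarrow> (\<And>k. k \<in> A \<Longrightarrow> approx_integral T (H k) (I k)) \<Longrightarrow>
    approx_integral T (\<lambda>i s \<omega>. \<Sum>k\<in>A. H k i s \<omega>) (\<lambda>t \<omega>. \<Sum>k\<in>A. I k t \<omega>)"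
proof (induction A rule: finite_induct)
  case (insert x A)
  then have "approx_integral T (\<lambda>i s \<omega>. H x i s \<omega> + (\<Sum>k\<in>A. H k i s \<omega>)) (\<lambda>t \<omega>. I x t \<omega> + (\<Sum>k\<in>A. I k t \<omega>))"
    by (intro approx_integral_add[OF T]) auto
  then show ?case using insert by simp
qed (use approx_integral_zero in simp)

lemma simple_integrand_simple_integral:
  assumes "simple_integrand M F m \<tau> \<xi>"
  shows "simple_integral (\<lambda>i s \<omega>. if i = k then simple_process m \<tau> \<xi> s \<omega> else 0) (simple_ito_integral (W k) m \<tau> \<xi>)"
proof -
  have nn: "0 \<le> \<tau> l" if "l \<le> m" for l
    using that
  proof (induction l)
    case (Suc l)
    then have "0 \<le> \<tau> l" "\<tau> l < \<tau> (Suc l)" using assms by (auto simp: simple_integrand_def)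
    then show ?case by simp
  qed (use assms in \<open>auto simp: simple_integrand_def\<close>)
  have "simple_integral (\<lambda>i s \<omega>. \<Sum>l<m. if i = k then \<xi> l \<omega> * indicator {\<tau> l<..\<tau> (Suc l)} s else 0)
    (\<lambda>t \<omega>. \<Sum>l<m. \<xi> l \<omega> * (W k (min t (\<tau> (Suc l))) \<omega> - W k (min t (\<tau> l)) \<omega>))"
  proof (rule simple_integral_sum)
    fix l assume l: "l \<in> {..<m}"
    then have "l < m" by simp
    then obtain C where "\<And>\<omega>. \<omega>\<in>space M \<Longrightarrow> \<bar>\<xi> l \<omega>\<bar> \<le> C" using assms unfolding simple_integrand_def by blast
    then show "simple_integral (\<lambda>i s \<omega>. if i = k then \<xi> l \<omega> * indicator {\<tau> l<..\<tau> (Suc l)} s else 0)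
       (\<lambda>t \<omega>. \<xi> l \<omega> * (W k (min t (\<tau> (Suc l))) \<omega> - W k (min t (\<tau> l)) \<omega>))"
      using l assms nn[of l] by (intro simple_integral.block) (auto simp: simple_integrand_def less_imp_le)
  qed simp
  moreover have "(\<lambda>i s \<omega>. \<Sum>l<m. if i = k then \<xi> l \<omega> * indicator {\<tau> l<..\<tau> (Suc l)} s else 0) =
     (\<lambda>i s \<omega>. if i = k then simple_process m \<tau> \<xi> s \<omega> else 0)"
    by (auto simp: fun_eq_iff simple_process_def)
  moreover have "(\<lambda>t \<omega>. \<Sum>l<m. \<xi> l \<omega> * (W k (min t (\<tau> (Suc l))) \<omega> - W k (min t (\<tau> l)) \<omega>)) = simple_ito_integral (W k) m \<tau> \<xi>"
    by (auto simp: fun_eq_iff simple_ito_integral_def)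
  ultimately show ?thesis by simp
qed

lemma sq_norm_single: "sq_norm (\<lambda>i s \<omega>. if i = k then f s \<omega> else 0) s \<omega> = ennreal ((f s \<omega>)\<^sup>2)"
  unfolding sq_norm_def by (simp add: if_distrib[of "\<lambda>x. x\<^sup>2"] cong: if_cong)

lemma int_cut_eq_set_integral:
  assumes "set_integrable lborel {0..T} (\<lambda>s. (f s \<omega>)\<^sup>2)"
  shows "int_cut T always (\<lambda>s \<omega>. ennreal ((f s \<omega>)\<^sup>2)) \<omega> = ennreal (LINT s:{0..T}|lborel. (f s \<omega>)\<^sup>2)"
proof -
  have "int_cut T always (\<lambda>s \<omega>. ennreal ((f s \<omega>)\<^sup>2)) \<omega> = (\<integral>\<^sup>+s. ennreal (indicator {0..T} s *\<^sub>R (f s \<omega>)\<^sup>2) \<partial>lborel)"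
    unfolding int_cut_def by (intro nn_integral_cong) (auto simp: indicator_def)
  also have "\<dots> = ennreal (LINT s:{0..T}|lborel. (f s \<omega>)\<^sup>2)"
    using assms unfolding set_lebesgue_integral_def set_integrable_def
    by (intro nn_integral_eq_integral) auto
  finally show ?thesis .
qed

lemma set_integrable_square_iff:
  assumes T: "0 < T" and H: "progressive T H" and o: "\<omega> \<in> space M"
  shows "set_integrable lborel {0..T} (\<lambda>s. (H s \<omega>)\<^sup>2) \<longleftrightarrow> int_cut T always (\<lambda>s \<omega>. ennreal ((H s \<omega>)\<^sup>2)) \<omega> < \<infinity>"
proof -
  have "progressive T (\<lambda>s \<omega>. (H s \<omega>)\<^sup>2)" by (rule progressive_compose[OF H]) auto
  from progressive_section[OF this _ o]
  have "(\<lambda>s. if s \<in> {0..T} then (H s \<omega>)\<^sup>2 else 0) \<in> borel_measurable borel" using T by simp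
  also have "(\<lambda>s. if s \<in> {0..T} then (H s \<omega>)\<^sup>2 else 0) = (\<lambda>s. indicator {0..T} s *\<^sub>R (H s \<omega>)\<^sup>2)"
    by (auto simp: fun_eq_iff)
  finally have m: "(\<lambda>s. indicat_real {0..T} s *\<^sub>R (H s \<omega>)\<^sup>2) \<in> borel_measurable lborel" by simp
  have eq: "(\<integral>\<^sup>+s. ennreal (norm (indicat_real {0..T} s *\<^sub>R (H s \<omega>)\<^sup>2)) \<partial>lborel) = int_cut T always (\<lambda>s \<omega>. ennreal ((H s \<omega>)\<^sup>2)) \<omega>"
    unfolding int_cut_def by (intro nn_integral_cong) (auto simp: indicator_def)
  show ?thesis unfolding set_integrable_def integrable_iff_bounded eq using m by simp
qed

text \<open>Countably many limits in probability are involved, the energy distance and the values at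
  the dyadic times, and one choice of indices makes all of them almost sure. A single integral is
  embedded in the column by setting the other integrands to 0.\<close>

lemma has_ito_integral_approx_integral:
  assumes T: "0 < T" and ito: "has_ito_integral M F (W k) T H I"
  shows "approx_integral T (\<lambda>i s \<omega>. if i = k then H s \<omega> else 0) I"
proof -
  obtain m \<tau> \<xi> where si: "\<And>N. simple_integrand M F (m N) (\<tau> N) (\<xi> N)"
    and c: "tendsto_in_prob M (\<lambda>N \<omega>. LINT s:{0..T}|lborel. (simple_process (m N) (\<tau> N) (\<xi> N) s \<omega> - H s \<omega>)\<^sup>2) (\<lambda>\<omega>. 0)"
    and cS: "\<And>t. t\<in>{0..T} \<Longrightarrow> tendsto_in_prob M (\<lambda>N. simple_ito_integral (W k) (m N) (\<tau> N) (\<xi> N) t) (I t)"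
    using ito unfolding has_ito_integral_def by blast
  have H: "progressive T H" and Hf: "AE \<omega> in M. set_integrable lborel {0..T} (\<lambda>s. (H s \<omega>)\<^sup>2)"
    and I: "\<And>t. t \<in> {0..T} \<Longrightarrow> I t \<in> borel_measurable (F t)"
    using ito unfolding has_ito_integral_def prog_measurable_iff adapted_on_def by auto
  define q where "q = from_nat_into (dyadic T)"
  have q: "q j \<in> dyadic T" for j unfolding q_def by (rule from_nat_into) (use zero_in_dyadic in blast)
  have q01: "q j \<in> {0..T}" for j using q dyadic_subset[OF T] by blast
  \<comment> \<open>Index 0 carries the energy distance, index l + 1 the value at the l-th dyadic
    time.\<close>
  define X where "X j = (case j of 0 \<Rightarrow> (\<lambda>N \<omega>. LINT s:{0..T}|lborel. (simple_process (m N) (\<tau> N) (\<xi> N) s \<omega> - H s \<omega>)\<^sup>2)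
    | Suc l \<Rightarrow> (\<lambda>N. simple_ito_integral (W k) (m N) (\<tau> N) (\<xi> N) (q l)))" for j
  define Y where "Y j = (case j of 0 \<Rightarrow> (\<lambda>\<omega>. 0) | Suc l \<Rightarrow> I (q l))" for j
  have "tendsto_in_prob M (X j) (Y j)" for j
    using c cS[OF q01] by (cases j) (simp_all add: X_def Y_def)
  then obtain r where r: "AE \<omega> in M. \<forall>j. (\<lambda>N. X j (r N) \<omega>) \<longlonglongrightarrow> Y j \<omega>" by (rule tendsto_in_prob_AE_subseq)
  define D where "D N i s \<omega> = (if i = k then simple_process (m (r N)) (\<tau> (r N)) (\<xi> (r N)) s \<omega> else 0)" for N i s \<omega>
  define S where "S N = simple_ito_integral (W k) (m (r N)) (\<tau> (r N)) (\<xi> (r N))" for N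
  have DS: "simple_integral (D N) (S N)" for N
    unfolding D_def[abs_def] S_def by (rule simple_integrand_simple_integral[OF si])
  have pD: "progressive T (simple_process (m (r N)) (\<tau> (r N)) (\<xi> (r N)))" for N
    using simple_integrand_progressive[OF DS, of T N k] by (simp add: D_def[abs_def])
  have "AE \<omega> in M. (\<lambda>N. int_cut T always (sq_norm (\<lambda>i s \<omega>. D N i s \<omega> - (if i = k then H s \<omega> else 0))) \<omega>) \<longlonglongrightarrow> 0"
    using r Hf AE_space
  proof eventually_elim
    case (elim \<omega>)
    let ?d = "\<lambda>N s \<omega>. simple_process (m (r N)) (\<tau> (r N)) (\<xi> (r N)) s \<omega> - H s \<omega>"
    have eq: "sq_norm (\<lambda>i s \<omega>. D N i s \<omega> - (if i = k then H s \<omega> else 0)) = (\<lambda>s \<omega>. ennreal ((?d N s \<omega>)\<^sup>2))" for N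
    proof (intro ext)
      fix s \<omega>
      have "(\<lambda>i s \<omega>. D N i s \<omega> - (if i = k then H s \<omega> else 0)) = (\<lambda>i s \<omega>. if i = k then ?d N s \<omega> else 0)"
        by (auto simp: D_def fun_eq_iff)
      then show "sq_norm (\<lambda>i s \<omega>. D N i s \<omega> - (if i = k then H s \<omega> else 0)) s \<omega> = ennreal ((?d N s \<omega>)\<^sup>2)"
        by (simp add: sq_norm_single)
    qed
    have "int_cut T always (\<lambda>s \<omega>. ennreal ((?d N s \<omega>)\<^sup>2)) \<omega> = ennreal (X 0 (r N) \<omega>)" for N
      unfolding X_def nat.case
    \<comment> \<open>The Bochner integral of a function that is not integrable is 0, so the squared
      difference must be seen to be integrable before its integral can be read as an energy.\<close>
    proof (rule int_cut_eq_set_integral)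
      have finD: "int_cut T always (\<lambda>s \<omega>. ennreal ((simple_process (m (r N)) (\<tau> (r N)) (\<xi> (r N)) s \<omega>)\<^sup>2)) \<omega> < \<infinity>"
      proof -
        have "set_integrable lborel {0..T} (\<lambda>s. \<Sum>i\<in>UNIV. D N i s \<omega> * D N i s \<omega>)"
          by (rule energy_integrable[OF DS DS elim(3)])
        then have "set_integrable lborel {0..T} (\<lambda>s. (simple_process (m (r N)) (\<tau> (r N)) (\<xi> (r N)) s \<omega>)\<^sup>2)"
          unfolding D_def by (simp add: if_distrib[of "\<lambda>x. x * _"] if_distrib[of "\<lambda>x. _ * x"] power2_eq_square cong: if_cong)
        then show ?thesis using set_integrable_square_iff[OF T pD elim(3)] by blast
      qed
      have finH: "int_cut T always (\<lambda>s \<omega>. ennreal ((H s \<omega>)\<^sup>2)) \<omega> < \<infinity>"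
        using set_integrable_square_iff[OF T H elim(3)] elim(2) by blast
      have sqp: "progressive T f \<Longrightarrow> progressive T (\<lambda>s \<omega>. ennreal ((f s \<omega>)\<^sup>2))" for f :: "real \<Rightarrow> 'a \<Rightarrow> real"
        by (rule progressive_compose[where g = "\<lambda>x. ennreal (x\<^sup>2)"]) auto
      have le: "ennreal ((a - b)\<^sup>2) \<le> 2 * ennreal (a\<^sup>2) + 2 * ennreal (b\<^sup>2)" for a b :: real
      proof -
        have "(a - b)\<^sup>2 \<le> 2 * a\<^sup>2 + 2 * b\<^sup>2"
          using zero_le_power2[of "a + b"] by (simp add: power2_eq_square algebra_simps)
        then have "ennreal ((a - b)\<^sup>2) \<le> ennreal (2 * a\<^sup>2 + 2 * b\<^sup>2)" by (rule ennreal_leI)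
        then show ?thesis by (simp add: ennreal_mult')
      qed
      have "int_cut T always (\<lambda>s \<omega>. ennreal ((?d N s \<omega>)\<^sup>2)) \<omega> \<le>
         2 * int_cut T always (\<lambda>s \<omega>. ennreal ((simple_process (m (r N)) (\<tau> (r N)) (\<xi> (r N)) s \<omega>)\<^sup>2)) \<omega>
         + 2 * int_cut T always (\<lambda>s \<omega>. ennreal ((H s \<omega>)\<^sup>2)) \<omega>"
        by (intro int_cut_add_le[OF cutoff_True T] sqp pD H elim le)
      also have "\<dots> < \<infinity>" using finD finH by (simp add: ennreal_mult_less_top)
      finally show "set_integrable lborel {0..T} (\<lambda>s. (?d N s \<omega>)\<^sup>2)"
        using set_integrable_square_iff[OF T progressive_diff[OF pD H] elim(3)] by blast
    qed
    moreover have "(\<lambda>N. ennreal (X 0 (r N) \<omega>)) \<longlonglongrightarrow> ennreal (Y 0 \<omega>)"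
      by (rule tendsto_ennrealI[OF elim(1)[rule_format]])
    ultimately show ?case unfolding eq by (simp add: Y_def)
  qed
  moreover have "AE \<omega> in M. \<forall>t\<in>dyadic T. (\<lambda>N. S N t \<omega>) \<longlonglongrightarrow> I t \<omega>"
    using r
  proof eventually_elim
    case (elim \<omega>)
    show ?case
    proof
      fix t assume "t \<in> dyadic T"
      then obtain j where j: "q j = t" unfolding q_def using from_nat_into_surj[OF countable_dyadic] by blast
      show "(\<lambda>N. S N t \<omega>) \<longlonglongrightarrow> I t \<omega>" using elim[rule_format, of "Suc j"] j by (simp add: X_def Y_def S_def)
    qed
  qed
  moreover have "AE \<omega> in M. int_cut T always (sq_norm (\<lambda>i s \<omega>. if i = k then H s \<omega> else 0)) \<omega> < \<infinity>"
    using Hf AE_space by eventually_elim (use set_integrable_square_iff[OF T H] in \<open>simp add: sq_norm_single[abs_def]\<close>)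
  moreover have "progressive T (\<lambda>s \<omega>. if i = k then H s \<omega> else 0)" for i
    using H progressive_zero by (cases "i = k") auto
  moreover have "I t \<in> borel_measurable M" if "t \<in> dyadic T" for t
    using that dyadic_subset[OF T] by (intro measurable_F_M[of t] I) auto
  ultimately show ?thesis unfolding approx_integral_def using DS by blast
qed

end

section \<open>Existence of It\^o integrals\<close>

text \<open>Serves both for simple integrals approaching an Ito integral and for Picard iterates. A
  geometric rate for the expected squared suprema yields, through a weighted series, almost sure
  uniform convergence on the dyadic times, which continuity extends to [0, T].\<close>

lemma (in filtered_prob_space) uniform_limit_exists:
  fixes Y :: "nat \<Rightarrow> real \<Rightarrow> 'a \<Rightarrow> 'b::euclidean_space"
  assumes T: "0 < T"
    and Ym: "\<And>j t. t \<in> {0..T} \<Longrightarrow> Y j t \<in> borel_measurable (F t)"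
    and Yc: "\<And>j. AE \<omega> in M. continuous_on {0..T} (\<lambda>t. Y j t \<omega>)"
    and A: "0 \<le> A"
    and rate: "\<And>j. (\<integral>\<^sup>+\<omega>. (SUP t\<in>dyadic T. ennreal ((norm (Y (Suc j) t \<omega> - Y j t \<omega>))\<^sup>2)) \<partial>M) \<le> ennreal (A * (1/8)^j)"
  shows "\<exists>I. (\<forall>t\<in>{0..T}. I t \<in> borel_measurable (F t)) \<and>
    (\<forall>\<omega>\<in>space M. continuous_on {0..T} (\<lambda>t. I t \<omega>)) \<and>
    (AE \<omega> in M. \<forall>t\<in>{0..T}. (\<lambda>j. Y j t \<omega>) \<longlonglongrightarrow> I t \<omega>) \<and>
    (\<forall>j. (\<integral>\<^sup>+\<omega>. (SUP t\<in>dyadic T. ennreal ((norm (I t \<omega> - Y j t \<omega>))\<^sup>2)) \<partial>M) \<le> ennreal (4 * A * (1/8)^j))"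
proof -
  have dy: "t \<in> dyadic T \<Longrightarrow> t \<in> {0..T}" for t using dyadic_subset[OF T] by blast
  have YM: "Y j t \<in> borel_measurable M" if "t \<in> {0..T}" for j t
    using measurable_F_M[of t, OF _ Ym[OF that]] that by simp
  define \<delta> where "\<delta> j \<omega> = (SUP t\<in>dyadic T. ennreal ((norm (Y (Suc j) t \<omega> - Y j t \<omega>))\<^sup>2))" for j \<omega>
  have \<delta>M: "\<delta> j \<in> borel_measurable M" for j
    unfolding \<delta>_def[abs_def] using YM dy by (intro borel_measurable_SUP) auto
  \<comment> \<open>Chaining with |a + b|^2 \<le> 2 |a|^2 + 2 |b|^2 doubles the weight at every
    link, hence 2 * 2^l. Against the rate 8^-l the series keeps the ratio 1/4, with total 2 * 4/3
    \<le> 4.\<close>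
  define G where "G j \<omega> = (\<Sum>l. ennreal (2 * 2 ^ l) * \<delta> (j + l) \<omega>)" for j \<omega>
  have GM: "G j \<in> borel_measurable M" for j unfolding G_def[abs_def] using \<delta>M by simp
  have EG: "(\<integral>\<^sup>+\<omega>. G j \<omega> \<partial>M) \<le> ennreal (4 * A * (1/8)^j)" for j
  proof -
    have "(\<integral>\<^sup>+\<omega>. G j \<omega> \<partial>M) = (\<Sum>l. ennreal (2 * 2 ^ l) * (\<integral>\<^sup>+\<omega>. \<delta> (j + l) \<omega> \<partial>M))"
      unfolding G_def using \<delta>M by (subst nn_integral_suminf) (auto simp: nn_integral_cmult)
    also have "\<dots> \<le> (\<Sum>l. ennreal (2 * A * (1/8)^j * (1/4)^l))"
    proof (intro suminf_le summableI)
      fix l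
      have "ennreal (2 * 2 ^ l) * (\<integral>\<^sup>+\<omega>. \<delta> (j + l) \<omega> \<partial>M) \<le> ennreal (2 * 2 ^ l) * ennreal (A * (1/8)^(j + l))"
        unfolding \<delta>_def by (intro mult_left_mono rate) simp
      also have "\<dots> = ennreal (2 * 2 ^ l * (A * (1/8)^(j + l)))" using A by (simp add: ennreal_mult)
      also have "2 * 2 ^ l * (A * (1/8)^(j + l)) = 2 * A * (1/8)^j * (1/4 :: real)^l"
        by (simp add: power_add power_divide field_simps) (simp add: power_mult_distrib[symmetric])
      finally show "ennreal (2 * 2 ^ l) * (\<integral>\<^sup>+\<omega>. \<delta> (j + l) \<omega> \<partial>M) \<le> ennreal (2 * A * (1/8)^j * (1/4)^l)" .
    qed
    also have "\<dots> = ennreal (2 * A * (1/8)^j * (4/3))"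
    proof (rule suminf_ennreal_eq)
      have "(\<lambda>l. (1/4 :: real)^l) sums (1 / (1 - 1/4))" by (rule geometric_sums) simp
      from sums_mult[OF this, of "2 * A * (1/8)^j"]
      show "(\<lambda>l. 2 * A * (1/8)^j * (1/4)^l) sums (2 * A * (1/8)^j * (4/3))" by simp
    qed (use A in auto)
    also have "\<dots> \<le> ennreal (4 * A * (1/8)^j)" using A by (intro ennreal_leI) simp
    finally show ?thesis .
  qed
  have chain: "ennreal ((norm (Y (j + m) t \<omega> - Y j t \<omega>))\<^sup>2) \<le> (\<Sum>l<m. ennreal (2 * 2 ^ l) * \<delta> (j + l) \<omega>)"
    if t: "t \<in> dyadic T" for j m t \<omega>
  proof (induction m arbitrary: j)
    case (Suc m)
    let ?a = "Y (Suc j) t \<omega> - Y j t \<omega>" and ?b = "Y (Suc j + m) t \<omega> - Y (Suc j) t \<omega>"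
    have "(norm (?a + ?b))\<^sup>2 \<le> (norm ?a + norm ?b)\<^sup>2" by (intro power_mono norm_triangle_ineq) simp
    also have "\<dots> \<le> 2 * (norm ?a)\<^sup>2 + 2 * (norm ?b)\<^sup>2"
      using zero_le_power2[of "norm ?a - norm ?b"] by (simp only: power2_sum power2_diff)
    finally have "(norm (Y (j + Suc m) t \<omega> - Y j t \<omega>))\<^sup>2 \<le> 2 * (norm ?a)\<^sup>2 + 2 * (norm ?b)\<^sup>2" by simp
    then have "ennreal ((norm (Y (j + Suc m) t \<omega> - Y j t \<omega>))\<^sup>2) \<le> ennreal (2 * (norm ?a)\<^sup>2 + 2 * (norm ?b)\<^sup>2)"
      by (rule ennreal_leI)
    also have "\<dots> = 2 * ennreal ((norm ?a)\<^sup>2) + 2 * ennreal ((norm ?b)\<^sup>2)" by (simp add: ennreal_mult')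
    also have "\<dots> \<le> 2 * \<delta> j \<omega> + 2 * (\<Sum>l<m. ennreal (2 * 2 ^ l) * \<delta> (Suc j + l) \<omega>)"
      unfolding \<delta>_def by (intro add_mono mult_left_mono SUP_upper t Suc.IH[unfolded \<delta>_def]) auto
    also have "\<dots> = (\<Sum>l<Suc m. ennreal (2 * 2 ^ l) * \<delta> (j + l) \<omega>)"
      unfolding sum.lessThan_Suc_shift sum_distrib_left
      by (simp add: mult.assoc[symmetric] ennreal_mult[symmetric] ennreal_numeral[symmetric] del: ennreal_numeral)
    finally show ?case .
  qed simp
  have YG: "ennreal ((norm (Y (j + m) t \<omega> - Y j t \<omega>))\<^sup>2) \<le> G j \<omega>" if "t \<in> dyadic T" for j m t \<omega>
    using chain[OF that, of j m \<omega>] unfolding G_def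
    by (rule order_trans) (intro sum_le_suminf summableI, auto)
  \<comment> \<open>The rate of uniform convergence: where the single variable \<open>G 0\<close> is
    finite, all squared distances from index j on are at most \<open>G 0\<close> times 2^-j.\<close>
  have Gdecay: "ennreal (2 ^ j) * G j \<omega> \<le> G 0 \<omega>" for j \<omega>
  proof -
    have "ennreal (2 ^ j) * (ennreal (2 * 2 ^ l) * \<delta> (j + l) \<omega>) = ennreal (2 * 2 ^ (l + j)) * \<delta> (l + j) \<omega>" for l
    proof -
      have "ennreal (2 ^ j) * (ennreal (2 * 2 ^ l) * \<delta> (j + l) \<omega>) = ennreal (2 ^ j * (2 * 2 ^ l)) * \<delta> (j + l) \<omega>"
        by (subst ennreal_mult) (simp_all add: mult.assoc)
      also have "2 ^ j * (2 * 2 ^ l) = (2 * 2 ^ (l + j) :: real)" by (simp add: power_add)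
      finally show ?thesis by (simp only: add.commute)
    qed
    then have "ennreal (2 ^ j) * G j \<omega> = (\<Sum>l. ennreal (2 * 2 ^ (l + j)) * \<delta> (l + j) \<omega>)"
      unfolding G_def ennreal_suminf_cmult[symmetric] by simp
    also have "\<dots> \<le> (\<Sum>l. ennreal (2 * 2 ^ (l + j)) * \<delta> (l + j) \<omega>) + (\<Sum>l<j. ennreal (2 * 2 ^ l) * \<delta> l \<omega>)" by simp
    also have "\<dots> = G 0 \<omega>" unfolding G_def
      using suminf_offset[of "\<lambda>l. ennreal (2 * 2 ^ l) * \<delta> l \<omega>" j] by (simp add: add.commute)
    finally show ?thesis .
  qed
  have good: "AE \<omega> in M. G 0 \<omega> < \<infinity> \<and> (\<forall>j. continuous_on {0..T} (\<lambda>t. Y j t \<omega>))"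
  proof -
    have "(\<integral>\<^sup>+\<omega>. G 0 \<omega> \<partial>M) \<noteq> \<infinity>" using EG[of 0] by (auto simp: top_unique)
    from nn_integral_PInf_AE[OF GM this] have "AE \<omega> in M. G 0 \<omega> < \<infinity>" by (simp add: less_top)
    moreover have "AE \<omega> in M. \<forall>j. continuous_on {0..T} (\<lambda>t. Y j t \<omega>)" using Yc by (simp add: AE_all_countable)
    ultimately show ?thesis by eventually_elim auto
  qed
  then obtain N where N: "N \<in> null_sets M" "\<And>\<omega>. \<omega> \<in> space M \<Longrightarrow> \<omega> \<notin> N \<Longrightarrow> G 0 \<omega> < \<infinity> \<and> (\<forall>j. continuous_on {0..T} (\<lambda>t. Y j t \<omega>))"
    by (elim AE_E) (force simp: null_sets_def)
  define Z where "Z j t \<omega> = (if \<omega> \<in> N then 0 else Y j t \<omega>)" for j t \<omega>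
  have ZF: "Z j t \<in> borel_measurable (F t)" if t: "t \<in> {0..T}" for j t
    unfolding Z_def
    by (rule AE_cong_measurable_F[OF _ Ym[OF t] N(1), where c = 0]) (use t in auto)
  have ucauchy: "uniformly_Cauchy_on {0..T} (\<lambda>j t. Y j t \<omega>)" if o: "\<omega> \<in> space M" "\<omega> \<notin> N" for \<omega>
  proof -
    obtain g where g: "G 0 \<omega> = ennreal g" "0 \<le> g" using N(2)[OF o] by (cases "G 0 \<omega>" rule: ennreal_cases) auto
    have cont: "continuous_on {0..T} (\<lambda>t. Y j t \<omega>)" for j using N(2)[OF o] by auto
    have bnd: "(norm (Y (j + m) t \<omega> - Y j t \<omega>))\<^sup>2 \<le> g * (1/2)^j" if t: "t \<in> {0..T}" for j m t
    proof -
      have d: "(norm (Y (j + m) t \<omega> - Y j t \<omega>))\<^sup>2 \<le> g * (1/2)^j" if "t \<in> dyadic T" for t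
      proof -
        have "ennreal (2 ^ j * (norm (Y (j + m) t \<omega> - Y j t \<omega>))\<^sup>2) = ennreal (2 ^ j) * ennreal ((norm (Y (j + m) t \<omega> - Y j t \<omega>))\<^sup>2)"
          by (simp add: ennreal_mult)
        also have "\<dots> \<le> ennreal (2 ^ j) * G j \<omega>" by (intro mult_left_mono YG that) simp
        also have "\<dots> \<le> ennreal g" using Gdecay[of j \<omega>] g by simp
        finally have "2 ^ j * (norm (Y (j + m) t \<omega> - Y j t \<omega>))\<^sup>2 \<le> g" using g by (subst (asm) ennreal_le_iff) auto
        then show ?thesis by (simp add: power_one_over field_simps)
      qed
      let ?g = "\<lambda>n. grid T n (grid_index T n t)"
      have gd: "?g n \<in> dyadic T" for n using grid_index_in_dyadic[OF T] t by auto
      have gl: "?g \<longlonglongrightarrow> t" using grid_index_tendsto[OF T] t by auto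
      have cd: "continuous_on {0..T} (\<lambda>t. (norm (Y (j + m) t \<omega> - Y j t \<omega>))\<^sup>2)"
        by (intro continuous_intros cont)
      have "(\<lambda>n. (norm (Y (j + m) (?g n) \<omega> - Y j (?g n) \<omega>))\<^sup>2) \<longlonglongrightarrow> (norm (Y (j + m) t \<omega> - Y j t \<omega>))\<^sup>2"
        using continuous_on_tendsto_compose[OF cd gl t] dy[OF gd] by simp
      then show ?thesis by (rule LIMSEQ_le_const2) (use d[OF gd] in auto)
    qed
    show ?thesis unfolding uniformly_Cauchy_on_def
    proof (intro allI impI)
      fix e :: real assume e: "0 < e"
      have "(\<lambda>j. g * (1/2)^j) \<longlonglongrightarrow> g * 0" by (intro tendsto_intros LIMSEQ_realpow_zero) auto
      then have "\<forall>\<^sub>F j in sequentially. g * (1/2)^j < (e/2)\<^sup>2" by (rule order_tendstoD(2)) (use e in auto)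
      then obtain j where j: "g * (1/2)^j < (e/2)\<^sup>2" by (auto simp: eventually_sequentially)
      have near: "dist (Y m t \<omega>) (Y j t \<omega>) < e / 2" if "t \<in> {0..T}" "j \<le> m" for m t
      proof -
        have "(norm (Y m t \<omega> - Y j t \<omega>))\<^sup>2 < (e/2)\<^sup>2" using bnd[OF that(1), of j "m - j"] j that by simp
        then show ?thesis unfolding dist_norm by (rule power2_less_imp_less) (use e in auto)
      qed
      show "\<exists>Ma. \<forall>t\<in>{0..T}. \<forall>m\<ge>Ma. \<forall>n\<ge>Ma. dist (Y m t \<omega>) (Y n t \<omega>) < e"
      proof (intro exI[of _ j] ballI allI impI)
        fix t m n assume "t \<in> {0..T}" "j \<le> m" "j \<le> n"
        then show "dist (Y m t \<omega>) (Y n t \<omega>) < e"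
          using near[of t m] near[of t n] dist_triangle_half_r by (metis dist_commute)
      qed
    qed
  qed
  \<comment> \<open>On the exceptional null set the value 0 keeps every path continuous;
    \<open>Z\<close> is the sequence modified in the same way, through which \<open>I\<close> is
    seen to be adapted.\<close>
  define I where "I t \<omega> = (if \<omega> \<in> N then 0 else lim (\<lambda>j. Y j t \<omega>))" for t \<omega>
  have unif: "uniform_limit {0..T} (\<lambda>j t. Y j t \<omega>) (\<lambda>t. I t \<omega>) sequentially" if o: "\<omega> \<in> space M" "\<omega> \<notin> N" for \<omega>
  proof -
    have "uniformly_convergent_on {0..T} (\<lambda>j t. Y j t \<omega>)" by (rule Cauchy_uniformly_convergent[OF ucauchy[OF o]])
    then have "uniform_limit {0..T} (\<lambda>j t. Y j t \<omega>) (\<lambda>t. lim (\<lambda>j. Y j t \<omega>)) sequentially"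
      by (simp add: uniformly_convergent_uniform_limit_iff)
    then show ?thesis using o by (simp add: I_def)
  qed
  have lim: "(\<lambda>j. Y j t \<omega>) \<longlonglongrightarrow> I t \<omega>" if "\<omega> \<in> space M" "\<omega> \<notin> N" "t \<in> {0..T}" for \<omega> t
    by (rule tendsto_uniform_limitI[OF unif[OF that(1,2)] that(3)])
  have AEN: "AE \<omega> in M. \<omega> \<in> space M \<and> \<omega> \<notin> N" using AE_not_in[OF N(1)] AE_space by eventually_elim auto
  show ?thesis
  proof (intro exI[of _ I] conjI ballI allI)
    fix t assume t: "t \<in> {0..T}"
    show "I t \<in> borel_measurable (F t)"
    proof (rule borel_measurable_LIMSEQ_metric[OF ZF[OF t]])
      fix \<omega> assume "\<omega> \<in> space (F t)"
      then show "(\<lambda>j. Z j t \<omega>) \<longlonglongrightarrow> I t \<omega>"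
        using lim[OF _ _ t, of \<omega>] by (cases "\<omega> \<in> N") (auto simp: Z_def I_def space_F)
    qed
  next
    fix \<omega> assume o: "\<omega> \<in> space M"
    show "continuous_on {0..T} (\<lambda>t. I t \<omega>)"
    proof (cases "\<omega> \<in> N")
      case True then show ?thesis by (simp add: I_def)
    next
      case False
      show ?thesis
        by (rule uniform_limit_theorem[OF _ unif[OF o False]]) (use N(2)[OF o False] in auto)
    qed
  next
    show "AE \<omega> in M. \<forall>t\<in>{0..T}. (\<lambda>j. Y j t \<omega>) \<longlonglongrightarrow> I t \<omega>"
      using AEN by eventually_elim (use lim in auto)
  next
    fix j
    have "AE \<omega> in M. (SUP t\<in>dyadic T. ennreal ((norm (I t \<omega> - Y j t \<omega>))\<^sup>2)) \<le> G j \<omega>"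
      using AEN
    proof eventually_elim
      case (elim \<omega>)
      show ?case
      proof (rule SUP_least)
        fix t assume t: "t \<in> dyadic T"
        have "(\<lambda>m. Y (m + j) t \<omega>) \<longlonglongrightarrow> I t \<omega>"
          using lim[of \<omega> t] elim dy[OF t] by (intro LIMSEQ_ignore_initial_segment) auto
        then have "(\<lambda>m. ennreal ((norm (Y (m + j) t \<omega> - Y j t \<omega>))\<^sup>2)) \<longlonglongrightarrow> ennreal ((norm (I t \<omega> - Y j t \<omega>))\<^sup>2)"
          by (intro tendsto_intros tendsto_ennrealI)
        then show "ennreal ((norm (I t \<omega> - Y j t \<omega>))\<^sup>2) \<le> G j \<omega>"
          by (rule LIMSEQ_le_const2) (use YG[OF t, of j] in \<open>auto simp: add.commute\<close>)
      qed
    qed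
    then have "(\<integral>\<^sup>+\<omega>. (SUP t\<in>dyadic T. ennreal ((norm (I t \<omega> - Y j t \<omega>))\<^sup>2)) \<partial>M) \<le> (\<integral>\<^sup>+\<omega>. G j \<omega> \<partial>M)"
      by (rule nn_integral_mono_AE)
    also note EG
    finally show "(\<integral>\<^sup>+\<omega>. (SUP t\<in>dyadic T. ennreal ((norm (I t \<omega> - Y j t \<omega>))\<^sup>2)) \<partial>M) \<le> ennreal (4 * A * (1/8)^j)" .
  qed
qed

lemma norm_set_integral_square_le:
  fixes f :: "real \<Rightarrow> 'b::{banach, second_countable_topology}"
  assumes f: "(\<lambda>s. indicator A s *\<^sub>R f s) \<in> borel_measurable lborel" and A: "A \<in> sets borel"
  shows "ennreal ((norm (LINT s:A|lborel. f s))\<^sup>2) \<le> emeasure lborel A * (\<integral>\<^sup>+s. indicator A s * ennreal ((norm (f s))\<^sup>2) \<partial>lborel)"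
\<comment> \<open>If f is not integrable over A, its Bochner integral is 0; otherwise this is the
  Cauchy-Schwarz inequality against the indicator of A.\<close>
proof (cases "set_integrable lborel A f")
  case False
  then show ?thesis by (simp add: set_integrable_def set_lebesgue_integral_def not_integrable_integral_eq)
next
  case True
  have "(\<lambda>s. norm (indicator A s *\<^sub>R f s)) \<in> borel_measurable lborel" using f by measurable
  then have m: "(\<lambda>s. ennreal (norm (indicator A s *\<^sub>R f s))) \<in> borel_measurable lborel" by measurable
  have "ennreal (norm (LINT s:A|lborel. f s)) \<le> (\<integral>\<^sup>+s. ennreal (norm (indicator A s *\<^sub>R f s)) \<partial>lborel)"
    unfolding set_lebesgue_integral_def using True unfolding set_integrable_def by (rule integral_norm_bound_ennreal)
  also have "\<dots> = (\<integral>\<^sup>+s. indicator A s * ennreal (norm (indicator A s *\<^sub>R f s)) \<partial>lborel)"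
    by (intro nn_integral_cong) (auto simp: indicator_def)
  finally have "(ennreal (norm (LINT s:A|lborel. f s)))\<^sup>2 \<le> (\<integral>\<^sup>+s. indicator A s * ennreal (norm (indicator A s *\<^sub>R f s)) \<partial>lborel)\<^sup>2"
    by (rule power_mono) simp
  also have "\<dots> \<le> (\<integral>\<^sup>+s. (indicator A s)\<^sup>2 \<partial>lborel) * (\<integral>\<^sup>+s. (ennreal (norm (indicator A s *\<^sub>R f s)))\<^sup>2 \<partial>lborel)"
    by (rule Cauchy_Schwarz_nn_integral) (use A m in auto)
  also have "(\<integral>\<^sup>+s. (indicator A s :: ennreal)\<^sup>2 \<partial>lborel) = (\<integral>\<^sup>+s. indicator A s \<partial>lborel)"
    by (intro nn_integral_cong) (auto simp: indicator_def)
  also have "(\<integral>\<^sup>+s. (ennreal (norm (indicator A s *\<^sub>R f s)))\<^sup>2 \<partial>lborel) = (\<integral>\<^sup>+s. indicator A s * ennreal ((norm (f s))\<^sup>2) \<partial>lborel)"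
    by (intro nn_integral_cong) (auto simp: indicator_def ennreal_power)
  finally show ?thesis using A by (simp add: ennreal_power)
qed

section \<open>Adapted step approximation of square integrable paths\<close>

definition knot :: "real \<Rightarrow> nat \<Rightarrow> nat \<Rightarrow> real" where
  "knot T N k = real k * T / real N"

text \<open>The average is taken over the interval preceding the one on which it is used, which makes the
  step process adapted.\<close>

definition lag_avg :: "real \<Rightarrow> nat \<Rightarrow> (real \<Rightarrow> real) \<Rightarrow> nat \<Rightarrow> real" where
  "lag_avg T N f k = (if k = 0 then 0 else real N / T * (LINT s:{knot T N (k - 1)<..knot T N k}|lborel. f s))"

definition lag_step :: "real \<Rightarrow> nat \<Rightarrow> (real \<Rightarrow> real) \<Rightarrow> real \<Rightarrow> real" where
  "lag_step T N f s = (\<Sum>k<N. lag_avg T N f k * indicator {knot T N k<..knot T N (Suc k)} s)"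

definition sq_int :: "real \<Rightarrow> (real \<Rightarrow> real) \<Rightarrow> ennreal" where
  "sq_int T f = (\<integral>\<^sup>+s. indicator {0..T} s * ennreal ((f s)\<^sup>2) \<partial>lborel)"

text \<open>Truncation to [-C, C]. Heights of simple integrands have to be bounded, and this
  retraction is 1-Lipschitz and fixes 0, so it enlarges neither squared norms nor distances.\<close>

definition clamp_abs :: "real \<Rightarrow> real \<Rightarrow> real" where
  "clamp_abs C x = max (- C) (min C x)"

lemma clamp_abs_bounds:
  "0 \<le> C \<Longrightarrow> \<bar>clamp_abs C x\<bar> \<le> C" "0 \<le> C \<Longrightarrow> \<bar>clamp_abs C x\<bar> \<le> \<bar>x\<bar>" "\<bar>x\<bar> \<le> C \<Longrightarrow> clamp_abs C x = x"
  "0 \<le> C \<Longrightarrow> \<bar>clamp_abs C x - clamp_abs C y\<bar> \<le> \<bar>x - y\<bar>" "0 \<le> C \<Longrightarrow> \<bar>x - clamp_abs C x\<bar> \<le> \<bar>x\<bar>"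
  "0 \<le> C \<Longrightarrow> clamp_abs C 0 = 0"
  unfolding clamp_abs_def by (auto simp: max_def min_def)

lemma clamp_abs_continuous: "continuous_on S (clamp_abs C)"
  unfolding clamp_abs_def by (intro continuous_intros)

lemma clamp_abs_measurable[measurable]: "clamp_abs C \<in> borel_measurable borel"
  unfolding clamp_abs_def[abs_def] by measurable

lemma clamp_abs_tendsto: "(\<lambda>n. clamp_abs (real n) x) \<longlonglongrightarrow> x"
proof (rule tendsto_eventually)
  obtain n0 :: nat where "\<bar>x\<bar> \<le> real n0" using real_arch_simple by blast
  then have "clamp_abs (real n) x = x" if "n0 \<le> n" for n using that by (intro clamp_abs_bounds(3)) simp
  then show "\<forall>\<^sub>F n in sequentially. clamp_abs (real n) x = x" by (auto simp: eventually_sequentially)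
qed

lemma square_le_square_abs: "\<bar>x\<bar> \<le> \<bar>y :: real\<bar> \<Longrightarrow> ennreal (x\<^sup>2) \<le> ennreal (y\<^sup>2)"
  by (intro ennreal_leI) (simp add: abs_le_square_iff)

lemma sq_int_mono: "(\<And>s. \<bar>f s\<bar> \<le> \<bar>g s\<bar>) \<Longrightarrow> sq_int T f \<le> sq_int T g"
  unfolding sq_int_def by (intro nn_integral_mono mult_left_mono square_le_square_abs) auto

lemma sq_int_minus_commute: "sq_int T (\<lambda>s. f s - g s) = sq_int T (\<lambda>s. g s - f s)"
  unfolding sq_int_def by (simp add: power2_commute)

lemma sq_int_add_le:
  assumes [measurable]: "f \<in> borel_measurable borel" "g \<in> borel_measurable borel"
  shows "sq_int T (\<lambda>s. f s + g s) \<le> 2 * sq_int T f + 2 * sq_int T g"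
proof -
  have "ennreal ((a + b)\<^sup>2) \<le> 2 * ennreal (a\<^sup>2) + 2 * ennreal (b\<^sup>2)" for a b :: real
  proof -
    have "(a + b)\<^sup>2 \<le> 2 * a\<^sup>2 + 2 * b\<^sup>2"
      using zero_le_power2[of "a - b"] by (simp add: power2_eq_square algebra_simps)
    then have "ennreal ((a + b)\<^sup>2) \<le> ennreal (2 * a\<^sup>2 + 2 * b\<^sup>2)" by (rule ennreal_leI)
    then show ?thesis by (simp add: ennreal_mult')
  qed
  then have "sq_int T (\<lambda>s. f s + g s) \<le> (\<integral>\<^sup>+s. 2 * (indicator {0..T} s * ennreal ((f s)\<^sup>2)) + 2 * (indicator {0..T} s * ennreal ((g s)\<^sup>2)) \<partial>lborel)"
    unfolding sq_int_def by (intro nn_integral_mono) (auto simp: indicator_def)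
  also have "\<dots> = 2 * sq_int T f + 2 * sq_int T g"
    unfolding sq_int_def by (subst nn_integral_add) (auto simp: nn_integral_cmult)
  finally show ?thesis .
qed

lemma sq_int_tendsto_0:
  assumes f: "\<And>n. f n \<in> borel_measurable borel" and w: "w \<in> borel_measurable borel" "sq_int T w < \<infinity>"
    and b: "\<And>n s. s \<in> {0..T} \<Longrightarrow> \<bar>f n s\<bar> \<le> \<bar>w s\<bar>" and l: "AE s in lborel. s \<in> {0..T} \<longrightarrow> (\<lambda>n. f n s) \<longlonglongrightarrow> 0"
  shows "(\<lambda>n. sq_int T (f n)) \<longlonglongrightarrow> 0"
proof -
  have "(\<lambda>n. \<integral>\<^sup>+s. indicator {0..T} s * ennreal ((f n s)\<^sup>2) \<partial>lborel) \<longlonglongrightarrow> (\<integral>\<^sup>+(s::real). 0 \<partial>lborel)"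
  proof (rule nn_integral_dominated_convergence[where w = "\<lambda>s. indicator {0..T} s * ennreal ((w s)\<^sup>2)"])
    show "(\<integral>\<^sup>+s. indicator {0..T} s * ennreal ((w s)\<^sup>2) \<partial>lborel) < \<infinity>" using w(2) by (simp add: sq_int_def)
    show "AE s in lborel. indicator {0..T} s * ennreal ((f n s)\<^sup>2) \<le> indicator {0..T} s * ennreal ((w s)\<^sup>2)" for n
      using square_le_square_abs[OF b] by (intro AE_I2) (simp add: indicator_def)
    show "AE s in lborel. (\<lambda>n. indicator {0..T} s * ennreal ((f n s)\<^sup>2)) \<longlonglongrightarrow> 0"
      using l
    proof eventually_elim
      case (elim s)
      show ?case
      proof (cases "s \<in> {0..T}")
        case True
        then have "(\<lambda>n. ennreal ((f n s)\<^sup>2)) \<longlonglongrightarrow> ennreal (0\<^sup>2)" using elim by (intro tendsto_ennrealI tendsto_power) auto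
        then show ?thesis using True by simp
      qed simp
    qed
  qed (use f w in auto)
  then show ?thesis by (simp add: sq_int_def)
qed

lemma sq_int_const: "0 < T \<Longrightarrow> sq_int T (\<lambda>_. C) < \<infinity>"
  unfolding sq_int_def by (subst nn_integral_multc) (auto simp: ennreal_mult_less_top)

lemma sq_int_bounded: "0 < T \<Longrightarrow> (\<And>s. \<bar>f s\<bar> \<le> C) \<Longrightarrow> sq_int T f < \<infinity>"
  by (rule le_less_trans[OF sq_int_mono sq_int_const[of T C]]) (auto intro: order_trans[OF _ abs_ge_self])

text \<open>Truncation first makes f bounded. A Lebesgue measurable function is an almost everywhere
  limit of continuous ones, and truncating these at the same level makes them dominated while
  leaving the limit unchanged.\<close>

lemma sq_int_continuous_approx:
  assumes T: "0 < T" and f: "f \<in> borel_measurable borel" "sq_int T f < \<infinity>" and e: "0 < (e::real)"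
  shows "\<exists>g C. continuous_on UNIV g \<and> (\<forall>s. \<bar>g s\<bar> \<le> C) \<and> sq_int T (\<lambda>s. f s - g s) < ennreal e"
proof -
  have [measurable]: "f \<in> borel_measurable borel" by fact
  have "(\<lambda>n. sq_int T (\<lambda>s. f s - clamp_abs (real n) (f s))) \<longlonglongrightarrow> 0"
  proof (rule sq_int_tendsto_0[OF _ f])
    have "(\<lambda>n. f s - clamp_abs (real n) (f s)) \<longlonglongrightarrow> f s - f s" for s by (intro tendsto_intros clamp_abs_tendsto)
    then show "AE s in lborel. s \<in> {0..T} \<longrightarrow> (\<lambda>n. f s - clamp_abs (real n) (f s)) \<longlonglongrightarrow> 0" by simp
  qed (auto intro: clamp_abs_bounds)
  then have "\<forall>\<^sub>F n in sequentially. sq_int T (\<lambda>s. f s - clamp_abs (real n) (f s)) < ennreal (e/4)"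
    by (rule order_tendstoD(2)) (use e in auto)
  then obtain n where n: "sq_int T (\<lambda>s. f s - clamp_abs (real n) (f s)) < ennreal (e/4)"
    by (auto simp: eventually_sequentially)
  let ?f = "\<lambda>s. clamp_abs (real n) (f s)"
  have "?f \<in> borel_measurable lebesgue"
  proof -
    have "?f \<in> borel_measurable lborel" by simp
    then show ?thesis by (rule measurable_completion)
  qed
  then have "?f measurable_on UNIV" by (rule lebesgue_measurable_imp_measurable_on_real) simp
  then obtain N g where N: "negligible N" and g: "\<And>k. continuous_on UNIV (g k)"
    and lim: "\<And>s. s \<notin> N \<Longrightarrow> (\<lambda>k. g k s) \<longlonglongrightarrow> ?f s"
    unfolding measurable_on_def by auto
  let ?g = "\<lambda>k s. clamp_abs (real n) (g k s)"
  have gc: "continuous_on UNIV (?g k)" for k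
    by (rule continuous_on_compose2[OF clamp_abs_continuous[of UNIV] g]) auto
  have gm: "?g k \<in> borel_measurable borel" for k by (rule borel_measurable_continuous_onI[OF gc])
  have "(\<lambda>k. sq_int T (\<lambda>s. ?f s - ?g k s)) \<longlonglongrightarrow> 0"
  proof (rule sq_int_tendsto_0[where w = "\<lambda>_. 2 * real n"])
    show "\<bar>?f s - ?g k s\<bar> \<le> \<bar>2 * real n\<bar>" for k s
      using clamp_abs_bounds(1)[of "real n" "f s"] clamp_abs_bounds(1)[of "real n" "g k s"] by simp
    have "AE s in lebesgue. s \<notin> N" using N by (intro AE_not_in) (simp add: negligible_iff_null_sets)
    then have "AE s in lebesgue. s \<in> {0..T} \<longrightarrow> (\<lambda>k. ?f s - ?g k s) \<longlonglongrightarrow> 0"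
    proof eventually_elim
      case (elim s)
      have "(\<lambda>k. ?f s - ?g k s) \<longlonglongrightarrow> ?f s - clamp_abs (real n) (?f s)"
        by (intro tendsto_diff tendsto_const continuous_on_tendsto_compose[OF clamp_abs_continuous[of UNIV] lim[OF elim]]) auto
      moreover have "clamp_abs (real n) (?f s) = ?f s" by (intro clamp_abs_bounds) simp
      ultimately show ?case by simp
    qed
    then show "AE s in lborel. s \<in> {0..T} \<longrightarrow> (\<lambda>k. ?f s - ?g k s) \<longlonglongrightarrow> 0" by (simp add: AE_completion_iff)
    show "sq_int T (\<lambda>_. 2 * real n) < \<infinity>" by (rule sq_int_const[OF T])
  qed (use gm in auto)
  then have "\<forall>\<^sub>F k in sequentially. sq_int T (\<lambda>s. ?f s - ?g k s) < ennreal (e/4)"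
    by (rule order_tendstoD(2)) (use e in auto)
  then obtain k where k: "sq_int T (\<lambda>s. ?f s - ?g k s) < ennreal (e/4)" by (auto simp: eventually_sequentially)
  have "sq_int T (\<lambda>s. f s - ?g k s) \<le> 2 * sq_int T (\<lambda>s. f s - ?f s) + 2 * sq_int T (\<lambda>s. ?f s - ?g k s)"
    using sq_int_add_le[of "\<lambda>s. f s - ?f s" "\<lambda>s. ?f s - ?g k s" T] gm[of k] by simp
  also have "\<dots> < 2 * ennreal (e/4) + 2 * ennreal (e/4)"
    using n k by (intro add_strict_mono ennreal_mult_strict_left_mono) auto
  also have "\<dots> = ennreal e" using e by (simp add: ennreal_mult'[symmetric] ennreal_plus[symmetric] ennreal_numeral[symmetric] del: ennreal_plus ennreal_numeral)
  finally show ?thesis using gc clamp_abs_bounds(1)[of "real n"] by (intro exI[of _ "?g k"] exI[of _ "real n"]) auto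
qed

lemma knot_mono: "0 < T \<Longrightarrow> j \<le> k \<Longrightarrow> knot T N j \<le> knot T N k"
  unfolding knot_def by (intro divide_right_mono mult_right_mono) auto

lemma knot_strict: "0 < T \<Longrightarrow> 0 < N \<Longrightarrow> knot T N k < knot T N (Suc k)"
  unfolding knot_def by (intro divide_strict_right_mono mult_strict_right_mono) auto

lemma knot_0[simp]: "knot T N 0 = 0" by (simp add: knot_def)

lemma knot_last[simp]: "0 < N \<Longrightarrow> knot T N N = T" by (simp add: knot_def)

lemma knot_nonneg: "0 < T \<Longrightarrow> 0 \<le> knot T N k" by (simp add: knot_def)

lemma knot_Suc_diff: "knot T N (Suc k) - knot T N k = T / N"
  unfolding knot_def by (simp add: diff_divide_distrib[symmetric] algebra_simps)

lemma knot_indicator_sum: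
  assumes "0 < T"
  shows "(\<Sum>k<n. indicator {knot T N k<..knot T N (Suc k)} s) = (indicator {0<..knot T N n} s :: real)"
proof (induction n)
  case (Suc n)
  then show ?case using knot_mono[OF assms, of 0 n N] knot_mono[OF assms, of n "Suc n" N] by (auto simp: indicator_def)
qed simp

lemma knot_indicator_mult:
  assumes "0 < T"
  shows "indicator {knot T N j<..knot T N (Suc j)} s * indicator {knot T N k<..knot T N (Suc k)} s =
    (if j = k then indicator {knot T N k<..knot T N (Suc k)} s else (0::real))"
  using knot_mono[OF assms, of "Suc j" k N] knot_mono[OF assms, of "Suc k" j N]
  by (cases j k rule: linorder_cases) (auto simp: indicator_def)

text \<open>At most one of the indicators is 1 at s, so a map \<phi> that fixes 0 acts on the
  coefficients. It is applied to squaring and to truncation.\<close>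

lemma step_compose:
  assumes T: "0 < T" and \<phi>: "\<phi> (0::real) = (0::real)"
  shows "\<phi> (\<Sum>k<N. a k * indicator {knot T N k<..knot T N (Suc k)} s) = (\<Sum>k<N. \<phi> (a k) * indicator {knot T N k<..knot T N (Suc k)} s)"
proof (cases "\<exists>k<N. s \<in> {knot T N k<..knot T N (Suc k)}")
  case False
  then have "indicator {knot T N k<..knot T N (Suc k)} s = (0::real)" if "k < N" for k using that by (auto simp: indicator_def)
  then show ?thesis by (simp add: \<phi>)
next
  case True
  then obtain k where k: "k < N" "s \<in> {knot T N k<..knot T N (Suc k)}" by blast
  have ind: "indicator {knot T N j<..knot T N (Suc j)} s = (if j = k then 1 else 0 :: real)" for j
    using knot_indicator_mult[OF T, of N j s k] k(2) by (simp add: indicator_def split: if_splits)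
  show ?thesis unfolding ind using k(1) by (simp add: if_distrib[of "\<lambda>x. _ * x"] cong: if_cong)
qed

lemma lag_step_measurable[measurable]: "lag_step T N f \<in> borel_measurable borel"
  unfolding lag_step_def[abs_def] by measurable

text \<open>By Cauchy-Schwarz the square of an average is at most the average of the squares. All
  intervals have the same length, so moving an average to the next interval changes no weight; the
  coefficient 0 on the first interval and the omission of the last average only decrease the
  sum.\<close>

lemma sq_int_lag_step_le:
  assumes T: "0 < T" and N: "0 < N" and f: "f \<in> borel_measurable borel"
  shows "sq_int T (lag_step T N f) \<le> sq_int T f"
proof -
  let ?J = "\<lambda>k. {knot T N k<..knot T N (Suc k)}"
  have [measurable]: "f \<in> borel_measurable borel" by fact
  have em: "emeasure lborel (?J k) = ennreal (T / N)" for k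
    using knot_strict[OF T N, of k] knot_Suc_diff[of T N k] by simp
  have avg: "ennreal ((lag_avg T N f (Suc k))\<^sup>2) * ennreal (T / N) \<le> (\<integral>\<^sup>+s. indicator (?J k) s * ennreal ((f s)\<^sup>2) \<partial>lborel)" for k
  proof -
    let ?L = "LINT s:?J k|lborel. f s"
    have m: "(\<lambda>s. indicator (?J k) s *\<^sub>R f s) \<in> borel_measurable lborel" by simp
    have J: "?J k \<in> sets borel" by simp
    have "ennreal (?L\<^sup>2) \<le> ennreal (T / N) * (\<integral>\<^sup>+s. indicator (?J k) s * ennreal ((f s)\<^sup>2) \<partial>lborel)"
      using norm_set_integral_square_le[OF m J] unfolding em by simp
    then have "ennreal (N / T) * ennreal (?L\<^sup>2) \<le> ennreal (N / T) * (ennreal (T / N) * (\<integral>\<^sup>+s. indicator (?J k) s * ennreal ((f s)\<^sup>2) \<partial>lborel))"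
      by (rule mult_left_mono) simp
    also have "\<dots> = (\<integral>\<^sup>+s. indicator (?J k) s * ennreal ((f s)\<^sup>2) \<partial>lborel)"
      using T N by (simp add: mult.assoc[symmetric] ennreal_mult[symmetric])
    also have "ennreal (N / T) * ennreal (?L\<^sup>2) = ennreal ((lag_avg T N f (Suc k))\<^sup>2) * ennreal (T / N)"
      using T N by (simp add: lag_avg_def ennreal_mult[symmetric] power_mult_distrib) (simp add: power2_eq_square field_simps)
    finally show ?thesis .
  qed
  have "sq_int T (lag_step T N f) = (\<integral>\<^sup>+s. indicator {0..T} s * (\<Sum>k<N. ennreal ((lag_avg T N f k)\<^sup>2) * indicator (?J k) s) \<partial>lborel)"
    unfolding sq_int_def
  proof (rule nn_integral_cong)
    fix s
    have "ennreal ((lag_step T N f s)\<^sup>2) = ennreal (\<Sum>k<N. (lag_avg T N f k)\<^sup>2 * indicator (?J k) s)"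
      unfolding lag_step_def by (subst step_compose[OF T, of "\<lambda>x. x\<^sup>2"]) auto
    also have "\<dots> = (\<Sum>k<N. ennreal ((lag_avg T N f k)\<^sup>2) * indicator (?J k) s)"
      by (subst sum_ennreal[symmetric]) (auto simp: indicator_def intro!: sum.cong)
    finally show "indicator {0..T} s * ennreal ((lag_step T N f s)\<^sup>2) =
      indicator {0..T} s * (\<Sum>k<N. ennreal ((lag_avg T N f k)\<^sup>2) * indicator (?J k) s)" by simp
  qed
  also have "\<dots> \<le> (\<integral>\<^sup>+s. (\<Sum>k<N. ennreal ((lag_avg T N f k)\<^sup>2) * indicator (?J k) s) \<partial>lborel)"
    by (intro nn_integral_mono) (auto simp: indicator_def)
  also have "\<dots> = (\<Sum>k<N. ennreal ((lag_avg T N f k)\<^sup>2) * ennreal (T / N))"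
    by (subst nn_integral_sum) (auto simp: nn_integral_cmult em simp del: emeasure_lborel_Ioc)
  also have "\<dots> = (\<Sum>k<N - 1. ennreal ((lag_avg T N f (Suc k))\<^sup>2) * ennreal (T / N))"
    using N by (cases N) (auto simp: sum.lessThan_Suc_shift lag_avg_def simp del: sum.lessThan_Suc)
  also have "\<dots> \<le> (\<Sum>k<N - 1. \<integral>\<^sup>+s. indicator (?J k) s * ennreal ((f s)\<^sup>2) \<partial>lborel)" by (intro sum_mono avg)
  also have "\<dots> \<le> (\<Sum>k<N. \<integral>\<^sup>+s. indicator (?J k) s * ennreal ((f s)\<^sup>2) \<partial>lborel)" by (intro sum_mono2) auto
  also have "\<dots> = (\<integral>\<^sup>+s. (\<Sum>k<N. indicator (?J k) s * ennreal ((f s)\<^sup>2)) \<partial>lborel)"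
    by (subst nn_integral_sum) auto
  also have "\<dots> \<le> sq_int T f" unfolding sq_int_def
  proof (rule nn_integral_mono)
    fix s
    have "(\<Sum>k<N. indicator (?J k) s) = ennreal (\<Sum>k<N. indicator (?J k) s)"
      unfolding ennreal_indicator[symmetric] by (rule sum_ennreal) simp
    also have "\<dots> = indicator {0<..T} s" unfolding knot_indicator_sum[OF T] using N by (simp add: indicator_def)
    finally have "(\<Sum>k<N. indicator (?J k) s * ennreal ((f s)\<^sup>2)) = indicator {0<..T} s * ennreal ((f s)\<^sup>2)"
      by (simp add: sum_distrib_right[symmetric])
    then show "(\<Sum>k<N. indicator (?J k) s * ennreal ((f s)\<^sup>2)) \<le> indicator {0..T} s * ennreal ((f s)\<^sup>2)"
      by (auto simp: indicator_def)
  qed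
  finally show ?thesis .
qed

lemma sq_int_set_integrable:
  assumes T: "0 < T" and f: "f \<in> borel_measurable borel" "sq_int T f < \<infinity>" and A: "A \<in> sets borel" "A \<subseteq> {0..T}"
  shows "set_integrable lborel A f"
proof -
  have [measurable]: "f \<in> borel_measurable borel" "A \<in> sets borel" by fact+
  have le: "\<bar>x\<bar> \<le> 1 + x\<^sup>2" for x :: real
    using zero_le_power2[of "\<bar>x\<bar> - 1"] by (simp only: power2_diff) auto
  have "(\<integral>\<^sup>+s. ennreal (norm (indicator A s *\<^sub>R f s)) \<partial>lborel) \<le>
    (\<integral>\<^sup>+s. indicator {0..T} s * ennreal ((1::real)\<^sup>2) + indicator {0..T} s * ennreal ((f s)\<^sup>2) \<partial>lborel)"
  proof (rule nn_integral_mono)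
    fix s
    have "ennreal \<bar>f s\<bar> \<le> ennreal ((1::real)\<^sup>2) + ennreal ((f s)\<^sup>2)"
      using ennreal_leI[OF le[of "f s"]] by simp
    then show "ennreal (norm (indicator A s *\<^sub>R f s)) \<le> indicator {0..T} s * ennreal ((1::real)\<^sup>2) + indicator {0..T} s * ennreal ((f s)\<^sup>2)"
      using A(2) by (auto simp: indicator_def)
  qed
  also have "\<dots> = sq_int T (\<lambda>_. 1) + sq_int T f"
    unfolding sq_int_def by (subst nn_integral_add) auto
  also have "\<dots> < \<infinity>" using sq_int_const[OF T, of 1] f by simp
  finally show ?thesis unfolding set_integrable_def by (intro integrableI_bounded) auto
qed

lemma lag_step_diff:
  assumes T: "0 < T" and N: "0 < N" and f: "f \<in> borel_measurable borel" "sq_int T f < \<infinity>"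
    and g: "g \<in> borel_measurable borel" "sq_int T g < \<infinity>"
  shows "lag_step T N (\<lambda>s. f s - g s) s = lag_step T N f s - lag_step T N g s"
proof -
  have "lag_avg T N (\<lambda>s. f s - g s) k = lag_avg T N f k - lag_avg T N g k" if "k < N" for k
  proof (cases k)
    case (Suc l)
    have "{knot T N l<..knot T N (Suc l)} \<subseteq> {0..T}"
      using knot_nonneg[OF T, of N l] knot_mono[OF T, of "Suc l" N N] that N Suc by auto
    then have "set_integrable lborel {knot T N l<..knot T N (Suc l)} f" "set_integrable lborel {knot T N l<..knot T N (Suc l)} g"
      using sq_int_set_integrable[OF T f] sq_int_set_integrable[OF T g] by auto
    then show ?thesis using Suc by (simp add: lag_avg_def set_integral_diff(2) right_diff_distrib)
  qed (simp add: lag_avg_def)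
  then show ?thesis unfolding lag_step_def by (simp add: left_diff_distrib sum_subtractf)
qed

lemma lag_avg_near:
  assumes T: "0 < T" and N: "0 < N" and g: "continuous_on UNIV g" and k: "0 < k"
    and near: "\<And>r. knot T N (k - 1) < r \<Longrightarrow> r \<le> knot T N k \<Longrightarrow> \<bar>g r - x\<bar> \<le> e"
  shows "\<bar>lag_avg T N g k - x\<bar> \<le> e"
proof -
  obtain l where l: "k = Suc l" using k by (cases k) auto
  let ?J = "{knot T N l<..knot T N (Suc l)}"
  have "set_integrable lborel {knot T N l..knot T N (Suc l)} g"
    by (intro borel_integrable_atLeastAtMost') (rule continuous_on_subset[OF g], simp)
  then have ig: "set_integrable lborel ?J g" by (rule set_integrable_subset) auto
  have ic: "set_integrable lborel ?J (\<lambda>_. c)" for c :: real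
    unfolding set_integrable_def using knot_strict[OF T N, of l] by simp
  have m: "measure lborel ?J = T / N" using knot_strict[OF T N, of l] knot_Suc_diff[of T N l] by simp
  have const: "(LINT s:?J|lborel. c) = T / N * c" for c :: real
    unfolding set_lebesgue_integral_def by (simp add: m del: measure_lborel_Ioc)
  have "(LINT s:?J|lborel. g s) - T / N * x = (LINT s:?J|lborel. g s - x)"
    using set_integral_diff(2)[OF ig ic[of x]] const[of x] by simp
  also have "\<bar>\<dots>\<bar> \<le> (LINT s:?J|lborel. \<bar>g s - x\<bar>)"
    using set_integral_norm_bound[OF set_integral_diff(1)[OF ig ic[of x]]] by simp
  also have "\<dots> \<le> (LINT s:?J|lborel. e)"
    by (rule set_integral_mono[OF set_integrable_abs[OF set_integral_diff(1)[OF ig ic]] ic]) (use near l in auto)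
  also have "\<dots> = T / N * e" by (rule const)
  finally have le: "\<bar>(LINT s:?J|lborel. g s) - T / N * x\<bar> \<le> T / N * e" .
  have "lag_avg T N g k - x = N / T * ((LINT s:?J|lborel. g s) - T / N * x)"
    using T N l by (simp add: lag_avg_def right_diff_distrib)
  then have "\<bar>lag_avg T N g k - x\<bar> = N / T * \<bar>(LINT s:?J|lborel. g s) - T / N * x\<bar>"
    using T N by (simp add: abs_mult)
  also have "\<dots> \<le> N / T * (T / N * e)" using T N by (intro mult_left_mono le) auto
  finally show ?thesis using T N by simp
qed

lemma knot_cover:
  assumes T: "0 < T" and N: "0 < N" and s: "0 < s" "s \<le> T"
  obtains k where "k < N" "s \<in> {knot T N k<..knot T N (Suc k)}"
proof -
  have "(\<Sum>k<N. indicator {knot T N k<..knot T N (Suc k)} s) = (1 :: real)"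
    unfolding knot_indicator_sum[OF T] using s N by simp
  then have "\<not> (\<forall>k\<in>{..<N}. indicator {knot T N k<..knot T N (Suc k)} s = (0::real))"
    using sum.neutral[of "{..<N}" "\<lambda>k. indicator {knot T N k<..knot T N (Suc k)} s :: real"] by linarith
  then have "\<exists>k<N. indicator {knot T N k<..knot T N (Suc k)} s \<noteq> (0::real)" by auto
  then show ?thesis using that by (auto simp: indicator_def split: if_splits)
qed

lemma lag_step_at:
  assumes T: "0 < T" and k: "k < N" "s \<in> {knot T N k<..knot T N (Suc k)}"
  shows "lag_step T N f s = lag_avg T N f k"
proof -
  have ind: "indicator {knot T N j<..knot T N (Suc j)} s = (if j = k then 1 else 0 :: real)" for j
    using knot_indicator_mult[OF T, of N j s k] k(2) by (simp add: indicator_def split: if_splits)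
  show ?thesis unfolding lag_step_def ind using k(1) by (simp add: if_distrib[of "\<lambda>x. _ * x"] cong: if_cong)
qed

lemma lag_step_continuous:
  assumes T: "0 < T" and g: "continuous_on UNIV g" and s: "0 < s" "s \<le> T"
  shows "(\<lambda>n. lag_step T (Suc n) g s) \<longlonglongrightarrow> g s"
proof (rule LIMSEQ_I)
  fix e :: real assume e: "0 < e"
  have "isCont g s" using g by (simp add: continuous_on_eq_continuous_at)
  then obtain d where d: "0 < d" "\<And>r. \<bar>r - s\<bar> < d \<Longrightarrow> \<bar>g r - g s\<bar> < e / 2"
    using e unfolding continuous_at_eps_delta dist_real_def by (metis half_gt_zero)
  \<comment> \<open>A mesh below s / 2 keeps s out of the first interval, where the step process is
    0; a mesh below d / 2 puts the interval of s and the preceding one within distance d of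
    s.\<close>
  have "(\<lambda>n. T * inverse (real (Suc n))) \<longlonglongrightarrow> T * 0" by (intro tendsto_intros LIMSEQ_inverse_real_of_nat)
  then have "\<forall>\<^sub>F n in sequentially. T * inverse (real (Suc n)) < min s d / 2"
    by (rule order_tendstoD(2)) (use s d in auto)
  then obtain n0 where "\<And>n. n0 \<le> n \<Longrightarrow> T * inverse (real (Suc n)) < min s d / 2"
    unfolding eventually_sequentially by blast
  then have n0: "\<And>n. n0 \<le> n \<Longrightarrow> T / real (Suc n) < min s d / 2" by (simp only: divide_inverse)
  show "\<exists>no. \<forall>n\<ge>no. norm (lag_step T (Suc n) g s - g s) < e"
  proof (intro exI[of _ n0] allI impI)
    fix n assume n: "n0 \<le> n"
    let ?N = "Suc n"
    obtain k where k: "k < ?N" "s \<in> {knot T ?N k<..knot T ?N (Suc k)}" using knot_cover[OF T _ s, of ?N] by auto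
    have h: "T / ?N < s / 2" "T / ?N < d / 2" using n0[OF n] by auto
    have k0: "0 < k"
    proof (rule ccontr)
      assume "\<not> 0 < k"
      then have "s \<le> T / ?N" using k(2) by (simp add: knot_def)
      then show False using h(1) s(1) by linarith
    qed
    then have kd: "knot T ?N k - knot T ?N (k - 1) = T / ?N" using knot_Suc_diff[of T ?N "k - 1"] by simp
    have kd': "knot T ?N (Suc k) - knot T ?N k = T / ?N" by (rule knot_Suc_diff)
    have "\<bar>lag_avg T ?N g k - g s\<bar> \<le> e / 2"
    proof (rule lag_avg_near[OF T _ g k0])
      fix r assume "knot T ?N (k - 1) < r" "r \<le> knot T ?N k"
      moreover have "knot T ?N k < s" "s \<le> knot T ?N (Suc k)" using k(2) by auto
      ultimately have "\<bar>r - s\<bar> < d" using kd kd' h(2) unfolding abs_less_iff by linarith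
      from d(2)[OF this] show "\<bar>g r - g s\<bar> \<le> e / 2" by simp
    qed simp
    then show "norm (lag_step T ?N g s - g s) < e" using lag_step_at[OF T k] e by simp
  qed
qed

lemma lag_step_bounded:
  assumes T: "0 < T" and g: "continuous_on UNIV g" "\<And>s. \<bar>g s\<bar> \<le> C" and s: "s \<in> {0..T}" and N: "0 < N"
  shows "\<bar>lag_step T N g s\<bar> \<le> C"
proof -
  have C: "0 \<le> C" using g(2)[of 0] by simp
  have avg: "\<bar>lag_avg T N g k\<bar> \<le> C" for k
    using lag_avg_near[OF T N g(1), of k 0 C] g(2) C by (cases "k = 0") (auto simp: lag_avg_def)
  show ?thesis
  proof (cases "s = 0")
    case True
    then have "lag_step T N g s = 0" unfolding lag_step_def
      using knot_nonneg[OF T, of N] by (intro sum.neutral) (auto simp: indicator_def not_less)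
    then show ?thesis using C by simp
  next
    case False
    then obtain k where "k < N" "s \<in> {knot T N k<..knot T N (Suc k)}" using knot_cover[OF T N, of s] s by auto
    then show ?thesis using lag_step_at[OF T] avg by simp
  qed
qed

text \<open>A density argument: for continuous bounded functions the convergence holds pointwise,
  and the step operator is linear and contracting, so the error for f is controlled by that for a
  nearby continuous g. Splitting (a + b)^2 twice gives the three errors the weights 2, 4 and 4, and
  10/12 < 1 explains \<open>e/12\<close>.\<close>

theorem lag_step_tendsto:
  assumes T: "0 < T" and f: "f \<in> borel_measurable borel" "sq_int T f < \<infinity>"
  shows "(\<lambda>n. sq_int T (\<lambda>s. lag_step T (Suc n) f s - f s)) \<longlonglongrightarrow> 0"
proof (rule order_tendstoI)
  fix a :: ennreal assume "0 < a"
  then obtain e where e: "0 < e" "ennreal e \<le> a"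
    by (cases a rule: ennreal_cases) (auto intro: that[of 1] that)
  obtain g C where g: "continuous_on UNIV g" "\<And>s. \<bar>g s\<bar> \<le> C" and fg: "sq_int T (\<lambda>s. f s - g s) < ennreal (e/12)"
    using sq_int_continuous_approx[OF T f, of "e/12"] e by auto
  have [measurable]: "f \<in> borel_measurable borel" "g \<in> borel_measurable borel"
    using f borel_measurable_continuous_onI[OF g(1)] by auto
  have "(\<lambda>n. sq_int T (\<lambda>s. lag_step T (Suc n) g s - g s)) \<longlonglongrightarrow> 0"
  proof (rule sq_int_tendsto_0[where w = "\<lambda>_. 2 * C"])
    show "sq_int T (\<lambda>_. 2 * C) < \<infinity>" by (rule sq_int_const[OF T])
    show "\<bar>lag_step T (Suc n) g s - g s\<bar> \<le> \<bar>2 * C\<bar>" if "s \<in> {0..T}" for n s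
      using lag_step_bounded[OF T g that, of "Suc n"] g(2)[of s] by simp
    show "AE s in lborel. s \<in> {0..T} \<longrightarrow> (\<lambda>n. lag_step T (Suc n) g s - g s) \<longlonglongrightarrow> 0"
      using AE_lborel_singleton[of 0]
    proof eventually_elim
      case (elim s)
      then show ?case using lag_step_continuous[OF T g(1), of s] by (auto simp: LIM_zero_iff)
    qed
  qed auto
  then have "\<forall>\<^sub>F n in sequentially. sq_int T (\<lambda>s. lag_step T (Suc n) g s - g s) < ennreal (e/12)"
    by (rule order_tendstoD(2)) (use e in auto)
  then show "\<forall>\<^sub>F n in sequentially. sq_int T (\<lambda>s. lag_step T (Suc n) f s - f s) < a"
  proof eventually_elim
    case (elim n)
    let ?L = "lag_step T (Suc n)"
    have gf: "sq_int T g < \<infinity>" by (rule sq_int_bounded[OF T g(2)])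
    have Ld: "?L f s - ?L g s = ?L (\<lambda>s. f s - g s) s" for s using lag_step_diff[OF T _ f _ gf, of "Suc n" s] by simp
    have 1: "sq_int T (\<lambda>s. ?L f s - ?L g s) < ennreal (e/12)"
      unfolding Ld using sq_int_lag_step_le[OF T, of "Suc n" "\<lambda>s. f s - g s"] fg by (auto intro: le_less_trans)
    have 2: "sq_int T (\<lambda>s. g s - f s) < ennreal (e/12)" using fg by (simp add: sq_int_minus_commute[of T g f])
    have "sq_int T (\<lambda>s. ?L f s - f s) \<le> 2 * sq_int T (\<lambda>s. ?L f s - ?L g s) + 2 * sq_int T (\<lambda>s. ?L g s - f s)"
      using sq_int_add_le[of "\<lambda>s. ?L f s - ?L g s" "\<lambda>s. ?L g s - f s" T] by simp
    also have "\<dots> \<le> 2 * sq_int T (\<lambda>s. ?L f s - ?L g s) + 2 * (2 * sq_int T (\<lambda>s. ?L g s - g s) + 2 * sq_int T (\<lambda>s. g s - f s))"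
      using sq_int_add_le[of "\<lambda>s. ?L g s - g s" "\<lambda>s. g s - f s" T] by (intro add_left_mono mult_left_mono) auto
    also have "\<dots> < 2 * ennreal (e/12) + 2 * (2 * ennreal (e/12) + 2 * ennreal (e/12))"
      using 1 2 elim by (intro add_strict_mono ennreal_mult_strict_left_mono) auto
    also have "\<dots> = ennreal (10 / 12 * e)" using e by (simp add: ennreal_mult'[symmetric] ennreal_plus[symmetric] ennreal_numeral[symmetric] del: ennreal_plus ennreal_numeral)
    also have "\<dots> \<le> ennreal e" using e by (intro ennreal_leI) simp
    also have "\<dots> \<le> a" by (rule e)
    finally show ?case .
  qed
qed simp

context orthogonal_bm begin

text \<open>Each path of H is replaced by its truncated lagged averages, which form a simple
  integrand. The energy error is dominated by four times the energy of H, so it tends to 0 in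
  expectation; along indices with error below 8^-j the maximal inequality turns it into a rate for
  the suprema of differences of the integrals.\<close>

theorem ito_integral_exists:
  assumes T: "0 < T" and H: "progressive T H"
    and fin: "(\<integral>\<^sup>+\<omega>. int_cut T always (\<lambda>s \<omega>. ennreal ((H s \<omega>)\<^sup>2)) \<omega> \<partial>M) < \<infinity>"
  shows "\<exists>I. has_ito_integral M F (W k) T H I"
proof -
  have T0: "0 \<le> T" "T \<le> T" using T by auto
  define f where "f \<omega> s = (if s \<in> {0..T} then H s \<omega> else 0)" for \<omega> s
  have fb: "f \<omega> \<in> borel_measurable borel" if "\<omega> \<in> space M" for \<omega>
    unfolding f_def[abs_def] by (rule progressive_section[OF H T0(1) that])
  define h2 where "h2 \<omega> = int_cut T always (\<lambda>s \<omega>. ennreal ((H s \<omega>)\<^sup>2)) \<omega>" for \<omega>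
  have sq_f: "sq_int T (f \<omega>) = h2 \<omega>" for \<omega>
    unfolding h2_def sq_int_def int_cut_def f_def by (intro nn_integral_cong) (auto simp: indicator_def)
  define \<tau> where "\<tau> n l = knot T (Suc n) l" for n l
  \<comment> \<open>Heights must be bounded, hence the truncation; its level n grows together with
    the fineness of the partition.\<close>
  define \<xi> where "\<xi> n l \<omega> = clamp_abs (real n) (lag_avg T (Suc n) (\<lambda>s. H s \<omega>) l)" for n l \<omega>
  have \<tau>: "0 \<le> \<tau> n l" "l \<le> Suc n \<Longrightarrow> \<tau> n l \<le> T" "\<tau> n l < \<tau> n (Suc l)" "j \<le> l \<Longrightarrow> \<tau> n j \<le> \<tau> n l" for n l j
    unfolding \<tau>_def using knot_nonneg[OF T] knot_mono[OF T, of l "Suc n" "Suc n"] knot_strict[OF T, of "Suc n" l]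
      knot_mono[OF T, of j l "Suc n"] by auto
  have \<xi>F: "\<xi> n l \<in> borel_measurable (F (\<tau> n l))" if l: "l < Suc n" for n l
  proof (cases l)
    case 0 then show ?thesis by (simp add: \<xi>_def[abs_def] lag_avg_def)
  next
    case (Suc q)
    note [measurable] = progressiveD[OF H \<tau>(1)[of n l] \<tau>(2)[OF less_imp_le[OF l]]]
    have "(\<lambda>\<omega>. LINT s|lborel. indicator {\<tau> n q<..\<tau> n l} s *\<^sub>R (if s \<in> {0..\<tau> n l} then H s \<omega> else 0)) \<in> borel_measurable (F (\<tau> n l))"
      by measurable
    also have "(\<lambda>\<omega>. LINT s|lborel. indicator {\<tau> n q<..\<tau> n l} s *\<^sub>R (if s \<in> {0..\<tau> n l} then H s \<omega> else 0)) =
      (\<lambda>\<omega>. LINT s:{\<tau> n q<..\<tau> n l}|lborel. H s \<omega>)"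
      unfolding set_lebesgue_integral_def
      by (intro ext Bochner_Integration.integral_cong refl) (use \<tau>(1)[of n q] in \<open>auto simp: indicator_def\<close>)
    finally show ?thesis unfolding \<xi>_def[abs_def] lag_avg_def using Suc by (simp add: \<tau>_def)
  qed
  have si: "simple_integrand M F (Suc n) (\<tau> n) (\<xi> n)" for n
    unfolding simple_integrand_def
  proof (intro conjI allI impI)
    fix l assume "l < Suc n"
    then show "\<xi> n l \<in> borel_measurable (F (\<tau> n l))" by (rule \<xi>F)
    show "\<exists>C. \<forall>\<omega>\<in>space M. \<bar>\<xi> n l \<omega>\<bar> \<le> C" unfolding \<xi>_def using clamp_abs_bounds(1)[of "real n"] by auto
  qed (use \<tau> in auto)
  define P where "P n = simple_process (Suc n) (\<tau> n) (\<xi> n)" for n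
  define S where "S n = simple_ito_integral (W k) (Suc n) (\<tau> n) (\<xi> n)" for n
  have DS: "simple_integral (\<lambda>i s \<omega>. if i = k then P n s \<omega> else 0) (S n)" for n
    unfolding P_def S_def by (rule simple_integrand_simple_integral[OF si])
  have Pp: "progressive T (P n)" for n
    using simple_integrand_progressive[OF DS[of n], of T k] by simp
  \<comment> \<open>Truncating the heights is the same as truncating the step process, so for each
    \<omega> the deterministic approximation theory applies to the path.\<close>
  have Peq: "P n s \<omega> = clamp_abs (real n) (lag_step T (Suc n) (f \<omega>) s)" for n s \<omega>
  proof -
    have avg: "lag_avg T (Suc n) (\<lambda>s. H s \<omega>) l = lag_avg T (Suc n) (f \<omega>) l" if l: "l < Suc n" for l
    proof (cases l)
      case (Suc q)
      have "(LINT s:{\<tau> n q<..\<tau> n l}|lborel. H s \<omega>) = (LINT s:{\<tau> n q<..\<tau> n l}|lborel. f \<omega> s)"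
        using \<tau>(1)[of n q] \<tau>(2)[of l n] l by (intro set_lebesgue_integral_cong) (auto simp: f_def)
      then show ?thesis using Suc by (simp add: lag_avg_def \<tau>_def)
    qed (simp add: lag_avg_def)
    have "clamp_abs (real n) (lag_step T (Suc n) (f \<omega>) s) =
      (\<Sum>l<Suc n. clamp_abs (real n) (lag_avg T (Suc n) (f \<omega>) l) * indicator {knot T (Suc n) l<..knot T (Suc n) (Suc l)} s)"
      unfolding lag_step_def by (rule step_compose[OF T]) (rule clamp_abs_bounds(6), simp)
    also have "\<dots> = P n s \<omega>" unfolding P_def simple_process_def \<xi>_def \<tau>_def
      by (intro sum.cong refl) (simp add: avg)
    finally show ?thesis by simp
  qed
  define e where "e n = int_cut T always (\<lambda>s \<omega>. ennreal ((P n s \<omega> - H s \<omega>)\<^sup>2))" for n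
  have sqp: "progressive T g \<Longrightarrow> progressive T (\<lambda>s \<omega>. ennreal ((g s \<omega>)\<^sup>2))" for g :: "real \<Rightarrow> 'a \<Rightarrow> real"
    by (rule progressive_compose[where g = "\<lambda>x. ennreal (x\<^sup>2)"]) auto
  have eM: "e n \<in> borel_measurable M" for n
    unfolding e_def by (rule int_cut_measurable_M[OF cutoff_True T sqp[OF progressive_diff[OF Pp H]]])
  have e_eq: "e n \<omega> = sq_int T (\<lambda>s. P n s \<omega> - f \<omega> s)" for n \<omega>
    unfolding e_def sq_int_def int_cut_def f_def by (intro nn_integral_cong) (auto simp: indicator_def)
  have h2M: "h2 \<in> borel_measurable M" unfolding h2_def[abs_def]
    by (rule int_cut_measurable_M[OF cutoff_True T sqp[OF H]])
  have h2fin: "AE \<omega> in M. h2 \<omega> < \<infinity>"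
    using nn_integral_PInf_AE[OF h2M] fin unfolding h2_def by (auto simp: less_top)
  have Pb: "(\<lambda>s. P n s \<omega>) \<in> borel_measurable borel" for n \<omega>
    unfolding Peq by measurable
  have e_le: "e n \<omega> \<le> 4 * h2 \<omega>" if o: "\<omega> \<in> space M" for n \<omega>
  proof -
    have "e n \<omega> \<le> 2 * sq_int T (\<lambda>s. P n s \<omega>) + 2 * sq_int T (\<lambda>s. - f \<omega> s)"
      unfolding e_eq using sq_int_add_le[OF Pb, of "\<lambda>s. - f \<omega> s"] fb[OF o] by simp
    also have "sq_int T (\<lambda>s. P n s \<omega>) \<le> sq_int T (lag_step T (Suc n) (f \<omega>))"
      unfolding Peq by (intro sq_int_mono clamp_abs_bounds) simp
    also have "\<dots> \<le> sq_int T (f \<omega>)" by (rule sq_int_lag_step_le[OF T _ fb[OF o]]) simp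
    also have "sq_int T (\<lambda>s. - f \<omega> s) = sq_int T (f \<omega>)" by (simp add: sq_int_def)
    also have "2 * sq_int T (f \<omega>) + 2 * sq_int T (f \<omega>) = 4 * h2 \<omega>" unfolding sq_f by (simp add: mult_2[symmetric] mult.assoc[symmetric])
    finally show ?thesis by (simp add: mult_left_mono add_right_mono)
  qed
  have e_lim: "(\<lambda>n. e n \<omega>) \<longlonglongrightarrow> 0" if o: "\<omega> \<in> space M" and fo: "h2 \<omega> < \<infinity>" for \<omega>
  proof (rule ennreal_tendsto_0_le)
    let ?L = "\<lambda>n. lag_step T (Suc n) (f \<omega>)"
    have ff: "sq_int T (f \<omega>) < \<infinity>" using fo sq_f by simp
    have [measurable]: "f \<omega> \<in> borel_measurable borel" by (rule fb[OF o])
    \<comment> \<open>The truncated path is inserted: truncation being 1-Lipschitz, the first term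
      is controlled by the averaging error without truncation, and the second vanishes as the level
      grows.\<close>
    show "e n \<omega> \<le> 2 * sq_int T (\<lambda>s. ?L n s - f \<omega> s) + 2 * sq_int T (\<lambda>s. clamp_abs (real n) (f \<omega> s) - f \<omega> s)" for n
    proof -
      have "e n \<omega> \<le> 2 * sq_int T (\<lambda>s. P n s \<omega> - clamp_abs (real n) (f \<omega> s)) + 2 * sq_int T (\<lambda>s. clamp_abs (real n) (f \<omega> s) - f \<omega> s)"
        unfolding e_eq using sq_int_add_le[of "\<lambda>s. P n s \<omega> - clamp_abs (real n) (f \<omega> s)" "\<lambda>s. clamp_abs (real n) (f \<omega> s) - f \<omega> s" T] Pb by simp
      also have "sq_int T (\<lambda>s. P n s \<omega> - clamp_abs (real n) (f \<omega> s)) \<le> sq_int T (\<lambda>s. ?L n s - f \<omega> s)"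
        unfolding Peq by (intro sq_int_mono clamp_abs_bounds) simp
      finally show ?thesis by (simp add: mult_left_mono add_right_mono)
    qed
    have "(\<lambda>n. sq_int T (\<lambda>s. clamp_abs (real n) (f \<omega> s) - f \<omega> s)) \<longlonglongrightarrow> 0"
    proof (rule sq_int_tendsto_0[OF _ fb[OF o] ff])
      have "(\<lambda>n. clamp_abs (real n) (f \<omega> s) - f \<omega> s) \<longlonglongrightarrow> f \<omega> s - f \<omega> s" for s by (intro tendsto_intros clamp_abs_tendsto)
      then show "AE s in lborel. s \<in> {0..T} \<longrightarrow> (\<lambda>n. clamp_abs (real n) (f \<omega> s) - f \<omega> s) \<longlonglongrightarrow> 0" by simp
      show "\<bar>clamp_abs (real n) (f \<omega> s) - f \<omega> s\<bar> \<le> \<bar>f \<omega> s\<bar>" for n s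
        using clamp_abs_bounds(5)[of "real n" "f \<omega> s"] by (simp add: abs_minus_commute)
    qed simp
    then have "(\<lambda>n. 2 * sq_int T (\<lambda>s. ?L n s - f \<omega> s) + 2 * sq_int T (\<lambda>s. clamp_abs (real n) (f \<omega> s) - f \<omega> s)) \<longlonglongrightarrow> 2 * 0 + 2 * 0"
      by (intro tendsto_add ennreal_tendsto_cmult lag_step_tendsto[OF T fb[OF o] ff]) auto
    then show "(\<lambda>n. 2 * sq_int T (\<lambda>s. ?L n s - f \<omega> s) + 2 * sq_int T (\<lambda>s. clamp_abs (real n) (f \<omega> s) - f \<omega> s)) \<longlonglongrightarrow> 0" by simp
  qed
  have "(\<lambda>n. \<integral>\<^sup>+\<omega>. e n \<omega> \<partial>M) \<longlonglongrightarrow> (\<integral>\<^sup>+(\<omega>::'a). 0 \<partial>M)"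
  proof (rule nn_integral_dominated_convergence[where w = "\<lambda>\<omega>. 4 * h2 \<omega>"])
    show "(\<integral>\<^sup>+\<omega>. 4 * h2 \<omega> \<partial>M) < \<infinity>"
      using fin h2M unfolding h2_def[symmetric] by (simp add: nn_integral_cmult ennreal_mult_less_top)
    show "AE \<omega> in M. (\<lambda>n. e n \<omega>) \<longlonglongrightarrow> 0" using h2fin AE_space by eventually_elim (rule e_lim)
  qed (use eM h2M e_le in auto)
  then have Elim: "(\<lambda>n. \<integral>\<^sup>+\<omega>. e n \<omega> \<partial>M) \<longlonglongrightarrow> 0" by simp
  \<comment> \<open>Besides the rate, n \<ge> j is demanded so that the pathwise limit of
    \<open>e\<close> persists along the chosen indices.\<close>
  have "\<exists>n\<ge>j. (\<integral>\<^sup>+\<omega>. e n \<omega> \<partial>M) < ennreal ((1/8)^j)" for j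
  proof -
    have "\<forall>\<^sub>F n in sequentially. (\<integral>\<^sup>+\<omega>. e n \<omega> \<partial>M) < ennreal ((1/8)^j)" by (rule order_tendstoD(2)[OF Elim]) simp
    then have "\<forall>\<^sub>F n in sequentially. (\<integral>\<^sup>+\<omega>. e n \<omega> \<partial>M) < ennreal ((1/8)^j) \<and> j \<le> n" using eventually_ge_at_top[of j] by eventually_elim auto
    then show ?thesis by (auto simp: eventually_sequentially)
  qed
  then obtain r where r: "\<And>j. j \<le> r j" "\<And>j. (\<integral>\<^sup>+\<omega>. e (r j) \<omega> \<partial>M) < ennreal ((1/8)^j)" by metis
  have er_lim: "(\<lambda>j. e (r j) \<omega>) \<longlonglongrightarrow> 0" if "\<omega> \<in> space M" "h2 \<omega> < \<infinity>" for \<omega>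
    by (rule filterlim_compose[OF e_lim[OF that]])
      (use r(1) in \<open>auto simp: filterlim_at_top eventually_sequentially intro: order_trans\<close>)
  have rate: "(\<integral>\<^sup>+\<omega>. (SUP t\<in>dyadic T. ennreal ((norm (S (r (Suc j)) t \<omega> - S (r j) t \<omega>))\<^sup>2)) \<partial>M) \<le> ennreal (16 * (1/8)^j)" for j
  proof -
    let ?D = "\<lambda>i s \<omega>. (if i = k then P (r (Suc j)) s \<omega> else 0) - (if i = k then P (r j) s \<omega> else 0)"
    have D: "simple_integral ?D (\<lambda>t \<omega>. S (r (Suc j)) t \<omega> - S (r j) t \<omega>)"
      by (rule simple_integral_diff[OF DS DS])
    have Deq: "(\<Sum>i\<in>UNIV. (?D i s \<omega>)\<^sup>2) = (P (r (Suc j)) s \<omega> - P (r j) s \<omega>)\<^sup>2" for s \<omega>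
    proof -
      have "?D i s \<omega> = (if i = k then P (r (Suc j)) s \<omega> - P (r j) s \<omega> else 0)" for i by simp
      then show ?thesis by (simp add: if_distrib[of "\<lambda>x. x\<^sup>2"] cong: if_cong)
    qed
    have "(\<integral>\<^sup>+\<omega>. (SUP t\<in>dyadic T. ennreal ((norm (S (r (Suc j)) t \<omega> - S (r j) t \<omega>))\<^sup>2)) \<partial>M) \<le>
      4 * (\<integral>\<^sup>+\<omega>. int_cut T always (\<lambda>s \<omega>. ennreal ((P (r (Suc j)) s \<omega> - P (r j) s \<omega>)\<^sup>2)) \<omega> \<partial>M)"
      using simple_cutoff_bound[OF T D cutoff_True] unfolding Deq sup_cut_def by simp
    also have "\<dots> \<le> 4 * (\<integral>\<^sup>+\<omega>. 2 * e (r (Suc j)) \<omega> + 2 * e (r j) \<omega> \<partial>M)"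
    proof (intro mult_left_mono nn_integral_mono)
      fix \<omega> assume o: "\<omega> \<in> space M"
      have "int_cut T always (\<lambda>s \<omega>. ennreal ((P (r (Suc j)) s \<omega> - P (r j) s \<omega>)\<^sup>2)) \<omega> = sq_int T (\<lambda>s. (P (r (Suc j)) s \<omega> - f \<omega> s) + (f \<omega> s - P (r j) s \<omega>))"
        unfolding sq_int_def int_cut_def by (intro nn_integral_cong) (auto simp: indicator_def)
      also have "\<dots> \<le> 2 * e (r (Suc j)) \<omega> + 2 * sq_int T (\<lambda>s. f \<omega> s - P (r j) s \<omega>)"
        unfolding e_eq using Pb fb[OF o] by (intro sq_int_add_le borel_measurable_diff)
      also have "sq_int T (\<lambda>s. f \<omega> s - P (r j) s \<omega>) = e (r j) \<omega>" unfolding e_eq by (rule sq_int_minus_commute)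
      finally show "int_cut T always (\<lambda>s \<omega>. ennreal ((P (r (Suc j)) s \<omega> - P (r j) s \<omega>)\<^sup>2)) \<omega> \<le> 2 * e (r (Suc j)) \<omega> + 2 * e (r j) \<omega>" .
    qed simp
    also have "\<dots> = 4 * (2 * (\<integral>\<^sup>+\<omega>. e (r (Suc j)) \<omega> \<partial>M) + 2 * (\<integral>\<^sup>+\<omega>. e (r j) \<omega> \<partial>M))"
      using eM by (subst nn_integral_add) (auto simp: nn_integral_cmult)
    \<comment> \<open>With these bounds the right-hand side is 9 times 8^-j; 16 is a convenient
      majorant of the 9.\<close>
    also have "\<dots> \<le> 4 * (2 * ennreal ((1/8)^Suc j) + 2 * ennreal ((1/8)^j))"
      using r(2)[of j] r(2)[of "Suc j"] by (intro mult_left_mono add_mono) auto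
    also have "\<dots> = ennreal (4 * (2 * (1/8)^Suc j + 2 * (1/8)^j))"
      by (simp add: ennreal_mult' ennreal_plus del: power_Suc)
    also have "\<dots> \<le> ennreal (16 * (1/8)^j)" by (intro ennreal_leI) simp
    finally show ?thesis .
  qed
  have "\<exists>I. (\<forall>t\<in>{0..T}. I t \<in> borel_measurable (F t)) \<and>
    (\<forall>\<omega>\<in>space M. continuous_on {0..T} (\<lambda>t. I t \<omega>)) \<and>
    (AE \<omega> in M. \<forall>t\<in>{0..T}. (\<lambda>j. S (r j) t \<omega>) \<longlonglongrightarrow> I t \<omega>) \<and>
    (\<forall>j. (\<integral>\<^sup>+\<omega>. (SUP t\<in>dyadic T. ennreal ((norm (I t \<omega> - S (r j) t \<omega>))\<^sup>2)) \<partial>M) \<le> ennreal (4 * 16 * (1/8)^j))"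
  proof (rule uniform_limit_exists[OF T])
    show "S (r j) t \<in> borel_measurable (F t)" if "t \<in> {0..T}" for j t
      using simple_integral_measurable[OF DS] that by auto
    show "AE \<omega> in M. continuous_on {0..T} (\<lambda>t. S (r j) t \<omega>)" for j
      using simple_integral_continuous[OF DS[of "r j"]] by eventually_elim (auto intro: continuous_on_subset)
  qed (use rate in auto)
  then obtain I where I: "\<And>t. t\<in>{0..T} \<Longrightarrow> I t \<in> borel_measurable (F t)" "\<And>\<omega>. \<omega>\<in>space M \<Longrightarrow> continuous_on {0..T} (\<lambda>t. I t \<omega>)"
    "AE \<omega> in M. \<forall>t\<in>{0..T}. (\<lambda>j. S (r j) t \<omega>) \<longlonglongrightarrow> I t \<omega>" by blast
  have int_e: "set_integrable lborel {0..T} (\<lambda>s. (P n s \<omega> - H s \<omega>)\<^sup>2)" if "\<omega> \<in> space M" "h2 \<omega> < \<infinity>" for n \<omega>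
  proof -
    have "e n \<omega> \<le> 4 * h2 \<omega>" by (rule e_le[OF that(1)])
    also have "\<dots> < \<infinity>" using that(2) by (simp add: ennreal_mult_less_top)
    finally show ?thesis using set_integrable_square_iff[OF T progressive_diff[OF Pp H] that(1)] by (simp add: e_def)
  qed
  have conv: "tendsto_in_prob M (\<lambda>N \<omega>. LINT s:{0..T}|lborel. (P (r N) s \<omega> - H s \<omega>)\<^sup>2) (\<lambda>\<omega>. 0)"
  proof (rule tendsto_in_prob_AE)
    fix N
    have "progressive T (\<lambda>s \<omega>. (P (r N) s \<omega> - H s \<omega>)\<^sup>2)"
      by (rule progressive_compose[OF progressive_diff[OF Pp H], where g = "\<lambda>x. x\<^sup>2"]) auto
    note [measurable] = progressive_M[OF this T0(1)]
    have "(\<lambda>\<omega>. LINT s|lborel. (if s \<in> {0..T} then (P (r N) s \<omega> - H s \<omega>)\<^sup>2 else 0)) \<in> borel_measurable M"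
      by measurable
    also have "(\<lambda>\<omega>. LINT s|lborel. (if s \<in> {0..T} then (P (r N) s \<omega> - H s \<omega>)\<^sup>2 else 0)) =
        (\<lambda>\<omega>. LINT s:{0..T}|lborel. (P (r N) s \<omega> - H s \<omega>)\<^sup>2)"
      unfolding set_lebesgue_integral_def by (intro ext Bochner_Integration.integral_cong) auto
    finally show "(\<lambda>\<omega>. LINT s:{0..T}|lborel. (P (r N) s \<omega> - H s \<omega>)\<^sup>2) \<in> borel_measurable M" .
  next
    show "AE \<omega> in M. (\<lambda>N. LINT s:{0..T}|lborel. (P (r N) s \<omega> - H s \<omega>)\<^sup>2) \<longlonglongrightarrow> 0"
      using h2fin AE_space
    proof eventually_elim
      case (elim \<omega>)
      have "e (r N) \<omega> = ennreal (LINT s:{0..T}|lborel. (P (r N) s \<omega> - H s \<omega>)\<^sup>2)" for N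
        unfolding e_def by (rule int_cut_eq_set_integral[where f = "\<lambda>s \<omega>. P (r N) s \<omega> - H s \<omega>"]) (rule int_e[OF elim(2,1)])
      then have "(\<lambda>N. ennreal (LINT s:{0..T}|lborel. (P (r N) s \<omega> - H s \<omega>)\<^sup>2)) \<longlonglongrightarrow> ennreal 0"
        using er_lim[OF elim(2,1)] by simp
      moreover have "0 \<le> (LINT s:{0..T}|lborel. (P (r N) s \<omega> - H s \<omega>)\<^sup>2)" for N
        unfolding set_lebesgue_integral_def by (intro Bochner_Integration.integral_nonneg) auto
      ultimately show ?case by (subst (asm) tendsto_ennreal_iff) auto
    qed
  qed simp
  have convI: "tendsto_in_prob M (\<lambda>N. S (r N) t) (I t)" if t: "t \<in> {0..T}" for t
  proof (rule tendsto_in_prob_AE)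
    show "S (r N) t \<in> borel_measurable M" for N using simple_integral_sq[OF DS, of t "r N"] t by (simp add: sq_integrable_def)
    show "I t \<in> borel_measurable M" using measurable_F_M[of t, OF _ I(1)[OF t]] t by simp
    show "AE \<omega> in M. (\<lambda>N. S (r N) t \<omega>) \<longlonglongrightarrow> I t \<omega>" using I(3) by eventually_elim (use t in auto)
  qed
  have "has_ito_integral M F (W k) T H I"
    unfolding has_ito_integral_def prog_measurable_iff adapted_on_def
  proof (intro conjI exI[of _ "\<lambda>N. Suc (r N)"] exI[of _ "\<lambda>N. \<tau> (r N)"] exI[of _ "\<lambda>N. \<xi> (r N)"] allI ballI)
    show "AE \<omega> in M. set_integrable lborel {0..T} (\<lambda>s. (H s \<omega>)\<^sup>2)"
      using h2fin AE_space by eventually_elim (use set_integrable_square_iff[OF T H] in \<open>simp add: h2_def\<close>)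
  qed (use H I si conv convI in \<open>auto simp: P_def S_def\<close>)
  then show ?thesis by blast
qed

end

section \<open>Gronwall's inequality\<close>

lemma mono_ennreal_measurable:
  fixes \<phi> :: "real \<Rightarrow> ennreal"
  assumes "mono \<phi>"
  shows "\<phi> \<in> borel_measurable borel"
proof (rule borel_measurableI_greater)
  fix y
  have "is_interval {s. y < \<phi> s}"
    unfolding is_interval_1 using assms by (auto dest: monoD intro: less_le_trans)
  from real_interval_borel_measurable[OF this] show "{s \<in> space borel. y < \<phi> s} \<in> sets borel" by simp
qed

text \<open>Gronwall's inequality for an integrable weight. Over an interval on which the integral of the
  weight is at most \<open>\<delta>\<close> the right-hand side grows by a factor of at most \<open>1 / (1 - C * \<delta>)\<close>.\<close>

lemma gronwall:
  fixes \<phi> :: "real \<Rightarrow> ennreal" and K :: "real \<Rightarrow> real"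
  assumes T: "0 < T" and K: "integrable lborel K" "\<And>s. 0 \<le> K s"
    and \<phi>: "mono \<phi>" "\<phi> T < \<infinity>" and AC: "0 \<le> A" "0 \<le> C"
    and ineq: "\<And>t. t \<in> {0..T} \<Longrightarrow> \<phi> t \<le> ennreal A + ennreal C * (\<integral>\<^sup>+s. indicator {0..t} s * (ennreal (K s) * \<phi> s) \<partial>lborel)"
  shows "\<phi> T \<le> ennreal (A * exp (C * (LINT s:{0..T}|lborel. K s)))"
proof -
  have [measurable]: "K \<in> borel_measurable borel" "\<phi> \<in> borel_measurable borel"
    using K mono_ennreal_measurable[OF \<phi>(1)] by auto
  define G where "G t = (LINT s:{0..t}|lborel. K s)" for t
  have Ki: "set_integrable lborel S K" if "S \<in> sets borel" for S
    using integrable_mult_indicator[of S lborel K] that K by (simp add: set_integrable_def)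
  have GK: "G t = integral {0..t} K" for t unfolding G_def by (rule set_borel_integral_eq_integral(2)[OF Ki]) simp
  have Gc: "continuous_on {0..T} G" unfolding GK
    by (rule indefinite_integral_continuous_1[OF set_borel_integral_eq_integral(1)[OF Ki]]) simp
  have G0: "G 0 = 0" unfolding GK by simp
  have Gnn: "(\<integral>\<^sup>+r. indicator {s<..t} r * ennreal (K r) \<partial>lborel) = ennreal (G t - G s)" if st: "0 \<le> s" "s \<le> t" for s t
  proof -
    have "(\<integral>\<^sup>+r. indicator {s<..t} r * ennreal (K r) \<partial>lborel) = (\<integral>\<^sup>+r. ennreal (indicator {s<..t} r *\<^sub>R K r) \<partial>lborel)"
      by (intro nn_integral_cong) (auto simp: indicator_def)
    also have "\<dots> = ennreal (LINT r:{s<..t}|lborel. K r)"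
      unfolding set_lebesgue_integral_def using Ki[of "{s<..t}"] K(2) by (intro nn_integral_eq_integral) (auto simp: set_integrable_def)
    also have "(LINT r:{s<..t}|lborel. K r) = G t - G s"
    proof -
      have "(LINT r:{0..s} \<union> {s<..t}|lborel. K r) = G s + (LINT r:{s<..t}|lborel. K r)"
        unfolding G_def by (rule set_integral_Un) (auto intro!: Ki)
      moreover have "{0..s} \<union> {s<..t} = {0..t}" using st by auto
      ultimately show ?thesis by (simp add: G_def)
    qed
    finally show ?thesis .
  qed
  have Gmono: "G s \<le> G t" if "0 \<le> s" "s \<le> t" for s t
  proof -
    have "(LINT r:{0..s} \<union> {s<..t}|lborel. K r) = G s + (LINT r:{s<..t}|lborel. K r)"
      unfolding G_def by (rule set_integral_Un) (auto intro!: Ki)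
    moreover have "{0..s} \<union> {s<..t} = {0..t}" using that by auto
    moreover have "0 \<le> (LINT r:{s<..t}|lborel. K r)"
      unfolding set_lebesgue_integral_def using K(2) by (intro Bochner_Integration.integral_nonneg) auto
    ultimately show ?thesis by (simp add: G_def)
  qed
  \<comment> \<open>The iteration runs on the right-hand side \<open>u\<close>, which dominates
    \<phi>, equals A at time 0 and satisfies an inequality of the same kind between any two
    times.\<close>
  define u where "u t = ennreal A + ennreal C * (\<integral>\<^sup>+s. indicator {0..t} s * (ennreal (K s) * \<phi> s) \<partial>lborel)" for t
  have \<phi>u: "\<phi> t \<le> u t" if "t \<in> {0..T}" for t using ineq[OF that] by (simp add: u_def)
  have umono: "u s \<le> u t" if "s \<le> t" for s t
    unfolding u_def using that by (intro add_left_mono mult_left_mono nn_integral_mono) (auto simp: indicator_def)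
  have ufin: "u t < \<infinity>" if t: "t \<in> {0..T}" for t
  proof -
    have "(\<integral>\<^sup>+s. indicator {0..t} s * (ennreal (K s) * \<phi> s) \<partial>lborel) \<le> (\<integral>\<^sup>+s. ennreal (K s) * \<phi> T \<partial>lborel)"
      using t monoD[OF \<phi>(1)] by (intro nn_integral_mono) (auto simp: indicator_def intro!: mult_left_mono)
    also have "\<dots> = ennreal (integral\<^sup>L lborel K) * \<phi> T"
      using K by (subst nn_integral_multc) (auto simp: nn_integral_eq_integral)
    also have "\<dots> < \<infinity>" using \<phi>(2) by (simp add: ennreal_mult_less_top)
    finally show ?thesis unfolding u_def by (simp add: ennreal_mult_less_top)
  qed
  have ustep: "u t \<le> u s + ennreal C * (ennreal (G t - G s) * u t)" if st: "0 \<le> s" "s \<le> t" "t \<le> T" for s t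
  proof -
    have "(\<integral>\<^sup>+r. indicator {0..t} r * (ennreal (K r) * \<phi> r) \<partial>lborel) =
      (\<integral>\<^sup>+r. indicator {0..s} r * (ennreal (K r) * \<phi> r) + indicator {s<..t} r * (ennreal (K r) * \<phi> r) \<partial>lborel)"
      using st by (intro nn_integral_cong) (auto simp: indicator_def)
    also have "\<dots> = (\<integral>\<^sup>+r. indicator {0..s} r * (ennreal (K r) * \<phi> r) \<partial>lborel) + (\<integral>\<^sup>+r. indicator {s<..t} r * (ennreal (K r) * \<phi> r) \<partial>lborel)"
      by (rule nn_integral_add) auto
    also have "(\<integral>\<^sup>+r. indicator {s<..t} r * (ennreal (K r) * \<phi> r) \<partial>lborel) \<le> (\<integral>\<^sup>+r. (indicator {s<..t} r * ennreal (K r)) * u t \<partial>lborel)"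
    proof (rule nn_integral_mono)
      fix r
      have "\<phi> r \<le> u t" if "r \<in> {s<..t}" using \<phi>u[of r] umono[of r t] that st by (auto intro: order_trans)
      then show "indicator {s<..t} r * (ennreal (K r) * \<phi> r) \<le> (indicator {s<..t} r * ennreal (K r)) * u t"
        by (auto simp: indicator_def intro!: mult_left_mono)
    qed
    also have "(\<integral>\<^sup>+r. (indicator {s<..t} r * ennreal (K r)) * u t \<partial>lborel) = ennreal (G t - G s) * u t"
      by (subst nn_integral_multc) (auto simp: Gnn[OF st(1,2)])
    finally have "(\<integral>\<^sup>+r. indicator {0..t} r * (ennreal (K r) * \<phi> r) \<partial>lborel) \<le>
      (\<integral>\<^sup>+r. indicator {0..s} r * (ennreal (K r) * \<phi> r) \<partial>lborel) + ennreal (G t - G s) * u t" by (simp add: add_left_mono)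
    then have "u t \<le> ennreal A + ennreal C * ((\<integral>\<^sup>+r. indicator {0..s} r * (ennreal (K r) * \<phi> r) \<partial>lborel) + ennreal (G t - G s) * u t)"
      unfolding u_def[of t] by (intro add_left_mono mult_left_mono) auto
    then show ?thesis unfolding u_def[of s] by (simp add: distrib_left add.assoc)
  qed
  define v where "v t = enn2real (u t)" for t
  have uv: "u t = ennreal (v t)" if "t \<in> {0..T}" for t unfolding v_def using ufin[OF that] by (simp add: ennreal_enn2real_if)
  have vnn: "0 \<le> v t" for t by (simp add: v_def)
  \<comment> \<open>The later value occurs on both sides of \<open>ustep\<close>; absorbing it on
    the left produces the factor 1 - C \<delta>. This is where the values have to be finite.\<close>
  have vstep: "v t * (1 - C * \<delta>) \<le> v s" if st: "0 \<le> s" "s \<le> t" "t \<le> T" and d: "G t - G s \<le> \<delta>" for s t \<delta>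
  proof -
    have "ennreal (v t) \<le> ennreal (v s + C * ((G t - G s) * v t))"
      using ustep[OF st] uv[of t] uv[of s] st vnn AC Gmono[OF st(1,2)] by (simp add: ennreal_mult)
    then have "v t \<le> v s + C * ((G t - G s) * v t)"
      using vnn AC Gmono[OF st(1,2)] by (subst (asm) ennreal_le_iff) auto
    moreover have "C * ((G t - G s) * v t) \<le> C * (\<delta> * v t)"
      using d vnn AC by (intro mult_left_mono mult_right_mono) auto
    ultimately show ?thesis by (simp add: algebra_simps)
  qed
  have u0: "v 0 = A"
  proof -
    have "(\<integral>\<^sup>+s. indicator {0..0} s * (ennreal (K s) * \<phi> s) \<partial>lborel) = (\<integral>\<^sup>+(s::real). 0 \<partial>lborel)"
    proof (rule nn_integral_cong_AE)
      show "AE s in lborel. indicator {0..0} s * (ennreal (K s) * \<phi> s) = 0"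
        using AE_lborel_singleton[of "0::real"] by eventually_elim (simp add: indicator_def)
    qed
    then show ?thesis using AC by (simp add: v_def u_def)
  qed
  \<comment> \<open>Time is measured by G: continuity and the intermediate value theorem supply a
    time at which G equals n \<delta>, so that each step uses up weight at most \<delta>.\<close>
  have ind: "v t * (1 - C * \<delta>) ^ n \<le> A" if t: "t \<in> {0..T}" and G: "G t \<le> real n * \<delta>" and \<delta>: "0 \<le> \<delta>" "C * \<delta> \<le> 1" for t n \<delta>
    using t G
  proof (induction n arbitrary: t)
    case 0
    then show ?case using vstep[of 0 t 0] u0 G0 by auto
  next
    case (Suc n)
    have p: "0 \<le> 1 - C * \<delta>" "1 - C * \<delta> \<le> 1" using \<delta> AC by auto
    show ?case
    proof (cases "G t \<le> real n * \<delta>")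
      case True
      have "v t * (1 - C * \<delta>) ^ Suc n \<le> v t * (1 - C * \<delta>) ^ n"
        using p vnn by (intro mult_left_mono) (auto intro: mult_left_le_one_le)
      then show ?thesis using Suc.IH[OF Suc.prems(1) True] by simp
    next
      case False
      have "\<exists>s\<ge>0. s \<le> t \<and> G s = real n * \<delta>"
        using False \<delta> G0 Suc.prems by (intro IVT' continuous_on_subset[OF Gc]) auto
      then obtain s where s: "0 \<le> s" "s \<le> t" "G s = real n * \<delta>" by blast
      have "v t * (1 - C * \<delta>) \<le> v s" using s Suc.prems by (intro vstep) (auto simp: algebra_simps)
      then have "v t * (1 - C * \<delta>) * (1 - C * \<delta>) ^ n \<le> v s * (1 - C * \<delta>) ^ n" using p by (intro mult_right_mono) auto
      also have "\<dots> \<le> A" using s Suc.prems by (intro Suc.IH) auto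
      finally show ?thesis by (simp add: mult.assoc)
    qed
  qed
  have GT: "0 \<le> G T" using Gmono[of 0 T] G0 T by simp
  \<comment> \<open>With \<delta> = G T / n the factors accumulate to (1 - C G T / n)^n, which tends
    to exp (- C G T).\<close>
  have "(\<lambda>n. v T * (1 + (- (C * G T)) / real n) ^ n) \<longlonglongrightarrow> v T * exp (- (C * G T))"
    by (intro tendsto_mult tendsto_const tendsto_exp_limit_sequentially)
  moreover have "\<forall>\<^sub>F n in sequentially. v T * (1 + (- (C * G T)) / real n) ^ n \<le> A"
  proof -
    obtain n0 :: nat where n0: "C * G T \<le> real n0" using real_arch_simple by blast
    show ?thesis using eventually_ge_at_top[of "Suc n0"]
    proof eventually_elim
      case (elim n)
      then have n: "0 < n" "C * G T \<le> real n" using n0 by auto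
      have "v T * (1 - C * (G T / real n)) ^ n \<le> A"
        using n T GT by (intro ind) (auto simp: field_simps)
      then show ?case by simp
    qed
  qed
  ultimately have "v T * exp (- (C * G T)) \<le> A"
    by (intro tendsto_upperbound[where f = "\<lambda>n. v T * (1 + (- (C * G T)) / real n) ^ n"]) auto
  then have "v T \<le> A * exp (C * G T)" by (simp add: exp_minus field_simps)
  then have "ennreal (v T) \<le> ennreal (A * exp (C * G T))" by (rule ennreal_leI)
  then show ?thesis using \<phi>u[of T] uv[of T] T by (simp add: G_def)
qed

section \<open>Matrix-valued integrals\<close>

lemma (in prob_space) indep_vars_imp_indep_var:
  assumes X: "indep_vars M' X I" and pq: "p \<in> I" "q \<in> I" "p \<noteq> q"
  shows "indep_var (M' p) (X p) (M' q) (X q)"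
proof -
  have "indep_var (PiM {p} M') (\<lambda>\<omega>. restrict (\<lambda>i. X i \<omega>) {p}) (PiM {q} M') (\<lambda>\<omega>. restrict (\<lambda>i. X i \<omega>) {q})"
    using pq by (intro indep_var_restrict[OF X]) auto
  from indep_var_compose[OF this measurable_component_singleton[of p] measurable_component_singleton[of q]]
  show ?thesis by (simp add: o_def)
qed

text \<open>Entry (i, j) of an integral against B involves only column j of B, so every entry can be
  treated inside the locale of one column.\<close>

lemma (in filtered_prob_space) matrix_brownian_motion_column:
  assumes "matrix_brownian_motion M F (B :: real \<Rightarrow> 'a \<Rightarrow> real^'n^'n)"
  shows "orthogonal_bm M F (\<lambda>m t \<omega>. B t \<omega> $ m $ j)"
proof
  show bm: "std_brownian_motion M F (\<lambda>t \<omega>. B t \<omega> $ m $ j)" for m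
    using assms by (simp add: matrix_brownian_motion_def)
  fix m m' :: 'n and s t :: real and Z :: "'a \<Rightarrow> real" and C :: real
  assume ne: "m \<noteq> m'" and st: "0 \<le> s" "s \<le> t" and Z: "Z \<in> borel_measurable (F s)" "\<And>\<omega>. \<omega> \<in> space M \<Longrightarrow> \<bar>Z \<omega>\<bar> \<le> C"
  have iv: "indep_vars (\<lambda>_. \<Pi>\<^sub>M t\<in>{0..}. borel) (\<lambda>(i, j) \<omega>. \<lambda>t\<in>{0..}. B t \<omega> $ i $ j) (UNIV :: ('n \<times> 'n) set)"
    using assms by (simp add: matrix_brownian_motion_def)
  have "indep_var (\<Pi>\<^sub>M t\<in>{0..}. borel) (\<lambda>\<omega>. \<lambda>t\<in>{0::real..}. B t \<omega> $ m $ j) (\<Pi>\<^sub>M t\<in>{0..}. borel) (\<lambda>\<omega>. \<lambda>t\<in>{0::real..}. B t \<omega> $ m' $ j)"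
    using indep_vars_imp_indep_var[OF iv, of "(m, j)" "(m', j)"] ne by simp
  from bm_orthogonal[OF bm bm this st Z]
  show "expectation (\<lambda>\<omega>. Z \<omega> * ((B t \<omega> $ m $ j - B s \<omega> $ m $ j) * (B t \<omega> $ m' $ j - B s \<omega> $ m' $ j))) = 0" .
qed

lemma (in orthogonal_bm) approx_integral_cong:
  assumes "approx_integral T H I" "\<And>t \<omega>. t \<in> dyadic T \<Longrightarrow> \<omega> \<in> space M \<Longrightarrow> I' t \<omega> = I t \<omega>"
  shows "approx_integral T H I'"
proof -
  obtain D S where DS: "\<And>N. simple_integral (D N) (S N)"
    and c: "AE \<omega> in M. (\<lambda>N. int_cut T always (sq_norm (\<lambda>i s \<omega>. D N i s \<omega> - H i s \<omega>)) \<omega>) \<longlonglongrightarrow> 0"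
    and cS: "AE \<omega> in M. \<forall>t\<in>dyadic T. (\<lambda>N. S N t \<omega>) \<longlonglongrightarrow> I t \<omega>"
    using assms(1) unfolding approx_integral_def by blast
  have "AE \<omega> in M. \<forall>t\<in>dyadic T. (\<lambda>N. S N t \<omega>) \<longlonglongrightarrow> I' t \<omega>"
    using cS AE_space by eventually_elim (use assms(2) in auto)
  moreover have "I' t \<in> borel_measurable M" if "t \<in> dyadic T" for t
    using assms that measurable_cong[of M "I' t" "I t" borel] unfolding approx_integral_def by auto
  ultimately show ?thesis using assms(1) DS c unfolding approx_integral_def by blast
qed

definition norm_sq :: "(real \<Rightarrow> 'a \<Rightarrow> 'b::real_normed_vector) \<Rightarrow> real \<Rightarrow> 'a \<Rightarrow> ennreal" where
  "norm_sq X s \<omega> = ennreal ((norm (X s \<omega>))\<^sup>2)"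

lemma ennreal_norm_add3:
  "ennreal ((norm (a + b + c))\<^sup>2) \<le> 3 * ennreal ((norm a)\<^sup>2) + 3 * ennreal ((norm b)\<^sup>2) + 3 * ennreal ((norm c)\<^sup>2)"
proof -
  have r: "(x + y + z)\<^sup>2 \<le> 3 * x\<^sup>2 + 3 * y\<^sup>2 + 3 * z\<^sup>2" for x y z :: real
    using zero_le_power2[of "x - y"] zero_le_power2[of "x - z"] zero_le_power2[of "y - z"]
    by (simp add: power2_eq_square algebra_simps)
  have "norm (a + b + c) \<le> norm a + norm b + norm c"
    using norm_triangle_ineq[of "a + b" c] norm_triangle_ineq[of a b] by linarith
  then have "(norm (a + b + c))\<^sup>2 \<le> (norm a + norm b + norm c)\<^sup>2" by (intro power_mono) auto
  also note r
  finally have "ennreal ((norm (a + b + c))\<^sup>2) \<le> ennreal (3 * (norm a)\<^sup>2 + 3 * (norm b)\<^sup>2 + 3 * (norm c)\<^sup>2)"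
    by (rule ennreal_leI)
  then show ?thesis by (simp add: ennreal_mult')
qed

lemma ennreal_norm_add2:
  "ennreal ((norm (a + b))\<^sup>2) \<le> 2 * ennreal ((norm a)\<^sup>2) + 2 * ennreal ((norm b)\<^sup>2)"
proof -
  have r: "(x + y)\<^sup>2 \<le> 2 * x\<^sup>2 + 2 * y\<^sup>2" for x y :: real
    using zero_le_power2[of "x - y"] by (simp add: power2_eq_square algebra_simps)
  have "(norm (a + b))\<^sup>2 \<le> (norm a + norm b)\<^sup>2" by (intro power_mono norm_triangle_ineq) auto
  also note r
  finally have "ennreal ((norm (a + b))\<^sup>2) \<le> ennreal (2 * (norm a)\<^sup>2 + 2 * (norm b)\<^sup>2)"
    by (rule ennreal_leI)
  then show ?thesis by (simp add: ennreal_mult')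
qed

lemma norm_matrix_sq: "(norm (A :: real^'n^'m))\<^sup>2 = (\<Sum>i\<in>UNIV. \<Sum>j\<in>UNIV. (A $ i $ j)\<^sup>2)"
  by (simp add: norm_vec_def L2_set_def sum_nonneg)

lemma sup_cut_upper: "t \<in> dyadic T \<Longrightarrow> c t \<omega> \<Longrightarrow> f t \<omega> \<le> sup_cut T c f \<omega>"
  unfolding sup_cut_def by (rule SUP_upper2[of t]) auto

lemma sup_cut_least: "(\<And>t. t \<in> dyadic T \<Longrightarrow> c t \<omega> \<Longrightarrow> f t \<omega> \<le> y) \<Longrightarrow> sup_cut T c f \<omega> \<le> y"
  unfolding sup_cut_def by (intro SUP_least) auto

text \<open>The dyadic points used approach s from below, so they respect both the bound r \<le> s
  and the cutoff.\<close>

lemma le_sup_cut: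
  assumes T: "0 < T" and s: "0 \<le> s" "s \<le> T" and c: "\<And>r. 0 \<le> r \<Longrightarrow> r \<le> s \<Longrightarrow> c r \<omega>"
    and Z: "continuous_on {0..T} (\<lambda>t. Z t \<omega>)"
  shows "norm_sq Z s \<omega> \<le> sup_cut T (\<lambda>r \<omega>. r \<le> s \<and> c r \<omega>) (norm_sq Z) \<omega>"
proof -
  let ?g = "\<lambda>n. grid T n (grid_index T n s)"
  have gd: "?g n \<in> dyadic T" and gs: "0 \<le> ?g n" "?g n \<le> s" for n
    using grid_index_in_dyadic[OF T s] grid_index_grid(1)[OF T s(1)] grid_nonneg[OF T] by auto
  have "(\<lambda>n. Z (?g n) \<omega>) \<longlonglongrightarrow> Z s \<omega>"
  proof (rule continuous_on_tendsto_compose[OF Z grid_index_tendsto[OF T s(1)]])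
    have "?g n \<in> {0..T}" for n using gs[of n] s by auto
    then show "\<forall>\<^sub>F n in sequentially. ?g n \<in> {0..T}" by (rule always_eventually[OF allI])
  qed (use s in auto)
  then have "(\<lambda>n. norm_sq Z (?g n) \<omega>) \<longlonglongrightarrow> norm_sq Z s \<omega>"
    unfolding norm_sq_def by (intro tendsto_ennrealI tendsto_power tendsto_norm)
  then show ?thesis
    by (rule LIMSEQ_le_const2) (use gd gs c in \<open>auto intro!: sup_cut_upper\<close>)
qed

lemma SUP_eq_sup_cut:
  assumes T: "0 < T" and Z: "continuous_on {0..T} (\<lambda>t. Z t \<omega>)"
  shows "(SUP t\<in>{0..T}. norm_sq Z t \<omega>) = sup_cut T always (norm_sq Z) \<omega>"
proof (rule antisym)
  show "(SUP t\<in>{0..T}. norm_sq Z t \<omega>) \<le> sup_cut T always (norm_sq Z) \<omega>"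
  proof (rule SUP_least)
    fix t assume t: "t \<in> {0..T}"
    have "norm_sq Z t \<omega> \<le> sup_cut T (\<lambda>r \<omega>. r \<le> t \<and> True) (norm_sq Z) \<omega>"
      by (rule le_sup_cut[where c = "\<lambda>_ _. True" and Z = Z and s = t and \<omega> = \<omega>, OF T _ _ _ Z]) (use t in auto)
    also have "\<dots> \<le> sup_cut T always (norm_sq Z) \<omega>" by (intro sup_cut_least sup_cut_upper) auto
    finally show "norm_sq Z t \<omega> \<le> sup_cut T always (norm_sq Z) \<omega>" .
  qed
  show "sup_cut T always (norm_sq Z) \<omega> \<le> (SUP t\<in>{0..T}. norm_sq Z t \<omega>)"
    using dyadic_subset[OF T] by (intro sup_cut_least SUP_upper) auto
qed

lemma dyadic_dense_eq:
  fixes f g :: "real \<Rightarrow> 'b::t2_space"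
  assumes T: "0 < T" and "continuous_on {0..T} f" "continuous_on {0..T} g" "\<And>t. t \<in> dyadic T \<Longrightarrow> f t = g t" and t: "t \<in> {0..T}"
  shows "f t = g t"
proof -
  let ?g = "\<lambda>n. grid T n (grid_index T n t)"
  have gd: "?g n \<in> dyadic T" for n using grid_index_in_dyadic[OF T] t by auto
  have "?g n \<in> {0..T}" for n using gd[of n] dyadic_subset[OF T] by blast
  then have gT: "\<forall>\<^sub>F n in sequentially. ?g n \<in> {0..T}" by (rule always_eventually[OF allI])
  have "(\<lambda>n. f (?g n)) \<longlonglongrightarrow> f t"
    by (rule continuous_on_tendsto_compose[OF assms(2) grid_index_tendsto[OF T] t gT]) (use t in simp)
  moreover have "(\<lambda>n. g (?g n)) \<longlonglongrightarrow> g t"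
    by (rule continuous_on_tendsto_compose[OF assms(3) grid_index_tendsto[OF T] t gT]) (use t in simp)
  ultimately show ?thesis using assms(4)[OF gd] LIMSEQ_unique by auto
qed

section \<open>Exit times, progressive coefficients and the maximal inequality for matrices\<close>

context filtered_prob_space begin

lemma cutoff_time: "cutoff T (\<lambda>s _. s \<le> u)"
  unfolding cutoff_def
proof (intro conjI ballI allI impI)
  fix s assume "s \<in> {0..T}"
  show "{\<omega>\<in>space M. s \<le> u} \<in> sets (F s)"
    using sets.top[of "F s"] by (cases "s \<le> u") (simp_all add: space_F)
next
  fix t assume t: "t \<in> {0<..T}" and le: "\<forall>s\<in>{0..<t}. s \<le> u"
  show "t \<le> u"
  proof (rule dense_le_bounded[of 0])
    show "s \<le> u" if "0 < s" "s < t" for s using le that by auto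
  qed (use t in auto)
qed auto

text \<open>The stopping time is the exit from a closed ball. Being inside up to time s is decided
  at the dyadic points of [0, s], since paths are continuous and the ball is closed; the case s = 0
  stands apart because a dyadic grid needs a positive length.\<close>

lemma cutoff_norm_le:
  fixes X :: "real \<Rightarrow> 'a \<Rightarrow> 'b::{real_normed_vector, second_countable_topology}"
  assumes T: "0 < T" and X: "adapted_on F {0..T} X" "\<And>\<omega>. \<omega> \<in> space M \<Longrightarrow> continuous_on {0..T} (\<lambda>t. X t \<omega>)"
  shows "cutoff T (\<lambda>s \<omega>. \<forall>r\<in>{0..s}. norm (X r \<omega>) \<le> R)"
  unfolding cutoff_def
proof (intro conjI ballI allI impI)
  fix s assume s: "s \<in> {0..T}"
  have XF: "X r \<in> borel_measurable (F s)" if "0 \<le> r" "r \<le> s" for r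
    using X(1) that s measurable_F_mono[of r s "X r"] by (auto simp: adapted_on_def)
  show "{\<omega>\<in>space M. \<forall>r\<in>{0..s}. norm (X r \<omega>) \<le> R} \<in> sets (F s)"
  proof (cases "s = 0")
    case True
    then have "{\<omega>\<in>space M. \<forall>r\<in>{0..s}. norm (X r \<omega>) \<le> R} = {\<omega>\<in>space (F s). norm (X 0 \<omega>) \<le> R}" by (auto simp: space_F)
    moreover have "{\<omega>\<in>space (F s). norm (X 0 \<omega>) \<le> R} \<in> sets (F s)"
    proof -
      have [measurable]: "X 0 \<in> borel_measurable (F s)" using XF[of 0] True by simp
      show ?thesis by measurable
    qed
    ultimately show ?thesis by simp
  next
    case False
    then have s0: "0 < s" using s by simp
    have eq: "{\<omega>\<in>space M. \<forall>r\<in>{0..s}. norm (X r \<omega>) \<le> R} = {\<omega>\<in>space (F s). \<forall>r\<in>dyadic s. norm (X r \<omega>) \<le> R}"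
    proof (intro Collect_cong conj_cong)
      fix \<omega> show "\<omega> \<in> space M \<longleftrightarrow> \<omega> \<in> space (F s)" by (simp add: space_F)
      assume "\<omega> \<in> space (F s)"
      then have o: "\<omega> \<in> space M" by (simp add: space_F)
      show "(\<forall>r\<in>{0..s}. norm (X r \<omega>) \<le> R) \<longleftrightarrow> (\<forall>r\<in>dyadic s. norm (X r \<omega>) \<le> R)"
      proof
        assume d: "\<forall>r\<in>dyadic s. norm (X r \<omega>) \<le> R"
        show "\<forall>r\<in>{0..s}. norm (X r \<omega>) \<le> R"
        proof
          fix r assume r: "r \<in> {0..s}"
          have gd: "grid s n (grid_index s n r) \<in> dyadic s" for n using grid_index_in_dyadic[OF s0] r by auto
          have "grid s n (grid_index s n r) \<in> {0..s}" for n using gd[of n] dyadic_subset[OF s0] by blast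
          then have gs: "\<forall>\<^sub>F n in sequentially. grid s n (grid_index s n r) \<in> {0..s}" by (rule always_eventually[OF allI])
          have "(\<lambda>n. X (grid s n (grid_index s n r)) \<omega>) \<longlonglongrightarrow> X r \<omega>"
            by (rule continuous_on_tendsto_compose[OF continuous_on_subset[OF X(2)[OF o], of "{0..s}"] grid_index_tendsto[OF s0] r gs])
              (use r s in auto)
          then have "(\<lambda>n. norm (X (grid s n (grid_index s n r)) \<omega>)) \<longlonglongrightarrow> norm (X r \<omega>)" by (rule tendsto_norm)
          then show "norm (X r \<omega>) \<le> R" by (rule LIMSEQ_le_const2) (use d gd in auto)
        qed
      qed (use dyadic_subset[OF s0] in auto)
    qed
    have "{\<omega>\<in>space (F s). norm (X r \<omega>) \<le> R} \<in> sets (F s)" if "r \<in> dyadic s" for r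
    proof -
      have [measurable]: "X r \<in> borel_measurable (F s)" using XF that dyadic_subset[OF s0] by auto
      show ?thesis by measurable
    qed
    then have "(\<Inter>r\<in>dyadic s. {\<omega>\<in>space (F s). norm (X r \<omega>) \<le> R}) \<in> sets (F s)"
      by (intro sets.countable_INT' countable_dyadic) (use zero_in_dyadic[of s] in blast)+
    also have "(\<Inter>r\<in>dyadic s. {\<omega>\<in>space (F s). norm (X r \<omega>) \<le> R}) = {\<omega>\<in>space (F s). \<forall>r\<in>dyadic s. norm (X r \<omega>) \<le> R}"
      using zero_in_dyadic[of s] by blast
    finally have "{\<omega>\<in>space (F s). \<forall>r\<in>dyadic s. norm (X r \<omega>) \<le> R} \<in> sets (F s)" .
    then show ?thesis using eq by simp
  qed
next
  fix \<omega> t assume o: "\<omega> \<in> space M" and t: "t \<in> {0<..T}" and le: "\<forall>s\<in>{0..<t}. \<forall>r\<in>{0..s}. norm (X r \<omega>) \<le> R"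
  fix r assume r: "r \<in> {0..t}"
  have lt: "norm (X q \<omega>) \<le> R" if "0 \<le> q" "q < t" for q using le that by auto
  show "norm (X r \<omega>) \<le> R"
  proof (cases "r < t")
    case False
    then have rt: "r = t" using r by simp
    define q where "q n = t * (real n / real (Suc n))" for n
    have q: "0 \<le> q n" "q n < t" for n using t by (auto simp: q_def field_simps)
    have "q \<longlonglongrightarrow> t * 1" unfolding q_def by (intro tendsto_intros LIMSEQ_n_over_Suc_n)
    then have ql: "q \<longlonglongrightarrow> t" by simp
    have "q n \<in> {0..T}" for n using q[of n] t by auto
    then have qT: "\<forall>\<^sub>F n in sequentially. q n \<in> {0..T}" by (rule always_eventually[OF allI])
    have "(\<lambda>n. X (q n) \<omega>) \<longlonglongrightarrow> X t \<omega>"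
      by (rule continuous_on_tendsto_compose[OF X(2)[OF o] ql _ qT]) (use t in auto)
    then have "(\<lambda>n. norm (X (q n) \<omega>)) \<longlonglongrightarrow> norm (X t \<omega>)" by (rule tendsto_norm)
    then show ?thesis unfolding rt by (rule LIMSEQ_le_const2) (use lt q in auto)
  qed (use lt r in auto)
qed auto

text \<open>The path is sampled at the grid point of [0, t] to the left of the current time; each
  sample is known at time t, and continuity gives convergence.\<close>

lemma progressive_continuous:
  fixes X :: "real \<Rightarrow> 'a \<Rightarrow> 'b::{second_countable_topology, real_normed_vector}"
  assumes X: "adapted_on F {0..T} X" "\<And>\<omega>. \<omega> \<in> space M \<Longrightarrow> continuous_on {0..T} (\<lambda>t. X t \<omega>)"
  shows "progressive T X"
  unfolding progressive_def
proof
  fix t assume t: "t \<in> {0..T}"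
  have XF: "X r \<in> borel_measurable (F t)" if "0 \<le> r" "r \<le> t" for r
    using X(1) that t measurable_F_mono[of r t "X r"] by (auto simp: adapted_on_def)
  have [measurable]: "Measurable.pred (borel \<Otimes>\<^sub>M F t) (\<lambda>x. fst x \<in> {0..t})" by measurable
  show "(\<lambda>(s, \<omega>). if s \<in> {0..t} then X s \<omega> else 0) \<in> borel_measurable (borel \<Otimes>\<^sub>M F t)"
  proof (cases "t = 0")
    case True
    have [measurable]: "X 0 \<in> borel_measurable (F t)" using XF[of 0] True by simp
    have "(\<lambda>x. if fst x \<in> {0..t} then X 0 (snd x) else 0) \<in> borel_measurable (borel \<Otimes>\<^sub>M F t)" by measurable
    also have "(\<lambda>x. if fst x \<in> {0..t} then X 0 (snd x) else 0) = (\<lambda>(s, \<omega>). if s \<in> {0..t} then X s \<omega> else 0)"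
      using True by (auto simp: fun_eq_iff)
    finally show ?thesis .
  next
    case False
    then have t0: "0 < t" using t by simp
    \<comment> \<open>Measurability of the composition is checked for every index k, including grid
      points beyond t; the minimum with t keeps these samples measurable with respect to
      \<open>F t\<close>.\<close>
    let ?f = "\<lambda>n x. if fst x \<in> {0..t} then X (min t (grid t n (grid_index t n (fst x)))) (snd x) else 0"
    have "?f n \<in> borel_measurable (borel \<Otimes>\<^sub>M F t)" for n
    proof -
      have "(\<lambda>x. X (min t (grid t n (grid_index t n (fst x)))) (snd x)) \<in> borel_measurable (borel \<Otimes>\<^sub>M F t)"
      proof (rule measurable_compose_countable[where f = "\<lambda>k x. X (min t (grid t n k)) (snd x)" and g = "\<lambda>x. grid_index t n (fst x)"])
        fix k
        have [measurable]: "X (min t (grid t n k)) \<in> borel_measurable (F t)"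
          using XF grid_nonneg[OF t0, of n k] t0 by auto
        show "(\<lambda>x. X (min t (grid t n k)) (snd x)) \<in> borel_measurable (borel \<Otimes>\<^sub>M F t)" by measurable
      qed measurable
      then show ?thesis by measurable
    qed
    then show ?thesis
    proof (rule borel_measurable_LIMSEQ_metric)
      fix x :: "real \<times> 'a" assume "x \<in> space (borel \<Otimes>\<^sub>M F t)"
      then have o: "snd x \<in> space M" by (auto simp: space_pair_measure space_F)
      show "(\<lambda>n. ?f n x) \<longlonglongrightarrow> (case x of (s, \<omega>) \<Rightarrow> if s \<in> {0..t} then X s \<omega> else 0)"
      proof (cases "fst x \<in> {0..t}")
        case True
        have "(\<lambda>n. min t (grid t n (grid_index t n (fst x)))) \<longlonglongrightarrow> min t (fst x)"
          by (intro tendsto_min tendsto_const grid_index_tendsto t0) (use True in auto)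
        then have l: "(\<lambda>n. min t (grid t n (grid_index t n (fst x)))) \<longlonglongrightarrow> fst x" using True by (simp add: min_absorb2)
        have "(\<lambda>n. X (min t (grid t n (grid_index t n (fst x)))) (snd x)) \<longlonglongrightarrow> X (fst x) (snd x)"
        proof (rule continuous_on_tendsto_compose[OF X(2)[OF o] l])
          have "min t (grid t n (grid_index t n (fst x))) \<in> {0..T}" for n
            using grid_nonneg[OF t0, of n "grid_index t n (fst x)"] t by auto
          then show "\<forall>\<^sub>F n in sequentially. min t (grid t n (grid_index t n (fst x))) \<in> {0..T}"
            by (rule always_eventually[OF allI])
        qed (use True t in auto)
        then show ?thesis using True by (simp add: case_prod_beta)
      next
        case False
        show ?thesis unfolding case_prod_beta if_not_P[OF False] by simp
      qed
    qed
  qed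
qed

lemma progressive_coefficient:
  fixes X :: "real \<Rightarrow> 'a \<Rightarrow> 'b::{second_countable_topology, real_normed_vector}" and g :: "real \<Rightarrow> 'b \<Rightarrow> 'c::{second_countable_topology, real_normed_vector}"
  assumes g: "(\<lambda>(t, y). g t y) \<in> borel_measurable (restrict_space borel {0..} \<Otimes>\<^sub>M borel)" and X: "progressive T X"
  shows "progressive T (\<lambda>s \<omega>. g s (X s \<omega>))"
  unfolding progressive_def
proof
  fix t assume t: "t \<in> {0..T}"
  have g': "(\<lambda>(r, y). indicator {0..} r *\<^sub>R g r y) \<in> borel_measurable (borel \<Otimes>\<^sub>M borel)"
    using borel_measurable_restrict_pair_iff[of "{0..}" borel g borel] g by simp
  have X': "(\<lambda>(s, \<omega>). if s \<in> {0..t} then X s \<omega> else 0) \<in> borel_measurable (borel \<Otimes>\<^sub>M F t)"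
    using progressiveD[OF X] t by auto
  have "(\<lambda>x. (fst x, (case x of (s, \<omega>) \<Rightarrow> if s \<in> {0..t} then X s \<omega> else 0))) \<in> measurable (borel \<Otimes>\<^sub>M F t) (borel \<Otimes>\<^sub>M borel)"
    by (intro measurable_Pair measurable_fst X')
  from measurable_compose[OF this g']
  have [measurable]: "(\<lambda>x. case (fst x, (case x of (s, \<omega>) \<Rightarrow> if s \<in> {0..t} then X s \<omega> else 0)) of (r, y) \<Rightarrow> indicator {0..} r *\<^sub>R g r y)
     \<in> borel_measurable (borel \<Otimes>\<^sub>M F t)" .
  have "(\<lambda>x. indicator {0..t} (fst x) *\<^sub>R (case (fst x, (case x of (s, \<omega>) \<Rightarrow> if s \<in> {0..t} then X s \<omega> else 0)) of (r, y) \<Rightarrow> indicator {0..} r *\<^sub>R g r y))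
     \<in> borel_measurable (borel \<Otimes>\<^sub>M F t)"
    by (intro borel_measurable_scaleR) measurable
  also have "(\<lambda>x. indicator {0..t} (fst x) *\<^sub>R (case (fst x, (case x of (s, \<omega>) \<Rightarrow> if s \<in> {0..t} then X s \<omega> else 0)) of (r, y) \<Rightarrow> indicator {0..} r *\<^sub>R g r y))
     = (\<lambda>(s, \<omega>). if s \<in> {0..t} then g s (X s \<omega>) else 0)"
    by (auto simp: fun_eq_iff indicator_def)
  finally show "(\<lambda>(s, \<omega>). if s \<in> {0..t} then g s (X s \<omega>) else 0) \<in> borel_measurable (borel \<Otimes>\<^sub>M F t)" .
qed

lemma progressive_norm_sq:
  fixes X :: "real \<Rightarrow> 'a \<Rightarrow> 'b::{second_countable_topology, real_normed_vector}"
  shows "progressive T X \<Longrightarrow> progressive T (norm_sq X)"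
  unfolding norm_sq_def[abs_def] by (rule progressive_compose[where g = "\<lambda>x. ennreal ((norm x)\<^sup>2)"]) auto

lemma progressive_entry:
  fixes V :: "real \<Rightarrow> 'a \<Rightarrow> real^'n^'m"
  shows "progressive T V \<Longrightarrow> progressive T (\<lambda>s \<omega>. V s \<omega> $ i $ j)"
  by (rule progressive_compose[where g = "\<lambda>A. A $ i $ j"]) (auto intro!: borel_measurable_continuous_onI continuous_intros)

lemma int_cut_add:
  assumes c: "cutoff T c" "0 < T" and f: "progressive T f" "progressive T g" and o: "\<omega> \<in> space M"
  shows "int_cut T c (\<lambda>s \<omega>. f s \<omega> + g s \<omega>) \<omega> = int_cut T c f \<omega> + int_cut T c g \<omega>"
proof -
  have "int_cut T c (\<lambda>s \<omega>. f s \<omega> + g s \<omega>) \<omega> = (\<integral>\<^sup>+s. (if s \<in> {0..T} \<and> c s \<omega> then f s \<omega> else 0) + (if s \<in> {0..T} \<and> c s \<omega> then g s \<omega> else 0) \<partial>lborel)"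
    unfolding int_cut_def by (intro nn_integral_cong) auto
  also have "\<dots> = int_cut T c f \<omega> + int_cut T c g \<omega>"
    unfolding int_cut_def using cut_section[OF c f(1) o] cut_section[OF c f(2) o] by (intro nn_integral_add) auto
  finally show ?thesis .
qed

lemma int_cut_sum:
  assumes c: "cutoff T c" "0 < T" and f: "\<And>i. i \<in> A \<Longrightarrow> progressive T (f i)" and o: "\<omega> \<in> space M"
  shows "int_cut T c (\<lambda>s \<omega>. \<Sum>i\<in>A. f i s \<omega>) \<omega> = (\<Sum>i\<in>A. int_cut T c (f i) \<omega>)"
  using f
proof (induction A rule: infinite_finite_induct)
  case (insert x A)
  then show ?case using int_cut_add[OF c _ progressive_sum[of A T f] o, of "f x"] by simp
qed (simp_all add: int_cut_def cong: if_cong)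

lemma drift_bound:
  fixes \<beta> :: "real \<Rightarrow> 'a \<Rightarrow> 'b::{banach, second_countable_topology}"
  assumes c: "cutoff T c" and T: "0 < T" and \<beta>: "progressive T \<beta>" and o: "\<omega> \<in> space M"
  shows "sup_cut T c (norm_sq (\<lambda>t \<omega>. LINT s:{0..t}|lborel. \<beta> s \<omega>)) \<omega> \<le> ennreal T * int_cut T c (norm_sq \<beta>) \<omega>"
proof (rule sup_cut_least)
  fix t assume t: "t \<in> dyadic T" and ct: "c t \<omega>"
  then have t01: "0 \<le> t" "t \<le> T" using dyadic_subset[OF T] by auto
  have [measurable]: "(\<lambda>s. if s \<in> {0..T} then \<beta> s \<omega> else 0) \<in> borel_measurable borel"
    by (rule progressive_section[OF \<beta> _ o]) (use T in simp)
  have "(\<lambda>s. indicator {0..t} s *\<^sub>R (if s \<in> {0..T} then \<beta> s \<omega> else 0)) \<in> borel_measurable lborel" by measurable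
  also have "(\<lambda>s. indicator {0..t} s *\<^sub>R (if s \<in> {0..T} then \<beta> s \<omega> else 0)) = (\<lambda>s. indicator {0..t} s *\<^sub>R \<beta> s \<omega>)"
    using t01 by (auto simp: fun_eq_iff indicator_def)
  finally have m: "(\<lambda>s. indicator {0..t} s *\<^sub>R \<beta> s \<omega>) \<in> borel_measurable lborel" .
  have "norm_sq (\<lambda>t \<omega>. LINT s:{0..t}|lborel. \<beta> s \<omega>) t \<omega> \<le> emeasure lborel {0..t} * (\<integral>\<^sup>+s. indicator {0..t} s * ennreal ((norm (\<beta> s \<omega>))\<^sup>2) \<partial>lborel)"
    unfolding norm_sq_def by (rule norm_set_integral_square_le[OF m]) simp
  also have "\<dots> \<le> ennreal T * int_cut T c (norm_sq \<beta>) \<omega>"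
  proof (rule mult_mono)
    show "emeasure lborel {0..t} \<le> ennreal T" using t01 by (simp add: ennreal_leI)
    show "(\<integral>\<^sup>+s. indicator {0..t} s * ennreal ((norm (\<beta> s \<omega>))\<^sup>2) \<partial>lborel) \<le> int_cut T c (norm_sq \<beta>) \<omega>"
      unfolding int_cut_def
    proof (rule nn_integral_mono)
      fix s
      have "c s \<omega>" if "s \<in> {0..t}" using cutoff_antimono[OF c o _ _ t01(2) ct] that by auto
      then show "indicator {0..t} s * ennreal ((norm (\<beta> s \<omega>))\<^sup>2) \<le> (if s \<in> {0..T} \<and> c s \<omega> then norm_sq \<beta> s \<omega> else 0)"
        using t01 by (auto simp: indicator_def norm_sq_def)
    qed
  qed auto
  finally show "norm_sq (\<lambda>t \<omega>. LINT s:{0..t}|lborel. \<beta> s \<omega>) t \<omega> \<le> ennreal T * int_cut T c (norm_sq \<beta>) \<omega>" .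
qed

definition matrix_approx ::
    "(real \<Rightarrow> 'a \<Rightarrow> real^'n^'n) \<Rightarrow> real \<Rightarrow> (real \<Rightarrow> 'a \<Rightarrow> real^'n^'n) \<Rightarrow> (real \<Rightarrow> 'a \<Rightarrow> real^'n^'n) \<Rightarrow> bool" where
  "matrix_approx B T V I \<longleftrightarrow>
    (\<forall>i j. orthogonal_bm.approx_integral M F (\<lambda>m t \<omega>. B t \<omega> $ m $ j) T (\<lambda>m s \<omega>. V s \<omega> $ i $ m) (\<lambda>t \<omega>. I t \<omega> $ i $ j))"

lemma has_matrix_ito_integral_approx:
  assumes B: "matrix_brownian_motion M F (B :: real \<Rightarrow> 'a \<Rightarrow> real^'n^'n)" and T: "0 < T" and I: "has_matrix_ito_integral M F B T V I"
  shows "matrix_approx B T V I"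
  unfolding matrix_approx_def
proof (intro allI)
  fix i j
  interpret orthogonal_bm M F "\<lambda>m t \<omega>. B t \<omega> $ m $ j" by (rule matrix_brownian_motion_column[OF B])
  obtain J where J: "\<And>i m j. has_ito_integral M F (\<lambda>t \<omega>. B t \<omega> $ m $ j) T (\<lambda>t \<omega>. V t \<omega> $ i $ m) (J i m j)"
    and IJ: "\<And>t \<omega>. t\<in>{0..T} \<Longrightarrow> \<omega>\<in>space M \<Longrightarrow> I t \<omega> = (\<chi> i j. \<Sum>m\<in>UNIV. J i m j t \<omega>)"
    using I unfolding has_matrix_ito_integral_def by blast
  have "approx_integral T (\<lambda>k s \<omega>. \<Sum>m\<in>UNIV. if k = m then V s \<omega> $ i $ m else 0) (\<lambda>t \<omega>. \<Sum>m\<in>UNIV. J i m j t \<omega>)"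
    by (intro approx_integral_sum[OF T] has_ito_integral_approx_integral[OF T J]) simp
  then have "approx_integral T (\<lambda>k s \<omega>. V s \<omega> $ i $ k) (\<lambda>t \<omega>. \<Sum>m\<in>UNIV. J i m j t \<omega>)" by simp
  then show "approx_integral T (\<lambda>m s \<omega>. V s \<omega> $ i $ m) (\<lambda>t \<omega>. I t \<omega> $ i $ j)"
    by (rule approx_integral_cong) (use dyadic_subset[OF T] IJ in auto)
qed

lemma matrix_approx_diff:
  assumes B: "matrix_brownian_motion M F (B :: real \<Rightarrow> 'a \<Rightarrow> real^'n^'n)" and T: "0 < T"
    and "matrix_approx B T V I" "matrix_approx B T V' I'"
  shows "matrix_approx B T (\<lambda>s \<omega>. V s \<omega> - V' s \<omega>) (\<lambda>t \<omega>. I t \<omega> - I' t \<omega>)"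
  unfolding matrix_approx_def
proof (intro allI)
  fix i j
  interpret orthogonal_bm M F "\<lambda>m t \<omega>. B t \<omega> $ m $ j" by (rule matrix_brownian_motion_column[OF B])
  show "approx_integral T (\<lambda>m s \<omega>. (V s \<omega> - V' s \<omega>) $ i $ m) (\<lambda>t \<omega>. (I t \<omega> - I' t \<omega>) $ i $ j)"
    using approx_integral_diff[OF T, of "\<lambda>m s \<omega>. V s \<omega> $ i $ m" "\<lambda>t \<omega>. I t \<omega> $ i $ j" "\<lambda>m s \<omega>. V' s \<omega> $ i $ m" "\<lambda>t \<omega>. I' t \<omega> $ i $ j"] assms(3,4)
    unfolding matrix_approx_def by simp
qed

text \<open>A supremum of sums is at most the sum of the suprema, so the scalar bound may be applied
  to each entry separately without a worse constant.\<close>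

theorem matrix_approx_bound:
  assumes B: "matrix_brownian_motion M F (B :: real \<Rightarrow> 'a \<Rightarrow> real^'n^'n)" and T: "0 < T"
    and I: "matrix_approx B T V I" and V: "progressive T V" and c: "cutoff T c"
  shows "(\<integral>\<^sup>+\<omega>. sup_cut T c (norm_sq I) \<omega> \<partial>M) \<le> ennreal (4 * real CARD('n)) * (\<integral>\<^sup>+\<omega>. int_cut T c (norm_sq V) \<omega> \<partial>M)"
proof -
  let ?s = "\<lambda>i j \<omega>. sup_cut T c (\<lambda>t \<omega>. ennreal ((I t \<omega> $ i $ j)\<^sup>2)) \<omega>"
  let ?r = "\<lambda>i. sq_norm (\<lambda>m s \<omega>. V s \<omega> $ i $ m)"
  have rp: "progressive T (?r i)" for i by (intro progressive_sq_norm progressive_entry V)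
  have entry: "(\<integral>\<^sup>+\<omega>. ?s i j \<omega> \<partial>M) \<le> 4 * (\<integral>\<^sup>+\<omega>. int_cut T c (?r i) \<omega> \<partial>M)"
    and sM: "?s i j \<in> borel_measurable M" for i j
  proof -
    interpret orthogonal_bm M F "\<lambda>m t \<omega>. B t \<omega> $ m $ j" by (rule matrix_brownian_motion_column[OF B])
    have a: "approx_integral T (\<lambda>m s \<omega>. V s \<omega> $ i $ m) (\<lambda>t \<omega>. I t \<omega> $ i $ j)" using I by (simp add: matrix_approx_def)
    show "(\<integral>\<^sup>+\<omega>. ?s i j \<omega> \<partial>M) \<le> 4 * (\<integral>\<^sup>+\<omega>. int_cut T c (?r i) \<omega> \<partial>M)" by (rule approx_integral_bound[OF T a c])
    have "\<And>t. t \<in> dyadic T \<Longrightarrow> (\<lambda>\<omega>. I t \<omega> $ i $ j) \<in> borel_measurable M" using a unfolding approx_integral_def by blast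
    then show "?s i j \<in> borel_measurable M" by (intro sup_cut_measurable[OF c T]) auto
  qed
  have "(\<integral>\<^sup>+\<omega>. sup_cut T c (norm_sq I) \<omega> \<partial>M) \<le> (\<integral>\<^sup>+\<omega>. (\<Sum>i\<in>UNIV. \<Sum>j\<in>UNIV. ?s i j \<omega>) \<partial>M)"
  proof (intro nn_integral_mono sup_cut_least)
    fix \<omega> t assume t: "t \<in> dyadic T" "c t \<omega>"
    have "norm_sq I t \<omega> = (\<Sum>i\<in>UNIV. \<Sum>j\<in>UNIV. ennreal ((I t \<omega> $ i $ j)\<^sup>2))"
      unfolding norm_sq_def norm_matrix_sq by (simp add: sum_nonneg sum_ennreal[symmetric] del: sum_ennreal)
    also have "\<dots> \<le> (\<Sum>i\<in>UNIV. \<Sum>j\<in>UNIV. ?s i j \<omega>)"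
      by (intro sum_mono sup_cut_upper[where f = "\<lambda>t \<omega>. ennreal ((I t \<omega> $ _ $ _)\<^sup>2)"] t)
    finally show "norm_sq I t \<omega> \<le> (\<Sum>i\<in>UNIV. \<Sum>j\<in>UNIV. ?s i j \<omega>)" .
  qed
  also have "\<dots> = (\<Sum>i\<in>UNIV. \<Sum>j\<in>UNIV. \<integral>\<^sup>+\<omega>. ?s i j \<omega> \<partial>M)"
    using sM by (simp add: nn_integral_sum)
  also have "\<dots> \<le> (\<Sum>i\<in>UNIV. \<Sum>j\<in>(UNIV :: 'n set). 4 * (\<integral>\<^sup>+\<omega>. int_cut T c (?r i) \<omega> \<partial>M))"
    by (intro sum_mono entry)
  also have "\<dots> = ennreal (4 * real CARD('n)) * (\<Sum>i\<in>UNIV. \<integral>\<^sup>+\<omega>. int_cut T c (?r i) \<omega> \<partial>M)"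
    by (simp add: sum_distrib_left[symmetric] ennreal_mult ennreal_of_nat_eq_real_of_nat mult_ac)
  also have "(\<Sum>i\<in>UNIV. \<integral>\<^sup>+\<omega>. int_cut T c (?r i) \<omega> \<partial>M) = (\<integral>\<^sup>+\<omega>. (\<Sum>i\<in>UNIV. int_cut T c (?r i) \<omega>) \<partial>M)"
    using int_cut_measurable_M[OF c T rp] by (intro nn_integral_sum[symmetric]) auto
  also have "\<dots> = (\<integral>\<^sup>+\<omega>. int_cut T c (norm_sq V) \<omega> \<partial>M)"
  proof (rule nn_integral_cong)
    fix \<omega> assume o: "\<omega> \<in> space M"
    have "(\<lambda>s \<omega>. \<Sum>i\<in>UNIV. ?r i s \<omega>) = norm_sq V"
      unfolding norm_sq_def sq_norm_def norm_matrix_sq by (simp add: fun_eq_iff sum_nonneg)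
    then show "(\<Sum>i\<in>UNIV. int_cut T c (?r i) \<omega>) = int_cut T c (norm_sq V) \<omega>"
      using int_cut_sum[where f = ?r and A = UNIV, OF c T rp o] by simp
  qed
  finally show ?thesis .
qed

end

section \<open>The Picard map\<close>

lemma (in filtered_prob_space) matrix_approx_measurable:
  assumes B: "matrix_brownian_motion M F (B :: real \<Rightarrow> 'a \<Rightarrow> real^'n^'n)" and I: "matrix_approx B T V I" and t: "t \<in> dyadic T"
  shows "norm_sq I t \<in> borel_measurable M"
proof -
  have "(\<lambda>\<omega>. I t \<omega> $ i $ j) \<in> borel_measurable M" for i j
  proof -
    interpret orthogonal_bm M F "\<lambda>m t \<omega>. B t \<omega> $ m $ j" by (rule matrix_brownian_motion_column[OF B])
    have "approx_integral T (\<lambda>m s \<omega>. V s \<omega> $ i $ m) (\<lambda>t \<omega>. I t \<omega> $ i $ j)" using I by (simp add: matrix_approx_def)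
    then show ?thesis using t unfolding approx_integral_def by blast
  qed
  then have "(\<lambda>\<omega>. \<Sum>i\<in>UNIV. \<Sum>j\<in>UNIV. (I t \<omega> $ i $ j)\<^sup>2) \<in> borel_measurable M" by measurable
  then show ?thesis unfolding norm_sq_def[abs_def] norm_matrix_sq by measurable
qed

text \<open>\<open>K\<close> is a Borel majorant of \<open>\<kappa>1 + \<kappa>2\<close>; the growth bound is what the assumptions at \<open>0\<close> yield.\<close>

locale sde = filtered_prob_space M F
  for M :: "'a measure" and F :: "real \<Rightarrow> 'a measure" +
  fixes B :: "real \<Rightarrow> 'a \<Rightarrow> real^'n^'n" and T :: real
    and b \<sigma> :: "real \<Rightarrow> real^'n^'n \<Rightarrow> real^'n^'n" and K :: "real \<Rightarrow> real" and C0 :: real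
  assumes C0_eq: "C0 = 3 * (T + 4 * real CARD('n))" and B: "matrix_brownian_motion M F B" and T: "0 < T"
    and b_meas: "(\<lambda>(t, y). b t y) \<in> borel_measurable (restrict_space borel {0..} \<Otimes>\<^sub>M borel)"
    and \<sigma>_meas: "(\<lambda>(t, y). \<sigma> t y) \<in> borel_measurable (restrict_space borel {0..} \<Otimes>\<^sub>M borel)"
    and K_int: "integrable lborel K" and K_nonneg: "\<And>s. 0 \<le> K s"
    and lip: "AE s in lborel. s \<in> {0..T} \<longrightarrow> (\<forall>y z.
        (norm (b s y - b s z))\<^sup>2 + (norm (\<sigma> s y - \<sigma> s z))\<^sup>2 \<le> K s * (norm (y - z))\<^sup>2)"
    and growth: "AE s in lborel. s \<in> {0..T} \<longrightarrow> (\<forall>y.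
        (norm (b s y))\<^sup>2 + (norm (\<sigma> s y))\<^sup>2 \<le> 2 * K s * (1 + (norm y)\<^sup>2))"
begin

lemma T0: "0 \<le> T" "T \<le> T" using T by auto

lemma C0_nonneg: "0 \<le> C0" using T by (simp add: C0_eq)

lemma K_meas[measurable]: "K \<in> borel_measurable borel" using K_int by auto

definition continuous_adapted :: "(real \<Rightarrow> 'a \<Rightarrow> real^'n^'n) \<Rightarrow> bool" where
  "continuous_adapted X \<longleftrightarrow> adapted_on F {0..T} X \<and> (\<forall>\<omega>\<in>space M. continuous_on {0..T} (\<lambda>t. X t \<omega>))"

lemma continuous_adaptedD:
  "continuous_adapted X \<Longrightarrow> adapted_on F {0..T} X" "continuous_adapted X \<Longrightarrow> \<omega> \<in> space M \<Longrightarrow> continuous_on {0..T} (\<lambda>t. X t \<omega>)"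
  by (auto simp: continuous_adapted_def)

lemma continuous_adapted_progressive: "continuous_adapted X \<Longrightarrow> progressive T X"
  by (intro progressive_continuous continuous_adaptedD)

lemma continuous_adapted_diff:
  "continuous_adapted X \<Longrightarrow> continuous_adapted Y \<Longrightarrow> continuous_adapted (\<lambda>t \<omega>. X t \<omega> - Y t \<omega>)"
  unfolding continuous_adapted_def adapted_on_def by (auto intro!: borel_measurable_diff continuous_on_diff)

lemma coefficient_progressive:
  assumes "continuous_adapted X"
  shows "progressive T (\<lambda>s \<omega>. b s (X s \<omega>))" "progressive T (\<lambda>s \<omega>. \<sigma> s (X s \<omega>))"
  by (rule progressive_coefficient[OF b_meas continuous_adapted_progressive[OF assms]])
    (rule progressive_coefficient[OF \<sigma>_meas continuous_adapted_progressive[OF assms]])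

lemma sup_cut_norm_sq_measurable:
  assumes c: "cutoff T c" and X: "continuous_adapted X"
  shows "sup_cut T c (norm_sq X) \<in> borel_measurable M"
proof (rule sup_cut_measurable[OF c T])
  fix t assume "t \<in> dyadic T"
  then have t: "t \<in> {0..T}" using dyadic_subset[OF T] by blast
  then have "X t \<in> borel_measurable (F t)" using X by (auto simp: continuous_adapted_def adapted_on_def)
  then have [measurable]: "X t \<in> borel_measurable M" using measurable_F_M[of t] t by auto
  show "norm_sq X t \<in> borel_measurable M" unfolding norm_sq_def[abs_def] by measurable
qed

text \<open>Formulated for an abstract drift and integrand so that it covers solutions started in x
  and, with start 0, differences of two solutions or of two Picard iterates. The cutoff is
  arbitrary, hence may include a deterministic time.\<close>

lemma integral_equation_bound:
  assumes Z: "AE \<omega> in M. \<forall>t\<in>{0..T}. Z t \<omega> = x + (LINT s:{0..t}|lborel. \<beta> s \<omega>) + I t \<omega>"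
    and \<beta>: "progressive T \<beta>" and V: "progressive T V" and I: "matrix_approx B T V I" and c: "cutoff T c"
  shows "(\<integral>\<^sup>+\<omega>. sup_cut T c (norm_sq Z) \<omega> \<partial>M) \<le>
    ennreal (3 * (norm x)\<^sup>2) + ennreal C0 * (\<integral>\<^sup>+\<omega>. int_cut T c (\<lambda>s \<omega>. norm_sq \<beta> s \<omega> + norm_sq V s \<omega>) \<omega> \<partial>M)"
proof -
  let ?\<beta> = "int_cut T c (norm_sq \<beta>)" and ?V = "int_cut T c (norm_sq V)" and ?I = "sup_cut T c (norm_sq I)"
  have p: "progressive T (norm_sq \<beta>)" "progressive T (norm_sq V)" by (intro progressive_norm_sq \<beta> V)+
  have m: "?\<beta> \<in> borel_measurable M" "?V \<in> borel_measurable M" "?I \<in> borel_measurable M"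
    by (rule int_cut_measurable_M[OF c T p(1)] int_cut_measurable_M[OF c T p(2)])+
      (rule sup_cut_measurable[OF c T matrix_approx_measurable[OF B I]])
  have "(\<integral>\<^sup>+\<omega>. sup_cut T c (norm_sq Z) \<omega> \<partial>M) \<le> (\<integral>\<^sup>+\<omega>. ennreal (3 * (norm x)\<^sup>2) + 3 * (ennreal T * ?\<beta> \<omega>) + 3 * ?I \<omega> \<partial>M)"
  proof (rule nn_integral_mono_AE)
    show "AE \<omega> in M. sup_cut T c (norm_sq Z) \<omega> \<le> ennreal (3 * (norm x)\<^sup>2) + 3 * (ennreal T * ?\<beta> \<omega>) + 3 * ?I \<omega>"
      using Z AE_space
    proof eventually_elim
      case (elim \<omega>)
      show ?case
      proof (rule sup_cut_least)
        fix t assume t: "t \<in> dyadic T" and ct: "c t \<omega>"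
        let ?b = "\<lambda>t \<omega>. LINT s:{0..t}|lborel. \<beta> s \<omega>"
        have up: "norm_sq W t \<omega> \<le> sup_cut T c (norm_sq W) \<omega>" for W :: "real \<Rightarrow> 'a \<Rightarrow> real^'n^'n"
          by (rule sup_cut_upper) (use t ct in auto)
        have "Z t \<omega> = x + ?b t \<omega> + I t \<omega>" using elim(1) t dyadic_subset[OF T] by blast
        then have "norm_sq Z t \<omega> \<le> 3 * ennreal ((norm x)\<^sup>2) + 3 * norm_sq ?b t \<omega> + 3 * norm_sq I t \<omega>"
          unfolding norm_sq_def using ennreal_norm_add3[of x "?b t \<omega>" "I t \<omega>"] by simp
        also have "\<dots> \<le> 3 * ennreal ((norm x)\<^sup>2) + 3 * (ennreal T * ?\<beta> \<omega>) + 3 * ?I \<omega>"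
          using order_trans[OF up drift_bound[OF c T \<beta> elim(2)]] up[of I] by (intro add_mono mult_left_mono) auto
        finally show "norm_sq Z t \<omega> \<le> ennreal (3 * (norm x)\<^sup>2) + 3 * (ennreal T * ?\<beta> \<omega>) + 3 * ?I \<omega>"
          by (simp add: ennreal_mult')
      qed
    qed
  qed
  also have "\<dots> = ennreal (3 * (norm x)\<^sup>2) + 3 * (ennreal T * (\<integral>\<^sup>+\<omega>. ?\<beta> \<omega> \<partial>M)) + 3 * (\<integral>\<^sup>+\<omega>. ?I \<omega> \<partial>M)"
    using m by (simp add: nn_integral_add nn_integral_cmult emeasure_space_1)
  also have "\<dots> \<le> ennreal (3 * (norm x)\<^sup>2) + 3 * (ennreal T * (\<integral>\<^sup>+\<omega>. ?\<beta> \<omega> \<partial>M)) + 3 * (ennreal (4 * real CARD('n)) * (\<integral>\<^sup>+\<omega>. ?V \<omega> \<partial>M))"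
    by (intro add_mono mult_left_mono matrix_approx_bound[OF B T I V c]) auto
  also have "\<dots> \<le> ennreal (3 * (norm x)\<^sup>2) + ennreal C0 * ((\<integral>\<^sup>+\<omega>. ?\<beta> \<omega> \<partial>M) + (\<integral>\<^sup>+\<omega>. ?V \<omega> \<partial>M))"
  proof -
    have "3 * (ennreal T * y) = ennreal (3 * T) * y" "3 * (ennreal (4 * real CARD('n)) * y) = ennreal (3 * (4 * real CARD('n))) * y" for y
      by (simp_all add: ennreal_mult' mult.assoc)
    then have "3 * (ennreal T * (\<integral>\<^sup>+\<omega>. ?\<beta> \<omega> \<partial>M)) \<le> ennreal C0 * (\<integral>\<^sup>+\<omega>. ?\<beta> \<omega> \<partial>M)"
      "3 * (ennreal (4 * real CARD('n)) * (\<integral>\<^sup>+\<omega>. ?V \<omega> \<partial>M)) \<le> ennreal C0 * (\<integral>\<^sup>+\<omega>. ?V \<omega> \<partial>M)"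
      using T by (auto simp: C0_eq intro!: mult_right_mono ennreal_leI)
    then show ?thesis by (simp add: distrib_left add.assoc add_mono)
  qed
  also have "(\<integral>\<^sup>+\<omega>. ?\<beta> \<omega> \<partial>M) + (\<integral>\<^sup>+\<omega>. ?V \<omega> \<partial>M) = (\<integral>\<^sup>+\<omega>. int_cut T c (\<lambda>s \<omega>. norm_sq \<beta> s \<omega> + norm_sq V s \<omega>) \<omega> \<partial>M)"
    using m by (subst nn_integral_add[symmetric]) (auto intro!: nn_integral_cong simp: int_cut_add[OF c T p])
  finally show ?thesis .
qed

text \<open>The function to which Gronwall's inequality is applied. The deterministic time s enters
  as one more cutoff, so that estimates on the fixed interval [0, T] can be used for every
  s.\<close>

definition expected_sup :: "(real \<Rightarrow> 'a \<Rightarrow> bool) \<Rightarrow> (real \<Rightarrow> 'a \<Rightarrow> real^'n^'n) \<Rightarrow> real \<Rightarrow> ennreal" where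
  "expected_sup c Z s = (\<integral>\<^sup>+\<omega>. sup_cut T (\<lambda>r \<omega>. r \<le> s \<and> c r \<omega>) (norm_sq Z) \<omega> \<partial>M)"

lemma cutoff_until: "cutoff T c \<Longrightarrow> cutoff T (\<lambda>r \<omega>. r \<le> s \<and> c r \<omega>)"
  by (intro cutoff_conj cutoff_time)

lemma expected_sup_mono: "mono (expected_sup c Z)"
  unfolding expected_sup_def
  by (intro monoI nn_integral_mono sup_cut_least sup_cut_upper) auto

lemma expected_sup_measurable[measurable]: "expected_sup c Z \<in> borel_measurable borel"
  by (rule mono_ennreal_measurable[OF expected_sup_mono])

lemma expected_sup_T: "expected_sup c Z T = (\<integral>\<^sup>+\<omega>. sup_cut T c (norm_sq Z) \<omega> \<partial>M)"
  unfolding expected_sup_def sup_cut_def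
  using dyadic_subset[OF T] by (intro nn_integral_cong SUP_cong refl) auto

lemma expected_sup_tonelli:
  assumes Z: "continuous_adapted Z" and c: "cutoff T c"
  shows "(\<integral>\<^sup>+\<omega>. int_cut T (\<lambda>s \<omega>. s \<le> u \<and> c s \<omega>) (\<lambda>s \<omega>. ennreal (K s) * norm_sq Z s \<omega>) \<omega> \<partial>M) \<le>
    (\<integral>\<^sup>+s. indicator {0..u} s * (ennreal (K s) * expected_sup c Z s) \<partial>lborel)"
proof -
  let ?d = "\<lambda>s \<omega>. s \<le> u \<and> c s \<omega>"
  let ?f = "\<lambda>s \<omega>. if s \<in> {0..T} \<and> ?d s \<omega> then ennreal (K s) * norm_sq Z s \<omega> else 0"
  interpret pair_sigma_finite lborel M ..
  have d: "cutoff T ?d" by (rule cutoff_until[OF c])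
  have [measurable]: "(\<lambda>(s, \<omega>). if s \<in> {0..T} then norm_sq Z s \<omega> else 0) \<in> borel_measurable (borel \<Otimes>\<^sub>M M)"
    by (rule progressive_M[OF progressive_norm_sq[OF continuous_adapted_progressive[OF Z]] T0(1)])
  have "(\<lambda>x. ennreal (K (fst x)) * (case x of (s, \<omega>) \<Rightarrow> if s \<in> {0..T} then norm_sq Z s \<omega> else 0)) \<in> borel_measurable (borel \<Otimes>\<^sub>M M)"
    by measurable
  also have "(\<lambda>x. ennreal (K (fst x)) * (case x of (s, \<omega>) \<Rightarrow> if s \<in> {0..T} then norm_sq Z s \<omega> else 0)) =
     (\<lambda>(s, \<omega>). indicator {0..T} s * (ennreal (K s) * norm_sq Z s \<omega>))" by (auto simp: fun_eq_iff indicator_def)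
  finally have "(\<lambda>(s, \<omega>). ?f s \<omega>) \<in> borel_measurable (borel \<Otimes>\<^sub>M M)"
    by (rule cut_measurable[OF subsetD[OF sets_pair_F_M[OF T0(1)] cutoff_joint[OF d T T0]] refl])
  then have fm: "(\<lambda>(s, \<omega>). ?f s \<omega>) \<in> borel_measurable (lborel \<Otimes>\<^sub>M M)"
    by (subst measurable_cong_sets[OF sets_pair_measure_cong[OF sets_lborel refl] refl])
  have "(\<integral>\<^sup>+\<omega>. int_cut T ?d (\<lambda>s \<omega>. ennreal (K s) * norm_sq Z s \<omega>) \<omega> \<partial>M) = (\<integral>\<^sup>+\<omega>. (\<integral>\<^sup>+s. ?f s \<omega> \<partial>lborel) \<partial>M)"
    unfolding int_cut_def ..
  also have "\<dots> = (\<integral>\<^sup>+s. (\<integral>\<^sup>+\<omega>. ?f s \<omega> \<partial>M) \<partial>lborel)" using Fubini'[OF fm] by simp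
  also have "\<dots> \<le> (\<integral>\<^sup>+s. indicator {0..u} s * (ennreal (K s) * expected_sup c Z s) \<partial>lborel)"
  proof (rule nn_integral_mono)
    fix s :: real
    show "(\<integral>\<^sup>+\<omega>. ?f s \<omega> \<partial>M) \<le> indicator {0..u} s * (ennreal (K s) * expected_sup c Z s)"
    proof (cases "s \<in> {0..T} \<and> s \<le> u")
      case True
      let ?s = "sup_cut T (\<lambda>r \<omega>. r \<le> s \<and> c r \<omega>) (norm_sq Z)"
      have "(\<integral>\<^sup>+\<omega>. ?f s \<omega> \<partial>M) \<le> (\<integral>\<^sup>+\<omega>. ennreal (K s) * ?s \<omega> \<partial>M)"
      proof (rule nn_integral_mono)
        fix \<omega> assume o: "\<omega> \<in> space M"
        show "?f s \<omega> \<le> ennreal (K s) * ?s \<omega>"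
        proof (cases "c s \<omega>")
          case cs: True
          have "norm_sq Z s \<omega> \<le> ?s \<omega>"
          proof (rule le_sup_cut[where Z = Z and c = c, OF T _ _ _ continuous_adaptedD(2)[OF Z o]])
            show "c r \<omega>" if "0 \<le> r" "r \<le> s" for r
              by (rule cutoff_antimono[OF c o that _ cs]) (use True in simp)
          qed (use True in auto)
          then show ?thesis by (auto intro!: mult_left_mono)
        qed simp
      qed
      also have "\<dots> = ennreal (K s) * expected_sup c Z s"
        unfolding expected_sup_def by (rule nn_integral_cmult[OF sup_cut_norm_sq_measurable[OF cutoff_until[OF c] Z]])
      finally show ?thesis using True by simp
    next
      case False
      then have "(\<integral>\<^sup>+\<omega>. ?f s \<omega> \<partial>M) = (\<integral>\<^sup>+(\<omega>::'a). 0 \<partial>M)" by (intro nn_integral_cong) auto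
      then show ?thesis by simp
    qed
  qed
  finally show ?thesis .
qed

lemma lipschitz_int_cut:
  "int_cut T c (\<lambda>s \<omega>. norm_sq (\<lambda>s \<omega>. b s (Y s \<omega>) - b s (Y' s \<omega>)) s \<omega> + norm_sq (\<lambda>s \<omega>. \<sigma> s (Y s \<omega>) - \<sigma> s (Y' s \<omega>)) s \<omega>) \<omega> \<le>
   int_cut T c (\<lambda>s \<omega>. ennreal (K s) * norm_sq (\<lambda>s \<omega>. Y s \<omega> - Y' s \<omega>) s \<omega>) \<omega>"
  unfolding int_cut_def
proof (rule nn_integral_mono_AE)
  have *: "ennreal (p\<^sup>2) + ennreal (q\<^sup>2) \<le> ennreal k * ennreal (z\<^sup>2)" if "p\<^sup>2 + q\<^sup>2 \<le> k * z\<^sup>2" "0 \<le> k" for p q k z :: real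
    using that by (simp add: ennreal_plus[symmetric] ennreal_mult[symmetric] ennreal_leI del: ennreal_plus)
  show "AE s in lborel. (if s \<in> {0..T} \<and> c s \<omega> then norm_sq (\<lambda>s \<omega>. b s (Y s \<omega>) - b s (Y' s \<omega>)) s \<omega> + norm_sq (\<lambda>s \<omega>. \<sigma> s (Y s \<omega>) - \<sigma> s (Y' s \<omega>)) s \<omega> else 0)
    \<le> (if s \<in> {0..T} \<and> c s \<omega> then ennreal (K s) * norm_sq (\<lambda>s \<omega>. Y s \<omega> - Y' s \<omega>) s \<omega> else 0)"
    using lip
  proof eventually_elim
    case (elim s)
    then show ?case unfolding norm_sq_def using *[OF _ K_nonneg] by simp
  qed
qed

lemma growth_int_cut:
  assumes c: "cutoff T c" and Y: "continuous_adapted Y" and o: "\<omega> \<in> space M"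
  shows "int_cut T (\<lambda>s \<omega>. s \<le> u \<and> c s \<omega>) (\<lambda>s \<omega>. norm_sq (\<lambda>s \<omega>. b s (Y s \<omega>)) s \<omega> + norm_sq (\<lambda>s \<omega>. \<sigma> s (Y s \<omega>)) s \<omega>) \<omega> \<le>
   2 * (\<integral>\<^sup>+s. indicator {0..u} s * ennreal (K s) \<partial>lborel) + 2 * int_cut T (\<lambda>s \<omega>. s \<le> u \<and> c s \<omega>) (\<lambda>s \<omega>. ennreal (K s) * norm_sq Y s \<omega>) \<omega>"
proof -
  let ?d = "\<lambda>s \<omega>. s \<le> u \<and> c s \<omega>"
  let ?f = "\<lambda>s. if s \<in> {0..T} \<and> ?d s \<omega> then ennreal (K s) * norm_sq Y s \<omega> else 0"
  have *: "ennreal (p\<^sup>2) + ennreal (q\<^sup>2) \<le> 2 * ennreal k + 2 * (ennreal k * ennreal (z\<^sup>2))"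
    if "p\<^sup>2 + q\<^sup>2 \<le> 2 * k * (1 + z\<^sup>2)" "0 \<le> k" for p q k z :: real
  proof -
    have "ennreal (p\<^sup>2) + ennreal (q\<^sup>2) = ennreal (p\<^sup>2 + q\<^sup>2)" by simp
    also have "\<dots> \<le> ennreal (2 * k + 2 * (k * z\<^sup>2))" using that by (intro ennreal_leI) (simp add: algebra_simps)
    also have "\<dots> = 2 * ennreal k + 2 * (ennreal k * ennreal (z\<^sup>2))" using that by (simp add: ennreal_mult ennreal_mult')
    finally show ?thesis .
  qed
  have [measurable]: "(\<lambda>s. if s \<in> {0..T} \<and> ?d s \<omega> then norm_sq Y s \<omega> else 0) \<in> borel_measurable borel"
    by (rule cut_section[OF cutoff_until[OF c] T progressive_norm_sq[OF continuous_adapted_progressive[OF Y]] o])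
  have "(\<lambda>s. ennreal (K s) * (if s \<in> {0..T} \<and> ?d s \<omega> then norm_sq Y s \<omega> else 0)) \<in> borel_measurable borel" by measurable
  also have "(\<lambda>s. ennreal (K s) * (if s \<in> {0..T} \<and> ?d s \<omega> then norm_sq Y s \<omega> else 0)) = ?f" by auto
  finally have fm: "?f \<in> borel_measurable borel" .
  have "int_cut T ?d (\<lambda>s \<omega>. norm_sq (\<lambda>s \<omega>. b s (Y s \<omega>)) s \<omega> + norm_sq (\<lambda>s \<omega>. \<sigma> s (Y s \<omega>)) s \<omega>) \<omega> \<le>
    (\<integral>\<^sup>+s. 2 * (indicator {0..u} s * ennreal (K s)) + 2 * ?f s \<partial>lborel)"
    unfolding int_cut_def
  proof (rule nn_integral_mono_AE)
    show "AE s in lborel. (if s \<in> {0..T} \<and> ?d s \<omega> then norm_sq (\<lambda>s \<omega>. b s (Y s \<omega>)) s \<omega> + norm_sq (\<lambda>s \<omega>. \<sigma> s (Y s \<omega>)) s \<omega> else 0)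
      \<le> 2 * (indicator {0..u} s * ennreal (K s)) + 2 * ?f s"
      using growth
    proof eventually_elim
      case (elim s)
      then show ?case unfolding norm_sq_def using *[OF _ K_nonneg] by simp
    qed
  qed
  also have "\<dots> = 2 * (\<integral>\<^sup>+s. indicator {0..u} s * ennreal (K s) \<partial>lborel) + 2 * int_cut T ?d (\<lambda>s \<omega>. ennreal (K s) * norm_sq Y s \<omega>) \<omega>"
    unfolding int_cut_def using fm by (subst nn_integral_add) (auto simp: nn_integral_cmult)
  finally show ?thesis .
qed

text \<open>A continuous path is bounded on [0, T], so the growth bound dominates the square of the
  drift along it by a multiple of K, and a \<le> 1 + a^2 passes from the square to the norm. The
  statement holds for every \<omega>, which makes the drift integral continuous on every
  path.\<close>

lemma drift_integrable:
  assumes Y: "continuous_adapted Y" and o: "\<omega> \<in> space M" and A: "A \<in> sets borel" "A \<subseteq> {0..T}"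
  shows "set_integrable lborel A (\<lambda>s. b s (Y s \<omega>))"
proof -
  have "compact ((\<lambda>t. Y t \<omega>) ` {0..T})" by (intro compact_continuous_image continuous_adaptedD(2)[OF Y o] compact_Icc)
  then have "bounded ((\<lambda>t. Y t \<omega>) ` {0..T})" by (rule compact_imp_bounded)
  then obtain R where "\<forall>y\<in>(\<lambda>t. Y t \<omega>) ` {0..T}. norm y \<le> R" unfolding bounded_iff by blast
  then have R: "\<And>t. t \<in> {0..T} \<Longrightarrow> norm (Y t \<omega>) \<le> R" by auto
  have m: "(\<lambda>s. if s \<in> {0..T} then b s (Y s \<omega>) else 0) \<in> borel_measurable borel"
    by (rule progressive_section[OF coefficient_progressive(1)[OF Y] T0(1) o])
  have "set_integrable lborel {0..T} (\<lambda>s. b s (Y s \<omega>))"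
    unfolding set_integrable_def
  proof (rule Bochner_Integration.integrable_bound)
    show "integrable lborel (\<lambda>s. indicat_real {0..T} s + 2 * (1 + R\<^sup>2) * K s)"
      using K_int T by (intro Bochner_Integration.integrable_add integrable_mult_right) auto
    have "(\<lambda>s. if s \<in> {0..T} then b s (Y s \<omega>) else 0) = (\<lambda>s. indicat_real {0..T} s *\<^sub>R b s (Y s \<omega>))"
      by (auto simp: fun_eq_iff)
    then show "(\<lambda>s. indicat_real {0..T} s *\<^sub>R b s (Y s \<omega>)) \<in> borel_measurable lborel" using m by simp
    show "AE s in lborel. norm (indicat_real {0..T} s *\<^sub>R b s (Y s \<omega>)) \<le> norm (indicat_real {0..T} s + 2 * (1 + R\<^sup>2) * K s)"
      using growth
    proof eventually_elim
      case (elim s)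
      show ?case
      proof (cases "s \<in> {0..T}")
        case True
        have le: "a \<le> 1 + a\<^sup>2" for a :: real
          using zero_le_power2[of "a - 1"] zero_le_power2[of a] unfolding power2_diff one_power2 by linarith
        have "norm (b s (Y s \<omega>)) \<le> 1 + (norm (b s (Y s \<omega>)))\<^sup>2" by (rule le)
        also have "(norm (b s (Y s \<omega>)))\<^sup>2 \<le> (norm (b s (Y s \<omega>)))\<^sup>2 + (norm (\<sigma> s (Y s \<omega>)))\<^sup>2" by simp
        also have "\<dots> \<le> 2 * K s * (1 + (norm (Y s \<omega>))\<^sup>2)" using elim True by blast
        also have "\<dots> \<le> 2 * K s * (1 + R\<^sup>2)"
          using R[OF True] K_nonneg[of s] by (intro mult_left_mono add_left_mono power_mono) auto
        finally show ?thesis using True K_nonneg[of s] by (simp add: mult_ac)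
      qed simp
    qed
  qed
  then show ?thesis by (rule set_integrable_subset) (use A in auto)
qed

text \<open>\<open>picard_step x Y X\<close>: \<open>X\<close> is the image of \<open>Y\<close> under the Picard map with starting point \<open>x\<close>.\<close>

definition picard_step :: "real^'n^'n \<Rightarrow> (real \<Rightarrow> 'a \<Rightarrow> real^'n^'n) \<Rightarrow> (real \<Rightarrow> 'a \<Rightarrow> real^'n^'n) \<Rightarrow> bool" where
  "picard_step x Y X \<longleftrightarrow> continuous_adapted X \<and>
    (\<exists>I. has_matrix_ito_integral M F B T (\<lambda>s \<omega>. \<sigma> s (Y s \<omega>)) I \<and>
      (AE \<omega> in M. \<forall>t\<in>{0..T}. X t \<omega> = x + (LINT s:{0..t}|lborel. b s (Y s \<omega>)) + I t \<omega>))"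

text \<open>One estimate with three uses: for two fixed points it is the Gronwall inequality behind
  uniqueness, for consecutive iterates the recursion of their differences, and for the limit of the
  iterates the proof that it is a fixed point.\<close>

lemma picard_step_diff:
  assumes Y: "continuous_adapted Y" "continuous_adapted Y'" and X: "picard_step x Y X" "picard_step x Y' X'" and c: "cutoff T c"
  shows "expected_sup c (\<lambda>t \<omega>. X t \<omega> - X' t \<omega>) u \<le>
    ennreal C0 * (\<integral>\<^sup>+s. indicator {0..u} s * (ennreal (K s) * expected_sup c (\<lambda>t \<omega>. Y t \<omega> - Y' t \<omega>) s) \<partial>lborel)"
proof -
  obtain I where I: "has_matrix_ito_integral M F B T (\<lambda>s \<omega>. \<sigma> s (Y s \<omega>)) I"
    "AE \<omega> in M. \<forall>t\<in>{0..T}. X t \<omega> = x + (LINT s:{0..t}|lborel. b s (Y s \<omega>)) + I t \<omega>"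
    using X(1) unfolding picard_step_def by blast
  obtain I' where I': "has_matrix_ito_integral M F B T (\<lambda>s \<omega>. \<sigma> s (Y' s \<omega>)) I'"
    "AE \<omega> in M. \<forall>t\<in>{0..T}. X' t \<omega> = x + (LINT s:{0..t}|lborel. b s (Y' s \<omega>)) + I' t \<omega>"
    using X(2) unfolding picard_step_def by blast
  let ?d = "\<lambda>s \<omega>. s \<le> u \<and> c s \<omega>"
  let ?\<beta> = "\<lambda>s \<omega>. b s (Y s \<omega>) - b s (Y' s \<omega>)" and ?V = "\<lambda>s \<omega>. \<sigma> s (Y s \<omega>) - \<sigma> s (Y' s \<omega>)"
  have d: "cutoff T ?d" by (rule cutoff_until[OF c])
  have ma: "matrix_approx B T ?V (\<lambda>t \<omega>. I t \<omega> - I' t \<omega>)"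
    by (intro matrix_approx_diff[OF B T] has_matrix_ito_integral_approx[OF B T] I(1) I'(1))
  have eq: "AE \<omega> in M. \<forall>t\<in>{0..T}. X t \<omega> - X' t \<omega> = 0 + (LINT s:{0..t}|lborel. ?\<beta> s \<omega>) + (I t \<omega> - I' t \<omega>)"
    using I(2) I'(2) AE_space
  proof eventually_elim
    case (elim \<omega>)
    show ?case
    proof
      fix t assume t: "t \<in> {0..T}"
      have "(LINT s:{0..t}|lborel. ?\<beta> s \<omega>) = (LINT s:{0..t}|lborel. b s (Y s \<omega>)) - (LINT s:{0..t}|lborel. b s (Y' s \<omega>))"
        using t by (intro set_integral_diff(2) drift_integrable Y elim(3)) auto
      then show "X t \<omega> - X' t \<omega> = 0 + (LINT s:{0..t}|lborel. ?\<beta> s \<omega>) + (I t \<omega> - I' t \<omega>)"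
        using elim(1,2) t by simp
    qed
  qed
  have "expected_sup c (\<lambda>t \<omega>. X t \<omega> - X' t \<omega>) u \<le> ennreal (3 * (norm (0 :: real^'n^'n))\<^sup>2) +
    ennreal C0 * (\<integral>\<^sup>+\<omega>. int_cut T ?d (\<lambda>s \<omega>. norm_sq ?\<beta> s \<omega> + norm_sq ?V s \<omega>) \<omega> \<partial>M)"
    unfolding expected_sup_def
    by (rule integral_equation_bound[OF eq _ _ ma d]) (intro progressive_diff coefficient_progressive Y)+
  also have "\<dots> \<le> ennreal C0 * (\<integral>\<^sup>+\<omega>. int_cut T ?d (\<lambda>s \<omega>. ennreal (K s) * norm_sq (\<lambda>s \<omega>. Y s \<omega> - Y' s \<omega>) s \<omega>) \<omega> \<partial>M)"
    by (simp add: mult_left_mono nn_integral_mono lipschitz_int_cut)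
  also have "\<dots> \<le> ennreal C0 * (\<integral>\<^sup>+s. indicator {0..u} s * (ennreal (K s) * expected_sup c (\<lambda>t \<omega>. Y t \<omega> - Y' t \<omega>) s) \<partial>lborel)"
    by (intro mult_left_mono expected_sup_tonelli continuous_adapted_diff Y c) simp
  finally show ?thesis .
qed

lemma int_cut_K_measurable:
  assumes Y: "continuous_adapted Y" and c: "cutoff T c"
  shows "int_cut T c (\<lambda>s \<omega>. ennreal (K s) * norm_sq Y s \<omega>) \<in> borel_measurable M"
proof -
  have "progressive T (\<lambda>s \<omega>. ennreal (K s) * norm_sq Y s \<omega>)"
    unfolding progressive_def
  proof
    fix t assume t: "t \<in> {0..T}"
    have [measurable]: "(\<lambda>(s, \<omega>). if s \<in> {0..t} then norm_sq Y s \<omega> else 0) \<in> borel_measurable (borel \<Otimes>\<^sub>M F t)"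
      using progressiveD[OF progressive_norm_sq[OF continuous_adapted_progressive[OF Y]]] t by auto
    have "(\<lambda>x. ennreal (K (fst x)) * (case x of (s, \<omega>) \<Rightarrow> if s \<in> {0..t} then norm_sq Y s \<omega> else 0)) \<in> borel_measurable (borel \<Otimes>\<^sub>M F t)"
      by measurable
    also have "(\<lambda>x. ennreal (K (fst x)) * (case x of (s, \<omega>) \<Rightarrow> if s \<in> {0..t} then norm_sq Y s \<omega> else 0)) =
      (\<lambda>(s, \<omega>). if s \<in> {0..t} then ennreal (K s) * norm_sq Y s \<omega> else 0)" by (auto simp: fun_eq_iff)
    finally show "(\<lambda>(s, \<omega>). if s \<in> {0..t} then ennreal (K s) * norm_sq Y s \<omega> else 0) \<in> borel_measurable (borel \<Otimes>\<^sub>M F t)" .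
  qed
  then show ?thesis by (rule int_cut_measurable_M[OF c T])
qed

lemma growth_expectation:
  assumes Y: "continuous_adapted Y" and c: "cutoff T c"
  shows "(\<integral>\<^sup>+\<omega>. int_cut T (\<lambda>s \<omega>. s \<le> u \<and> c s \<omega>) (\<lambda>s \<omega>. norm_sq (\<lambda>s \<omega>. b s (Y s \<omega>)) s \<omega> + norm_sq (\<lambda>s \<omega>. \<sigma> s (Y s \<omega>)) s \<omega>) \<omega> \<partial>M) \<le>
    2 * (\<integral>\<^sup>+s. indicator {0..u} s * (ennreal (K s) * (1 + expected_sup c Y s)) \<partial>lborel)"
proof -
  let ?d = "\<lambda>s \<omega>. s \<le> u \<and> c s \<omega>"
  let ?k = "\<integral>\<^sup>+s. indicator {0..u} s * ennreal (K s) \<partial>lborel"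
  have "(\<integral>\<^sup>+\<omega>. int_cut T ?d (\<lambda>s \<omega>. norm_sq (\<lambda>s \<omega>. b s (Y s \<omega>)) s \<omega> + norm_sq (\<lambda>s \<omega>. \<sigma> s (Y s \<omega>)) s \<omega>) \<omega> \<partial>M) \<le>
    (\<integral>\<^sup>+\<omega>. 2 * ?k + 2 * int_cut T ?d (\<lambda>s \<omega>. ennreal (K s) * norm_sq Y s \<omega>) \<omega> \<partial>M)"
    by (intro nn_integral_mono growth_int_cut[OF c Y])
  also have "\<dots> = 2 * ?k + 2 * (\<integral>\<^sup>+\<omega>. int_cut T ?d (\<lambda>s \<omega>. ennreal (K s) * norm_sq Y s \<omega>) \<omega> \<partial>M)"
    using int_cut_K_measurable[OF Y cutoff_until[OF c], of u]
    by (subst nn_integral_add) (auto simp: nn_integral_cmult emeasure_space_1)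
  also have "\<dots> \<le> 2 * ?k + 2 * (\<integral>\<^sup>+s. indicator {0..u} s * (ennreal (K s) * expected_sup c Y s) \<partial>lborel)"
    by (intro add_left_mono mult_left_mono expected_sup_tonelli Y c) simp
  also have "\<dots> = 2 * (\<integral>\<^sup>+s. indicator {0..u} s * ennreal (K s) + indicator {0..u} s * (ennreal (K s) * expected_sup c Y s) \<partial>lborel)"
    by (subst nn_integral_add) (auto simp: distrib_left)
  also have "\<dots> = 2 * (\<integral>\<^sup>+s. indicator {0..u} s * (ennreal (K s) * (1 + expected_sup c Y s)) \<partial>lborel)"
    by (simp add: distrib_left)
  finally show ?thesis .
qed

lemma picard_step_growth:
  assumes Y: "continuous_adapted Y" and X: "picard_step x Y X" and c: "cutoff T c"
  shows "expected_sup c X u \<le> ennreal (3 * (norm x)\<^sup>2) +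
    ennreal (2 * C0) * (\<integral>\<^sup>+s. indicator {0..u} s * (ennreal (K s) * (1 + expected_sup c Y s)) \<partial>lborel)"
proof -
  obtain I where I: "has_matrix_ito_integral M F B T (\<lambda>s \<omega>. \<sigma> s (Y s \<omega>)) I"
    "AE \<omega> in M. \<forall>t\<in>{0..T}. X t \<omega> = x + (LINT s:{0..t}|lborel. b s (Y s \<omega>)) + I t \<omega>"
    using X unfolding picard_step_def by blast
  have "expected_sup c X u \<le> ennreal (3 * (norm x)\<^sup>2) + ennreal C0 *
    (\<integral>\<^sup>+\<omega>. int_cut T (\<lambda>s \<omega>. s \<le> u \<and> c s \<omega>) (\<lambda>s \<omega>. norm_sq (\<lambda>s \<omega>. b s (Y s \<omega>)) s \<omega> + norm_sq (\<lambda>s \<omega>. \<sigma> s (Y s \<omega>)) s \<omega>) \<omega> \<partial>M)"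
    unfolding expected_sup_def
    by (rule integral_equation_bound[OF I(2) _ _ has_matrix_ito_integral_approx[OF B T I(1)] cutoff_until[OF c]])
      (intro coefficient_progressive Y)+
  also have "\<dots> \<le> ennreal (3 * (norm x)\<^sup>2) + ennreal C0 * (2 * (\<integral>\<^sup>+s. indicator {0..u} s * (ennreal (K s) * (1 + expected_sup c Y s)) \<partial>lborel))"
    by (intro add_left_mono mult_left_mono growth_expectation Y c) simp
  also have "ennreal C0 * (2 * (\<integral>\<^sup>+s. indicator {0..u} s * (ennreal (K s) * (1 + expected_sup c Y s)) \<partial>lborel)) =
    ennreal (2 * C0) * (\<integral>\<^sup>+s. indicator {0..u} s * (ennreal (K s) * (1 + expected_sup c Y s)) \<partial>lborel)"
    by (simp add: ennreal_mult' mult.assoc mult.left_commute)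
  finally show ?thesis .
qed

end

lemma borel_measurable_matrix:
  fixes f :: "'a \<Rightarrow> real^'n^'m"
  assumes "\<And>i j. (\<lambda>\<omega>. f \<omega> $ i $ j) \<in> borel_measurable N"
  shows "f \<in> borel_measurable N"
  unfolding borel_measurable_euclidean_space[of f]
proof
  fix e :: "real^'n^'m" assume "e \<in> Basis"
  then obtain i j where "e = axis i (axis j 1)" by (auto simp: Basis_vec_def)
  then show "(\<lambda>\<omega>. f \<omega> \<bullet> e) \<in> borel_measurable N" using assms by (simp add: inner_axis)
qed

section \<open>Uniqueness and the moment bound\<close>

context sde
begin

lemma path_bounded:
  assumes X: "continuous_adapted X" and o: "\<omega> \<in> space M"
  obtains n :: nat where "\<And>t. t \<in> {0..T} \<Longrightarrow> norm (X t \<omega>) \<le> real n"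
proof -
  have "compact ((\<lambda>t. X t \<omega>) ` {0..T})" by (intro compact_continuous_image continuous_adaptedD(2)[OF X o] compact_Icc)
  then have "bounded ((\<lambda>t. X t \<omega>) ` {0..T})" by (rule compact_imp_bounded)
  then obtain R where "\<forall>y\<in>(\<lambda>t. X t \<omega>) ` {0..T}. norm y \<le> R" unfolding bounded_iff by blast
  then have R: "\<And>t. t \<in> {0..T} \<Longrightarrow> norm (X t \<omega>) \<le> R" by auto
  obtain n :: nat where "R \<le> real n" using real_arch_simple by blast
  then show ?thesis using R order_trans by (intro that[of n]) blast
qed

text \<open>Gronwall's inequality requires a finite quantity, and solutions are not known to have
  moments. Cutting off when either of them leaves the ball of radius n bounds the difference by 2 n;
  with additive constant 0 the inequality gives 0 for every n, and each path stays in some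
  ball.\<close>

lemma picard_fixed_point_unique:
  assumes X: "picard_step x X X" and Y: "picard_step x Y Y"
  shows "AE \<omega> in M. \<forall>t\<in>{0..T}. X t \<omega> = Y t \<omega>"
proof -
  have ca: "continuous_adapted X" "continuous_adapted Y" using X Y by (auto simp: picard_step_def)
  let ?Z = "\<lambda>t \<omega>. X t \<omega> - Y t \<omega>"
  define c where "c n s \<omega> \<longleftrightarrow> (\<forall>r\<in>{0..s}. norm (X r \<omega>) \<le> real n) \<and> (\<forall>r\<in>{0..s}. norm (Y r \<omega>) \<le> real n)" for n :: nat and s \<omega>
  have c: "cutoff T (c n)" for n
    unfolding c_def[abs_def] by (intro cutoff_conj cutoff_norm_le T continuous_adaptedD ca)
  have zero: "AE \<omega> in M. sup_cut T (c n) (norm_sq ?Z) \<omega> = 0" for n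
  proof -
    have "expected_sup (c n) ?Z T \<le> (\<integral>\<^sup>+\<omega>. ennreal ((2 * real n)\<^sup>2) \<partial>M)"
      unfolding expected_sup_T
    proof (intro nn_integral_mono sup_cut_least)
      fix \<omega> t assume "t \<in> dyadic T" and ct: "c n t \<omega>"
      then have "0 \<le> t" using dyadic_subset[OF T] by auto
      then have "norm (X t \<omega>) \<le> real n" "norm (Y t \<omega>) \<le> real n" using ct by (auto simp: c_def)
      then have "norm (?Z t \<omega>) \<le> 2 * real n" using norm_triangle_ineq4[of "X t \<omega>" "Y t \<omega>"] by linarith
      then show "norm_sq ?Z t \<omega> \<le> ennreal ((2 * real n)\<^sup>2)"
        unfolding norm_sq_def by (intro ennreal_leI power_mono) auto
    qed
    then have fin: "expected_sup (c n) ?Z T < \<infinity>" by (auto simp: emeasure_space_1 intro: le_less_trans)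
    have "expected_sup (c n) ?Z T \<le> ennreal (0 * exp (C0 * (LINT s:{0..T}|lborel. K s)))"
      by (rule gronwall[OF T K_int K_nonneg expected_sup_mono fin order_refl C0_nonneg])
        (use picard_step_diff[OF ca X Y c] in simp)
    then have "(\<integral>\<^sup>+\<omega>. sup_cut T (c n) (norm_sq ?Z) \<omega> \<partial>M) = 0" by (simp add: expected_sup_T)
    then show ?thesis
      using nn_integral_0_iff_AE[OF sup_cut_norm_sq_measurable[OF c continuous_adapted_diff[OF ca]]] by simp
  qed
  then have "AE \<omega> in M. \<forall>n. sup_cut T (c n) (norm_sq ?Z) \<omega> = 0" by (simp add: AE_all_countable)
  then show ?thesis
    using AE_space
  proof eventually_elim
    case (elim \<omega>)
    obtain n m where n: "\<And>t. t \<in> {0..T} \<Longrightarrow> norm (X t \<omega>) \<le> real n" and m: "\<And>t. t \<in> {0..T} \<Longrightarrow> norm (Y t \<omega>) \<le> real m"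
      using path_bounded[OF ca(1) elim(2)] path_bounded[OF ca(2) elim(2)] by metis
    have "X t \<omega> = Y t \<omega>" if t: "t \<in> dyadic T" for t
    proof -
      have tT: "t \<in> {0..T}" using t dyadic_subset[OF T] by blast
      have "norm (X r \<omega>) \<le> real (max n m)" "norm (Y r \<omega>) \<le> real (max n m)" if "r \<in> {0..t}" for r
        using n[of r] m[of r] that tT by auto
      then have "c (max n m) t \<omega>" by (auto simp: c_def)
      then have "norm_sq ?Z t \<omega> \<le> sup_cut T (c (max n m)) (norm_sq ?Z) \<omega>" by (intro sup_cut_upper t)
      then have "norm_sq ?Z t \<omega> = 0" using elim(1) by simp
      then show ?thesis by (simp add: norm_sq_def)
    qed
    then show ?case
      using dyadic_dense_eq[OF T continuous_adaptedD(2)[OF ca(1) elim(2)] continuous_adaptedD(2)[OF ca(2) elim(2)]] by blast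
  qed
qed

text \<open>Finiteness of the moment is part of the conclusion. Up to the exit from the ball of
  radius n it is bounded trivially, Gronwall's inequality then replaces that bound by one free of n,
  and monotone convergence lifts the cutoff.\<close>

lemma picard_fixed_point_moment:
  assumes X: "picard_step x X X"
  shows "(\<integral>\<^sup>+\<omega>. sup_cut T always (norm_sq X) \<omega> \<partial>M) \<le>
    ennreal ((1 + 3 * (norm x)\<^sup>2) * exp (2 * C0 * (LINT s:{0..T}|lborel. K s)))"
    (is "_ \<le> ?bound")
proof -
  have ca: "continuous_adapted X" using X by (auto simp: picard_step_def)
  define c where "c n s \<omega> \<longleftrightarrow> (\<forall>r\<in>{0..s}. norm (X r \<omega>) \<le> real n)" for n :: nat and s \<omega>
  have c: "cutoff T (c n)" for n
    unfolding c_def[abs_def] by (intro cutoff_norm_le T continuous_adaptedD ca)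
  have bnd: "(\<integral>\<^sup>+\<omega>. sup_cut T (c n) (norm_sq X) \<omega> \<partial>M) \<le> ?bound" for n
  proof -
    define \<psi> where "\<psi> u = 1 + expected_sup (c n) X u" for u
    have "expected_sup (c n) X T \<le> (\<integral>\<^sup>+\<omega>. ennreal ((real n)\<^sup>2) \<partial>M)"
      unfolding expected_sup_T
    proof (intro nn_integral_mono sup_cut_least)
      fix \<omega> t assume "t \<in> dyadic T" and ct: "c n t \<omega>"
      then have "0 \<le> t" using dyadic_subset[OF T] by auto
      then have "norm (X t \<omega>) \<le> real n" using ct by (auto simp: c_def)
      then show "norm_sq X t \<omega> \<le> ennreal ((real n)\<^sup>2)"
        unfolding norm_sq_def by (intro ennreal_leI power_mono) auto
    qed
    then have "expected_sup (c n) X T < \<infinity>" by (auto simp: emeasure_space_1 intro: le_less_trans)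
    then have fin: "\<psi> T < \<infinity>" by (simp add: \<psi>_def)
    have mono: "mono \<psi>" unfolding \<psi>_def using expected_sup_mono[of "c n" X] by (auto simp: mono_def intro: add_left_mono)
    have "\<psi> T \<le> ?bound"
    proof (rule gronwall[OF T K_int K_nonneg mono fin])
      fix u
      have "\<psi> u \<le> 1 + (ennreal (3 * (norm x)\<^sup>2) +
        ennreal (2 * C0) * (\<integral>\<^sup>+s. indicator {0..u} s * (ennreal (K s) * \<psi> s) \<partial>lborel))"
        unfolding \<psi>_def by (intro add_left_mono picard_step_growth ca X c)
      also have "\<dots> = ennreal (1 + 3 * (norm x)\<^sup>2) + ennreal (2 * C0) * (\<integral>\<^sup>+s. indicator {0..u} s * (ennreal (K s) * \<psi> s) \<partial>lborel)"
        by (simp add: ennreal_plus add.assoc)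
      finally show "\<psi> u \<le> ennreal (1 + 3 * (norm x)\<^sup>2) + ennreal (2 * C0) * (\<integral>\<^sup>+s. indicator {0..u} s * (ennreal (K s) * \<psi> s) \<partial>lborel)" .
    qed (use C0_nonneg in auto)
    moreover have "(\<integral>\<^sup>+\<omega>. sup_cut T (c n) (norm_sq X) \<omega> \<partial>M) \<le> \<psi> T"
      by (simp add: \<psi>_def expected_sup_T add_increasing)
    ultimately show ?thesis by simp
  qed
  have inc: "incseq (\<lambda>n \<omega>. sup_cut T (c n) (norm_sq X) \<omega>)"
  proof (intro incseq_SucI le_funI sup_cut_least sup_cut_upper)
    fix n t \<omega> assume "c n t \<omega>"
    then show "c (Suc n) t \<omega>" by (force simp: c_def)
  qed
  have "(\<integral>\<^sup>+\<omega>. sup_cut T always (norm_sq X) \<omega> \<partial>M) \<le> (\<integral>\<^sup>+\<omega>. (SUP n. sup_cut T (c n) (norm_sq X) \<omega>) \<partial>M)"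
  proof (intro nn_integral_mono sup_cut_least)
    fix \<omega> t assume o: "\<omega> \<in> space M" and t: "t \<in> dyadic T"
    have tT: "t \<in> {0..T}" using t dyadic_subset[OF T] by blast
    obtain n where n: "\<And>t. t \<in> {0..T} \<Longrightarrow> norm (X t \<omega>) \<le> real n" using path_bounded[OF ca o] by metis
    then have "c n t \<omega>" using tT by (auto simp: c_def)
    then have "norm_sq X t \<omega> \<le> sup_cut T (c n) (norm_sq X) \<omega>" by (intro sup_cut_upper t)
    also have "\<dots> \<le> (SUP n. sup_cut T (c n) (norm_sq X) \<omega>)" by (rule SUP_upper) simp
    finally show "norm_sq X t \<omega> \<le> (SUP n. sup_cut T (c n) (norm_sq X) \<omega>)" .
  qed
  also have "\<dots> = (SUP n. \<integral>\<^sup>+\<omega>. sup_cut T (c n) (norm_sq X) \<omega> \<partial>M)"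
    by (rule nn_integral_monotone_convergence_SUP[OF inc sup_cut_norm_sq_measurable[OF c ca]])
  also have "\<dots> \<le> ?bound" by (intro SUP_least bnd)
  finally show ?thesis .
qed

section \<open>Existence by Picard iteration\<close>

abbreviation total_sup :: "(real \<Rightarrow> 'a \<Rightarrow> real^'n^'n) \<Rightarrow> ennreal" where
  "total_sup X \<equiv> expected_sup always X T"

lemma K_mult_bound:
  assumes "mono \<phi>" and u: "u \<in> {0..T}"
  shows "(\<integral>\<^sup>+s. indicator {0..u} s * (ennreal (K s) * \<phi> s) \<partial>lborel) \<le> ennreal (integral\<^sup>L lborel K) * \<phi> T"
proof -
  have "(\<integral>\<^sup>+s. indicator {0..u} s * (ennreal (K s) * \<phi> s) \<partial>lborel) \<le> (\<integral>\<^sup>+s. ennreal (K s) * \<phi> T \<partial>lborel)"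
    using u monoD[OF assms(1)] by (intro nn_integral_mono) (auto simp: indicator_def intro!: mult_left_mono)
  also have "\<dots> = ennreal (integral\<^sup>L lborel K) * \<phi> T"
    using K_int K_nonneg by (subst nn_integral_multc) (auto simp: nn_integral_eq_integral)
  finally show ?thesis .
qed

lemma K_mult_finite:
  assumes "mono \<phi>" "\<phi> T < \<infinity>" and u: "u \<in> {0..T}"
  shows "(\<integral>\<^sup>+s. indicator {0..u} s * (ennreal (K s) * \<phi> s) \<partial>lborel) < \<infinity>"
  using K_mult_bound[OF assms(1) u] assms(2) by (auto simp: ennreal_mult_less_top intro: le_less_trans)

lemma one_plus_expected_sup:
  "mono (\<lambda>s. 1 + expected_sup c Y s)" "expected_sup c Y T < \<infinity> \<Longrightarrow> 1 + expected_sup c Y T < \<infinity>"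
  using expected_sup_mono[of c Y] by (auto simp: mono_def intro: add_left_mono)

lemma total_sup_add:
  assumes X: "continuous_adapted X" and Y: "continuous_adapted Y" and Z: "\<And>t \<omega>. Z t \<omega> = X t \<omega> + Y t \<omega>"
  shows "total_sup Z \<le> 2 * total_sup X + 2 * total_sup Y"
proof -
  note m = sup_cut_norm_sq_measurable[OF cutoff_True X] sup_cut_norm_sq_measurable[OF cutoff_True Y]
  have "total_sup Z \<le> (\<integral>\<^sup>+\<omega>. 2 * sup_cut T always (norm_sq X) \<omega> + 2 * sup_cut T always (norm_sq Y) \<omega> \<partial>M)"
    unfolding expected_sup_T
  proof (intro nn_integral_mono sup_cut_least)
    fix \<omega> t assume t: "t \<in> dyadic T"
    have "norm_sq Z t \<omega> \<le> 2 * norm_sq X t \<omega> + 2 * norm_sq Y t \<omega>"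
      unfolding norm_sq_def Z by (rule ennreal_norm_add2)
    also have "\<dots> \<le> 2 * sup_cut T always (norm_sq X) \<omega> + 2 * sup_cut T always (norm_sq Y) \<omega>"
      by (intro add_mono mult_left_mono sup_cut_upper t) auto
    finally show "norm_sq Z t \<omega> \<le> 2 * sup_cut T always (norm_sq X) \<omega> + 2 * sup_cut T always (norm_sq Y) \<omega>" .
  qed
  also have "\<dots> = 2 * total_sup X + 2 * total_sup Y"
    unfolding expected_sup_T using m by (subst nn_integral_add) (auto simp: nn_integral_cmult)
  finally show ?thesis .
qed

lemma total_sup_minus: "(\<And>t \<omega>. X t \<omega> = - Y t \<omega>) \<Longrightarrow> total_sup X = total_sup Y"
  unfolding expected_sup_T sup_cut_def norm_sq_def by simp

lemma continuous_adapted_uminus: "continuous_adapted X \<Longrightarrow> continuous_adapted (\<lambda>t \<omega>. - X t \<omega>)"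
  unfolding continuous_adapted_def adapted_on_def by (auto intro!: borel_measurable_uminus continuous_on_minus)

lemma total_sup_diff:
  assumes X: "continuous_adapted X" and Y: "continuous_adapted Y"
  shows "total_sup (\<lambda>t \<omega>. X t \<omega> - Y t \<omega>) \<le> 2 * total_sup X + 2 * total_sup Y"
  using total_sup_add[OF X continuous_adapted_uminus[OF Y], of "\<lambda>t \<omega>. X t \<omega> - Y t \<omega>"]
    total_sup_minus[of "\<lambda>t \<omega>. - Y t \<omega>" Y] by simp

text \<open>A finite expected supremum of Y makes the energy of \<sigma> along Y finite through the
  growth bound, which is what the construction of Ito integrals asks for. The same bound returns a
  finite expected supremum of the image, so the map can be iterated.\<close>

lemma picard_step_exists:
  assumes Y: "continuous_adapted Y" and fin: "total_sup Y < \<infinity>"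
  shows "\<exists>X. picard_step x Y X \<and> total_sup X < \<infinity>"
proof -
  let ?s = "\<lambda>s \<omega>. \<sigma> s (Y s \<omega>)" and ?b = "\<lambda>s \<omega>. b s (Y s \<omega>)"
  have ex: "\<exists>J. has_ito_integral M F (\<lambda>t \<omega>. B t \<omega> $ m $ j) T (\<lambda>t \<omega>. ?s t \<omega> $ i $ m) J" for i m j
  proof -
    interpret orthogonal_bm M F "\<lambda>m t \<omega>. B t \<omega> $ m $ j" by (rule matrix_brownian_motion_column[OF B])
    have "(\<integral>\<^sup>+\<omega>. int_cut T always (\<lambda>s \<omega>. ennreal ((?s s \<omega> $ i $ m)\<^sup>2)) \<omega> \<partial>M) \<le>
      (\<integral>\<^sup>+\<omega>. int_cut T (\<lambda>s \<omega>. s \<le> T \<and> True) (\<lambda>s \<omega>. norm_sq ?b s \<omega> + norm_sq ?s s \<omega>) \<omega> \<partial>M)"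
    proof (rule nn_integral_mono)
      fix \<omega>
      have "ennreal ((?s s \<omega> $ i $ m)\<^sup>2) \<le> norm_sq ?b s \<omega> + norm_sq ?s s \<omega>" for s
      proof -
        have "\<bar>?s s \<omega> $ i $ m\<bar> \<le> norm (?s s \<omega>)"
          using component_le_norm_cart[of "?s s \<omega> $ i" m] Finite_Cartesian_Product.norm_nth_le[of "?s s \<omega>" i] by linarith
        then have "(?s s \<omega> $ i $ m)\<^sup>2 \<le> (norm (?s s \<omega>))\<^sup>2" by (simp add: abs_le_square_iff[symmetric])
        then have "ennreal ((?s s \<omega> $ i $ m)\<^sup>2) \<le> norm_sq ?s s \<omega>" unfolding norm_sq_def by (rule ennreal_leI)
        then show ?thesis by (simp add: add_increasing)
      qed
      then show "int_cut T always (\<lambda>s \<omega>. ennreal ((?s s \<omega> $ i $ m)\<^sup>2)) \<omega> \<le>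
        int_cut T (\<lambda>s \<omega>. s \<le> T \<and> True) (\<lambda>s \<omega>. norm_sq ?b s \<omega> + norm_sq ?s s \<omega>) \<omega>"
        unfolding int_cut_def by (intro nn_integral_mono) auto
    qed
    also have "\<dots> \<le> 2 * (\<integral>\<^sup>+s. indicator {0..T} s * (ennreal (K s) * (1 + expected_sup always Y s)) \<partial>lborel)"
      by (rule growth_expectation[OF Y cutoff_True])
    also have "\<dots> < \<infinity>"
      using K_mult_finite[OF one_plus_expected_sup(1) one_plus_expected_sup(2)[OF fin], of T] T
      by (simp add: ennreal_mult_less_top)
    finally show ?thesis
      by (intro ito_integral_exists[OF T, where k = m] progressive_entry coefficient_progressive Y)
  qed
  \<comment> \<open>Integrals are determined only up to indistinguishability, so one version is
    chosen for each triple of indices.\<close>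
  define J where "J i m j = (SOME J. has_ito_integral M F (\<lambda>t \<omega>. B t \<omega> $ m $ j) T (\<lambda>t \<omega>. ?s t \<omega> $ i $ m) J)" for i m j
  have J: "has_ito_integral M F (\<lambda>t \<omega>. B t \<omega> $ m $ j) T (\<lambda>t \<omega>. ?s t \<omega> $ i $ m) (J i m j)" for m j i
    unfolding J_def by (rule someI_ex[OF ex])
  define I where "I t \<omega> = (\<chi> i j. \<Sum>m\<in>UNIV. J i m j t \<omega>)" for t \<omega>
  have I: "has_matrix_ito_integral M F B T ?s I"
    unfolding has_matrix_ito_integral_def using J by (intro exI[of _ J]) (simp add: I_def)
  define X where "X t \<omega> = x + (LINT s:{0..t}|lborel. ?b s \<omega>) + I t \<omega>" for t \<omega>
  have "continuous_adapted X"
    unfolding continuous_adapted_def adapted_on_def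
  proof (intro conjI ballI)
    fix t assume t: "t \<in> {0..T}"
    have "I t \<in> borel_measurable (F t)"
    proof (rule borel_measurable_matrix)
      fix i j
      have "J i m j t \<in> borel_measurable (F t)" for m
        using J[of m j i] t unfolding has_ito_integral_def adapted_on_def by blast
      then show "(\<lambda>\<omega>. I t \<omega> $ i $ j) \<in> borel_measurable (F t)" unfolding I_def by simp
    qed
    moreover have "(\<lambda>\<omega>. LINT s:{0..t}|lborel. ?b s \<omega>) \<in> borel_measurable (F t)"
    proof -
      have "(\<lambda>(\<omega>, s). if s \<in> {0..t} then ?b s \<omega> else 0) \<in> borel_measurable (F t \<Otimes>\<^sub>M borel)"
        using measurable_pair_swap[OF progressiveD[OF coefficient_progressive(1)[OF Y], of t]] t by simp
      also have "borel_measurable (F t \<Otimes>\<^sub>M borel) = borel_measurable (F t \<Otimes>\<^sub>M lborel)"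
        by (intro measurable_cong_sets sets_pair_measure_cong) auto
      finally have "(\<lambda>\<omega>. LINT s|lborel. (if s \<in> {0..t} then ?b s \<omega> else 0)) \<in> borel_measurable (F t)"
        by (rule lborel.borel_measurable_lebesgue_integral)
      also have "(\<lambda>\<omega>. LINT s|lborel. (if s \<in> {0..t} then ?b s \<omega> else 0)) = (\<lambda>\<omega>. LINT s:{0..t}|lborel. ?b s \<omega>)"
        unfolding set_lebesgue_integral_def by (intro ext Bochner_Integration.integral_cong) auto
      finally show ?thesis .
    qed
    ultimately show "X t \<in> borel_measurable (F t)" unfolding X_def[abs_def] by measurable
  next
    fix \<omega> assume o: "\<omega> \<in> space M"
    have Jc: "continuous_on {0..T} (\<lambda>t. J i m j t \<omega>)" for i m j
      using J[of m j i] o unfolding has_ito_integral_def by blast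
    have "continuous_on {0..T} (\<lambda>t. LINT s:{0..t}|lborel. ?b s \<omega>)"
    proof -
      have "(\<lambda>s. ?b s \<omega>) integrable_on {0..T}"
        by (rule set_borel_integral_eq_integral(1)[OF drift_integrable[OF Y o]]) auto
      then have "continuous_on {0..T} (\<lambda>t. integral {0..t} (\<lambda>s. ?b s \<omega>))" by (rule indefinite_integral_continuous_1)
      moreover have "(LINT s:{0..t}|lborel. ?b s \<omega>) = integral {0..t} (\<lambda>s. ?b s \<omega>)" if "t \<in> {0..T}" for t
        by (rule set_borel_integral_eq_integral(2)[OF drift_integrable[OF Y o]]) (use that in auto)
      ultimately show ?thesis using continuous_on_cong[OF refl, of "{0..T}" "\<lambda>t. LINT s:{0..t}|lborel. ?b s \<omega>" "\<lambda>t. integral {0..t} (\<lambda>s. ?b s \<omega>)"] by blast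
    qed
    then show "continuous_on {0..T} (\<lambda>t. X t \<omega>)" unfolding X_def I_def
      by (intro continuous_intros continuous_on_vec_lambda Jc)
  qed
  then have X: "picard_step x Y X" unfolding picard_step_def using I by (auto simp: X_def)
  have "total_sup X \<le> ennreal (3 * (norm x)\<^sup>2) +
    ennreal (2 * C0) * (\<integral>\<^sup>+s. indicator {0..T} s * (ennreal (K s) * (1 + expected_sup always Y s)) \<partial>lborel)"
    by (rule picard_step_growth[OF Y X cutoff_True])
  also have "\<dots> < \<infinity>"
    using K_mult_finite[OF one_plus_expected_sup(1) one_plus_expected_sup(2)[OF fin], of T] T
    by (simp add: ennreal_mult_less_top)
  finally show ?thesis using X by blast
qed

text \<open>The recursion bounds each difference by an integral of the preceding one. In the
  weighted sum the shift of the index costs one factor 8, so the sum satisfies a Gronwall inequality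
  with constant 8 \<open>C0\<close> and additive term \<open>d 0 T\<close>. The weight 8 is dictated
  by the rate that \<open>uniform_limit_exists\<close> expects.\<close>

lemma picard_iterates_rate:
  assumes P: "\<And>n. continuous_adapted (P n)" "\<And>n. total_sup (P n) < \<infinity>" "\<And>n. picard_step x (P n) (P (Suc n))"
  shows "\<exists>A\<ge>0. \<forall>n. total_sup (\<lambda>t \<omega>. P (Suc n) t \<omega> - P n t \<omega>) \<le> ennreal (A * (1/8)^n)"
proof -
  define d where "d n = expected_sup always (\<lambda>t \<omega>. P (Suc n) t \<omega> - P n t \<omega>)" for n
  have dm: "mono (d n)" for n unfolding d_def by (rule expected_sup_mono)
  have [measurable]: "d n \<in> borel_measurable borel" for n unfolding d_def by measurable
  have dfin: "d n T < \<infinity>" for n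
  proof -
    have "d n T \<le> 2 * total_sup (P (Suc n)) + 2 * total_sup (P n)" unfolding d_def by (rule total_sup_diff[OF P(1) P(1)])
    also have "\<dots> < \<infinity>" using P(2) by (simp add: ennreal_mult_less_top)
    finally show ?thesis .
  qed
  have dstep: "d (Suc n) u \<le> ennreal C0 * (\<integral>\<^sup>+s. indicator {0..u} s * (ennreal (K s) * d n s) \<partial>lborel)" for n u
    unfolding d_def by (rule picard_step_diff[OF P(1) P(1) P(3) P(3) cutoff_True])
  define \<psi> where "\<psi> n u = (\<Sum>k\<le>n. ennreal (8 ^ k) * d k u)" for n u
  have \<psi>m: "mono (\<psi> n)" for n
    unfolding \<psi>_def using monoD[OF dm] by (intro monoI sum_mono mult_left_mono) auto
  have \<psi>fin: "\<psi> n T < \<infinity>" for n unfolding \<psi>_def using dfin by (simp add: ennreal_mult_less_top)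
  define A0 where "A0 = enn2real (d 0 T)"
  have A0: "0 \<le> A0" "d 0 T = ennreal A0" unfolding A0_def using dfin[of 0] by (auto simp: ennreal_enn2real_if)
  define A where "A = A0 * exp (8 * C0 * (LINT s:{0..T}|lborel. K s))"
  have "\<psi> n T \<le> ennreal A" for n
    unfolding A_def
  proof (rule gronwall[OF T K_int K_nonneg \<psi>m \<psi>fin A0(1)])
    fix u assume u: "u \<in> {0..T}"
    have step: "ennreal (8 ^ Suc k) * d (Suc k) u \<le> ennreal (8 * C0) * (\<integral>\<^sup>+s. indicator {0..u} s * (ennreal (K s) * (ennreal (8 ^ k) * d k s)) \<partial>lborel)" for k
    proof -
      have "ennreal (8 ^ Suc k) * d (Suc k) u \<le> ennreal (8 ^ Suc k) * (ennreal C0 * (\<integral>\<^sup>+s. indicator {0..u} s * (ennreal (K s) * d k s) \<partial>lborel))"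
        by (intro mult_left_mono dstep) simp
      also have "\<dots> = ennreal (8 * C0) * (ennreal (8 ^ k) * (\<integral>\<^sup>+s. indicator {0..u} s * (ennreal (K s) * d k s) \<partial>lborel))"
      proof -
        have "ennreal (8 ^ Suc k) * ennreal C0 = ennreal (8 * C0) * ennreal (8 ^ k)"
          using C0_nonneg by (simp add: ennreal_mult[symmetric] mult_ac)
        then show ?thesis by (simp only: mult.assoc[symmetric])
      qed
      also have "ennreal (8 ^ k) * (\<integral>\<^sup>+s. indicator {0..u} s * (ennreal (K s) * d k s) \<partial>lborel) =
          (\<integral>\<^sup>+s. indicator {0..u} s * (ennreal (K s) * (ennreal (8 ^ k) * d k s)) \<partial>lborel)"
        by (subst nn_integral_cmult[symmetric]) (auto simp: mult_ac)
      finally show ?thesis .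
    qed
    have "\<psi> n u = d 0 u + (\<Sum>k<n. ennreal (8 ^ Suc k) * d (Suc k) u)"
      unfolding \<psi>_def lessThan_Suc_atMost[symmetric] sum.lessThan_Suc_shift by simp
    also have "\<dots> \<le> ennreal A0 + (\<Sum>k<n. ennreal (8 * C0) * (\<integral>\<^sup>+s. indicator {0..u} s * (ennreal (K s) * (ennreal (8 ^ k) * d k s)) \<partial>lborel))"
      unfolding A0(2)[symmetric] using monoD[OF dm, of u T 0] u by (intro add_mono sum_mono step) auto
    also have "(\<Sum>k<n. ennreal (8 * C0) * (\<integral>\<^sup>+s. indicator {0..u} s * (ennreal (K s) * (ennreal (8 ^ k) * d k s)) \<partial>lborel)) =
      ennreal (8 * C0) * (\<integral>\<^sup>+s. (\<Sum>k<n. indicator {0..u} s * (ennreal (K s) * (ennreal (8 ^ k) * d k s))) \<partial>lborel)"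
      by (subst nn_integral_sum) (auto simp: sum_distrib_left)
    also have "\<dots> \<le> ennreal (8 * C0) * (\<integral>\<^sup>+s. indicator {0..u} s * (ennreal (K s) * \<psi> n s) \<partial>lborel)"
      unfolding \<psi>_def sum_distrib_left by (intro mult_left_mono nn_integral_mono sum_mono2) auto
    finally show "\<psi> n u \<le> ennreal A0 + ennreal (8 * C0) * (\<integral>\<^sup>+s. indicator {0..u} s * (ennreal (K s) * \<psi> n s) \<partial>lborel)"
      by (simp add: add_left_mono)
  qed (use C0_nonneg in auto)
  moreover have "ennreal (8 ^ n) * d n T \<le> \<psi> n T" for n
    unfolding \<psi>_def by (rule member_le_sum[of n]) auto
  ultimately have le: "ennreal (8 ^ n) * d n T \<le> ennreal A" for n using order_trans by blast
  have A: "0 \<le> A" unfolding A_def using A0 by simp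
  have "d n T \<le> ennreal (A * (1/8)^n)" for n
  proof -
    have "ennreal ((1/8) ^ n) * (ennreal (8 ^ n) * d n T) \<le> ennreal ((1/8) ^ n) * ennreal A"
      by (intro mult_left_mono le) simp
    moreover have "ennreal ((1/8) ^ n) * (ennreal (8 ^ n) * d n T) = d n T"
      by (simp add: mult.assoc[symmetric] ennreal_mult[symmetric] power_mult_distrib[symmetric])
    ultimately show ?thesis using A by (simp add: ennreal_mult[symmetric] mult.commute)
  qed
  then show ?thesis using A unfolding d_def by blast
qed

text \<open>Instead of passing to the limit inside stochastic integrals, the Picard map is applied
  once more to the limit X of the iterates. Up to a constant factor the image Y is as close to
  \<open>P (Suc j)\<close> as X is to \<open>P j\<close>, so Y and X agree almost surely, and the
  equation that defines Y is the equation for X.\<close>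

lemma picard_fixed_point_exists: "\<exists>X. picard_step x X X"
proof -
  have "total_sup (\<lambda>_ _. 0) \<le> (\<integral>\<^sup>+(\<omega>::'a). 0 \<partial>M)"
    unfolding expected_sup_T by (intro nn_integral_mono sup_cut_least) (simp add: norm_sq_def)
  then have z: "continuous_adapted (\<lambda>_ _. 0)" "total_sup (\<lambda>_ _. 0) < \<infinity>"
    unfolding continuous_adapted_def adapted_on_def by auto
  \<comment> \<open>Images under the Picard map are not unique as functions of \<omega>, so the
    sequence is obtained by dependent choice, together with the finiteness that each next step
    requires.\<close>
  have "\<exists>P. \<forall>n. (continuous_adapted (P n) \<and> total_sup (P n) < \<infinity>) \<and> picard_step x (P n) (P (Suc n))"
  proof (rule dependent_nat_choice)
    show "\<exists>X. continuous_adapted X \<and> total_sup X < \<infinity>" using z by blast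
    show "\<exists>Y. (continuous_adapted Y \<and> total_sup Y < \<infinity>) \<and> picard_step x X Y"
      if "continuous_adapted X \<and> total_sup X < \<infinity>" for X and n :: nat
      using picard_step_exists[of X x] that by (auto simp: picard_step_def)
  qed
  then obtain P where P: "\<And>n. continuous_adapted (P n)" "\<And>n. total_sup (P n) < \<infinity>" "\<And>n. picard_step x (P n) (P (Suc n))"
    by blast
  obtain A where A: "0 \<le> A" "\<And>n. total_sup (\<lambda>t \<omega>. P (Suc n) t \<omega> - P n t \<omega>) \<le> ennreal (A * (1/8)^n)"
    using picard_iterates_rate[of P x, OF P] by blast
  have ts: "total_sup Z = (\<integral>\<^sup>+\<omega>. (SUP t\<in>dyadic T. ennreal ((norm (Z t \<omega>))\<^sup>2)) \<partial>M)" for Z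
    unfolding expected_sup_T sup_cut_def norm_sq_def by simp
  have "\<exists>X. (\<forall>t\<in>{0..T}. X t \<in> borel_measurable (F t)) \<and>
    (\<forall>\<omega>\<in>space M. continuous_on {0..T} (\<lambda>t. X t \<omega>)) \<and>
    (AE \<omega> in M. \<forall>t\<in>{0..T}. (\<lambda>j. P j t \<omega>) \<longlonglongrightarrow> X t \<omega>) \<and>
    (\<forall>j. (\<integral>\<^sup>+\<omega>. (SUP t\<in>dyadic T. ennreal ((norm (X t \<omega> - P j t \<omega>))\<^sup>2)) \<partial>M) \<le> ennreal (4 * A * (1/8)^j))"
  proof (rule uniform_limit_exists[OF T _ _ A(1)])
    show "P j t \<in> borel_measurable (F t)" if "t \<in> {0..T}" for j t
      using P(1)[of j] that by (auto simp: continuous_adapted_def adapted_on_def)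
    show "AE \<omega> in M. continuous_on {0..T} (\<lambda>t. P j t \<omega>)" for j
      using P(1)[of j] by (intro AE_I2) (auto simp: continuous_adapted_def)
  qed (use A(2) in \<open>simp add: ts\<close>)
  then obtain X where X: "continuous_adapted X" and rate: "\<And>j. total_sup (\<lambda>t \<omega>. X t \<omega> - P j t \<omega>) \<le> ennreal (4 * A * (1/8)^j)"
    unfolding continuous_adapted_def adapted_on_def ts by blast
  have Xfin: "total_sup X < \<infinity>"
  proof -
    have "total_sup X \<le> 2 * total_sup (\<lambda>t \<omega>. X t \<omega> - P 0 t \<omega>) + 2 * total_sup (P 0)"
      by (rule total_sup_add[OF continuous_adapted_diff[OF X P(1)] P(1)]) simp
    also have "\<dots> < \<infinity>" using rate[of 0] P(2)[of 0] by (auto simp: ennreal_mult_less_top intro: le_less_trans)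
    finally show ?thesis .
  qed
  obtain Y where Y: "picard_step x X Y" using picard_step_exists[OF X Xfin] by blast
  then have Yc: "continuous_adapted Y" by (simp add: picard_step_def)
  define L where "L = integral\<^sup>L lborel K"
  have L: "0 \<le> L" unfolding L_def using K_nonneg by simp
  \<comment> \<open>The iterate \<open>P (Suc j)\<close> is inserted between Y and X: one distance
    is bounded by the Lipschitz estimate and the rate for X - P j, the other directly by the
    rate.\<close>
  have bound: "total_sup (\<lambda>t \<omega>. Y t \<omega> - X t \<omega>) \<le> ennreal ((2 * (C0 * L) + 2) * (4 * A) * (1/8)^j)" for j
  proof -
    have "total_sup (\<lambda>t \<omega>. Y t \<omega> - P (Suc j) t \<omega>) \<le>
      ennreal C0 * (\<integral>\<^sup>+s. indicator {0..T} s * (ennreal (K s) * expected_sup always (\<lambda>t \<omega>. X t \<omega> - P j t \<omega>) s) \<partial>lborel)"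
      by (rule picard_step_diff[OF X P(1) Y P(3) cutoff_True])
    also have "\<dots> \<le> ennreal C0 * (ennreal L * ennreal (4 * A * (1/8)^j))"
      unfolding L_def
      by (intro mult_left_mono order_trans[OF K_mult_bound[OF expected_sup_mono]] rate) (use T in auto)
    also have "\<dots> = ennreal (C0 * L * (4 * A * (1/8)^j))"
      using C0_nonneg L A by (simp add: ennreal_mult[symmetric] mult.assoc del: ennreal_mult_less_top)
    finally have 1: "total_sup (\<lambda>t \<omega>. Y t \<omega> - P (Suc j) t \<omega>) \<le> ennreal (C0 * L * (4 * A * (1/8)^j))" .
    have "total_sup (\<lambda>t \<omega>. P (Suc j) t \<omega> - X t \<omega>) = total_sup (\<lambda>t \<omega>. X t \<omega> - P (Suc j) t \<omega>)"
      by (rule total_sup_minus) simp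
    also have "\<dots> \<le> ennreal (4 * A * (1/8)^Suc j)" by (rule rate)
    also have "\<dots> \<le> ennreal (4 * A * (1/8)^j)" using A(1) by (intro ennreal_leI mult_left_mono) auto
    finally have 2: "total_sup (\<lambda>t \<omega>. P (Suc j) t \<omega> - X t \<omega>) \<le> ennreal (4 * A * (1/8)^j)" .
    have "total_sup (\<lambda>t \<omega>. Y t \<omega> - X t \<omega>) \<le> 2 * total_sup (\<lambda>t \<omega>. Y t \<omega> - P (Suc j) t \<omega>) + 2 * total_sup (\<lambda>t \<omega>. P (Suc j) t \<omega> - X t \<omega>)"
      by (rule total_sup_add[OF continuous_adapted_diff[OF Yc P(1)] continuous_adapted_diff[OF P(1) X]]) simp
    also have "\<dots> \<le> 2 * ennreal (C0 * L * (4 * A * (1/8)^j)) + 2 * ennreal (4 * A * (1/8)^j)"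
      by (intro add_mono mult_left_mono 1 2) auto
    also have "\<dots> = ennreal (2 * (C0 * L * (4 * A * (1/8)^j)) + 2 * (4 * A * (1/8)^j))"
    proof -
      have "0 \<le> C0 * L * (4 * A * (1/8)^j)" "0 \<le> 4 * A * (1/8)^j" using C0_nonneg L A(1) by auto
      then show ?thesis by (simp only: ennreal_plus ennreal_mult mult_nonneg_nonneg zero_le_numeral ennreal_numeral)
    qed
    also have "2 * (C0 * L * (4 * A * (1/8)^j)) + 2 * (4 * A * (1/8)^j) = (2 * (C0 * L) + 2) * (4 * A) * (1/8)^j"
      by (simp add: algebra_simps)
    finally show ?thesis .
  qed
  have "(\<lambda>j. ennreal ((2 * (C0 * L) + 2) * (4 * A) * (1/8)^j)) \<longlonglongrightarrow> ennreal ((2 * (C0 * L) + 2) * (4 * A) * 0)"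
    by (intro tendsto_ennrealI tendsto_mult tendsto_const LIMSEQ_realpow_zero) auto
  then have "total_sup (\<lambda>t \<omega>. Y t \<omega> - X t \<omega>) \<le> ennreal ((2 * (C0 * L) + 2) * (4 * A) * 0)"
    by (rule LIMSEQ_le_const) (use bound in auto)
  then have "(\<integral>\<^sup>+\<omega>. sup_cut T always (norm_sq (\<lambda>t \<omega>. Y t \<omega> - X t \<omega>)) \<omega> \<partial>M) = 0" by (simp add: expected_sup_T)
  then have "AE \<omega> in M. sup_cut T always (norm_sq (\<lambda>t \<omega>. Y t \<omega> - X t \<omega>)) \<omega> = 0"
    using nn_integral_0_iff_AE[OF sup_cut_norm_sq_measurable[OF cutoff_True continuous_adapted_diff[OF Yc X]]] by simp
  then have XY: "AE \<omega> in M. \<forall>t\<in>{0..T}. Y t \<omega> = X t \<omega>"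
    using AE_space
  proof eventually_elim
    case (elim \<omega>)
    have "Y t \<omega> = X t \<omega>" if t: "t \<in> dyadic T" for t
    proof -
      have "norm_sq (\<lambda>t \<omega>. Y t \<omega> - X t \<omega>) t \<omega> \<le> 0"
        using sup_cut_upper[OF t, of always \<omega> "norm_sq (\<lambda>t \<omega>. Y t \<omega> - X t \<omega>)"] elim(1) by simp
      then show ?thesis by (simp add: norm_sq_def)
    qed
    then show ?case
      using dyadic_dense_eq[OF T continuous_adaptedD(2)[OF Yc elim(2)] continuous_adaptedD(2)[OF X elim(2)]] by blast
  qed
  obtain I where I: "has_matrix_ito_integral M F B T (\<lambda>s \<omega>. \<sigma> s (X s \<omega>)) I"
    "AE \<omega> in M. \<forall>t\<in>{0..T}. Y t \<omega> = x + (LINT s:{0..t}|lborel. b s (X s \<omega>)) + I t \<omega>"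
    using Y unfolding picard_step_def by blast
  have "AE \<omega> in M. \<forall>t\<in>{0..T}. X t \<omega> = x + (LINT s:{0..t}|lborel. b s (X s \<omega>)) + I t \<omega>"
    using I(2) XY by eventually_elim auto
  then show ?thesis unfolding picard_step_def using X I(1) by blast
qed

text \<open>Integrability of the drift, the one clause that \<open>picard_step\<close> does not
  carry, holds along every continuous adapted process by \<open>drift_integrable\<close>.\<close>

lemma strong_solution_iff: "strong_solution M F B T b \<sigma> x X \<longleftrightarrow> picard_step x X X"
proof
  assume "picard_step x X X"
  moreover from this have "AE \<omega> in M. set_integrable lborel {0..T} (\<lambda>s. b s (X s \<omega>))"
    by (intro AE_I2 drift_integrable) (auto simp: picard_step_def)
  ultimately show "strong_solution M F B T b \<sigma> x X"
    unfolding strong_solution_def picard_step_def continuous_adapted_def by blast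
qed (auto simp: strong_solution_def picard_step_def continuous_adapted_def)

end

theorem theorem3p1:
  fixes M :: "'a measure" and F :: "real \<Rightarrow> 'a measure"
    and B :: "real \<Rightarrow> 'a \<Rightarrow> real^'n^'n"
    and b \<sigma> :: "real \<Rightarrow> real^'n^'n \<Rightarrow> real^'n^'n"
    and \<kappa>1 \<kappa>2 :: "real \<Rightarrow> real" and T :: real and x :: "real^'n^'n"
  assumes "filtered_prob_space M F"
    and "matrix_brownian_motion M F B"
    and "CARD('n) \<ge> 2"
    and "T > 0"
    and "(\<lambda>(t, y). b t y) \<in> borel_measurable (restrict_space borel {0..} \<Otimes>\<^sub>M borel)"
    and "(\<lambda>(t, y). \<sigma> t y) \<in> borel_measurable (restrict_space borel {0..} \<Otimes>\<^sub>M borel)"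
    and "set_integrable lebesgue {0..T} \<kappa>1" and "\<forall>t\<in>{0..T}. \<kappa>1 t \<ge> 0"
    and "set_integrable lebesgue {0..T} \<kappa>2" and "\<forall>t\<in>{0..T}. \<kappa>2 t \<ge> 0"
    and "\<forall>t\<in>{0..T}. \<forall>y z.
           (hs_norm (b t y - b t z))\<^sup>2 + (hs_norm (\<sigma> t y - \<sigma> t z))\<^sup>2 \<le> \<kappa>1 t * (hs_norm (y - z))\<^sup>2"
    and "\<forall>t\<in>{0..T}. (hs_norm (b t 0))\<^sup>2 + (hs_norm (\<sigma> t 0))\<^sup>2 \<le> \<kappa>2 t"
  shows "(\<exists>X. strong_solution M F B T b \<sigma> x X) \<and>
    (\<forall>X Y. strong_solution M F B T b \<sigma> x X \<longrightarrow> strong_solution M F B T b \<sigma> x Y \<longrightarrow>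
       indistinguishable_on M {0..T} X Y) \<and>
    (\<forall>X. strong_solution M F B T b \<sigma> x X \<longrightarrow>
       (\<integral>\<^sup>+ \<omega>. (SUP t\<in>{0..T}. ennreal ((hs_norm (X t \<omega>))\<^sup>2)) \<partial>M)
         \<le> ennreal ((1 + 3 * (hs_norm x)\<^sup>2) *
             exp (6 * (T + 4 * real CARD('n)) * (LINT s:{0..T}|lebesgue. \<kappa>1 s + \<kappa>2 s))))"
proof -
  let ?\<kappa> = "\<lambda>s. indicator {0..T} s *\<^sub>R (\<kappa>1 s + \<kappa>2 s)"
  have int_\<kappa>: "integrable lebesgue ?\<kappa>"
    using set_integral_add(1)[OF assms(7,9)] by (simp add: set_integrable_def)
  \<comment> \<open>The bounds are measurable only for the completed \<sigma>-algebra, whereas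
    Tonelli and Gronwall are applied over \<open>lborel\<close>. A Borel version differs from them
    on a null set, which is why the Lipschitz and growth conditions of the locale are required
    almost everywhere only.\<close>
  obtain g where g: "g \<in> borel_measurable lborel" and \<kappa>g: "AE s in lborel. ?\<kappa> s = g s"
    using completion_ex_borel_measurable_real[of ?\<kappa> lborel] int_\<kappa> by (auto simp: borel_measurable_integrable)
  \<comment> \<open>The Borel version may be negative on that null set, and K is wanted nonnegative
    everywhere.\<close>
  define K where "K s = max 0 (g s)" for s
  have Km: "K \<in> borel_measurable lborel" using g unfolding K_def[abs_def] by measurable
  have K_eq: "AE s in lborel. K s = ?\<kappa> s"
    using \<kappa>g
  proof eventually_elim
    case (elim s)
    have "0 \<le> ?\<kappa> s" using assms(8,10) by (auto simp: indicator_def)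
    then show ?case using elim by (simp add: K_def)
  qed
  then have K_eq': "AE s in lebesgue. K s = ?\<kappa> s" by (simp add: AE_completion)
  have Km': "K \<in> borel_measurable lebesgue" by (rule measurable_completion[OF Km])
  have "integrable lebesgue K \<longleftrightarrow> integrable lebesgue ?\<kappa>"
    by (rule integrable_cong_AE[OF Km' borel_measurable_integrable[OF int_\<kappa>] K_eq'])
  then have K_int: "integrable lborel K" using int_\<kappa> integrable_completion[OF Km] by simp
  have K_val: "(LINT s:{0..T}|lborel. K s) = (LINT s:{0..T}|lebesgue. \<kappa>1 s + \<kappa>2 s)"
  proof -
    have m: "(\<lambda>s. indicator {0..T} s *\<^sub>R K s) \<in> borel_measurable lborel" using Km by measurable
    have "(LINT s:{0..T}|lborel. K s) = (LINT s|lebesgue. indicator {0..T} s *\<^sub>R K s)"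
      unfolding set_lebesgue_integral_def by (rule integral_completion[OF m, symmetric])
    also have "\<dots> = (LINT s|lebesgue. ?\<kappa> s)"
    proof (rule integral_cong_AE[OF measurable_completion[OF m] borel_measurable_integrable[OF int_\<kappa>]])
      show "AE s in lebesgue. indicator {0..T} s *\<^sub>R K s = ?\<kappa> s"
        using K_eq' by eventually_elim (auto simp: indicator_def)
    qed
    finally show ?thesis by (simp add: set_lebesgue_integral_def)
  qed
  have lip: "(norm (b s y - b s z))\<^sup>2 + (norm (\<sigma> s y - \<sigma> s z))\<^sup>2 \<le> \<kappa>1 s * (norm (y - z))\<^sup>2" if "s \<in> {0..T}" for s y z
    using assms(11) that by (simp add: hs_norm_eq_norm)
  have at0: "(norm (b s 0))\<^sup>2 + (norm (\<sigma> s 0))\<^sup>2 \<le> \<kappa>2 s" if "s \<in> {0..T}" for s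
    using assms(12) that by (simp add: hs_norm_eq_norm)
  \<comment> \<open>Applied with p a coefficient at y and q the same coefficient at 0; this is where
    the factor 2 of the growth bound arises.\<close>
  have two: "(norm p)\<^sup>2 \<le> 2 * (norm (p - q))\<^sup>2 + 2 * (norm q)\<^sup>2" for p q :: "real^'n^'n"
  proof -
    have "norm p \<le> norm (p - q) + norm q" using norm_triangle_ineq[of "p - q" q] by simp
    then have "(norm p)\<^sup>2 \<le> (norm (p - q) + norm q)\<^sup>2" by (intro power_mono) auto
    also have "\<dots> \<le> 2 * (norm (p - q))\<^sup>2 + 2 * (norm q)\<^sup>2"
      using zero_le_power2[of "norm (p - q) - norm q"] by (simp only: power2_sum power2_diff)
    finally show ?thesis .
  qed
  interpret filtered_prob_space M F by fact
  interpret sde M F B T b \<sigma> K "3 * (T + 4 * real CARD('n))"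
  proof
    show "AE s in lborel. s \<in> {0..T} \<longrightarrow> (\<forall>y z. (norm (b s y - b s z))\<^sup>2 + (norm (\<sigma> s y - \<sigma> s z))\<^sup>2 \<le> K s * (norm (y - z))\<^sup>2)"
      using K_eq
    proof eventually_elim
      case (elim s)
      show ?case
      proof (intro impI allI)
        fix y z :: "real^'n^'n" assume s: "s \<in> {0..T}"
        have "\<kappa>1 s \<le> K s" using elim s assms(10) by simp
        then have "\<kappa>1 s * (norm (y - z))\<^sup>2 \<le> K s * (norm (y - z))\<^sup>2" by (rule mult_right_mono) simp
        then show "(norm (b s y - b s z))\<^sup>2 + (norm (\<sigma> s y - \<sigma> s z))\<^sup>2 \<le> K s * (norm (y - z))\<^sup>2"
          using lip[OF s, of y z] by simp
      qed
    qed
    show "AE s in lborel. s \<in> {0..T} \<longrightarrow> (\<forall>y. (norm (b s y))\<^sup>2 + (norm (\<sigma> s y))\<^sup>2 \<le> 2 * K s * (1 + (norm y)\<^sup>2))"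
      using K_eq
    proof eventually_elim
      case (elim s)
      show ?case
      proof (intro impI allI)
        fix y :: "real^'n^'n" assume s: "s \<in> {0..T}"
        have k: "K s = \<kappa>1 s + \<kappa>2 s" "0 \<le> \<kappa>1 s" "0 \<le> \<kappa>2 s" using elim s assms(8,10) by auto
        have "(norm (b s y))\<^sup>2 + (norm (\<sigma> s y))\<^sup>2 \<le> 2 * \<kappa>1 s * (norm y)\<^sup>2 + 2 * \<kappa>2 s"
          using two[of "b s y" "b s 0"] two[of "\<sigma> s y" "\<sigma> s 0"] lip[OF s, of y 0] at0[OF s] by simp
        also have "\<dots> \<le> 2 * K s * (1 + (norm y)\<^sup>2)" using k by (simp add: algebra_simps)
        finally show "(norm (b s y))\<^sup>2 + (norm (\<sigma> s y))\<^sup>2 \<le> 2 * K s * (1 + (norm y)\<^sup>2)" .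
      qed
    qed
  qed (use assms K_int in \<open>auto simp: K_def\<close>)
  show ?thesis
  proof (intro conjI allI impI)
    show "\<exists>X. strong_solution M F B T b \<sigma> x X" unfolding strong_solution_iff by (rule picard_fixed_point_exists)
  next
    fix X Y assume "strong_solution M F B T b \<sigma> x X" "strong_solution M F B T b \<sigma> x Y"
    then show "indistinguishable_on M {0..T} X Y"
      unfolding strong_solution_iff indistinguishable_on_def by (rule picard_fixed_point_unique)
  next
    fix X assume "strong_solution M F B T b \<sigma> x X"
    then have X: "picard_step x X X" by (simp add: strong_solution_iff)
    then have ca: "continuous_adapted X" by (simp add: picard_step_def)
    have "(\<integral>\<^sup>+ \<omega>. (SUP t\<in>{0..T}. ennreal ((hs_norm (X t \<omega>))\<^sup>2)) \<partial>M) = (\<integral>\<^sup>+\<omega>. sup_cut T always (norm_sq X) \<omega> \<partial>M)"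
    proof (rule nn_integral_cong)
      fix \<omega> assume "\<omega> \<in> space M"
      from SUP_eq_sup_cut[where Z = X, OF T continuous_adaptedD(2)[OF ca this]]
      show "(SUP t\<in>{0..T}. ennreal ((hs_norm (X t \<omega>))\<^sup>2)) = sup_cut T always (norm_sq X) \<omega>"
        by (simp add: hs_norm_eq_norm norm_sq_def)
    qed
    also have "\<dots> \<le> ennreal ((1 + 3 * (norm x)\<^sup>2) * exp (2 * (3 * (T + 4 * real CARD('n))) * (LINT s:{0..T}|lborel. K s)))"
      by (rule picard_fixed_point_moment[OF X])
    also have "2 * (3 * (T + 4 * real CARD('n))) = 6 * (T + 4 * real CARD('n))" by simp
    finally show "(\<integral>\<^sup>+ \<omega>. (SUP t\<in>{0..T}. ennreal ((hs_norm (X t \<omega>))\<^sup>2)) \<partial>M)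
      \<le> ennreal ((1 + 3 * (hs_norm x)\<^sup>2) * exp (6 * (T + 4 * real CARD('n)) * (LINT s:{0..T}|lebesgue. \<kappa>1 s + \<kappa>2 s)))"
      by (simp add: K_val hs_norm_eq_norm)
  qed
qed

end
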